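(* Let $s\ge t\ge2$ be integers. The $3^{\mathrm{rd}}$-order weight-$2$ type-(a) automatic degeneracy of the planar ICIS germ $y^t-x^s\in k[[x,y]]$ is $$\mathrm{AD}^3_{(2)}(y^t-x^s)=(2t-3)(s-1).$$ In particular, the number of $3^{\mathrm{rd}}$-order weight-$2$ type-(a) inflection points limiting to this singularity in a general $2$-parameter deformation is equal to $(t-2)(s-1)$.
   Context: $k$ is an algebraically closed field of characteristic $0$. A planar ICIS germ is $f\in k[[x,y]]$, $f(0)=0$, defining an isolated curve singularity; $A=k[[x,y]]/(f)$. Deformations: let $\delta_1,\dots,\delta_d\in k[[x,y]]$ represent a $k$-basis of $\mathrm{Def}^1(f)=\mathrm{Ext}^1_A(\Omega^1_{A/k},A)$ (a quotient of $A$). A $1$-parameter deformation $X/B$ of $f$, given by $(a_i)\in k^d$, has $\mathscr O_B=k[[\epsilon]]$, $\mathscr O_X=k[[x,y]][[\epsilon]]/(f+\epsilon\sum_i a_i\delta_i)$. A $2$-parameter deformation $\widetilde X/\widetilde B$, given by $(a_i,b_i)\in k^{2d}$, has $\mathscr O_{\widetilde B}=k[[\sigma,\epsilon]]$, $\mathscr O_{\widetilde X}=k[[x,y]][[\sigma,\epsilon]]/(f+\sum_i (a_i\sigma+b_i\epsilon)\delta_i)$. $\mathrm{Sing}$ is the locus where the map to the base is not smooth. Principal parts: for $Y/C$ one of these deformations, $\mathscr P^m_{Y/C}=(\mathscr O_Y\widehat\otimes_{\mathscr O_C}\mathscr O_Y)/I_\Delta^m$, $I_\Delta$ the ideal of the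 diagonal, regarded as an $\mathscr O_Y$-module via the left factor. For a general deformation its dual is free of rank $m$; let $e_1,\dots,e_m$ be a basis of it. For a list $\overline\tau=(\tau_1,\dots,\tau_n)$ of elements of $\mathscr P^m_{Y/C}$, let $I^m_{\overline\tau}\subset\mathscr O_Y$ be the ideal of maximal minors of the $m\times n$ matrix $(e_i(\tau_j))$. Automatic degeneracy: for $m\ge2$, $\mathrm{AD}^m_{(2)}(f)=\min_{X/B}\min_{\overline\tau}\dim_k\mathscr O_X/I^m_{\overline\tau}$, the minimum over $1$-parameter deformations $X/B$ of $f$ (with $(\mathscr P^m_{X/B})^\vee$ free of rank $m$) and lists $\overline\tau$ of $n=m-1$ elements of $\mathscr P^m_{X/B}$. Limiting inflection points: for a general $2$-parameter deformation $\widetilde X/\widetilde B$ and a general list $\overline\tau$ of $m-1$ elements of $\mathscr P^m_{\widetilde X/\widetilde B}$, let $L$ be an algebraic closure of $k((\sigma))$. The number of $m^{\mathrm{th}}$-order weight-$2$ type-(a) inflection points limiting to the singularity in a general $2$-parameter deformation is the total length over $L$ of $(\mathscr O_{\widetilde X}/I^m_{\overline\tau})\otimes_{k[[\sigma]]}L$ at its points not lying in $\mathrm{Sing}(\widetilde X/\widetilde B)$. "General" means in a suitable dense Zariski-open subset of the parameters, respectively of the lists modulo a sufficiently high power of the maximal ideal. *)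

theory Defs
  imports
    "HOL-Library.Extended_Nat"
    "HOL-Library.Poly_Mapping"
    "HOL-Computational_Algebra.Formal_Laurent_Series"
    "HOL-Algebra.Algebraic_Closure_Type"
    "Jordan_Normal_Form.Determinant"
begin

section \<open>Ideals and quotient rings\<close>

text \<open>
  Every ring in this theory is a quotient \<open>T/I\<close> of a commutative ring \<open>T\<close> that is a type (an
  iterated power series ring, or a monoid algebra) by an ideal \<open>I\<close>. Elements of \<open>T/I\<close> are given
  by representatives in \<open>T\<close>, and an ideal of \<open>T/I\<close> by its preimage in \<open>T\<close>.
\<close>

lemma module_times: "Modules.module ((*) :: 'a::comm_ring_1 \<Rightarrow> 'a \<Rightarrow> 'a)"
  by unfold_locales (simp_all add: algebra_simps)

abbreviation ideal_gen :: "'a::comm_ring_1 set \<Rightarrow> 'a set" where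
  "ideal_gen \<equiv> Modules.module.span (*)"

definition ideal_power :: "'a::comm_ring_1 set \<Rightarrow> nat \<Rightarrow> 'a set" where
  "ideal_power I n = ideal_gen {\<Prod>i<n. g i | g. \<forall>i<n. g i \<in> I}"

definition prime_ideal :: "'a::comm_ring_1 set \<Rightarrow> bool" where
  "prime_ideal P \<longleftrightarrow>
     Modules.module.subspace (*) P \<and> 1 \<notin> P \<and> (\<forall>a b. a * b \<in> P \<longrightarrow> a \<in> P \<or> b \<in> P)"

text \<open>The maximal ideal; only used for rings that are local.\<close>

definition nonunits :: "'a::comm_ring_1 set" where
  "nonunits = {u. \<not> u dvd 1}"

text \<open>The dimension of the quotient vector space \<open>V/W\<close>, where \<open>scale\<close> is the scalar
  multiplication of \<open>V\<close>.\<close>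

definition quotient_dim :: "('k::field \<Rightarrow> 'v::ab_group_add \<Rightarrow> 'v) \<Rightarrow> 'v set \<Rightarrow> enat" where
  "quotient_dim scale W = Sup {enat n | n. \<exists>v :: nat \<Rightarrow> 'v.
     \<forall>c. (\<Sum>i<n. scale (c i) (v i)) \<in> W \<longrightarrow> (\<forall>i<n. c i = 0)}"

text \<open>
  The dimension over the field \<open>'l\<close> of the localization of \<open>T/K\<close> at the prime \<open>P \<supseteq> K\<close>: the
  supremum of the sizes of linearly independent families of fractions \<open>a\<^sub>i/s\<^sub>i\<close>. A fraction is
  zero in the localization iff its numerator is killed in \<open>T/K\<close> by some \<open>u \<notin> P\<close>.
\<close>

definition localization_dim ::
    "('l::field \<Rightarrow> 'a::comm_ring_1 \<Rightarrow> 'a) \<Rightarrow> 'a set \<Rightarrow> 'a set \<Rightarrow> enat" where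
  "localization_dim scale K P = Sup {enat n | n. \<exists>a s :: nat \<Rightarrow> 'a. (\<forall>i<n. s i \<notin> P) \<and>
     (\<forall>c. (\<exists>u. u \<notin> P \<and> u * (\<Sum>i<n. scale (c i) (a i) * (\<Prod>j\<in>{..<n} - {i}. s j)) \<in> K)
        \<longrightarrow> (\<forall>i<n. c i = 0))}"


section \<open>Extension of scalars\<close>

text \<open>\<open>'a mon\<close> is the multiplicative monoid of \<open>'a\<close>, written additively, so that
  \<open>'a mon \<Rightarrow>\<^sub>0 'l\<close> is the monoid algebra over \<open>'l\<close> of the multiplicative monoid of \<open>'a\<close>.\<close>

datatype 'a mon = Mon 'a

instantiation mon :: (comm_monoid_mult) comm_monoid_add
begin

fun plus_mon :: "'a mon \<Rightarrow> 'a mon \<Rightarrow> 'a mon" where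
  "plus_mon (Mon a) (Mon b) = Mon (a * b)"

definition zero_mon :: "'a mon" where
  "zero_mon = Mon 1"

instance
proof
  fix x y z :: "'a mon"
  show "x + y + z = x + (y + z)" by (cases x; cases y; cases z) (simp add: mult.assoc)
  show "x + y = y + x" by (cases x; cases y) (simp add: mult.commute)
  show "0 + x = x" by (cases x) (simp add: zero_mon_def)
qed

end

text \<open>
  For ring homomorphisms \<open>i : B \<rightarrow> R\<close> and \<open>j : B \<rightarrow> L\<close> and an ideal \<open>I\<close> of \<open>R\<close>, the \<open>L\<close>-algebra
  \<open>(R/I) \<otimes>\<^sub>B L\<close> is the quotient of the monoid algebra of \<open>R\<close> over \<open>L\<close> by the following ideal;
  \<open>single (Mon r) l\<close> represents \<open>r \<otimes> l\<close>.
\<close>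

definition tensor_ideal ::
    "('b \<Rightarrow> 'r::comm_ring_1) \<Rightarrow> ('b \<Rightarrow> 'l::comm_ring_1) \<Rightarrow> 'r set \<Rightarrow> ('r mon \<Rightarrow>\<^sub>0 'l) set" where
  "tensor_ideal i j I = ideal_gen
     ({Poly_Mapping.single (Mon (a + b)) 1 - Poly_Mapping.single (Mon a) 1
         - Poly_Mapping.single (Mon b) 1 | a b. True}
      \<union> {Poly_Mapping.single (Mon (i g * a)) 1 - Poly_Mapping.single (Mon a) (j g) | g a. True}
      \<union> {Poly_Mapping.single (Mon a) 1 | a. a \<in> I})"

definition monalg_scale :: "'l \<Rightarrow> ('r::comm_ring_1 mon \<Rightarrow>\<^sub>0 'l::comm_ring_1) \<Rightarrow> ('r mon \<Rightarrow>\<^sub>0 'l)" where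
  "monalg_scale l q = Poly_Mapping.single 0 l * q"


section \<open>General elements\<close>

text \<open>Polynomial functions on a space whose coordinate functions are \<open>\<Phi>\<close>.\<close>

inductive_set polyfuns :: "('x \<Rightarrow> 'k::comm_ring_1) set \<Rightarrow> ('x \<Rightarrow> 'k) set"
  for \<Phi> :: "('x \<Rightarrow> 'k) set" where
  const: "(\<lambda>_. c) \<in> polyfuns \<Phi>"
| coord: "\<phi> \<in> \<Phi> \<Longrightarrow> \<phi> \<in> polyfuns \<Phi>"
| add: "p \<in> polyfuns \<Phi> \<Longrightarrow> q \<in> polyfuns \<Phi> \<Longrightarrow> (\<lambda>x. p x + q x) \<in> polyfuns \<Phi>"
| mult: "p \<in> polyfuns \<Phi> \<Longrightarrow> q \<in> polyfuns \<Phi> \<Longrightarrow> (\<lambda>x. p x * q x) \<in> polyfuns \<Phi>"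

definition zariski_open :: "'x set \<Rightarrow> ('x \<Rightarrow> 'k::comm_ring_1) set \<Rightarrow> 'x set \<Rightarrow> bool" where
  "zariski_open S \<Phi> U \<longleftrightarrow> (\<exists>E. E \<subseteq> polyfuns \<Phi> \<and> U = {x \<in> S. \<exists>p\<in>E. p x \<noteq> 0})"

definition for_general :: "'x set \<Rightarrow> ('x \<Rightarrow> 'k::comm_ring_1) set \<Rightarrow> ('x \<Rightarrow> bool) \<Rightarrow> bool" where
  "for_general S \<Phi> Q \<longleftrightarrow> (\<exists>U. zariski_open S \<Phi> U
     \<and> (\<forall>W. zariski_open S \<Phi> W \<and> W \<noteq> {} \<longrightarrow> U \<inter> W \<noteq> {})
     \<and> (\<forall>x\<in>U. Q x))"


section \<open>Power series in two variables\<close>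

text \<open>
  \<open>'c fps fps\<close> is \<open>C[[x]][[y]] = C[[x,y]]\<close>: the outer variable is \<open>y\<close>. For the base rings
  \<open>C = k[[\<epsilon>]]\<close> and \<open>C = k[[\<sigma>]][[\<epsilon>]]\<close> this is \<open>k[[x,y]][[\<epsilon>]]\<close> and \<open>k[[x,y]][[\<sigma>,\<epsilon>]]\<close>, with the
  variables of the base written innermost.
\<close>

definition varx :: "'c::comm_ring_1 fps fps" where "varx = fps_const fps_X"
definition vary :: "'c::comm_ring_1 fps fps" where "vary = fps_X"

definition const2 :: "'c::zero \<Rightarrow> 'c fps fps" where
  "const2 c = fps_const (fps_const c)"

definition map_coeffs :: "('c \<Rightarrow> 'd) \<Rightarrow> 'c fps fps \<Rightarrow> 'd fps fps" where
  "map_coeffs h F = Abs_fps (\<lambda>j. Abs_fps (\<lambda>i. h (fps_nth (fps_nth F j) i)))"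

definition dx :: "'c::comm_ring_1 fps fps \<Rightarrow> 'c fps fps" where
  "dx F = Abs_fps (\<lambda>j. fps_deriv (fps_nth F j))"

definition dy :: "'c::comm_ring_1 fps fps \<Rightarrow> 'c fps fps" where
  "dy F = fps_deriv F"


section \<open>First-order deformations\<close>

text \<open>
  Let \<open>A = k[[x,y]]/(f)\<close>. The module of (continuous) differentials is
  \<open>\<Omega>\<^sup>1 = (A dx \<oplus> A dy)/K\<close>, where \<open>K = A\<cdot>df\<close>. As \<open>A dx \<oplus> A dy\<close> is free, \<open>Ext\<^sup>1(\<Omega>\<^sup>1, A)\<close> is the
  cokernel of the restriction map \<open>Hom(A dx \<oplus> A dy, A) \<rightarrow> Hom(K, A)\<close>.
\<close>

definition df_module :: "'k::field fps fps \<Rightarrow> ('k fps fps \<times> 'k fps fps) set" where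
  "df_module f = {(u, v). \<exists>a. u - a * dx f \<in> ideal_gen {f} \<and> v - a * dy f \<in> ideal_gen {f}}"

definition df_hom :: "'k::field fps fps \<Rightarrow> ('k fps fps \<times> 'k fps fps \<Rightarrow> 'k fps fps) \<Rightarrow> bool" where
  "df_hom f \<phi> \<longleftrightarrow>
     (\<forall>u v u' v'. (u, v) \<in> df_module f \<longrightarrow> (u', v') \<in> df_module f \<longrightarrow>
        \<phi> (u + u', v + v') - \<phi> (u, v) - \<phi> (u', v') \<in> ideal_gen {f})
   \<and> (\<forall>r u v. (u, v) \<in> df_module f \<longrightarrow> \<phi> (r * u, r * v) - r * \<phi> (u, v) \<in> ideal_gen {f})
   \<and> (\<forall>u v. u \<in> ideal_gen {f} \<longrightarrow> v \<in> ideal_gen {f} \<longrightarrow> \<phi> (u, v) \<in> ideal_gen {f})"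

definition df_hom_extends ::
    "'k::field fps fps \<Rightarrow> ('k fps fps \<times> 'k fps fps \<Rightarrow> 'k fps fps) \<Rightarrow> bool" where
  "df_hom_extends f \<phi> \<longleftrightarrow> (\<exists>\<alpha> \<beta>. \<forall>u v. (u, v) \<in> df_module f \<longrightarrow>
     \<phi> (u, v) - (\<alpha> * u + \<beta> * v) \<in> ideal_gen {f})"

text \<open>
  A power series \<open>\<delta>\<close> represents the class in \<open>Ext\<^sup>1(\<Omega>\<^sup>1, A)\<close> of the homomorphism \<open>df \<mapsto> \<delta>\<close> on \<open>K\<close>.
\<close>

definition represents_Def1_basis :: "'k::field fps fps \<Rightarrow> 'k fps fps list \<Rightarrow> bool" where
  "represents_Def1_basis f \<delta> \<longleftrightarrow> (\<exists>\<phi> :: nat \<Rightarrow> 'k fps fps \<times> 'k fps fps \<Rightarrow> 'k fps fps.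
     (\<forall>i<length \<delta>. df_hom f (\<phi> i) \<and> \<phi> i (dx f, dy f) - \<delta> ! i \<in> ideal_gen {f})
   \<and> (\<forall>c. df_hom_extends f (\<lambda>w. \<Sum>i<length \<delta>. const2 (c i) * \<phi> i w)
        \<longrightarrow> (\<forall>i<length \<delta>. c i = 0))
   \<and> (\<forall>\<psi>. df_hom f \<psi> \<longrightarrow>
        (\<exists>c. df_hom_extends f (\<lambda>w. \<psi> w - (\<Sum>i<length \<delta>. const2 (c i) * \<phi> i w)))))"


section \<open>Deformations and principal parts\<close>

text \<open>
  \<open>deformation \<iota> f \<delta> p\<close> is \<open>F = f + \<Sum>\<^sub>i p\<^sub>i \<delta>\<^sub>i\<close>, where \<open>p\<^sub>i\<close> lies in the base ring \<open>C\<close> and \<open>\<iota>\<close> is the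
  inclusion of \<open>k\<close> into \<open>C\<close>. The ring of the total space \<open>Y\<close> is \<open>C[[x,y]]/(F)\<close>.
\<close>

definition deformation ::
    "('k \<Rightarrow> 'c) \<Rightarrow> 'k fps fps \<Rightarrow> 'k fps fps list \<Rightarrow> (nat \<Rightarrow> 'c) \<Rightarrow> 'c::comm_ring_1 fps fps" where
  "deformation \<iota> f \<delta> p =
     map_coeffs \<iota> f + (\<Sum>i<length \<delta>. const2 (p i) * map_coeffs \<iota> (\<delta> ! i))"

definition deformation1 ::
    "'k::field fps fps \<Rightarrow> 'k fps fps list \<Rightarrow> 'k list \<Rightarrow> 'k fps fps fps" where
  "deformation1 f \<delta> a = deformation fps_const f \<delta> (\<lambda>i. fps_const (a ! i) * fps_X)"

text \<open>In \<open>k[[\<sigma>]][[\<epsilon>]]\<close> the outer variable is \<open>\<epsilon>\<close>.\<close>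

definition deformation2 ::
    "'k::field fps fps \<Rightarrow> 'k fps fps list \<Rightarrow> 'k list \<Rightarrow> 'k list \<Rightarrow> 'k fps fps fps fps" where
  "deformation2 f \<delta> a b = deformation const2 f \<delta>
     (\<lambda>i. const2 (a ! i) * fps_const fps_X + const2 (b ! i) * fps_X)"

text \<open>
  The completed tensor product of \<open>C[[x,y]]/(F)\<close> with itself over \<open>C\<close> is
  \<open>C[[x,y]][[x',y']]/(F(x,y), F(x',y'))\<close>, a quotient of \<open>'c fps fps fps fps\<close> (the outer variables
  are \<open>x'\<close> and \<open>y'\<close>). The maps \<open>inleft\<close> and \<open>inright\<close> are \<open>g \<mapsto> g(x,y)\<close> and \<open>g \<mapsto> g(x',y')\<close>.
\<close>

definition inleft :: "'c::comm_ring_1 fps fps \<Rightarrow> 'c fps fps fps fps" where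
  "inleft g = const2 g"

definition inright :: "'c::comm_ring_1 fps fps \<Rightarrow> 'c fps fps fps fps" where
  "inright g = map_coeffs const2 g"

definition diagonal_ideal :: "'c::comm_ring_1 fps fps fps fps set" where
  "diagonal_ideal = ideal_gen {inright varx - inleft varx, inright vary - inleft vary}"

text \<open>The module of principal parts of order \<open>m\<close> is the quotient by the following ideal.\<close>

definition pp_ideal :: "'c::comm_ring_1 fps fps \<Rightarrow> nat \<Rightarrow> 'c fps fps fps fps set" where
  "pp_ideal F m = ideal_gen ({inleft F, inright F} \<union> ideal_power diagonal_ideal m)"

text \<open>Elements of the dual module: linear maps from principal parts to \<open>C[[x,y]]/(F)\<close>, the
  module structure being given by \<open>inleft\<close>.\<close>

definition pp_dual ::
    "'c::comm_ring_1 fps fps \<Rightarrow> nat \<Rightarrow> ('c fps fps fps fps \<Rightarrow> 'c fps fps) \<Rightarrow> bool" where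
  "pp_dual F m \<phi> \<longleftrightarrow>
     (\<forall>u v. \<phi> (u + v) - \<phi> u - \<phi> v \<in> ideal_gen {F})
   \<and> (\<forall>r u. \<phi> (inleft r * u) - r * \<phi> u \<in> ideal_gen {F})
   \<and> (\<forall>u \<in> pp_ideal F m. \<phi> u \<in> ideal_gen {F})"

text \<open>\<open>e 0, \<dots>, e (m - 1)\<close> is a basis of the dual; in particular the dual is free of rank \<open>m\<close>.\<close>

definition pp_dual_basis ::
    "'c::comm_ring_1 fps fps \<Rightarrow> nat \<Rightarrow> (nat \<Rightarrow> 'c fps fps fps fps \<Rightarrow> 'c fps fps) \<Rightarrow> bool" where
  "pp_dual_basis F m e \<longleftrightarrow>
     (\<forall>i<m. pp_dual F m (e i))
   \<and> (\<forall>c. (\<forall>u. (\<Sum>i<m. c i * e i u) \<in> ideal_gen {F}) \<longrightarrow> (\<forall>i<m. c i \<in> ideal_gen {F}))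
   \<and> (\<forall>\<phi>. pp_dual F m \<phi> \<longrightarrow> (\<exists>c. \<forall>u. \<phi> u - (\<Sum>i<m. c i * e i u) \<in> ideal_gen {F}))"

text \<open>The ideal of maximal minors of the matrix \<open>(e\<^sub>i(\<tau>\<^sub>j))\<close> with \<open>m\<close> rows and \<open>n \<le> m\<close> columns,
  where \<open>n\<close> is the length of \<open>\<tau>\<close>; \<open>r\<close> selects the rows.\<close>

definition minors_ideal ::
    "'c::comm_ring_1 fps fps \<Rightarrow> nat \<Rightarrow> (nat \<Rightarrow> 'c fps fps fps fps \<Rightarrow> 'c fps fps) \<Rightarrow>
     'c fps fps fps fps list \<Rightarrow> 'c fps fps set" where
  "minors_ideal F m e \<tau> = ideal_gen (insert F
     {det (mat (length \<tau>) (length \<tau>) (\<lambda>(i, j). e (r i) (\<tau> ! j))) | r.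
        strict_mono_on {..<length \<tau>} r \<and> r ` {..<length \<tau>} \<subseteq> {..<m}})"


section \<open>Automatic degeneracy\<close>

definition AD2 :: "nat \<Rightarrow> 'k::field fps fps \<Rightarrow> 'k fps fps list \<Rightarrow> enat" where
  "AD2 m f \<delta> = Inf {quotient_dim (\<lambda>c g. const2 (fps_const c) * g)
       (minors_ideal (deformation1 f \<delta> a) m e \<tau>) | a e \<tau>.
     length a = length \<delta> \<and> pp_dual_basis (deformation1 f \<delta> a) m e \<and> length \<tau> = m - 1}"


section \<open>Limiting inflection points\<close>

text \<open>
  Let \<open>M\<close> be the module of principal parts modulo the \<open>N\<close>-th power of the maximal ideal of the
  completed tensor product, a finite-dimensional vector space. As coordinate functions on lists
  of \<open>n\<close> elements of \<open>M\<close> we take all \<open>k\<close>-linear functionals on \<open>M\<close>, applied to an entry.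
\<close>

definition jet_coords :: "'k::field fps fps fps fps \<Rightarrow> nat \<Rightarrow> nat \<Rightarrow> nat \<Rightarrow>
     ('k fps fps fps fps fps fps list \<Rightarrow> 'k) set" where
  "jet_coords F m n N = {\<lambda>\<tau>. \<phi> (\<tau> ! j) | \<phi> j. j < n
     \<and> Modules.module_hom (\<lambda>c u. inleft (const2 (const2 c)) * u) (*) \<phi>
     \<and> (\<forall>u \<in> pp_ideal F m \<union> ideal_power nonunits N. \<phi> u = 0)}"

text \<open>\<open>L\<close> is the type \<open>'k fls alg_closure\<close>.\<close>

definition sigma_in_total :: "'k::field fps \<Rightarrow> 'k fps fps fps fps" where
  "sigma_in_total g = const2 (fps_const g)"

definition sigma_in_L :: "'k::field fps \<Rightarrow> 'k fls alg_closure" where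
  "sigma_in_L g = to_ac (fps_to_fls g)"

text \<open>
  For an ideal \<open>I \<ni> F\<close>, the total length over \<open>L\<close> of \<open>(C[[x,y]]/I) \<otimes> L\<close>, where the tensor product is
  over \<open>k[[\<sigma>]]\<close>, at its points outside the singular locus. By the Jacobian criterion a point lies
  in the singular locus iff both partial derivatives of \<open>F\<close> vanish there.
\<close>

definition nonsingular_points ::
    "'k::field fps fps fps fps \<Rightarrow> 'k fps fps fps fps set \<Rightarrow>
     ('k fps fps fps fps mon \<Rightarrow>\<^sub>0 'k fls alg_closure) set set" where
  "nonsingular_points F I = {P. prime_ideal P \<and> tensor_ideal sigma_in_total sigma_in_L I \<subseteq> P
     \<and> \<not> (Poly_Mapping.single (Mon (dx F)) 1 \<in> P \<and> Poly_Mapping.single (Mon (dy F)) 1 \<in> P)}"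

definition nonsingular_length ::
    "'k::field fps fps fps fps \<Rightarrow> 'k fps fps fps fps set \<Rightarrow> enat" where
  "nonsingular_length F I = Sup {\<Sum>P\<in>\<A>. localization_dim monalg_scale
       (tensor_ideal sigma_in_total sigma_in_L I) P | \<A>.
     finite \<A> \<and> \<A> \<subseteq> nonsingular_points F I}"

definition limiting_inflection_points ::
    "nat \<Rightarrow> 'k::field fps fps \<Rightarrow> 'k fps fps list \<Rightarrow> enat \<Rightarrow> bool" where
  "limiting_inflection_points m f \<delta> \<nu> \<longleftrightarrow>
     for_general {(a, b). length a = length \<delta> \<and> length b = length \<delta>}
       ({\<lambda>(a, b). a ! i | i. i < length \<delta>} \<union> {\<lambda>(a, b). b ! i | i. i < length \<delta>})
       (\<lambda>(a, b). let F = deformation2 f \<delta> a b in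
          (\<exists>e. pp_dual_basis F m e) \<and>
          (\<exists>N. for_general {\<tau>. length \<tau> = m - 1} (jet_coords F m (m - 1) N)
             (\<lambda>\<tau>. \<forall>e. pp_dual_basis F m e \<longrightarrow>
                nonsingular_length F (minors_ideal F m e \<tau>) = \<nu>)))"

end

theory Submission
  imports Defs
begin

text \<open>
  Let \<open>F\<close> be the equation of a deformation. If the dual of the principal parts is free, then
  \<open>F, dy F, dx F\<close> is a regular sequence, and the iterates of the tangent field
  \<open>dy F \<partial>\<^sub>x - dx F \<partial>\<^sub>y\<close>, evaluated on the diagonal, are a basis of the dual. For suitable weights
  the rows of the matrix in this basis have high order, and counting monomials bounds the colength of
  the minors from below by \<open>(2t-3)(s-1)\<close>.

  If a section does not vanish at the origin, the ideal of minors is \<open>(F, h, h')\<close> with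
  \<open>h = \<beta> dy F - \<gamma> dx F\<close>, and modulo \<open>(F, h)\<close> the second minor \<open>h'\<close> is a unit times \<open>dx F \<cdot> k\<close>, where \<open>k\<close>
  is, up to a multiple of \<open>dx F\<close>, the Hessian form of \<open>F\<close> in the direction tangent to the section. So the
  ideal splits into \<open>(F, h, dx F)\<close>, of colength \<open>(t-1)(s-1)\<close>, and \<open>(F, h, k)\<close>, of colength \<open>(t-2)(s-1)\<close>;
  this makes the lower bound sharp. In a general two-parameter deformation the quotient by \<open>(F, h, k)\<close> is
  free of rank \<open>(t-2)(s-1)\<close> over \<open>k[[\<sigma>]]\<close>, and a power of \<open>\<sigma>\<close> lies in \<open>(F, dx F, dy F, k)\<close>, so that after inverting
  \<open>\<sigma>\<close> exactly this part of the scheme lies outside the singular locus.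
\<close>


section \<open>Algebra in complete filtered rings and linear algebra over domains\<close>

section \<open>Ideals and regular sequences\<close>

text \<open>The minimum runs over every deformation whose dual happens to be free, and its generic
  fibre might still be singular. To exclude this, one localizes at an associated prime of
  (\<open>F\<close>, \<open>dy F\<close>) containing \<open>dx F\<close>. There a free dual would
  produce two derivations that act on forms in \<open>dx F, dy F\<close> as lowering and raising
  operators; they turn a single relation among forms into the vanishing of a power of
  \<open>dy F\<close> times an element outside the prime.

  The lower bound must also cover sections that both vanish at the origin, where three minors are
  really needed. Adding a scalar to one entry makes it a unit, generation survives almost every such
  perturbation, and a weighted Bezout count applies to the two minors that remain.

  The weights are forced: with t - 1 for x and s - 1 for y both partials of y^t - x^s have order
  (t-1)(s-1). Upper bounds use other weights, in which the generators have leading forms simple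
  enough for division with remainder. Regular sequences are permuted by completeness, so that
  regularity may be proved in whichever order is easiest.\<close>

interpretation ideal: Modules.module "(*) :: 'a::comm_ring_1 \<Rightarrow> 'a \<Rightarrow> 'a"
  by (rule module_times)

text \<open>Scalars and ring elements coincide here, so this rule reassociates products and would
  fight \<open>mult.assoc\<close>.\<close>

declare ideal.scale_scale [simp del]

lemma ideal_gen_mult: "a \<in> ideal_gen S \<Longrightarrow> r * a \<in> ideal_gen S"
  by (rule ideal.span_scale)

lemma ideal_gen_mult2: "a \<in> ideal_gen S \<Longrightarrow> a * r \<in> ideal_gen S"
  using ideal.span_scale[of a S r] by (simp add: mult.commute)

lemma ideal_gen_insertE:
  assumes "x \<in> ideal_gen (insert a S)"
  obtains k where "x - k * a \<in> ideal_gen S"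
  using assms ideal.span_breakdown_eq by blast

lemma ideal_gen_insertI: "x - k * a \<in> ideal_gen S \<Longrightarrow> x \<in> ideal_gen (insert a S)"
  using ideal.span_breakdown_eq by blast

lemma ideal_gen_singleton: "x \<in> ideal_gen {a} \<longleftrightarrow> (\<exists>k. x = k * a)"
  by (simp add: ideal.span_breakdown_eq)

lemma ideal_gen_2: "x \<in> ideal_gen {a, b} \<longleftrightarrow> (\<exists>k l. x = k * a + l * b)"
  by (simp add: ideal.span_breakdown_eq algebra_simps)

lemma ideal_gen_3: "x \<in> ideal_gen {a, b, c} \<longleftrightarrow> (\<exists>k l m. x = k * a + l * b + m * c)"
  by (simp add: ideal.span_breakdown_eq algebra_simps)

lemma ideal_gen_4: "x \<in> ideal_gen {a, b, c, d} \<longleftrightarrow> (\<exists>k l m n. x = k * a + l * b + m * c + n * d)"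
  by (simp add: ideal.span_breakdown_eq algebra_simps)

text \<open>Nonzerodivisor on the quotient by the ideal generated by \<open>S\<close>; a zero
  quotient is allowed. The parameter is a generating set, so that sequences grow by
  \<open>insert\<close>.\<close>

definition nzd :: "'a::comm_ring_1 set \<Rightarrow> 'a \<Rightarrow> bool" where
  "nzd S a \<longleftrightarrow> (\<forall>r. a * r \<in> ideal_gen S \<longrightarrow> r \<in> ideal_gen S)"

lemma nzdD: "nzd S a \<Longrightarrow> a * r \<in> ideal_gen S \<Longrightarrow> r \<in> ideal_gen S"
  by (simp add: nzd_def)

lemma nzd_power: "nzd S a \<Longrightarrow> a ^ n * r \<in> ideal_gen S \<Longrightarrow> r \<in> ideal_gen S"
proof (induction n)
  case (Suc n)
  then have "a * (a ^ n * r) \<in> ideal_gen S" by (simp add: mult.assoc)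
  with Suc show ?case by (blast dest: nzdD)
qed simp

text \<open>Modulo \<open>S\<close> a power of \<open>z\<close> is a multiple of \<open>a\<close>,
  so whatever \<open>a\<close> kills is killed by that power. This is the usual way to verify
  regularity below: a finite-dimensional quotient or an explicit identity supplies the
  power.\<close>

lemma nzd_if_power_mem:
  assumes "nzd S z" and "z ^ n \<in> ideal_gen (insert a S)"
  shows "nzd S a"
  unfolding nzd_def
proof (intro allI impI)
  fix r assume r: "a * r \<in> ideal_gen S"
  obtain k where "z ^ n - k * a \<in> ideal_gen S" using assms(2) by (rule ideal_gen_insertE)
  then have "(z ^ n - k * a) * r \<in> ideal_gen S" by (rule ideal_gen_mult2)
  moreover have "k * (a * r) \<in> ideal_gen S" using r by (rule ideal_gen_mult)
  ultimately have "(z ^ n - k * a) * r + k * (a * r) \<in> ideal_gen S" by (rule ideal.span_add)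
  then have "z ^ n * r \<in> ideal_gen S" by (simp add: algebra_simps)
  then show "r \<in> ideal_gen S" using assms(1) nzd_power by blast
qed

text \<open>The purely algebraic half of exchanging neighbours in a regular sequence: a r = c b
  forces c to be a multiple of a, which then cancels. The other half is \<open>nzd_lift\<close> and
  uses completeness.\<close>

lemma nzd_insert_swap:
  assumes a: "nzd S a" and b: "nzd (insert a S) b"
  shows "nzd (insert b S) a"
  unfolding nzd_def
proof (intro allI impI)
  fix r assume "a * r \<in> ideal_gen (insert b S)"
  then obtain c where c: "a * r - c * b \<in> ideal_gen S" by (rule ideal_gen_insertE)
  have "b * c - r * a \<in> ideal_gen S" using ideal.span_neg[OF c] by (simp add: algebra_simps)
  then have "b * c \<in> ideal_gen (insert a S)" by (rule ideal_gen_insertI)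
  with b have "c \<in> ideal_gen (insert a S)" by (rule nzdD)
  then obtain k where k: "c - k * a \<in> ideal_gen S" by (rule ideal_gen_insertE)
  have "(a * r - c * b) + b * (c - k * a) \<in> ideal_gen S"
    using c ideal_gen_mult[OF k] by (rule ideal.span_add)
  then have "a * (r - k * b) \<in> ideal_gen S" by (simp add: algebra_simps)
  then have "r - k * b \<in> ideal_gen S" using a nzdD by blast
  then show "r \<in> ideal_gen (insert b S)" by (rule ideal_gen_insertI)
qed

text \<open>Weakly regular sequences: the last quotient may be zero.\<close>

fun regular :: "'a::comm_ring_1 set \<Rightarrow> 'a list \<Rightarrow> bool" where
  "regular S [] \<longleftrightarrow> True"
| "regular S (a # as) \<longleftrightarrow> nzd S a \<and> regular (insert a S) as"


section \<open>Complete filtrations\<close>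

text \<open>A separated and complete filtration by ideals. Completeness is stated for series because
  successive corrections come as series. One locale serves all weightings of the variables, which
  differ from one estimate to the next.\<close>

locale filtered =
  fixes Fil :: "nat \<Rightarrow> 'a::comm_ring_1 set"
  assumes Fil_0 [simp]: "Fil 0 = UNIV"
    and Fil_SucD: "a \<in> Fil (Suc n) \<Longrightarrow> a \<in> Fil n"
    and Fil_zero [simp]: "0 \<in> Fil n"
    and Fil_add: "a \<in> Fil n \<Longrightarrow> b \<in> Fil n \<Longrightarrow> a + b \<in> Fil n"
    and Fil_mult: "a \<in> Fil m \<Longrightarrow> b \<in> Fil n \<Longrightarrow> a * b \<in> Fil (m + n)"
    and Fil_separated: "(\<And>n. a \<in> Fil n) \<Longrightarrow> a = 0"
    and Fil_complete: "(\<And>n. s n \<in> Fil n) \<Longrightarrow> \<exists>S. \<forall>n. S - (\<Sum>i<n. s i) \<in> Fil n"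
begin

lemma Fil_mono: "a \<in> Fil n \<Longrightarrow> m \<le> n \<Longrightarrow> a \<in> Fil m"
  by (induction n) (auto simp: le_Suc_eq dest: Fil_SucD)

lemma Fil_mult1: "a \<in> Fil n \<Longrightarrow> r * a \<in> Fil n"
  using Fil_mult[of r 0 a n] by simp

lemma Fil_mult2: "a \<in> Fil n \<Longrightarrow> a * r \<in> Fil n"
  using Fil_mult1[of a n r] by (simp add: mult.commute)

lemma Fil_multI: "a \<in> Fil m \<Longrightarrow> b \<in> Fil n \<Longrightarrow> k \<le> m + n \<Longrightarrow> a * b \<in> Fil k"
  using Fil_mult Fil_mono by blast

lemma Fil_uminus: "a \<in> Fil n \<Longrightarrow> - a \<in> Fil n"
  using Fil_mult1[of a n "-1"] by simp

lemma Fil_diff: "a \<in> Fil n \<Longrightarrow> b \<in> Fil n \<Longrightarrow> a - b \<in> Fil n"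
  using Fil_add[of a n "- b"] Fil_uminus by auto

lemma Fil_sum: "(\<And>i. i \<in> I \<Longrightarrow> s i \<in> Fil n) \<Longrightarrow> sum s I \<in> Fil n"
  by (induction I rule: infinite_finite_induct) (auto intro: Fil_add)

lemma Fil_power: "a \<in> Fil n \<Longrightarrow> a ^ k \<in> Fil (k * n)"
  by (induction k) (auto intro: Fil_mult)

lemma Fil_powerI: "a \<in> Fil n \<Longrightarrow> m \<le> k * n \<Longrightarrow> a ^ k \<in> Fil m"
  using Fil_power Fil_mono by blast

lemma Fil_eqI: "(\<And>n. a - b \<in> Fil n) \<Longrightarrow> a = b"
  using Fil_separated[of "a - b"] by simp

text \<open>Truncated subtraction leaves the first \<open>w\<close> terms unrestricted; they are
  split off and the tail is summed.\<close>

lemma Fil_complete_shift: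
  assumes s: "\<And>n. s n \<in> Fil (n - w)"
  shows "\<exists>S. \<forall>n. S - (\<Sum>i<n. s i) \<in> Fil (n - w)"
proof -
  have "\<exists>S. \<forall>n. S - (\<Sum>i<n. s (i + w)) \<in> Fil n"
    by (rule Fil_complete) (metis add_diff_cancel_right' s)
  then obtain S where S: "\<And>n. S - (\<Sum>i<n. s (i + w)) \<in> Fil n" by blast
  have split: "(\<Sum>i<n + w. s i) = (\<Sum>i<w. s i) + (\<Sum>i<n. s (i + w))" for n
    by (induction n) auto
  have "(S + (\<Sum>i<w. s i)) - (\<Sum>i<n. s i) \<in> Fil (n - w)" for n
  proof (cases "n \<le> w")
    case False
    then obtain k where "n = k + w" by (metis add.commute le_add_diff_inverse nat_le_linear)
    then show ?thesis using S[of k] split[of k] by (simp add: algebra_simps)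
  qed simp
  then show ?thesis by blast
qed

text \<open>Successive approximation: a description of all of \<open>Q n\<close> up to \<open>Q (n + 1)\<close>, with
  coefficients tending to zero, sums up to an exact one. The \<open>g i\<close> have arbitrary coefficients
  and the \<open>m j\<close> have coefficients in a second complete ring.\<close>

lemma approx_rem:
  fixes FV :: "nat \<Rightarrow> 'v::comm_ring_1 set" and emb :: "'v \<Rightarrow> 'a"
  assumes V: "filtered FV"
    and emb_add: "\<And>a b. emb (a + b) = emb a + emb b"
    and emb_Fil: "\<And>n a. a \<in> FV n \<Longrightarrow> emb a \<in> Fil n"
    and fin: "finite I" "finite J"
    and QF: "\<And>n u. u \<in> Q n \<Longrightarrow> u \<in> Fil n"
    and step: "\<And>n u. N \<le> n \<Longrightarrow> u \<in> Q n \<Longrightarrow> \<exists>a b. (\<forall>i\<in>I. a i \<in> Fil (n - w)) \<and>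
      (\<forall>j\<in>J. b j \<in> FV (n - w)) \<and> u - ((\<Sum>i\<in>I. a i * g i) + (\<Sum>j\<in>J. emb (b j) * m j)) \<in> Q (Suc n)"
    and u: "u \<in> Q N"
  shows "\<exists>a b. u = (\<Sum>i\<in>I. a i * g i) + (\<Sum>j\<in>J. emb (b j) * m j)"
proof -
  interpret V: filtered FV by fact
  have emb_diff: "emb (a - b) = emb a - emb b" for a b
    using emb_add[of "a - b" b] by simp
  have emb_0: "emb 0 = 0" using emb_add[of 0 0] by simp
  define P where "P n u a b \<longleftrightarrow> (\<forall>i\<in>I. a i \<in> Fil (n - w)) \<and> (\<forall>j\<in>J. b j \<in> FV (n - w)) \<and>
      u - ((\<Sum>i\<in>I. a i * g i) + (\<Sum>j\<in>J. emb (b j) * m j)) \<in> Q (Suc n)" for n u a b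
  \<comment> \<open>The coefficients depend on the stage and on the current remainder, so they are
    chosen as functions of both before the iteration is set up.\<close>
  define A where "A n u = (SOME a. \<exists>b. P n u a b)" for n u
  define B where "B n u = (SOME b. P n u (A n u) b)" for n u
  have AB: "(\<forall>i\<in>I. A n u i \<in> Fil (n - w)) \<and> (\<forall>j\<in>J. B n u j \<in> FV (n - w)) \<and>
      u - ((\<Sum>i\<in>I. A n u i * g i) + (\<Sum>j\<in>J. emb (B n u j) * m j)) \<in> Q (Suc n)"
    if "N \<le> n" "u \<in> Q n" for n u
  proof -
    have "\<exists>a b. P n u a b" using step[OF that] unfolding P_def by blast
    then have "\<exists>b. P n u (A n u) b" unfolding A_def by (rule someI_ex)
    then have "P n u (A n u) (B n u)" unfolding B_def by (rule someI_ex)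
    then show ?thesis unfolding P_def .
  qed
  define T where "T n v = (\<Sum>i\<in>I. A (n + N) v i * g i) + (\<Sum>j\<in>J. emb (B (n + N) v j) * m j)" for n v
  define U where "U = rec_nat u (\<lambda>n v. v - T n v)"
  have U0: "U 0 = u" and US: "U (Suc n) = U n - T n (U n)" for n
    by (simp_all add: U_def)
  have UQ: "U n \<in> Q (n + N)" for n
  proof (induction n)
    case (Suc n)
    show ?case using AB[of "n + N" "U n"] Suc unfolding US T_def by simp
  qed (simp add: U0 u)
  have aF: "A (n + N) (U n) i \<in> Fil (n - w)" if "i \<in> I" for n i
    using AB[of "n + N" "U n"] UQ that by (meson Fil_mono diff_le_mono le_add1 le_add2)
  have bF: "B (n + N) (U n) j \<in> FV (n - w)" if "j \<in> J" for n j
    using AB[of "n + N" "U n"] UQ that by (meson V.Fil_mono diff_le_mono le_add1 le_add2)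
  have "\<forall>i\<in>I. \<exists>S. \<forall>n. S - (\<Sum>l<n. A (l + N) (U l) i) \<in> Fil (n - w)"
    by (intro ballI Fil_complete_shift aF)
  from bchoice[OF this]
  obtain a where a: "\<And>i n. i \<in> I \<Longrightarrow> a i - (\<Sum>l<n. A (l + N) (U l) i) \<in> Fil (n - w)"
    by blast
  have "\<forall>j\<in>J. \<exists>S. \<forall>n. S - (\<Sum>l<n. B (l + N) (U l) j) \<in> FV (n - w)"
    by (intro ballI V.Fil_complete_shift bF)
  from bchoice[OF this]
  obtain b where b: "\<And>j n. j \<in> J \<Longrightarrow> b j - (\<Sum>l<n. B (l + N) (U l) j) \<in> FV (n - w)"
    by blast
  have part: "u - U n = (\<Sum>i\<in>I. (\<Sum>l<n. A (l + N) (U l) i) * g i)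
      + (\<Sum>j\<in>J. emb (\<Sum>l<n. B (l + N) (U l) j) * m j)" for n
    by (induction n) (auto simp: U0 US T_def emb_0 emb_add distrib_right sum.distrib)
  have "u = (\<Sum>i\<in>I. a i * g i) + (\<Sum>j\<in>J. emb (b j) * m j)"
  proof (rule Fil_eqI)
    fix k
    \<comment> \<open>Coefficients are known only to order \<open>n - w\<close>, so the partial sum
      goes \<open>w\<close> steps beyond the order \<open>k\<close> being tested.\<close>
    define n where "n = k + w"
    have "u - ((\<Sum>i\<in>I. a i * g i) + (\<Sum>j\<in>J. emb (b j) * m j)) = U n
        - ((\<Sum>i\<in>I. (a i - (\<Sum>l<n. A (l + N) (U l) i)) * g i)
        + (\<Sum>j\<in>J. emb (b j - (\<Sum>l<n. B (l + N) (U l) j)) * m j))"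
      using part[of n] by (simp add: left_diff_distrib emb_diff sum_subtractf diff_eq_eq add.commute)
    also have "\<dots> \<in> Fil k"
    proof (intro Fil_diff Fil_add Fil_sum)
      show "U n \<in> Fil k" using QF[OF UQ[of n]] by (rule Fil_mono) (simp add: n_def)
      show "(a i - (\<Sum>l<n. A (l + N) (U l) i)) * g i \<in> Fil k" if "i \<in> I" for i
        using a[OF that, of n] by (intro Fil_mult2) (simp add: n_def)
      show "emb (b j - (\<Sum>l<n. B (l + N) (U l) j)) * m j \<in> Fil k" if "j \<in> J" for j
        using emb_Fil[OF b[OF that, of n]] by (intro Fil_mult2) (simp add: n_def)
    qed
    finally show "u - ((\<Sum>i\<in>I. a i * g i) + (\<Sum>j\<in>J. emb (b j) * m j)) \<in> Fil k" .
  qed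
  then show ?thesis by blast
qed

lemma approx:
  assumes fin: "finite I"
    and QF: "\<And>n u. u \<in> Q n \<Longrightarrow> u \<in> Fil n"
    and step: "\<And>n u. N \<le> n \<Longrightarrow> u \<in> Q n \<Longrightarrow> \<exists>a. (\<forall>i\<in>I. a i \<in> Fil (n - w)) \<and>
      u - (\<Sum>i\<in>I. a i * g i) \<in> Q (Suc n)"
    and u: "u \<in> Q N"
  shows "\<exists>a. u = (\<Sum>i\<in>I. a i * g i)"
proof -
  have "\<exists>a b. u = (\<Sum>i\<in>I. a i * g i) + (\<Sum>j\<in>({}::nat set). b j * (\<lambda>_. 0) j)"
    by (rule approx_rem[where FV = Fil and w = w and N = N and Q = Q])
      (use assms filtered_axioms in auto)
  then show ?thesis by simp
qed

text \<open>If \<open>p\<close> kills \<open>r\<close>, then \<open>r\<close> is a multiple of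
  \<open>z\<close>, and \<open>p\<close> also kills the cofactor because \<open>z\<close> cancels.
  Iterating makes \<open>r\<close>, modulo \<open>S\<close>, a multiple of every power of
  \<open>z\<close>. Completeness, instead of Krull's intersection theorem, puts \<open>r\<close>
  into the ideal itself: the corrections are convergent series of multiples of the finitely many
  generators.\<close>

lemma nzd_lift:
  assumes fin: "finite S" and z: "z \<in> Fil 1" and nz: "nzd S z" and np: "nzd (insert z S) p"
  shows "nzd S p"
  unfolding nzd_def
proof (intro allI impI)
  fix r assume r: "p * r \<in> ideal_gen S"
  define Q where "Q n = {z ^ n * v | v. p * v \<in> ideal_gen S}" for n
  have "\<exists>a. r = (\<Sum>s\<in>S. a s * s)"
  proof (rule approx[where N = 0 and Q = Q and w = 0 and I = S and g = "\<lambda>s. s"])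
    fix n u assume "u \<in> Q n"
    then show "u \<in> Fil n"
      using Fil_mult2[OF Fil_power[OF z, of n]] unfolding Q_def by auto
  next
    fix n u assume "u \<in> Q n"
    then obtain v where u: "u = z ^ n * v" and v: "p * v \<in> ideal_gen S" unfolding Q_def by blast
    have "p * v \<in> ideal_gen (insert z S)" using v ideal.span_mono[of S "insert z S"] by blast
    with np have "v \<in> ideal_gen (insert z S)" by (rule nzdD)
    then obtain k where k: "v - k * z \<in> ideal_gen S" by (rule ideal_gen_insertE)
    then obtain b where b: "v - k * z = (\<Sum>s\<in>S. b s * s)"
      unfolding ideal.span_finite[OF fin] by blast
    have "p * v - p * (v - k * z) \<in> ideal_gen S" using v ideal_gen_mult[OF k] by (rule ideal.span_diff)
    then have "z * (p * k) \<in> ideal_gen S" by (simp add: algebra_simps)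
    then have pk: "p * k \<in> ideal_gen S" using nz nzdD by blast
    have "u - (\<Sum>s\<in>S. (z ^ n * b s) * s) = z ^ n * (v - (\<Sum>s\<in>S. b s * s))"
      by (simp add: u right_diff_distrib sum_distrib_left mult.assoc)
    also have "\<dots> = z ^ Suc n * k" using b by (simp add: algebra_simps)
    finally have "u - (\<Sum>s\<in>S. (z ^ n * b s) * s) \<in> Q (Suc n)" using pk unfolding Q_def by blast
    moreover have "z ^ n * b s \<in> Fil (n - 0)" for s
      using Fil_mult2[OF Fil_power[OF z, of n]] by simp
    ultimately show "\<exists>a. (\<forall>i\<in>S. a i \<in> Fil (n - 0)) \<and> u - (\<Sum>i\<in>S. a i * i) \<in> Q (Suc n)"
      by (intro exI[of _ "\<lambda>s. z ^ n * b s"]) simp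
  next
    show "r \<in> Q 0" unfolding Q_def using r by auto
  qed (use fin in auto)
  then show "r \<in> ideal_gen S" unfolding ideal.span_finite[OF fin] by blast
qed

lemma regular_swap:
  assumes "finite S" "a \<in> Fil 1" "regular S (a # b # as)"
  shows "regular S (b # a # as)"
  using assms nzd_lift[of S a b] nzd_insert_swap[of S a b] by (simp add: insert_commute)

end

text \<open>The discrete filtration of the coefficient ring, the innermost layer of every weighted
  filtration.\<close>

definition trivial_fil :: "nat \<Rightarrow> 'a::comm_ring_1 set" where
  "trivial_fil n = (if n = 0 then UNIV else {0})"

lemma filtered_trivial: "filtered (trivial_fil :: nat \<Rightarrow> 'a::comm_ring_1 set)"
proof
  fix s :: "nat \<Rightarrow> 'a" assume s: "\<And>n. s n \<in> trivial_fil n"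
  have "s 0 - (\<Sum>i<n. s i) \<in> trivial_fil n" for n
  proof (cases n)
    case (Suc m)
    have "s (Suc i) = 0" for i using s[of "Suc i"] by (simp add: trivial_fil_def)
    then show ?thesis unfolding Suc sum.lessThan_Suc_shift by (simp add: trivial_fil_def)
  qed (simp add: trivial_fil_def)
  then show "\<exists>S. \<forall>n. S - (\<Sum>i<n. s i) \<in> trivial_fil n" by blast
next
  fix a :: 'a assume "\<And>n. a \<in> trivial_fil n"
  from this[of 1] show "a = 0" by (simp add: trivial_fil_def)
qed (auto simp: trivial_fil_def split: if_splits)

text \<open>Total weight when the new variable has weight \<open>w\<close> and \<open>V\<close>
  measures the coefficients. Truncated subtraction drops the condition once \<open>w * j\<close>
  reaches \<open>n\<close>. Weight 0 is allowed and makes the variable invisible to the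
  filtration.\<close>

definition wfil :: "nat \<Rightarrow> (nat \<Rightarrow> 'a::comm_ring_1 set) \<Rightarrow> nat \<Rightarrow> 'a fps set" where
  "wfil w V n = {g. \<forall>j. fps_nth g j \<in> V (n - w * j)}"

lemma filtered_wfil:
  assumes "filtered V"
  shows "filtered (wfil w V)"
proof -
  interpret V: filtered V by fact
  show ?thesis
  proof
    show "a \<in> wfil w V n" if "a \<in> wfil w V (Suc n)" for a n
      using that unfolding wfil_def by (auto intro: V.Fil_mono)
    show "a * b \<in> wfil w V (m + n)" if a: "a \<in> wfil w V m" and b: "b \<in> wfil w V n" for a b m n
      unfolding wfil_def mem_Collect_eq fps_mult_nth
    proof (intro allI V.Fil_sum)
      fix j i :: nat assume "i \<in> {0..j}"
      then have "m + n - w * j \<le> (m - w * i) + (n - w * (j - i))"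
        by (auto simp: diff_mult_distrib2)
      then show "fps_nth a i * fps_nth b (j - i) \<in> V (m + n - w * j)"
        using a b unfolding wfil_def by (auto intro: V.Fil_multI)
    qed
    show "a = 0" if "\<And>n. a \<in> wfil w V n" for a
    proof (rule fps_ext)
      fix j
      have "fps_nth a j \<in> V n" for n
        using that[of "n + w * j"] unfolding wfil_def by (auto dest: spec[of _ j])
      then show "fps_nth a j = fps_nth 0 j" using V.Fil_separated[of "fps_nth a j"] by simp
    qed
    show "\<exists>S. \<forall>n. S - (\<Sum>i<n. s i) \<in> wfil w V n" if s: "\<And>n. s n \<in> wfil w V n" for s
    proof -
      have "\<forall>j. \<exists>S. \<forall>n. S - (\<Sum>i<n. fps_nth (s i) j) \<in> V (n - w * j)"
        by (intro allI V.Fil_complete_shift) (use s in \<open>auto simp: wfil_def\<close>)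
      from choice[OF this]
      obtain S where "\<And>j n. S j - (\<Sum>i<n. fps_nth (s i) j) \<in> V (n - w * j)" by blast
      then have "\<forall>n. Abs_fps S - (\<Sum>i<n. s i) \<in> wfil w V n"
        by (simp add: wfil_def fps_sum_nth)
      then show ?thesis by blast
    qed
  qed (auto simp: wfil_def intro: V.Fil_add)
qed

lemma wfil_const: "filtered V \<Longrightarrow> c \<in> V n \<Longrightarrow> fps_const c \<in> wfil w V n"
  by (auto simp: wfil_def filtered.Fil_zero)

lemma wfil_X: "filtered V \<Longrightarrow> n \<le> w \<Longrightarrow> fps_X \<in> wfil w V n"
  by (auto simp: wfil_def fps_X_def filtered.Fil_zero filtered.Fil_0)

lemma wfil_monom: "filtered V \<Longrightarrow> c \<in> V (n - w * k) \<Longrightarrow> fps_const c * fps_X ^ k \<in> wfil w V n"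
  by (auto simp: wfil_def fps_X_power_nth filtered.Fil_zero filtered.Fil_0)

text \<open>Modulo terms of weight above \<open>n\<close>, an element of weight \<open>n\<close> is a finite sum of monomials.\<close>

lemma wfil_reduce:
  assumes V: "filtered V" and w: "0 < w" and u: "u \<in> wfil w V n"
    and Q_add: "\<And>a b. Q a \<Longrightarrow> Q b \<Longrightarrow> Q (a + b)"
    and Q_higher: "\<And>a. a \<in> wfil w V (Suc n) \<Longrightarrow> Q a"
    and Q_monom: "\<And>c j. w * j \<le> n \<Longrightarrow> c \<in> V (n - w * j) \<Longrightarrow> Q (fps_const c * fps_X ^ j)"
  shows "Q u"
proof -
  interpret V: filtered V by fact
  interpret W: filtered "wfil w V" using V by (rule filtered_wfil)
  define p where "p = (\<Sum>j\<in>{j. w * j \<le> n}. fps_const (fps_nth u j) * fps_X ^ j)"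
  have fin: "finite {j. w * j \<le> n}"
    by (rule finite_subset[of _ "{..n}"]) (use w in \<open>auto intro: order_trans[rotated]\<close>)
  have p_nth: "fps_nth p j = (if w * j \<le> n then fps_nth u j else 0)" for j
    using fin unfolding p_def fps_sum_nth by (simp add: fps_X_power_nth if_distrib cong: if_cong)
  have "u - p \<in> wfil w V (Suc n)"
    unfolding wfil_def by (auto simp: p_nth not_le Suc_leI)
  then have "Q (u - p)" by (rule Q_higher)
  moreover have "Q p"
  proof -
    have "Q (\<Sum>j\<in>I. fps_const (fps_nth u j) * fps_X ^ j)"
      if "finite I" "\<And>j. j \<in> I \<Longrightarrow> w * j \<le> n" for I
      using that
    proof (induction I rule: finite_induct)
      case empty
      show ?case using Q_higher[OF W.Fil_zero] by simp
    next
      case (insert j I)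
      have "Q (fps_const (fps_nth u j) * fps_X ^ j)"
        using Q_monom[of j "fps_nth u j"] insert.prems u by (simp add: wfil_def)
      then show ?case using insert by (auto intro: Q_add)
    qed
    then show ?thesis unfolding p_def using fin by blast
  qed
  ultimately have "Q ((u - p) + p)" by (rule Q_add)
  then show ?thesis by simp
qed

lemma is_unit_fps_iff:
  fixes f :: "'a::comm_ring_1 fps"
  shows "f dvd 1 \<longleftrightarrow> fps_nth f 0 dvd 1"
proof
  assume "f dvd 1"
  then obtain g where "1 = f * g" by (rule dvdE)
  then have "fps_nth 1 0 = fps_nth (f * g) 0" by simp
  then have "1 = fps_nth f 0 * fps_nth g 0" by simp
  then show "fps_nth f 0 dvd 1" by (rule dvdI)
next
  assume "fps_nth f 0 dvd 1"
  then obtain y where "fps_nth f 0 * y = 1" by (metis dvdE)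
  then have "f * fps_right_inverse f y = 1" by (rule fps_right_inverse)
  then show "f dvd 1" by (metis dvd_triv_left)
qed


section \<open>Linear algebra modulo a subspace\<close>

text \<open>Elimination by cross-multiplication, without division, since the base rings to which
  this is applied are in part only domains.\<close>

lemma more_vectors_than_coordinates:
  fixes c :: "'i \<Rightarrow> 'j \<Rightarrow> 'a::idom"
  assumes "finite J" "finite I" "card J < card I"
  shows "\<exists>r. (\<exists>i\<in>I. r i \<noteq> 0) \<and> (\<forall>j\<in>J. (\<Sum>i\<in>I. r i * c i j) = 0)"
  using assms
proof (induction J arbitrary: I c rule: finite_induct)
  case empty
  then obtain i where "i \<in> I" by fastforce
  then show ?case by (intro exI[of _ "\<lambda>_. 1"]) auto
next
  case (insert j J)
  show ?case
  proof (cases "\<exists>i\<in>I. c i j \<noteq> 0")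
    case False
    obtain r where "\<exists>i\<in>I. r i \<noteq> 0" "\<forall>j\<in>J. (\<Sum>i\<in>I. r i * c i j) = 0"
      using insert.IH[of I c] insert.prems insert.hyps by (auto dest: Suc_lessD)
    with False show ?thesis by (intro exI[of _ r]) auto
  next
    case True
    then obtain i0 where i0: "i0 \<in> I" "c i0 j \<noteq> 0" by blast
    define I' where "I' = I - {i0}"
    have I: "I = insert i0 I'" "i0 \<notin> I'" "finite I'" using i0 insert.prems by (auto simp: I'_def)
    have "card J < card I'" using insert I by simp
    then obtain r where r: "\<exists>i\<in>I'. r i \<noteq> 0"
        "\<forall>l\<in>J. (\<Sum>i\<in>I'. r i * (c i0 j * c i l - c i j * c i0 l)) = 0"
      using insert.IH[of I' "\<lambda>i l. c i0 j * c i l - c i j * c i0 l"] I by blast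
    \<comment> \<open>The pivot coefficient cancels column \<open>j\<close>; the others carry the
      pivot entry as a factor to avoid a denominator.\<close>
    define r' where "r' i = (if i = i0 then - (\<Sum>i\<in>I'. r i * c i j) else r i * c i0 j)" for i
    have sum: "(\<Sum>i\<in>I. r' i * c i l) = (\<Sum>i\<in>I'. r i * (c i0 j * c i l - c i j * c i0 l))" for l
    proof -
      have "(\<Sum>i\<in>I'. r' i * c i l) = (\<Sum>i\<in>I'. r i * c i0 j * c i l)"
        by (rule sum.cong) (use I in \<open>auto simp: r'_def\<close>)
      then show ?thesis using I
        by (simp add: r'_def right_diff_distrib sum_subtractf sum_distrib_right mult.assoc)
    qed
    have "\<forall>l\<in>insert j J. (\<Sum>i\<in>I. r' i * c i l) = 0"
      unfolding sum using r(2) by (auto intro!: sum.neutral simp: mult.commute)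
    moreover have "\<exists>i\<in>I. r' i \<noteq> 0" using r(1) I i0 by (auto simp: r'_def)
    ultimately show ?thesis by blast
  qed
qed

lemma quotient_dim_le:
  fixes scale :: "'k::field \<Rightarrow> 'v::ab_group_add \<Rightarrow> 'v"
  assumes vs: "vector_space scale" and W: "Modules.module.subspace scale W"
    and J: "finite J"
    and span: "\<And>v. \<exists>c. v - (\<Sum>j\<in>J. scale (c j) (b j)) \<in> W"
  shows "quotient_dim scale W \<le> enat (card J)"
  unfolding quotient_dim_def
proof (rule Sup_least)
  interpret vector_space scale by fact
  fix x assume "x \<in> {enat n | n. \<exists>v :: nat \<Rightarrow> 'v. \<forall>c. (\<Sum>i<n. scale (c i) (v i)) \<in> W \<longrightarrow> (\<forall>i<n. c i = 0)}"
  then obtain n and v :: "nat \<Rightarrow> 'v" where x: "x = enat n"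
    and ind: "\<And>c. (\<Sum>i<n. scale (c i) (v i)) \<in> W \<Longrightarrow> \<forall>i<n. c i = 0" by blast
  have "\<forall>i. \<exists>c. v i - (\<Sum>j\<in>J. scale (c j) (b j)) \<in> W" using span by blast
  from choice[OF this]
  obtain C where C: "\<And>i. v i - (\<Sum>j\<in>J. scale (C i j) (b j)) \<in> W" by blast
  have "n \<le> card J"
  proof (rule ccontr)
    assume "\<not> n \<le> card J"
    then obtain r where r: "\<exists>i\<in>{..<n}. r i \<noteq> 0" "\<forall>j\<in>J. (\<Sum>i<n. r i * C i j) = 0"
      using more_vectors_than_coordinates[of J "{..<n}" C] J by auto
    have "(\<Sum>i<n. scale (r i) (v i - (\<Sum>j\<in>J. scale (C i j) (b j)))) \<in> W"
      using W C by (intro subspace_sum subspace_scale) auto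
    also have "(\<Sum>i<n. scale (r i) (v i - (\<Sum>j\<in>J. scale (C i j) (b j))))
        = (\<Sum>i<n. scale (r i) (v i)) - (\<Sum>j\<in>J. scale (\<Sum>i<n. r i * C i j) (b j))"
      by (simp add: scale_right_diff_distrib sum_subtractf scale_sum_right scale_sum_left)
        (rule sum.swap)
    also have "\<dots> = (\<Sum>i<n. scale (r i) (v i))" using r(2) by simp
    finally show False using ind r(1) by auto
  qed
  then show "x \<le> enat (card J)" by (simp add: x)
qed

lemma quotient_dim_ge:
  assumes "finite J"
    and "\<And>c. (\<Sum>j\<in>J. scale (c j) (b j)) \<in> W \<Longrightarrow> \<forall>j\<in>J. c j = 0"
  shows "enat (card J) \<le> quotient_dim scale W"
proof -
  obtain h where h: "bij_betw h {..<card J} J"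
    using ex_bij_betw_nat_finite[OF assms(1)] by (auto simp: atLeast0LessThan)
  have "\<forall>i<card J. c i = 0" if c: "(\<Sum>i<card J. scale (c i) (b (h i))) \<in> W" for c
  proof -
    define g where "g = the_inv_into {..<card J} h"
    have gh: "g (h i) = i" if "i < card J" for i
      unfolding g_def using h that by (auto simp: bij_betw_def intro: the_inv_into_f_f)
    have "(\<Sum>j\<in>J. scale (c (g j)) (b j)) = (\<Sum>i<card J. scale (c i) (b (h i)))"
      using gh by (intro sum.reindex_bij_betw[OF h, symmetric, THEN trans] sum.cong) auto
    then have "\<forall>j\<in>J. c (g j) = 0" using assms(2)[of "\<lambda>j. c (g j)"] c by simp
    then show ?thesis using h gh unfolding bij_betw_def by force
  qed
  then have "enat (card J) \<in> {enat n | n. \<exists>v. \<forall>c. (\<Sum>i<n. scale (c i) (v i)) \<in> W \<longrightarrow> (\<forall>i<n. c i = 0)}"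
    by (intro CollectI exI[of _ "card J"]) (auto intro!: exI[of _ "\<lambda>i. b (h i)"])
  then show ?thesis unfolding quotient_dim_def by (rule Sup_upper)
qed

text \<open>The sizes of independent families are bounded, so one of maximal size exists, and
  maximality makes it span: the supremum in \<open>quotient_dim\<close> is realized by a
  basis.\<close>

lemma quotient_dim_less_span:
  fixes scale :: "'k::field \<Rightarrow> 'v::ab_group_add \<Rightarrow> 'v"
  assumes vs: "vector_space scale" and W: "Modules.module.subspace scale W"
    and less: "quotient_dim scale W < enat q"
  obtains n b where "n < q" "\<And>v. \<exists>c. v - (\<Sum>i<n. scale (c i) (b i)) \<in> W"
    "\<And>c. (\<Sum>i<n. scale (c i) (b i)) \<in> W \<Longrightarrow> \<forall>i<n. c i = 0"
proof -
  interpret vector_space scale by fact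
  define Z where "Z = {n. \<exists>v :: nat \<Rightarrow> 'v. \<forall>c. (\<Sum>i<n. scale (c i) (v i)) \<in> W \<longrightarrow> (\<forall>i<n. c i = 0)}"
  have bd: "n < q" if "n \<in> Z" for n
  proof -
    have "enat n \<le> quotient_dim scale W"
      unfolding quotient_dim_def by (rule Sup_upper) (use that in \<open>auto simp: Z_def\<close>)
    then show ?thesis using less by (metis enat_ord_simps(2) order_le_less_trans)
  qed
  have "0 \<in> Z" by (simp add: Z_def)
  have fin: "finite Z" using bd by (meson finite_nat_set_iff_bounded)
  define n where "n = Max Z"
  have nX: "n \<in> Z" unfolding n_def using fin \<open>0 \<in> Z\<close> by (intro Max_in) auto
  have nmax: "Suc n \<notin> Z"
  proof
    assume "Suc n \<in> Z"
    with fin have "Suc n \<le> n" unfolding n_def by (rule Max_ge)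
    then show False by simp
  qed
  from nX obtain b where b: "\<And>c. (\<Sum>i<n. scale (c i) (b i)) \<in> W \<Longrightarrow> \<forall>i<n. c i = 0"
    unfolding Z_def by blast
  have "\<exists>c. v - (\<Sum>i<n. scale (c i) (b i)) \<in> W" for v
  proof -
    define b' where "b' i = (if i < n then b i else v)" for i
    have eq: "(\<Sum>i<Suc n. scale (c i) (b' i)) = (\<Sum>i<n. scale (c i) (b i)) + scale (c n) v" for c
      by (simp add: b'_def)
    obtain c where "(\<Sum>i<Suc n. scale (c i) (b' i)) \<in> W" and c0: "\<not> (\<forall>i<Suc n. c i = 0)"
      using nmax unfolding Z_def by blast
    then have c: "(\<Sum>i<n. scale (c i) (b i)) + scale (c n) v \<in> W" unfolding eq by simp
    have cn: "c n \<noteq> 0"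
    proof
      assume "c n = 0"
      then have "\<forall>i<n. c i = 0" using c b by simp
      with c0 \<open>c n = 0\<close> show False using less_Suc_eq by auto
    qed
    have "scale (inverse (c n)) ((\<Sum>i<n. scale (c i) (b i)) + scale (c n) v) \<in> W"
      using W c by (rule subspace_scale)
    then have "v - (\<Sum>i<n. scale (- inverse (c n) * c i) (b i)) \<in> W"
      using cn by (simp add: scale_right_distrib scale_sum_right sum_negf add.commute)
    then show ?thesis by (rule exI[where x = "\<lambda>i. - inverse (c n) * c i"])
  qed
  with that[of n b] bd[OF nX] b show ?thesis by blast
qed


section \<open>Substitution into power series\<close>

text \<open>The value of the series at \<open>c\<close>, as the limit of its partial sums;
  meaningful for \<open>c\<close> in \<open>Fil 1\<close>.\<close>

definition fsubst :: "(nat \<Rightarrow> 'a::comm_ring_1 set) \<Rightarrow> 'a \<Rightarrow> 'a fps \<Rightarrow> 'a" where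
  "fsubst Fil c g = (THE S. \<forall>n. S - (\<Sum>i<n. fps_nth g i * c ^ i) \<in> Fil n)"

context filtered
begin

context
  fixes c assumes c: "c \<in> Fil 1"
begin

lemma fsubst_unique:
  assumes "\<And>n. S - (\<Sum>i<n. fps_nth g i * c ^ i) \<in> Fil n" "\<And>n. T - (\<Sum>i<n. fps_nth g i * c ^ i) \<in> Fil n"
  shows "S = T"
proof (rule Fil_eqI)
  fix n
  show "S - T \<in> Fil n" using Fil_diff[OF assms(1)[of n] assms(2)[of n]] by simp
qed

lemma fsubst_approx: "fsubst Fil c g - (\<Sum>i<n. fps_nth g i * c ^ i) \<in> Fil n"
proof -
  have "\<exists>S. \<forall>n. S - (\<Sum>i<n. fps_nth g i * c ^ i) \<in> Fil n"
    by (intro Fil_complete Fil_mult1 Fil_powerI[OF c]) simp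
  then obtain S where S: "\<forall>n. S - (\<Sum>i<n. fps_nth g i * c ^ i) \<in> Fil n" by blast
  have "\<forall>n. fsubst Fil c g - (\<Sum>i<n. fps_nth g i * c ^ i) \<in> Fil n"
    unfolding fsubst_def
    by (rule theI[where a = S]) (use S fsubst_unique[of _ g S] in blast)+
  then show ?thesis by blast
qed

lemma fsubst_eqI: "(\<And>n. S - (\<Sum>i<n. fps_nth g i * c ^ i) \<in> Fil n) \<Longrightarrow> fsubst Fil c g = S"
  using fsubst_unique[of "fsubst Fil c g" g S] fsubst_approx by blast

lemma fsubst_add: "fsubst Fil c (g + h) = fsubst Fil c g + fsubst Fil c h"
proof (rule fsubst_eqI)
  fix n
  show "fsubst Fil c g + fsubst Fil c h - (\<Sum>i<n. fps_nth (g + h) i * c ^ i) \<in> Fil n"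
    using Fil_add[OF fsubst_approx[of g n] fsubst_approx[of h n]]
    by (simp add: algebra_simps sum.distrib)
qed

lemma fsubst_const_mult: "fsubst Fil c (fps_const a * g) = a * fsubst Fil c g"
proof (rule fsubst_eqI)
  fix n
  show "a * fsubst Fil c g - (\<Sum>i<n. fps_nth (fps_const a * g) i * c ^ i) \<in> Fil n"
    using Fil_mult1[OF fsubst_approx[of g n], of a]
    by (simp add: algebra_simps sum_distrib_left)
qed

lemma fsubst_shift: "fsubst Fil c g = fps_nth g 0 + c * fsubst Fil c (fps_shift 1 g)"
proof (rule fsubst_eqI)
  fix n
  show "fps_nth g 0 + c * fsubst Fil c (fps_shift 1 g) - (\<Sum>i<n. fps_nth g i * c ^ i) \<in> Fil n"
  proof (cases n)
    case (Suc m)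
    have "c * (fsubst Fil c (fps_shift 1 g) - (\<Sum>i<m. fps_nth (fps_shift 1 g) i * c ^ i)) \<in> Fil (1 + m)"
      using c fsubst_approx by (rule Fil_mult)
    then show ?thesis unfolding Suc sum.lessThan_Suc_shift
      by (simp add: algebra_simps sum_distrib_left)
  qed simp
qed

lemma fsubst_0: "fsubst Fil c 0 = 0"
  by (rule fsubst_eqI) simp

lemma fsubst_const: "fsubst Fil c (fps_const a) = a"
  using fsubst_shift[of "fps_const a"] by (simp add: fps_shift_fps_const fsubst_0)

lemma fsubst_X_mult: "fsubst Fil c (fps_X * g) = c * fsubst Fil c g"
proof -
  have "fps_shift 1 (fps_X * g) = g" by (rule fps_ext) simp
  then show ?thesis using fsubst_shift[of "fps_X * g"] by simp
qed

lemma fsubst_minus: "fsubst Fil c (- g) = - fsubst Fil c g"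
  using fsubst_const_mult[of "-1" g] by (simp flip: fps_const_neg)

lemma fsubst_diff: "fsubst Fil c (g - h) = fsubst Fil c g - fsubst Fil c h"
  using fsubst_add[of g "- h"] by (simp add: fsubst_minus)

lemma fsubst_X: "fsubst Fil c fps_X = c"
  using fsubst_X_mult[of 1] fsubst_const[of 1] by simp

text \<open>The remainder theorem. As in Horner's scheme, the coefficients of the quotient are the
  values at \<open>c\<close> of the shifted series.\<close>

lemma fsubst_factor: "\<exists>q. g = fps_const (fsubst Fil c g) + (fps_X - fps_const c) * q"
proof -
  define q where "q = Abs_fps (\<lambda>n. fsubst Fil c (fps_shift (Suc n) g))"
  have "g = fps_const (fsubst Fil c g) + (fps_X - fps_const c) * q"
  proof (rule fps_ext)
    fix n
    show "fps_nth g n = fps_nth (fps_const (fsubst Fil c g) + (fps_X - fps_const c) * q) n"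
    proof (cases n)
      case 0
      then show ?thesis using fsubst_shift[of g] by (simp add: q_def left_diff_distrib)
    next
      case (Suc m)
      have "fps_shift 1 (fps_shift n g) = fps_shift (Suc n) g"
        using fps_shift_fps_shift[of 1 n g] by simp
      then have "fsubst Fil c (fps_shift n g) = fps_nth g n + c * fsubst Fil c (fps_shift (Suc n) g)"
        using fsubst_shift[of "fps_shift n g"] by simp
      then show ?thesis using Suc by (simp add: q_def left_diff_distrib)
    qed
  qed
  then show ?thesis by blast
qed

text \<open>By the remainder theorem \<open>g\<close> may be replaced by a constant, because
  multiples of \<open>fps_X - fps_const c\<close> have value 0. This avoids Cauchy products of
  limits.\<close>

lemma fsubst_mult: "fsubst Fil c (g * h) = fsubst Fil c g * fsubst Fil c h"
proof -
  have kill: "fsubst Fil c ((fps_X - fps_const c) * q) = 0" for q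
    by (simp add: left_diff_distrib fsubst_diff fsubst_X_mult fsubst_const_mult)
  obtain q where q: "g = fps_const (fsubst Fil c g) + (fps_X - fps_const c) * q"
    using fsubst_factor by blast
  have "g * h = fps_const (fsubst Fil c g) * h + (fps_X - fps_const c) * (q * h)"
    by (subst q) (simp add: algebra_simps)
  then have "fsubst Fil c (g * h) = fsubst Fil c (fps_const (fsubst Fil c g) * h + (fps_X - fps_const c) * (q * h))"
    by simp
  then show ?thesis by (simp only: fsubst_add fsubst_const_mult kill) simp
qed

end

end


section \<open>Principal parts: Taylor expansion along the diagonal, the dual module and its
  minors\<close>

section \<open>Evaluation on the diagonal\<close>

definition adic :: "nat \<Rightarrow> 'c::comm_ring_1 fps fps set" where
  "adic = wfil 1 (wfil 1 trivial_fil)"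

lemma adic_iff: "g \<in> adic n \<longleftrightarrow> (\<forall>i j. i + j < n \<longrightarrow> fps_nth (fps_nth g j) i = 0)"
  unfolding adic_def wfil_def trivial_fil_def
  by (auto simp: less_diff_conv split: if_splits)

lemma filtered_adic: "filtered adic"
  unfolding adic_def by (intro filtered_wfil filtered_trivial)

lemma filtered_wfil_adic: "filtered (wfil 1 adic)"
  by (intro filtered_wfil filtered_adic)

lemma varx_adic: "(varx :: 'c::comm_ring_1 fps fps) \<in> adic 1"
  by (simp add: varx_def adic_iff fps_X_def)

lemma const_vary_adic: "fps_const (vary :: 'c::comm_ring_1 fps fps) \<in> wfil 1 adic 1"
  by (intro wfil_const filtered_adic) (simp add: vary_def adic_iff fps_X_def)

text \<open>Restriction to the diagonal: the outermost variable y' becomes y, then x' becomes x. The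
  intermediate ring is C[[x,y]][[x']], which explains the two filtrations.\<close>

definition ev :: "'c::comm_ring_1 fps fps fps fps \<Rightarrow> 'c fps fps" where
  "ev w = fsubst adic varx (fsubst (wfil 1 adic) (fps_const vary) w)"

lemmas ev_inner = filtered.fsubst_add[OF filtered_wfil_adic const_vary_adic]
  filtered.fsubst_mult[OF filtered_wfil_adic const_vary_adic]
  filtered.fsubst_diff[OF filtered_wfil_adic const_vary_adic]
  filtered.fsubst_minus[OF filtered_wfil_adic const_vary_adic]
  filtered.fsubst_0[OF filtered_wfil_adic const_vary_adic]
  filtered.fsubst_const[OF filtered_wfil_adic const_vary_adic]
  filtered.fsubst_X[OF filtered_wfil_adic const_vary_adic]

lemmas ev_outer = filtered.fsubst_add[OF filtered_adic varx_adic]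
  filtered.fsubst_mult[OF filtered_adic varx_adic]
  filtered.fsubst_diff[OF filtered_adic varx_adic]
  filtered.fsubst_minus[OF filtered_adic varx_adic]
  filtered.fsubst_0[OF filtered_adic varx_adic]
  filtered.fsubst_const[OF filtered_adic varx_adic]
  filtered.fsubst_X[OF filtered_adic varx_adic]

lemma ev_add: "ev (a + b) = ev a + ev b"
  and ev_mult: "ev (a * b) = ev a * ev b"
  and ev_diff: "ev (a - b) = ev a - ev b"
  and ev_minus: "ev (- a) = - ev a"
  and ev_0: "ev 0 = 0"
  by (simp_all only: ev_def ev_inner ev_outer)

lemma ev_inleft: "ev (inleft r) = r"
  by (simp only: ev_def inleft_def const2_def ev_inner ev_outer)

lemma ev_varx: "ev varx = varx"
proof -
  have "ev varx = ev (fps_const fps_X)" by (simp add: varx_def)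
  also have "\<dots> = varx" by (simp only: ev_def ev_inner ev_outer)
  finally show ?thesis .
qed

lemma ev_vary: "ev vary = vary"
proof -
  have "ev vary = ev fps_X" by (simp add: vary_def)
  also have "\<dots> = vary" by (simp only: ev_def ev_inner ev_outer)
  finally show ?thesis .
qed

lemma inright_varx: "inright varx = varx" and inright_vary: "inright vary = vary"
  by (auto simp: inright_def map_coeffs_def varx_def vary_def const2_def fps_eq_iff fps_X_def)

lemma map_coeffs_nth: "fps_nth (fps_nth (map_coeffs h g) j) i = h (fps_nth (fps_nth g j) i)"
  by (simp add: map_coeffs_def)

lemma map_coeffs_add:
  "(\<And>a b. h (a + b) = h a + h b) \<Longrightarrow> map_coeffs h (a + b) = map_coeffs h a + map_coeffs h b"
  by (simp add: map_coeffs_def fps_eq_iff)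

lemma hom_sum:
  assumes "h 0 = (0::'b::comm_monoid_add)" "\<And>a b :: 'a::comm_monoid_add. h (a + b) = h a + h b"
  shows "h (sum s I) = (\<Sum>i\<in>I. h (s i))"
  by (induction I rule: infinite_finite_induct) (auto simp: assms)

lemma map_coeffs_mult:
  fixes h :: "'a::comm_ring_1 \<Rightarrow> 'b::comm_ring_1"
  assumes "h 0 = 0" "\<And>a b. h (a + b) = h a + h b" "\<And>a b. h (a * b) = h a * h b"
  shows "map_coeffs h (a * b) = map_coeffs h a * map_coeffs h b"
  by (simp add: map_coeffs_def fps_eq_iff fps_mult_nth fps_sum_nth hom_sum[of h] assms)

lemma const2_add: "const2 (a + b) = const2 a + const2 (b::'a::comm_ring_1)"
  and const2_mult: "const2 (a * b) = const2 a * const2 b"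
  and const2_diff: "const2 (a - b) = const2 a - const2 b"
  and const2_minus: "const2 (- a) = - const2 a"
  and const2_0: "const2 0 = (0::'a fps fps)"
  and const2_1: "const2 1 = (1::'a fps fps)"
  by (simp_all add: const2_def fps_const_add[symmetric] fps_const_mult[symmetric] fps_const_sub[symmetric] fps_const_neg[symmetric] del: fps_const_add fps_const_mult fps_const_sub fps_const_neg)

lemma inright_add: "inright (a + b) = inright a + inright b"
  unfolding inright_def by (rule map_coeffs_add) (rule const2_add)

lemma inright_mult: "inright (a * b) = inright a * inright b"
  unfolding inright_def by (rule map_coeffs_mult) (rule const2_0 const2_add const2_mult)+

lemma inleft_add: "inleft (a + b) = inleft a + inleft b"
  and inleft_mult: "inleft (a * b) = inleft a * inleft b"
  and inleft_diff: "inleft (a - b) = inleft a - inleft b"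
  and inleft_minus: "inleft (- a) = - inleft a"
  and inleft_0: "inleft 0 = 0" and inleft_1: "inleft 1 = 1"
  unfolding inleft_def by (rule const2_add const2_mult const2_diff const2_minus const2_0 const2_1)+

lemma ev_inright: "ev (inright g) = (g :: 'c::comm_ring_1 fps fps)"
proof -
  \<comment> \<open>The result of the first substitution: \<open>g\<close> sorted by powers of x',
    after y' has become y.\<close>
  define S where "S = Abs_fps (\<lambda>i. Abs_fps (\<lambda>j. fps_const (fps_nth (fps_nth g j) i)))"
  have pow: "fps_const (vary :: 'c fps fps) ^ j = fps_const (fps_X ^ j)" for j
    by (simp add: vary_def fps_const_power)
  have "fsubst (wfil 1 adic) (fps_const vary) (inright g) = S"
  proof (rule filtered.fsubst_eqI[OF filtered_wfil_adic const_vary_adic])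
    fix n
    have sum: "fps_nth (fps_nth (fps_nth (\<Sum>j<n. fps_nth (inright g) j * fps_const vary ^ j) i) l) k
        = (if l < n \<and> k = 0 then fps_nth (fps_nth g l) i else 0)" for i l k
    proof -
      have "fps_nth (fps_nth (fps_nth (\<Sum>j<n. fps_nth (inright g) j * fps_const vary ^ j) i) l) k
        = (\<Sum>j<n. fps_nth (fps_nth (const2 (fps_nth (fps_nth g j) i) * fps_X ^ j) l) k)"
        by (simp add: fps_sum_nth pow[unfolded vary_def] vary_def inright_def map_coeffs_def)
      also have "\<dots> = (\<Sum>j<n. if j = l then (if k = 0 then fps_nth (fps_nth g l) i else 0) else 0)"
        by (rule sum.cong) (auto simp: const2_def fps_X_power_mult_right_nth fps_X_power_nth)
      finally show ?thesis by auto
    qed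
    show "S - (\<Sum>j<n. fps_nth (inright g) j * fps_const vary ^ j) \<in> wfil 1 adic n"
      unfolding wfil_def[of 1 adic] adic_iff mem_Collect_eq fps_sub_nth sum
      by (auto simp: S_def)
  qed
  then have "ev (inright g) = fsubst adic varx S" by (simp add: ev_def)
  also have "\<dots> = g"
  proof (rule filtered.fsubst_eqI[OF filtered_adic varx_adic])
    fix n
    have "fps_nth (fps_nth (\<Sum>i<n. fps_nth S i * varx ^ i) l) k
        = (if k < n then fps_nth (fps_nth g l) k else 0)" for l k
    proof -
      have "fps_nth (fps_nth (\<Sum>i<n. fps_nth S i * varx ^ i) l) k
          = (\<Sum>i<n. if i = k then fps_nth (fps_nth g l) k else 0)"
        by (simp add: fps_sum_nth varx_def fps_const_power S_def fps_X_power_nth if_distrib[of "(*) _"] cong: if_cong)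
      then show ?thesis by auto
    qed
    then show "g - (\<Sum>i<n. fps_nth S i * varx ^ i) \<in> adic n"
      unfolding adic_iff fps_sub_nth by auto
  qed
  finally show ?thesis .
qed

text \<open>In the doubled ring \<open>varx\<close> and \<open>vary\<close> are the outer variables,
  so \<open>dU\<close> and \<open>dV\<close> are x' - x and y' - y.\<close>

definition dU :: "'c::comm_ring_1 fps fps fps fps" where "dU = varx - inleft varx"
definition dV :: "'c::comm_ring_1 fps fps fps fps" where "dV = vary - inleft vary"

lemma diagonal_ideal_eq: "diagonal_ideal = ideal_gen {dU, dV}"
  by (simp add: diagonal_ideal_def dU_def dV_def inright_varx inright_vary)

lemma ev_dU: "ev dU = 0" and ev_dV: "ev dV = 0"
  by (simp_all add: dU_def dV_def ev_diff ev_varx ev_vary ev_inleft)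

text \<open>The remainder theorem for y' and then for x'; the quotients become the cofactors of
  \<open>dV\<close> and \<open>dU\<close>. Iteration gives Taylor expansions.\<close>

lemma ev_expand: "\<exists>a b. w = inleft (ev w) + a * dU + b * dV"
proof -
  define v where "v = fsubst (wfil 1 adic) (fps_const vary) w"
  obtain q where q: "w = fps_const v + (fps_X - fps_const (fps_const vary)) * q"
    unfolding v_def using filtered.fsubst_factor[OF filtered_wfil_adic const_vary_adic] by blast
  obtain p where p: "v = fps_const (fsubst adic varx v) + (fps_X - fps_const varx) * p"
    using filtered.fsubst_factor[OF filtered_adic varx_adic] by blast
  have evw: "ev w = fsubst adic varx v" by (simp only: ev_def v_def)
  have 1: "fps_const v = inleft (ev w) + fps_const p * dU"
    by (subst p) (simp add: evw inleft_def const2_def dU_def varx_def mult.commute)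
  have 2: "fps_X - fps_const (fps_const vary) = dV"
    by (simp add: dV_def inleft_def const2_def vary_def)
  have "w = inleft (ev w) + fps_const p * dU + q * dV"
    using q unfolding 1 2 by (simp only: mult.commute)
  then show ?thesis by blast
qed

lemma ev_diagonal_ideal: "w \<in> diagonal_ideal \<Longrightarrow> ev w = 0"
  unfolding diagonal_ideal_eq ideal_gen_2 by (auto simp: ev_add ev_mult ev_dU ev_dV)


section \<open>Derivations and powers of the diagonal ideal\<close>

lemma dx_add: "dx (a + b) = dx a + dx (b :: 'c::comm_ring_1 fps fps)"
  and dx_diff: "dx (a - b) = dx a - dx b"
  and dx_minus: "dx (- a) = - dx a"
  and dx_0: "dx 0 = (0 :: 'c fps fps)"
  by (simp_all add: dx_def fps_eq_iff algebra_simps)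

lemma dx_mult: "dx (a * b) = dx a * b + a * dx (b :: 'c::comm_ring_1 fps fps)"
proof (rule fps_ext)
  fix n
  have "fps_nth (dx (a * b)) n = fps_deriv (\<Sum>i=0..n. fps_nth a i * fps_nth b (n - i))"
    by (simp add: dx_def fps_mult_nth)
  also have "\<dots> = (\<Sum>i=0..n. fps_deriv (fps_nth a i * fps_nth b (n - i)))"
    by (rule hom_sum) auto
  finally show "fps_nth (dx (a * b)) n = fps_nth (dx a * b + a * dx b) n"
    by (simp add: dx_def fps_mult_nth sum.distrib add.commute)
qed

lemma dy_add: "dy (a + b) = dy a + dy (b :: 'c::comm_ring_1 fps fps)"
  and dy_diff: "dy (a - b) = dy a - dy b"
  and dy_minus: "dy (- a) = - dy a"
  and dy_0: "dy 0 = (0 :: 'c fps fps)"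
  and dy_mult: "dy (a * b) = dy a * b + a * dy b"
  by (simp_all add: dy_def algebra_simps)

lemma dx_dy: "dx (dy a) = dy (dx a)"
  by (simp add: dx_def dy_def fps_eq_iff mult.left_commute flip: of_nat_Suc)

lemma dx_const2: "dx (const2 c) = 0" and dy_const2: "dy (const2 c) = 0"
  by (simp_all add: dx_def dy_def const2_def fps_eq_iff)

lemma dx_inleft: "dx (inleft r) = 0" and dy_inleft: "dy (inleft r) = 0"
  by (simp_all add: inleft_def dx_const2 dy_const2)

lemma dx_varx: "dx varx = 1" and dy_varx: "dy varx = 0" and dx_vary: "dx vary = 0" and dy_vary: "dy vary = 1"
  by (auto simp: dx_def dy_def varx_def vary_def fps_eq_iff fps_X_def)

lemma dx_dU: "dx dU = 1" and dy_dU: "dy dU = 0" and dx_dV: "dx dV = 0" and dy_dV: "dy dV = 1"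
  by (simp_all add: dU_def dV_def dx_diff dy_diff dx_varx dy_varx dx_vary dy_vary dx_inleft dy_inleft)

lemma const2_of_nat: "const2 (of_nat n * a) = of_nat n * const2 (a::'a::comm_ring_1)"
  by (induction n) (simp_all add: const2_0 const2_add distrib_right)

lemma dx_inright: "dx (inright g) = inright (dx g)" and dy_inright: "dy (inright g) = inright (dy g)"
  by (simp_all add: dx_def dy_def inright_def map_coeffs_def fps_eq_iff const2_of_nat flip: of_nat_Suc)

lemma ideal_power_Suc:
  assumes a: "a \<in> ideal_gen S" and b: "b \<in> ideal_power (ideal_gen S) n"
  shows "a * b \<in> ideal_power (ideal_gen S) (Suc n)"
  using b unfolding ideal_power_def
proof (induction rule: ideal.span_induct_alt)
  case base
  show ?case by (simp add: ideal.span_zero)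
next
  case (step c x y)
  then obtain g where g: "x = (\<Prod>i<n. g i)" "\<forall>i<n. g i \<in> ideal_gen S" by blast
  have "a * x = (\<Prod>i<Suc n. (g(n := a)) i)" by (simp add: g(1) mult.commute)
  moreover have "\<forall>i<Suc n. (g(n := a)) i \<in> ideal_gen S" using g(2) a by (simp add: less_Suc_eq)
  ultimately have "a * x \<in> {\<Prod>i<Suc n. g i |g. \<forall>i<Suc n. g i \<in> ideal_gen S}" by blast
  then have "c * (a * x) + a * y \<in> ideal_gen {\<Prod>i<Suc n. g i |g. \<forall>i<Suc n. g i \<in> ideal_gen S}"
    by (intro ideal.span_add[OF ideal_gen_mult[OF ideal.span_base] step.IH])
  then show ?case by (simp add: algebra_simps)
qed

lemma ideal_power_Suc_induct:
  assumes w: "w \<in> ideal_power I (Suc n)"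
    and 0: "P 0" and add: "\<And>a b. P a \<Longrightarrow> P b \<Longrightarrow> P (a + b)"
    and mult: "\<And>r a b. a \<in> I \<Longrightarrow> b \<in> ideal_power I n \<Longrightarrow> P (r * (a * b))"
  shows "P w"
  using w unfolding ideal_power_def
proof (induction rule: ideal.span_induct_alt)
  case (step c x y)
  then obtain g where g: "x = (\<Prod>i<Suc n. g i)" "\<forall>i<Suc n. g i \<in> I" by blast
  have "(\<Prod>i<n. g i) \<in> ideal_power I n"
    unfolding ideal_power_def by (rule ideal.span_base) (use g(2) in auto)
  then have "P (c * (g n * (\<Prod>i<n. g i)))" using g(2) by (intro mult) auto
  then have "P (c * x)" by (simp add: g(1) mult.commute)
  then show ?case using step add by blast
qed (rule 0)

lemma ideal_power_0: "ideal_power I 0 = UNIV"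
proof -
  have "x \<in> ideal_power I 0" for x :: 'a
    using ideal_gen_mult[of 1 _ x] ideal.span_base[of 1] unfolding ideal_power_def by force
  then show ?thesis by blast
qed

lemma ideal_power_closed:
  "a \<in> ideal_power I n \<Longrightarrow> b \<in> ideal_power I n \<Longrightarrow> a + b \<in> ideal_power I n"
  "a \<in> ideal_power I n \<Longrightarrow> r * a \<in> ideal_power I n"
  "0 \<in> ideal_power I n"
  unfolding ideal_power_def by (rule ideal.span_add ideal.span_scale ideal.span_zero; assumption?)+

lemma ideal_power_decseq: "w \<in> ideal_power I (Suc n) \<Longrightarrow> w \<in> ideal_power I n"
  by (erule ideal_power_Suc_induct) (auto intro: ideal_power_closed)

lemma derivation_ideal_power:
  assumes \<D>: "\<And>a b. \<D> (a + b) = \<D> a + \<D> b" "\<And>a b. \<D> (a * b) = \<D> a * b + a * \<D> b"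
    and w: "w \<in> ideal_power (ideal_gen S) (Suc n)"
  shows "\<D> w \<in> ideal_power (ideal_gen S) n"
  using w
proof (induction n arbitrary: w)
  case 0
  show ?case by (simp add: ideal_power_0)
next
  case (Suc n)
  have \<D>0: "\<D> 0 = 0" using \<D>(1)[of 0 0] by simp
  show ?case
  proof (rule ideal_power_Suc_induct[OF Suc.prems])
    fix r a b assume 3: "a \<in> ideal_gen S" "b \<in> ideal_power (ideal_gen S) (Suc n)"
    have "a * b \<in> ideal_power (ideal_gen S) (Suc (Suc n))" using 3 by (rule ideal_power_Suc)
    then have "\<D> r * (a * b) \<in> ideal_power (ideal_gen S) (Suc n)"
      by (rule ideal_power_closed(2)[OF ideal_power_decseq])
    moreover have "r * \<D> a * b \<in> ideal_power (ideal_gen S) (Suc n)"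
      using 3(2) by (rule ideal_power_closed(2))
    moreover have "r * (a * \<D> b) \<in> ideal_power (ideal_gen S) (Suc n)"
      by (rule ideal_power_closed(2)[OF ideal_power_Suc[OF 3(1) Suc.IH[OF 3(2)]]])
    ultimately have "\<D> r * (a * b) + (r * \<D> a * b + r * (a * \<D> b)) \<in> ideal_power (ideal_gen S) (Suc n)"
      by (intro ideal_power_closed(1))
    then show "\<D> (r * (a * b)) \<in> ideal_power (ideal_gen S) (Suc n)" by (simp add: \<D> algebra_simps)
  qed (simp_all add: \<D>0 \<D> ideal_power_closed)
qed

lemma ev_ideal_power: "w \<in> ideal_power diagonal_ideal (Suc n) \<Longrightarrow> ev w = 0"
  by (erule ideal_power_Suc_induct) (simp_all add: ev_0 ev_add ev_mult ev_diagonal_ideal)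

text \<open>The expansion is doubled so that no division by 2 is asked of the base ring. Three
  levels of \<open>ev_expand\<close> give a quadratic polynomial in \<open>dU, dV\<close> and a
  remainder in the cube of the diagonal ideal. Derivatives of order at most 2 of such a remainder
  vanish on the diagonal, which identifies the coefficients.\<close>

lemma taylor2:
  fixes w :: "'c::comm_ring_1 fps fps fps fps"
  shows "2 * w - (inleft (2 * ev w) + inleft (2 * ev (dx w)) * dU + inleft (2 * ev (dy w)) * dV
    + inleft (ev (dx (dx w))) * dU\<^sup>2 + inleft (2 * ev (dx (dy w))) * (dU * dV)
    + inleft (ev (dy (dy w))) * dV\<^sup>2) \<in> ideal_power diagonal_ideal 3"
proof -
  let ?I = "diagonal_ideal :: 'c fps fps fps fps set"
  have UV: "dU \<in> ?I" "dV \<in> ?I" unfolding diagonal_ideal_eq by (auto intro: ideal.span_base)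
  have I3: "a * (b * c) \<in> ideal_power ?I 3" if "a \<in> ?I" "b \<in> ?I" "c \<in> ?I" for a b c
  proof -
    have "a * (b * (c * 1)) \<in> ideal_power ?I (Suc (Suc (Suc 0)))"
      using that unfolding diagonal_ideal_eq by (intro ideal_power_Suc) (simp_all add: ideal_power_0)
    then show ?thesis by (simp add: numeral_3_eq_3)
  qed
  obtain a b where ab: "w = inleft (ev w) + a * dU + b * dV" using ev_expand by blast
  obtain a1 a2 where a: "a = inleft (ev a) + a1 * dU + a2 * dV" using ev_expand by blast
  obtain b1 b2 where b: "b = inleft (ev b) + b1 * dU + b2 * dV" using ev_expand by blast
  obtain p p' where p: "a1 = inleft (ev a1) + p * dU + p' * dV" using ev_expand by blast
  \<comment> \<open>The mixed monomial arises in both orders, so its two coefficients are expanded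
    together.\<close>
  obtain q q' where q: "a2 + b1 = inleft (ev (a2 + b1)) + q * dU + q' * dV" using ev_expand by blast
  obtain r r' where r: "b2 = inleft (ev b2) + r * dU + r' * dV" using ev_expand by blast
  define z where "z = w - (inleft (ev w) + inleft (ev a) * dU + inleft (ev b) * dV
    + inleft (ev a1) * dU\<^sup>2 + inleft (ev (a2 + b1)) * (dU * dV) + inleft (ev b2) * dV\<^sup>2)"
  have "z = p * (dU * (dU * dU)) + p' * (dV * (dU * dU)) + q * (dU * (dU * dV)) + q' * (dV * (dU * dV))
      + r * (dU * (dV * dV)) + r' * (dV * (dV * dV))"
  proof -
    have "w = inleft (ev w) + inleft (ev a) * dU + inleft (ev b) * dV
      + a1 * dU\<^sup>2 + (a2 + b1) * (dU * dV) + b2 * dV\<^sup>2"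
      by (subst ab, subst a, subst b) (simp add: algebra_simps power2_eq_square)
    also have "a1 * dU\<^sup>2 = (inleft (ev a1) + p * dU + p' * dV) * dU\<^sup>2"
      by (rule arg_cong[OF p])
    also have "(a2 + b1) * (dU * dV) = (inleft (ev (a2 + b1)) + q * dU + q' * dV) * (dU * dV)"
      by (rule arg_cong[OF q])
    also have "b2 * dV\<^sup>2 = (inleft (ev b2) + r * dU + r' * dV) * dV\<^sup>2"
      by (rule arg_cong[OF r])
    finally have W: "w = inleft (ev w) + inleft (ev a) * dU + inleft (ev b) * dV
      + (inleft (ev a1) + p * dU + p' * dV) * dU\<^sup>2
      + (inleft (ev (a2 + b1)) + q * dU + q' * dV) * (dU * dV)
      + (inleft (ev b2) + r * dU + r' * dV) * dV\<^sup>2" .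
    define t where "t = inleft (ev w) + inleft (ev a) * dU + inleft (ev b) * dV
      + inleft (ev a1) * dU\<^sup>2 + inleft (ev (a2 + b1)) * (dU * dV) + inleft (ev b2) * dV\<^sup>2"
    have "w = t + (p * (dU * (dU * dU)) + p' * (dV * (dU * dU)) + q * (dU * (dU * dV))
      + q' * (dV * (dU * dV)) + r * (dU * (dV * dV)) + r' * (dV * (dV * dV)))"
      by (rule trans[OF W]) (simp add: t_def algebra_simps power2_eq_square)
    then show ?thesis unfolding z_def t_def[symmetric] by (rule trans[OF arg_cong]) simp
  qed
  also have "\<dots> \<in> ideal_power ?I 3"
    by (intro ideal_power_closed(1) ideal_power_closed(2)[OF I3] UV)
  finally have z: "z \<in> ideal_power ?I 3" .
  have w: "w = inleft (ev w) + inleft (ev a) * dU + inleft (ev b) * dV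
    + inleft (ev a1) * dU\<^sup>2 + inleft (ev (a2 + b1)) * (dU * dV) + inleft (ev b2) * dV\<^sup>2 + z"
    by (simp add: z_def)
  have d: "dx z \<in> ideal_power ?I 2" "dy z \<in> ideal_power ?I 2"
    using derivation_ideal_power[of dx z _ 2] derivation_ideal_power[of dy z _ 2] z
    unfolding diagonal_ideal_eq by (simp_all add: dx_add dx_mult dy_add dy_mult numeral_3_eq_3)
  have dd: "dx (dx z) \<in> ideal_power ?I 1" "dx (dy z) \<in> ideal_power ?I 1" "dy (dy z) \<in> ideal_power ?I 1"
    using derivation_ideal_power[of dx "dx z" _ 1] derivation_ideal_power[of dx "dy z" _ 1]
      derivation_ideal_power[of dy "dy z" _ 1] d
    unfolding diagonal_ideal_eq by (simp_all add: dx_add dx_mult dy_add dy_mult numeral_2_eq_2)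
  have ez: "ev (dx z) = 0" "ev (dy z) = 0" "ev (dx (dx z)) = 0" "ev (dx (dy z)) = 0" "ev (dy (dy z)) = 0"
    using d dd ev_ideal_power[of _ 1] ev_ideal_power[of _ 0] by (simp_all add: numeral_2_eq_2)
  note dsimps = dx_add dy_add dx_mult dy_mult dx_inleft dy_inleft dx_dU dy_dU dx_dV dy_dV dx_0 dy_0
    ev_add ev_mult ev_inleft ev_dU ev_dV ev_0 ez power2_eq_square
  have "dx w = inleft (ev a) + 2 * inleft (ev a1) * dU + inleft (ev (a2 + b1)) * dV + dx z"
    by (subst w) (simp add: dsimps algebra_simps)
  moreover have "dy w = inleft (ev b) + inleft (ev (a2 + b1)) * dU + 2 * inleft (ev b2) * dV + dy z"
    by (subst w) (simp add: dsimps algebra_simps)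
  moreover have num: "dx 2 = (0 :: 'c fps fps fps fps)" "dy 2 = (0 :: 'c fps fps fps fps)"
      "ev 2 = (2 :: 'c fps fps)"
  proof -
    have i2: "inleft (2 :: 'c fps fps) = 2" using inleft_add[of 1 "1 :: 'c fps fps"] by (simp add: inleft_1)
    show "dx 2 = (0 :: 'c fps fps fps fps)" "dy 2 = (0 :: 'c fps fps fps fps)" "ev 2 = (2 :: 'c fps fps)"
      using dx_inleft[of "2 :: 'c fps fps"] dy_inleft[of "2 :: 'c fps fps"] ev_inleft[of "2 :: 'c fps fps"]
      unfolding i2 .
  qed
  ultimately have E: "ev (dx w) = ev a" "ev (dy w) = ev b" "ev (dx (dx w)) = 2 * ev a1"
    "ev (dx (dy w)) = ev (a2 + b1)" "ev (dy (dy w)) = 2 * ev b2"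
    by (simp_all add: dsimps num)
  have inl2: "inleft (2 * r) = 2 * inleft r" for r :: "'c fps fps"
    using inleft_add[of r r] by simp
  have "2 * w - (inleft (2 * ev w) + inleft (2 * ev (dx w)) * dU + inleft (2 * ev (dy w)) * dV
    + inleft (ev (dx (dx w))) * dU\<^sup>2 + inleft (2 * ev (dx (dy w))) * (dU * dV)
    + inleft (ev (dy (dy w))) * dV\<^sup>2) = 2 * z"
    unfolding E inl2 z_def by (simp add: algebra_simps)
  then show ?thesis using ideal_power_closed(2)[OF z, of 2] by (simp only:)
qed


section \<open>The dual of the module of principal parts\<close>

lemma ideal_gen_dvd: "x \<in> ideal_gen {F} \<longleftrightarrow> F dvd x"
  by (auto simp: ideal_gen_singleton dvd_def mult.commute)

text \<open>The vector field tangent to the fibres, acting on the primed variables. It is linear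
  over the left factor and kills F(x',y'), so it respects the relations of principal parts, except
  that it lowers powers of the diagonal ideal by one.\<close>

definition tangent :: "'c::comm_ring_1 fps fps \<Rightarrow> 'c fps fps fps fps \<Rightarrow> 'c fps fps fps fps" where
  "tangent F w = inright (dy F) * dx w - inright (dx F) * dy w"

definition dbasis :: "'c::comm_ring_1 fps fps \<Rightarrow> nat \<Rightarrow> 'c fps fps fps fps \<Rightarrow> 'c fps fps" where
  "dbasis F i w = ev ((tangent F ^^ i) w)"

lemma tangent_add: "tangent F (a + b) = tangent F a + tangent F b"
  by (simp add: tangent_def dx_add dy_add algebra_simps)

lemma tangent_mult: "tangent F (a * b) = tangent F a * b + a * tangent F b"
  by (simp add: tangent_def dx_mult dy_mult algebra_simps)

lemma tangent_pow_add: "(tangent F ^^ i) (a + b) = (tangent F ^^ i) a + (tangent F ^^ i) b"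
  by (induction i) (simp_all add: tangent_add)

lemma tangent_inleft: "tangent F (inleft r) = 0"
  by (simp add: tangent_def dx_inleft dy_inleft)

lemma tangent_inright: "tangent F (inright F) = 0"
  by (simp add: tangent_def dx_inright dy_inright mult.commute)

lemma tangent_pow_const:
  assumes "tangent F a = 0"
  shows "(tangent F ^^ i) (a * w) = a * (tangent F ^^ i) w"
  by (induction i) (simp_all add: tangent_mult assms)

lemma tangent_pow_ideal_power:
  "w \<in> ideal_power diagonal_ideal (n + i) \<Longrightarrow> (tangent F ^^ i) w \<in> ideal_power diagonal_ideal n"
proof (induction i arbitrary: n)
  case (Suc i)
  from Suc.prems have "(tangent F ^^ i) w \<in> ideal_power diagonal_ideal (Suc n)"
    by (intro Suc.IH) simp
  then show ?case
    unfolding diagonal_ideal_eq by (auto intro: derivation_ideal_power tangent_add tangent_mult)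
qed simp

text \<open>Every application of \<open>tangent\<close> costs one power of the diagonal ideal;
  \<open>i < m\<close> leaves at least one, which dies on the diagonal.\<close>

lemma pp_dual_dbasis:
  assumes "i < m"
  shows "pp_dual F m (dbasis F i)"
  unfolding pp_dual_def ideal_gen_dvd
proof (intro conjI allI ballI)
  fix u v r
  show "F dvd dbasis F i (u + v) - dbasis F i u - dbasis F i v"
    by (simp add: dbasis_def tangent_pow_add ev_add)
  show "F dvd dbasis F i (inleft r * u) - r * dbasis F i u"
    by (simp add: dbasis_def tangent_pow_const[OF tangent_inleft] ev_mult ev_inleft)
next
  fix u assume "u \<in> pp_ideal F m"
  then have "u \<in> ideal_gen (insert (inleft F) (insert (inright F) (ideal_power diagonal_ideal m)))"
    by (simp add: pp_ideal_def)
  then obtain k where "u - k * inleft F \<in> ideal_gen (insert (inright F) (ideal_power diagonal_ideal m))"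
    by (rule ideal_gen_insertE)
  then obtain l where "u - k * inleft F - l * inright F \<in> ideal_gen (ideal_power diagonal_ideal m)"
    by (rule ideal_gen_insertE)
  then have z: "u - k * inleft F - l * inright F \<in> ideal_power diagonal_ideal m"
    unfolding ideal_power_def by (simp only: ideal.span_span)
  define z where "z = u - k * inleft F - l * inright F"
  have "(tangent F ^^ i) z \<in> ideal_power diagonal_ideal (Suc (m - Suc i))"
    by (rule tangent_pow_ideal_power) (use z assms in \<open>simp add: z_def\<close>)
  then have "ev ((tangent F ^^ i) z) = 0" by (rule ev_ideal_power)
  moreover have u: "u = z + (inleft F * k + inright F * l)" by (simp add: z_def mult.commute)
  have "dbasis F i u = ev ((tangent F ^^ i) z)
      + (F * ev ((tangent F ^^ i) k) + F * ev ((tangent F ^^ i) l))"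
    unfolding u by (simp only: dbasis_def tangent_pow_add tangent_pow_const[OF tangent_inleft]
        tangent_pow_const[OF tangent_inright] ev_add ev_mult ev_inleft ev_inright)
  ultimately show "F dvd dbasis F i u" by simp
qed

lemma dbasis_0: "dbasis F 0 w = ev w"
  by (simp add: dbasis_def)

lemma dbasis_1: "dbasis F 1 w = dy F * ev (dx w) - dx F * ev (dy w)"
  by (simp add: dbasis_def tangent_def ev_diff ev_mult ev_inright)

lemma ev_monomials:
  "ev 1 = (1 :: 'c::comm_ring_1 fps fps)" "dx 1 = (0 :: 'c fps fps fps fps)" "dy 1 = (0 :: 'c fps fps fps fps)"
  using ev_inleft[of "1 :: 'c fps fps"] dx_inleft[of "1 :: 'c fps fps"] dy_inleft[of "1 :: 'c fps fps"]
  by (simp_all add: inleft_1)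

lemma ev_2: "ev 2 = (2 :: 'c::comm_ring_1 fps fps)"
  using ev_add[of 1 "1 :: 'c fps fps fps fps"] by (simp add: ev_monomials)

lemma dbasis_2: "dbasis F 2 w = (dy F)\<^sup>2 * ev (dx (dx w)) - 2 * dy F * dx F * ev (dx (dy w))
    + (dx F)\<^sup>2 * ev (dy (dy w))
    + (dy F * dx (dy F) - dx F * dy (dy F)) * ev (dx w)
    - (dy F * dx (dx F) - dx F * dx (dy F)) * ev (dy w)"
  by (simp add: dbasis_def numeral_2_eq_2 tangent_def dx_diff dy_diff dx_mult dy_mult dx_inright dy_inright
      ev_diff ev_add ev_mult ev_inright ev_2 dx_dy[symmetric] algebra_simps power2_eq_square)

lemma pp_dual_add: "pp_dual F m \<phi> \<Longrightarrow> F dvd \<phi> (u + v) - \<phi> u - \<phi> v"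
  and pp_dual_scale: "pp_dual F m \<phi> \<Longrightarrow> F dvd \<phi> (inleft r * u) - r * \<phi> u"
  and pp_dual_ideal: "pp_dual F m \<phi> \<Longrightarrow> u \<in> pp_ideal F m \<Longrightarrow> F dvd \<phi> u"
  by (simp_all add: pp_dual_def ideal_gen_dvd)

lemma dvd_diff_trans: "(F :: 'a::comm_ring_1) dvd a - b \<Longrightarrow> F dvd b - c \<Longrightarrow> F dvd a - c"
  using dvd_add[of F "a - b" "b - c"] by simp

lemma dvd_diff_add: "(F :: 'a::comm_ring_1) dvd a - b \<Longrightarrow> F dvd c - d \<Longrightarrow> F dvd (a + c) - (b + d)"
  using dvd_add[of F "a - b" "c - d"] by (simp add: algebra_simps)

lemma dvd_diff_iff: "(F :: 'a::comm_ring_1) dvd a - b \<Longrightarrow> F dvd a \<longleftrightarrow> F dvd b"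
  using dvd_add[of F "a - b" b] dvd_diff[of F a "a - b"] by auto

text \<open>Reduces a functional to its six values on the monomials of degree at most 2 in
  \<open>dU, dV\<close>.\<close>

lemma pp_dual_taylor:
  assumes \<phi>: "pp_dual F 3 \<phi>"
  shows "F dvd 2 * \<phi> w - (2 * ev w * \<phi> 1 + 2 * ev (dx w) * \<phi> dU + 2 * ev (dy w) * \<phi> dV
    + ev (dx (dx w)) * \<phi> (dU\<^sup>2) + 2 * ev (dx (dy w)) * \<phi> (dU * dV) + ev (dy (dy w)) * \<phi> (dV\<^sup>2))"
proof -
  note s = pp_dual_scale[OF \<phi>]
  have a: "F dvd \<phi> (u + v) - (\<phi> u + \<phi> v)" for u v
    using pp_dual_add[OF \<phi>, of u v] by (simp add: algebra_simps)
  define T where "T = inleft (2 * ev w) * 1 + inleft (2 * ev (dx w)) * dU + inleft (2 * ev (dy w)) * dV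
    + inleft (ev (dx (dx w))) * dU\<^sup>2 + inleft (2 * ev (dx (dy w))) * (dU * dV)
    + inleft (ev (dy (dy w))) * dV\<^sup>2"
  have "2 * w - T \<in> pp_ideal F 3"
    using taylor2[of w] unfolding pp_ideal_def T_def by (auto intro: ideal.span_base)
  then have "F dvd \<phi> (2 * w - T)" by (rule pp_dual_ideal[OF \<phi>])
  moreover have "F dvd \<phi> ((2 * w - T) + T) - (\<phi> (2 * w - T) + \<phi> T)" by (rule a)
  ultimately have "F dvd \<phi> (2 * w) - \<phi> T"
    using dvd_add[of F "\<phi> (2 * w - T)" "\<phi> (2 * w) - (\<phi> (2 * w - T) + \<phi> T)"] by simp
  moreover have "F dvd \<phi> T - (2 * ev w * \<phi> 1 + 2 * ev (dx w) * \<phi> dU + 2 * ev (dy w) * \<phi> dV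
    + ev (dx (dx w)) * \<phi> (dU\<^sup>2) + 2 * ev (dx (dy w)) * \<phi> (dU * dV) + ev (dy (dy w)) * \<phi> (dV\<^sup>2))"
    unfolding T_def by (intro dvd_diff_trans[OF a] dvd_diff_add s)
  moreover have "F dvd 2 * \<phi> w - \<phi> (2 * w)"
  proof -
    have "F dvd \<phi> (inleft 2 * w) - 2 * \<phi> w" by (rule s)
    moreover have "inleft (2 :: 'a fps fps) = 2"
      using inleft_add[of 1 "1 :: 'a fps fps"] by (simp add: inleft_1)
    ultimately show ?thesis using dvd_minus_iff[of F "\<phi> (2 * w) - 2 * \<phi> w"] by simp
  qed
  ultimately show ?thesis by (blast intro: dvd_diff_trans)
qed

lemma dvd_cancel_unit:
  fixes a :: "'a::comm_ring_1"
  assumes "(2 :: 'a) dvd 1" "F dvd 2 * a"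
  shows "F dvd a"
proof -
  obtain h :: 'a where "1 = 2 * h" using assms(1) by (rule dvdE)
  then have "a = h * (2 * a)" by (metis mult.assoc mult.commute mult_1)
  then show "F dvd a" using \<open>F dvd 2 * a\<close> by (metis dvd_mult)
qed

text \<open>The relations that a vector of values on the monomials of degree at most 2 in \<open>dU, dV\<close>
  must satisfy; they express that \<open>F(x',y')\<close>, \<open>F(x',y') dU\<close> and \<open>F(x',y') dV\<close> are killed.\<close>

lemma pp_dual_relations:
  fixes F :: "'c::comm_ring_1 fps fps"
  assumes \<phi>: "pp_dual F 3 \<phi>" and two: "(2 :: 'c fps fps) dvd 1"
  shows "F dvd 2 * (dx F * \<phi> dU + dy F * \<phi> dV) + dx (dx F) * \<phi> (dU\<^sup>2)
      + 2 * dx (dy F) * \<phi> (dU * dV) + dy (dy F) * \<phi> (dV\<^sup>2)"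
    and "F dvd dx F * \<phi> (dU\<^sup>2) + dy F * \<phi> (dU * dV)"
    and "F dvd dx F * \<phi> (dU * dV) + dy F * \<phi> (dV\<^sup>2)"
proof -
  have kill: "F dvd \<phi> (inright F * w)" for w
  proof (rule pp_dual_ideal[OF \<phi>])
    have "inright F \<in> pp_ideal F 3" unfolding pp_ideal_def by (rule ideal.span_base) simp
    then show "inright F * w \<in> pp_ideal F 3" unfolding pp_ideal_def by (rule ideal_gen_mult2)
  qed
  have main: "F dvd (2 * ev w * \<phi> 1 + 2 * ev (dx w) * \<phi> dU + 2 * ev (dy w) * \<phi> dV
    + ev (dx (dx w)) * \<phi> (dU\<^sup>2) + 2 * ev (dx (dy w)) * \<phi> (dU * dV) + ev (dy (dy w)) * \<phi> (dV\<^sup>2))"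
    if "F dvd \<phi> w" for w
    using dvd_diff_iff[OF pp_dual_taylor[OF \<phi>, of w]] dvd_mult[OF that, of 2] by blast
  note dsimps = dx_mult dy_mult dx_add dy_add dx_inright dy_inright dx_dU dy_dU dx_dV dy_dV dx_0 dy_0
    ev_mult ev_add ev_inright ev_dU ev_dV ev_0 ev_2
  have ev1: "ev 1 = (1 :: 'c fps fps)" using ev_inleft[of "1 :: 'c fps fps"] by (simp add: inleft_1)
  have d1: "dx 1 = (0 :: 'c fps fps fps fps)" "dy 1 = (0 :: 'c fps fps fps fps)"
    using dx_inleft[of "1 :: 'c fps fps"] dy_inleft[of "1 :: 'c fps fps"] by (simp_all add: inleft_1)
  have "F dvd \<phi> (inright F)" using kill[of 1] by simp
  from main[OF this] have "F dvd 2 * F * \<phi> 1 + (2 * (dx F * \<phi> dU + dy F * \<phi> dV) + dx (dx F) * \<phi> (dU\<^sup>2)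
      + 2 * dx (dy F) * \<phi> (dU * dV) + dy (dy F) * \<phi> (dV\<^sup>2))"
    by (simp add: dsimps algebra_simps)
  then show "F dvd 2 * (dx F * \<phi> dU + dy F * \<phi> dV) + dx (dx F) * \<phi> (dU\<^sup>2)
      + 2 * dx (dy F) * \<phi> (dU * dV) + dy (dy F) * \<phi> (dV\<^sup>2)"
    by (subst (asm) dvd_add_right_iff) simp_all
  from main[OF kill[of dU]]
  have "F dvd F * (2 * \<phi> dU) + 2 * (dx F * \<phi> (dU\<^sup>2) + dy F * \<phi> (dU * dV))"
    by (simp add: dsimps ev1 d1 algebra_simps)
  then have "F dvd 2 * (dx F * \<phi> (dU\<^sup>2) + dy F * \<phi> (dU * dV))"
    by (subst (asm) dvd_add_right_iff) simp_all
  then show "F dvd dx F * \<phi> (dU\<^sup>2) + dy F * \<phi> (dU * dV)"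
    by (rule dvd_cancel_unit[OF two])
  from main[OF kill[of dV]]
  have "F dvd F * (2 * \<phi> dV) + 2 * (dx F * \<phi> (dU * dV) + dy F * \<phi> (dV\<^sup>2))"
    by (simp add: dsimps ev1 d1 algebra_simps)
  then have "F dvd 2 * (dx F * \<phi> (dU * dV) + dy F * \<phi> (dV\<^sup>2))"
    by (subst (asm) dvd_add_right_iff) simp_all
  then show "F dvd dx F * \<phi> (dU * dV) + dy F * \<phi> (dV\<^sup>2)"
    by (rule dvd_cancel_unit[OF two])
qed

text \<open>By \<open>pp_dual_relations\<close> the second-order values of a functional form two
  overlapping syzygies of (\<open>dx F\<close>, \<open>dy F\<close>). Regularity makes the Koszul
  complex exact, so these values are a multiple of those of \<open>dbasis F 2\<close>. After
  subtracting it, the first-order values form a syzygy too and are a multiple of those of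
  \<open>dbasis F 1\<close>.\<close>

lemma pp_dual_basis_dbasis:
  fixes F :: "'c::comm_ring_1 fps fps"
  assumes two: "(2 :: 'c fps fps) dvd 1" and y: "nzd {F} (dy F)" and x: "nzd {F, dy F} (dx F)"
  shows "pp_dual_basis F 3 (dbasis F)"
proof -
  have y': "F dvd r" if "F dvd dy F * r" for r using nzdD[OF y, of r] that by (simp add: ideal_gen_dvd)
  \<comment> \<open>Exactness of the Koszul complex: modulo \<open>F\<close>, every syzygy of
    (\<open>dx F\<close>, \<open>dy F\<close>) is a multiple of (\<open>dy F\<close>,
    \<open>- dx F\<close>).\<close>
  have koszul: "\<exists>w. F dvd u - w * dy F \<and> F dvd v + w * dx F" if uv: "F dvd dx F * u + dy F * v" for u v
  proof -
    obtain k where k: "dx F * u + dy F * v = F * k" using uv by (rule dvdE)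
    have "dx F * u \<in> ideal_gen {F, dy F}"
      unfolding ideal_gen_2 by (intro exI[of _ k] exI[of _ "- v"]) (use k in \<open>simp add: algebra_simps\<close>)
    with x have "u \<in> ideal_gen {F, dy F}" by (rule nzdD)
    then obtain a w where aw: "u = a * F + w * dy F" unfolding ideal_gen_2 by blast
    have "dy F * (v + w * dx F) = F * (k - dx F * a)" using k by (simp add: aw algebra_simps)
    then have "F dvd dy F * (v + w * dx F)" by simp
    then have "F dvd v + w * dx F" by (rule y')
    then show ?thesis by (intro exI[of _ w]) (simp add: aw)
  qed
  have vals: "dbasis F 0 1 = 1" "dbasis F 1 1 = 0" "dbasis F 2 1 = 0"
    "dbasis F 0 dU = 0" "dbasis F 1 dU = dy F" "dbasis F 0 dV = 0" "dbasis F 1 dV = - dx F"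
    "dbasis F 0 (dU\<^sup>2) = 0" "dbasis F 1 (dU\<^sup>2) = 0" "dbasis F 2 (dU\<^sup>2) = 2 * (dy F)\<^sup>2"
    "dbasis F 0 (dU * dV) = 0" "dbasis F 1 (dU * dV) = 0" "dbasis F 2 (dU * dV) = - (2 * dy F * dx F)"
    "dbasis F 0 (dV\<^sup>2) = 0" "dbasis F 1 (dV\<^sup>2) = 0" "dbasis F 2 (dV\<^sup>2) = 2 * (dx F)\<^sup>2"
    unfolding dbasis_0 dbasis_1 dbasis_2
    by (simp_all add: ev_monomials ev_2 ev_dU ev_dV dx_dU dx_dV dy_dU dy_dV dx_mult dy_mult dx_add dy_add
        dx_0 dy_0 ev_0 ev_add ev_mult power2_eq_square)
  note vals = vals vals(2,5,7,9,12,15)[unfolded One_nat_def]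
  have dual: "pp_dual F 3 (dbasis F i)" if "i < 3" for i using that by (rule pp_dual_dbasis)
  have lin: "pp_dual F 3 (\<lambda>w. \<phi> w - (a * dbasis F 0 w + b * dbasis F 1 w + c * dbasis F 2 w))"
    if \<phi>: "pp_dual F 3 \<phi>" for \<phi> a b c
    unfolding pp_dual_def ideal_gen_dvd
  proof (intro conjI allI ballI)
    fix u v r
    note d = dual[of 0] dual[of 1] dual[of 2]
    have "F dvd (\<phi> (u + v) - \<phi> u - \<phi> v) - (a * (dbasis F 0 (u + v) - dbasis F 0 u - dbasis F 0 v)
        + b * (dbasis F 1 (u + v) - dbasis F 1 u - dbasis F 1 v) + c * (dbasis F 2 (u + v) - dbasis F 2 u - dbasis F 2 v))"
      by (intro dvd_diff dvd_add dvd_mult pp_dual_add[OF \<phi>] d[THEN pp_dual_add]) simp_all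
    then show "F dvd \<phi> (u + v) - (a * dbasis F 0 (u + v) + b * dbasis F 1 (u + v) + c * dbasis F 2 (u + v)) -
       (\<phi> u - (a * dbasis F 0 u + b * dbasis F 1 u + c * dbasis F 2 u)) -
       (\<phi> v - (a * dbasis F 0 v + b * dbasis F 1 v + c * dbasis F 2 v))"
      by (simp add: algebra_simps)
    have "F dvd (\<phi> (inleft r * u) - r * \<phi> u) - (a * (dbasis F 0 (inleft r * u) - r * dbasis F 0 u)
        + b * (dbasis F 1 (inleft r * u) - r * dbasis F 1 u) + c * (dbasis F 2 (inleft r * u) - r * dbasis F 2 u))"
      by (intro dvd_diff dvd_add dvd_mult pp_dual_scale[OF \<phi>] d[THEN pp_dual_scale]) simp_all
    then show "F dvd \<phi> (inleft r * u) - (a * dbasis F 0 (inleft r * u) + b * dbasis F 1 (inleft r * u)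
        + c * dbasis F 2 (inleft r * u)) - r * (\<phi> u - (a * dbasis F 0 u + b * dbasis F 1 u + c * dbasis F 2 u))"
      by (simp add: algebra_simps)
  next
    fix u assume u: "u \<in> pp_ideal F 3"
    show "F dvd \<phi> u - (a * dbasis F 0 u + b * dbasis F 1 u + c * dbasis F 2 u)"
      by (intro dvd_diff dvd_add dvd_mult pp_dual_ideal[OF \<phi> u] dual[THEN pp_dual_ideal, OF _ u]) simp_all
  qed
  have sum3: "(\<Sum>i<3. h i) = h 0 + h 1 + h 2" for h :: "nat \<Rightarrow> 'c fps fps"
    by (simp add: numeral_3_eq_3 numeral_2_eq_2)
  show ?thesis
    unfolding pp_dual_basis_def sum3 ideal_gen_dvd
  proof (intro conjI allI impI dual)
    fix c :: "nat \<Rightarrow> 'c fps fps" and i :: nat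
    assume c: "\<forall>u. F dvd c 0 * dbasis F 0 u + c 1 * dbasis F 1 u + c 2 * dbasis F 2 u" and i: "i < 3"
    have "F dvd c 0" using spec[OF c, of 1] by (simp add: vals)
    moreover have c2: "F dvd c 2"
    proof -
      have "F dvd 2 * (dy F * (dy F * c 2))" using spec[OF c, of "dU\<^sup>2"]
        unfolding vals by (simp add: power2_eq_square mult_ac)
      then show ?thesis using dvd_cancel_unit[OF two] y' by blast
    qed
    moreover have "F dvd c 1"
    proof -
      have "F dvd c 1 * dy F + c 2 * dbasis F 2 dU" using spec[OF c, of dU] by (simp add: vals)
      then have "F dvd dy F * c 1" using c2 by (simp add: dvd_add_left_iff mult.commute)
      then show ?thesis by (rule y')
    qed
    ultimately show "F dvd c i" using i by (auto simp: numeral_3_eq_3 numeral_2_eq_2 less_Suc_eq)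
  next
    fix \<phi> assume \<phi>: "pp_dual F 3 \<phi>"
    obtain h where h: "1 = 2 * (h :: 'c fps fps)" using two by (auto elim: dvdE)
    obtain w1 where w1: "F dvd \<phi> (dU\<^sup>2) - w1 * dy F" "F dvd \<phi> (dU * dV) + w1 * dx F"
      using koszul[OF pp_dual_relations(2)[OF \<phi> two]] by blast
    obtain w2 where w2: "F dvd \<phi> (dU * dV) - w2 * dy F" "F dvd \<phi> (dV\<^sup>2) + w2 * dx F"
      using koszul[OF pp_dual_relations(3)[OF \<phi> two]] by blast
    \<comment> \<open>Two expressions for the middle value give one more syzygy, hence a common
      factor \<open>w\<close>. The second-order values are then \<open>w\<close> times
      \<open>(dy F)\<^sup>2\<close>, \<open>- (dx F * dy F)\<close>,
      \<open>(dx F)\<^sup>2\<close>.\<close>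
    have "F dvd (\<phi> (dU * dV) + w1 * dx F) - (\<phi> (dU * dV) - w2 * dy F)"
      using w1(2) w2(1) by (rule dvd_diff)
    then have "F dvd dx F * w1 + dy F * w2" by (simp add: algebra_simps)
    from koszul[OF this] obtain w where w: "F dvd w1 - w * dy F" "F dvd w2 + w * dx F" by blast
    \<comment> \<open>\<open>dbasis F 2\<close> takes twice those values, so half of
      \<open>w\<close> is subtracted.\<close>
    define c where "c = h * w"
    have c: "2 * c = w" using h by (metis c_def mult.assoc mult_1)
    define \<psi> where "\<psi> u = \<phi> u - (0 * dbasis F 0 u + 0 * dbasis F 1 u + c * dbasis F 2 u)" for u
    have \<psi>: "pp_dual F 3 \<psi>" unfolding \<psi>_def by (rule lin[OF \<phi>])
    have "\<psi> (dU\<^sup>2) = (\<phi> (dU\<^sup>2) - w1 * dy F) + dy F * (w1 - w * dy F)"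
      unfolding \<psi>_def vals c[symmetric] by (simp add: power2_eq_square algebra_simps)
    then have u0: "F dvd \<psi> (dU\<^sup>2)" using w1 w by simp
    have "\<psi> (dU * dV) = (\<phi> (dU * dV) + w1 * dx F) - dx F * (w1 - w * dy F)"
      unfolding \<psi>_def vals c[symmetric] by (simp add: power2_eq_square algebra_simps)
    then have u1: "F dvd \<psi> (dU * dV)" using w1 w by simp
    have "\<psi> (dV\<^sup>2) = (\<phi> (dV\<^sup>2) + w2 * dx F) - dx F * (w2 + w * dx F)"
      unfolding \<psi>_def vals c[symmetric] by (simp add: power2_eq_square algebra_simps)
    then have u2: "F dvd \<psi> (dV\<^sup>2)" using w2 w by simp
    have "F dvd 2 * (dx F * \<psi> dU + dy F * \<psi> dV) + (dx (dx F) * \<psi> (dU\<^sup>2)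
      + 2 * dx (dy F) * \<psi> (dU * dV) + dy (dy F) * \<psi> (dV\<^sup>2))"
      using pp_dual_relations(1)[OF \<psi> two] by (simp add: algebra_simps)
    moreover have "F dvd dx (dx F) * \<psi> (dU\<^sup>2) + 2 * dx (dy F) * \<psi> (dU * dV) + dy (dy F) * \<psi> (dV\<^sup>2)"
      using u0 u1 u2 by (intro dvd_add dvd_mult)
    ultimately have "F dvd 2 * (dx F * \<psi> dU + dy F * \<psi> dV)" by (simp add: dvd_add_left_iff)
    then have "F dvd dx F * \<psi> dU + dy F * \<psi> dV" by (rule dvd_cancel_unit[OF two])
    from koszul[OF this] obtain b where b: "F dvd \<psi> dU - b * dy F" "F dvd \<psi> dV + b * dx F" by blast
    define a where "a = \<phi> 1"
    define \<chi> where "\<chi> u = \<psi> u - (a * dbasis F 0 u + b * dbasis F 1 u + 0 * dbasis F 2 u)" for u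
    have \<chi>: "pp_dual F 3 \<chi>" unfolding \<chi>_def by (rule lin[OF \<psi>])
    have "F dvd \<chi> 1" by (simp add: \<chi>_def \<psi>_def vals a_def)
    moreover have "F dvd \<chi> dU" "F dvd \<chi> dV" using b by (simp_all add: \<chi>_def vals)
    moreover have "F dvd \<chi> (dU\<^sup>2)" "F dvd \<chi> (dU * dV)" "F dvd \<chi> (dV\<^sup>2)"
      using u0 u1 u2 by (simp_all add: \<chi>_def vals)
    ultimately have "F dvd 2 * ev u * \<chi> 1 + 2 * ev (dx u) * \<chi> dU + 2 * ev (dy u) * \<chi> dV
      + ev (dx (dx u)) * \<chi> (dU\<^sup>2) + 2 * ev (dx (dy u)) * \<chi> (dU * dV) + ev (dy (dy u)) * \<chi> (dV\<^sup>2)" for u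
      by (intro dvd_add dvd_mult)
    then have "F dvd \<chi> u" for u
      using pp_dual_taylor[OF \<chi>, of u] dvd_diff_iff dvd_cancel_unit[OF two] by blast
    then show "\<exists>c :: nat \<Rightarrow> 'c fps fps. \<forall>u. F dvd \<phi> u - (c 0 * dbasis F 0 u + c 1 * dbasis F 1 u + c 2 * dbasis F 2 u)"
      by (intro exI[of _ "\<lambda>i. if i = 0 then a else if i = 1 then b else c"])
        (simp add: \<chi>_def \<psi>_def algebra_simps)
  qed
qed


section \<open>Maximal minors of a matrix with three rows and two columns\<close>

definition minor2 :: "(nat \<Rightarrow> 'w \<Rightarrow> 'a::comm_ring_1) \<Rightarrow> 'w \<Rightarrow> 'w \<Rightarrow> nat \<Rightarrow> nat \<Rightarrow> 'a" where
  "minor2 e v w i j = e i v * e j w - e i w * e j v"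

lemma det_2: "det (mat 2 2 h) = h (0, 0) * h (1, 1) - h (0, 1) * h (1, 0 :: nat)" for h :: "nat \<times> nat \<Rightarrow> 'a::comm_ring_1"
proof -
  have p: "{p. p permutes {0..<2::nat}} = {id, Transposition.transpose 0 1}"
  proof -
    have "{0..<2::nat} = {0, 1}" by auto
    then show ?thesis by (simp add: permutes_doubleton_iff) auto
  qed
  have ne: "id \<noteq> Transposition.transpose 0 (1::nat)"
    by (metis id_apply transpose_apply_first zero_neq_one)
  have prod2: "(\<Prod>i=0..<2. k i) = k 0 * k (1::nat)" for k :: "nat \<Rightarrow> 'a"
    by (simp add: numeral_2_eq_2)
  show ?thesis
    unfolding det_def using ne by (simp add: p prod2 sign_swap_id)
qed

lemma minors_ideal_3:
  "minors_ideal F 3 e [v, w] = ideal_gen {F, minor2 e v w 0 1, minor2 e v w 0 2, minor2 e v w 1 2}"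
proof -
  have *: "det (mat 2 2 (\<lambda>(i, j). e (r i) ([v, w] ! j))) = minor2 e v w (r 0) (r 1)" for r
    unfolding det_2 by (simp add: minor2_def)
  have r: "(\<exists>r. x = minor2 e v w (r 0) (r 1) \<and> strict_mono_on {..<2::nat} r \<and> r ` {..<2} \<subseteq> {..<3::nat})
      \<longleftrightarrow> x \<in> {minor2 e v w 0 1, minor2 e v w 0 2, minor2 e v w 1 2}" (is "?L \<longleftrightarrow> ?R") for x
  proof
    assume ?L
    then obtain r where x: "x = minor2 e v w (r 0) (r 1)" and r: "strict_mono_on {..<2::nat} r" "r ` {..<2} \<subseteq> {..<3::nat}"
      by blast
    have "r 0 < r 1" using r(1) by (auto simp: strict_mono_on_def)
    moreover have "r 1 \<in> {..<3}" using r(2) by (rule subsetD) simp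
    ultimately have "(r 0, r 1) \<in> {(0, 1), (0, 2), (1, 2)}" by auto
    then show ?R unfolding x by auto
  next
    assume ?R
    then obtain a b where ab: "x = minor2 e v w a b" "a < b" "b < (3::nat)" by auto
    show ?L
      by (rule exI[of _ "\<lambda>i. if i = 0 then a else b"])
        (use ab in \<open>auto simp: strict_mono_on_def lessThan_Suc numeral_2_eq_2\<close>)
  qed
  have "{det (mat (length [v, w]) (length [v, w]) (\<lambda>(i, j). e (r i) ([v, w] ! j))) | r.
        strict_mono_on {..<length [v, w]} r \<and> r ` {..<length [v, w]} \<subseteq> {..<3}}
      = {minor2 e v w 0 1, minor2 e v w 0 2, minor2 e v w 1 2}"
    using r * by (simp add: set_eq_iff numeral_2_eq_2[symmetric] eval_nat_numeral(2)[symmetric])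
  then show ?thesis unfolding minors_ideal_def by simp
qed

text \<open>Cauchy-Binet: writing \<open>e\<close> in terms of \<open>e'\<close> turns minors of the
  first matrix into combinations of minors of the second, up to multiples of \<open>F\<close>.
  Applied in both directions it makes the ideal independent of the basis.\<close>

lemma minors_ideal_mono:
  assumes e: "\<And>i. i < 3 \<Longrightarrow> pp_dual F 3 (e i)" and e': "pp_dual_basis F 3 e'"
  shows "minors_ideal F 3 e [v, w] \<subseteq> minors_ideal F 3 e' [v, w]"
proof -
  let ?M = "ideal_gen {F, minor2 e' v w 0 1, minor2 e' v w 0 2, minor2 e' v w 1 2}"
  have sum3: "(\<Sum>i<3. h i) = h 0 + h 1 + h 2" for h :: "nat \<Rightarrow> 'a fps fps"
    by (simp add: numeral_3_eq_3 numeral_2_eq_2)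
  have "minor2 e v w i j \<in> ?M" if ij: "i < 3" "j < 3" for i j
  proof -
    from e' e[OF ij(1)] obtain c :: "nat \<Rightarrow> 'a fps fps" where c: "\<And>u. F dvd e i u - (c 0 * e' 0 u + c 1 * e' 1 u + c 2 * e' 2 u)"
      unfolding pp_dual_basis_def sum3 ideal_gen_dvd by blast
    from e' e[OF ij(2)] obtain d :: "nat \<Rightarrow> 'a fps fps" where d: "\<And>u. F dvd e j u - (d 0 * e' 0 u + d 1 * e' 1 u + d 2 * e' 2 u)"
      unfolding pp_dual_basis_def sum3 ideal_gen_dvd by blast
    have "\<forall>u. \<exists>a. e i u = c 0 * e' 0 u + c 1 * e' 1 u + c 2 * e' 2 u + F * a"
    proof
      fix u
      obtain a where "e i u - (c 0 * e' 0 u + c 1 * e' 1 u + c 2 * e' 2 u) = F * a" using c[of u] by (rule dvdE)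
      then show "\<exists>a. e i u = c 0 * e' 0 u + c 1 * e' 1 u + c 2 * e' 2 u + F * a"
        by (intro exI[of _ a]) (simp add: diff_eq_eq add.commute)
    qed
    from choice[OF this] obtain a where a: "\<And>u. e i u = c 0 * e' 0 u + c 1 * e' 1 u + c 2 * e' 2 u + F * a u" by blast
    have "\<forall>u. \<exists>a. e j u = d 0 * e' 0 u + d 1 * e' 1 u + d 2 * e' 2 u + F * a"
    proof
      fix u
      obtain a where "e j u - (d 0 * e' 0 u + d 1 * e' 1 u + d 2 * e' 2 u) = F * a" using d[of u] by (rule dvdE)
      then show "\<exists>a. e j u = d 0 * e' 0 u + d 1 * e' 1 u + d 2 * e' 2 u + F * a"
        by (intro exI[of _ a]) (simp add: diff_eq_eq add.commute)
    qed
    from choice[OF this] obtain b where b: "\<And>u. e j u = d 0 * e' 0 u + d 1 * e' 1 u + d 2 * e' 2 u + F * b u" by blast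
    have "minor2 e v w i j = (a v * e j w + (e i v - F * a v) * b w - a w * e j v - (e i w - F * a w) * b v) * F
      + (c 0 * d 1 - c 1 * d 0) * minor2 e' v w 0 1 + (c 0 * d 2 - c 2 * d 0) * minor2 e' v w 0 2
      + (c 1 * d 2 - c 2 * d 1) * minor2 e' v w 1 2"
      unfolding minor2_def a[of v] a[of w] b[of v] b[of w] by (simp add: algebra_simps)
    then show ?thesis unfolding ideal_gen_4 by blast
  qed
  then show ?thesis
    unfolding minors_ideal_3 by (intro ideal.span_minimal) (auto intro: ideal.span_base)
qed

lemma minors_ideal_basis_eq:
  assumes "pp_dual_basis F 3 e" "pp_dual_basis F 3 e'"
  shows "minors_ideal F 3 e [v, w] = minors_ideal F 3 e' [v, w]"
  using minors_ideal_mono[of F e e'] minors_ideal_mono[of F e' e] assms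
  unfolding pp_dual_basis_def by blast


section \<open>The lower bound: weighted monomial counts and perturbation\<close>

section \<open>Colength bounds by counting monomials\<close>

definition kscale :: "'k::field \<Rightarrow> 'k fps fps fps \<Rightarrow> 'k fps fps fps" where
  "kscale c g = const2 (fps_const c) * g"

lemma kscale_nth: "fps_nth (fps_nth (fps_nth (kscale c g) j) i) l = c * fps_nth (fps_nth (fps_nth g j) i) l"
  by (simp add: kscale_def const2_def)

lemma vector_space_kscale: "vector_space kscale"
  by unfold_locales
    (simp_all add: kscale_def algebra_simps const2_add const2_mult const2_1
      flip: fps_const_add fps_const_mult)

interpretation kvs: vector_space kscale by (rule vector_space_kscale)

lemma kscale_mult: "kscale c g * h = kscale c (g * h)" "h * kscale c g = kscale c (h * g)"
  by (simp_all add: kscale_def mult_ac)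

lemma subspace_ideal_gen: "kvs.subspace (ideal_gen S)"
  by (rule kvs.subspaceI) (auto simp: kscale_def intro: ideal.span_zero ideal.span_add ideal.span_scale)

definition fil3 :: "nat \<Rightarrow> nat \<Rightarrow> nat \<Rightarrow> nat \<Rightarrow> 'k::comm_ring_1 fps fps fps set" where
  "fil3 a b e = wfil b (wfil a (wfil e trivial_fil))"

lemma filtered_fil3: "filtered (fil3 a b e)"
  unfolding fil3_def by (intro filtered_wfil filtered_trivial)

lemma fil3_iff: "g \<in> fil3 a b e n \<longleftrightarrow>
    (\<forall>i j l. a * i + b * j + e * l < n \<longrightarrow> fps_nth (fps_nth (fps_nth g j) i) l = 0)"
  unfolding fil3_def wfil_def trivial_fil_def
  by (auto simp: less_diff_conv algebra_simps split: if_splits)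

definition co3 :: "'k::comm_ring_1 fps fps fps \<Rightarrow> nat \<times> nat \<times> nat \<Rightarrow> 'k" where
  "co3 g = (\<lambda>(i, j, l). fps_nth (fps_nth (fps_nth g j) i) l)"

definition mono3 :: "nat \<times> nat \<times> nat \<Rightarrow> 'k::comm_ring_1 fps fps fps" where
  "mono3 = (\<lambda>(i, j, l). Abs_fps (\<lambda>j'. Abs_fps (\<lambda>i'. Abs_fps (\<lambda>l'. if i' = i \<and> j' = j \<and> l' = l then 1 else 0))))"

definition below3 :: "nat \<Rightarrow> nat \<Rightarrow> nat \<Rightarrow> nat \<Rightarrow> (nat \<times> nat \<times> nat) set" where
  "below3 a b e n = {(i, j, l). a * i + b * j + e * l < n}"

lemma co3_add: "co3 (g + h) m = co3 g m + co3 h m"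
  and co3_diff: "co3 (g - h) m = co3 g m - co3 h m"
  and co3_scale: "co3 (kscale c g') m = c * co3 g' m"
  by (auto simp: co3_def kscale_nth split: prod.splits)

lemma co3_sum: "co3 (sum s I) m = (\<Sum>i\<in>I. co3 (s i) m)"
  by (auto simp: co3_def fps_sum_nth split: prod.splits)

lemma co3_mono3: "co3 (mono3 m) m' = (if m' = m then 1 else 0)"
  by (auto simp: co3_def mono3_def split: prod.splits)

lemma fil3_co3: "g \<in> fil3 a b e n \<longleftrightarrow> (\<forall>m\<in>below3 a b e n. co3 g m = 0)"
  by (auto simp: fil3_iff below3_def co3_def)

lemma finite_below3:
  assumes "0 < a" "0 < b" "0 < e"
  shows "finite (below3 a b e n)"
proof (rule finite_subset)
  have *: "i < n \<and> j < n \<and> l < n" if "a * i + b * j + e * l < n" for i j l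
  proof -
    have "i \<le> a * i" "j \<le> b * j" "l \<le> e * l" using assms by simp_all
    then show ?thesis using that by linarith
  qed
  show "below3 a b e n \<subseteq> {..<n} \<times> {..<n} \<times> {..<n}"
  proof
    fix x assume "x \<in> below3 a b e n"
    then obtain i j l where "x = (i, j, l)" "a * i + b * j + e * l < n" by (auto simp: below3_def)
    then show "x \<in> {..<n} \<times> {..<n} \<times> {..<n}" using *[of i j l] by simp
  qed
qed simp

lemma fil3_truncate:
  assumes "0 < a" "0 < b" "0 < e"
  shows "g - (\<Sum>m\<in>below3 a b e n. kscale (co3 g m) (mono3 m)) \<in> fil3 a b e n"
proof -
  have "co3 (\<Sum>m\<in>below3 a b e n. kscale (co3 g m) (mono3 m)) m' = co3 g m'" if "m' \<in> below3 a b e n" for m'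
    using that finite_below3[OF assms, of n]
    by (simp add: co3_sum co3_scale co3_mono3 if_distrib cong: if_cong)
  then show ?thesis by (simp add: fil3_co3 co3_diff)
qed

text \<open>Modulo \<open>fil3 a b e n\<close> the monomials of weight below \<open>n\<close> are
  linearly independent, so a spanning family is at least as large as their number.\<close>

lemma card_below3_le:
  assumes pos: "0 < a" "0 < b" "0 < e" and J: "finite J"
    and span: "\<And>g. \<exists>c. g - (\<Sum>j\<in>J. kscale (c j) (v j)) \<in> fil3 a b e n"
  shows "card (below3 a b e n) \<le> card J"
proof (rule ccontr)
  let ?M = "below3 a b e n"
  assume "\<not> card ?M \<le> card J"
  have "\<forall>m. \<exists>c. mono3 m - (\<Sum>j\<in>J. kscale (c j) (v j)) \<in> fil3 a b e n" using span by blast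
  from choice[OF this] obtain C
    where C: "\<And>m. mono3 m - (\<Sum>j\<in>J. kscale (C m j) (v j)) \<in> fil3 a b e n" by blast
  obtain r where r: "\<exists>m\<in>?M. r m \<noteq> 0" "\<forall>j\<in>J. (\<Sum>m\<in>?M. r m * C m j) = 0"
    using more_vectors_than_coordinates[of J ?M C] J finite_below3[OF pos] \<open>\<not> card ?M \<le> card J\<close>
    by (meson not_le)
  have Ceq: "(\<Sum>j\<in>J. C m j * co3 (v j) m') = co3 (mono3 m) m'" if "m' \<in> ?M" for m m'
    using C[of m] that by (simp add: fil3_co3 co3_diff co3_sum co3_scale)
  have "r m' = 0" if m': "m' \<in> ?M" for m'
  proof -
    have "r m' = (\<Sum>m\<in>?M. r m * co3 (mono3 m) m')"
      using m' finite_below3[OF pos] by (simp add: co3_mono3 if_distrib cong: if_cong)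
    also have "\<dots> = (\<Sum>m\<in>?M. \<Sum>j\<in>J. r m * C m j * co3 (v j) m')"
      by (simp add: Ceq[OF m', symmetric] sum_distrib_left mult.assoc)
    also have "\<dots> = (\<Sum>j\<in>J. (\<Sum>m\<in>?M. r m * C m j) * co3 (v j) m')"
      by (subst sum.swap) (simp add: sum_distrib_right)
    also have "\<dots> = 0" using r(2) by simp
    finally show ?thesis .
  qed
  with r(1) show False by blast
qed

definition below2 :: "nat \<Rightarrow> nat \<Rightarrow> nat \<Rightarrow> (nat \<times> nat) set" where
  "below2 a b n = {(i, j). a * i + b * j < n}"

lemma below2_Sigma:
  assumes "n \<le> a * m"
  shows "below2 a b n = Sigma {..<m} (\<lambda>i. {j. b * j < n - a * i})"
proof -
  have "a * i + b * j < n \<longleftrightarrow> i < m \<and> b * j < n - a * i" for i j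
  proof
    assume ij: "a * i + b * j < n"
    have "i < m"
    proof (rule ccontr)
      assume "\<not> i < m"
      then have "a * m \<le> a * i" by simp
      with ij assms show False by linarith
    qed
    with ij show "i < m \<and> b * j < n - a * i" by linarith
  qed linarith
  then show ?thesis unfolding below2_def Sigma_def by (simp add: set_eq_iff)
qed

lemma multiples_below: "0 < b \<Longrightarrow> {j. b * j < x} = {..<(x + b - 1) div b}" for b :: nat
proof -
  assume b: "0 < b"
  have "b * j < x \<longleftrightarrow> Suc j \<le> (x + b - 1) div b" for j
    unfolding less_eq_div_iff_mult_less_eq[OF b] using b by (auto simp: mult.commute)
  then show ?thesis unfolding set_eq_iff mem_Collect_eq lessThan_iff by (simp only: Suc_le_eq simp_thms)
qed

lemma card_multiples_below:
  fixes b :: nat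
  assumes "0 < b"
  shows "x \<le> b * card {j. b * j < x}" "b * card {j. b * j < x} \<le> x + b"
proof -
  let ?d = "(x + b - 1) div b"
  have c: "card {j. b * j < x} = ?d" by (simp add: multiples_below[OF assms])
  have "x + b - 1 < b * ?d + b" using assms mult.commute[of b ?d]
    by (metis add.commute dividend_less_div_times)
  then show "x \<le> b * card {j. b * j < x}" unfolding c using assms by linarith
  show "b * card {j. b * j < x} \<le> x + b" unfolding c using times_div_less_eq_dividend[of b "x + b - 1"] by linarith
qed

lemma sum_descending: "2 * (\<Sum>i<n. c * (n - i)) = c * n * Suc n" for c :: nat
proof (induction n)
  case (Suc n)
  have "(\<Sum>i<Suc n. c * (Suc n - i)) = c * Suc n + (\<Sum>i<n. c * (n - i))"
    by (subst sum.lessThan_Suc_shift) simp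
  then show ?case using Suc by (simp add: algebra_simps)
qed simp

text \<open>Lattice points in a triangle, counted column by column. The area a b K^2 / 2 is the main
  term, and the excess is linear in \<open>K\<close>, which suffices for the asymptotic comparison
  in \<open>colength_ge\<close>.\<close>

lemma card_below2:
  fixes a b :: nat
  assumes pos: "0 < a" "0 < b"
  shows "a * b * K\<^sup>2 \<le> 2 * card (below2 a b (a * b * K))"
    and "2 * card (below2 a b (a * b * K)) \<le> K * (a * b * K + a + 2 * b)"
proof -
  have "below2 a b (a * b * K) = Sigma {..<b * K} (\<lambda>i. {j. b * j < a * b * K - a * i})"
    by (rule below2_Sigma) (simp add: mult.assoc)
  moreover have fin: "finite {j. b * j < x}" for x by (simp add: multiples_below[OF pos(2)])
  ultimately have card: "card (below2 a b (a * b * K)) = (\<Sum>i<b * K. card {j. b * j < a * (b * K - i)})"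
    by (simp add: right_diff_distrib' mult.assoc)
  have "b * (a * K * (b * K + 1)) = 2 * (\<Sum>i<b * K. a * (b * K - i))"
    unfolding sum_descending by (simp add: algebra_simps)
  also have "\<dots> \<le> 2 * (\<Sum>i<b * K. b * card {j. b * j < a * (b * K - i)})"
    by (intro mult_left_mono sum_mono card_multiples_below pos) simp
  also have "\<dots> = b * (2 * card (below2 a b (a * b * K)))"
    by (simp add: card sum_distrib_left mult.left_commute)
  finally have "a * K * (b * K + 1) \<le> 2 * card (below2 a b (a * b * K))" using pos by simp
  then show "a * b * K\<^sup>2 \<le> 2 * card (below2 a b (a * b * K))"
    by (simp add: algebra_simps power2_eq_square)
  have "b * (2 * card (below2 a b (a * b * K))) = 2 * (\<Sum>i<b * K. b * card {j. b * j < a * (b * K - i)})"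
    by (simp add: card sum_distrib_left mult.left_commute)
  also have "\<dots> \<le> 2 * (\<Sum>i<b * K. a * (b * K - i) + b)"
    by (intro mult_left_mono sum_mono card_multiples_below pos) simp
  also have "\<dots> = a * (b * K) * Suc (b * K) + 2 * (b * K * b)"
    unfolding sum.distrib distrib_left sum_descending by simp
  also have "\<dots> = b * (K * (a * b * K + a + 2 * b))" by (simp add: algebra_simps)
  finally show "2 * card (below2 a b (a * b * K)) \<le> K * (a * b * K + a + 2 * b)" using pos by simp
qed

text \<open>Monomials without and with a factor of the last variable. If \<open>F\<close> has weight
  \<open>e\<close>, the second group is what multiples of \<open>F\<close> can account for, so only
  a two-dimensional count is left.\<close>

lemma card_below3:
  assumes pos: "0 < a" "0 < b" "0 < e"
  shows "card (below3 a b e n) = card (below2 a b n) + card (below3 a b e (n - e))"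
proof -
  have eq: "below3 a b e n = (\<lambda>(i, j). (i, j, 0)) ` below2 a b n \<union> (\<lambda>(i, j, l). (i, j, Suc l)) ` below3 a b e (n - e)"
    (is "_ = ?A \<union> ?B")
  proof (intro equalityI subsetI)
    fix x assume x: "x \<in> below3 a b e n"
    obtain i j l where ijl: "x = (i, j, l)" by (cases x)
    show "x \<in> ?A \<union> ?B"
    proof (cases l)
      case 0
      then show ?thesis using x by (auto simp: ijl below3_def below2_def)
    next
      case (Suc l')
      then have "(i, j, l') \<in> below3 a b e (n - e)"
        using x by (auto simp: ijl below3_def less_diff_conv algebra_simps)
      then show ?thesis using Suc ijl by force
    qed
  qed (auto simp: below3_def below2_def less_diff_conv algebra_simps)
  have "card (below3 a b e n) = card ?A + card ?B"
    unfolding eq by (rule card_Un_disjoint) (use eq finite_below3[OF pos, of n] in \<open>auto intro: finite_subset\<close>)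
  also have "card ?A = card (below2 a b n)" by (rule card_image) (auto simp: inj_on_def)
  also have "card ?B = card (below3 a b e (n - e))" by (rule card_image) (auto simp: inj_on_def)
  finally show ?thesis .
qed

text \<open>The products \<open>h\<^sup>\<alpha> g\<^sup>\<beta> v\<^sub>i\<close> of bounded weight and the multiples of \<open>F\<close> span modulo
  high weights. Comparing their number with the number of monomials bounds the number of the
  \<open>v\<^sub>i\<close> below, as in Bezout's theorem for weighted multiplicities.\<close>

lemma colength_ge:
  fixes F h g :: "'k::field fps fps fps" and v :: "nat \<Rightarrow> 'k fps fps fps"
  assumes pos: "0 < a" "0 < b" "0 < e" "0 < q"
    and F: "F \<in> fil3 a b e e" and h: "h \<in> fil3 a b e (a * b)" and g: "g \<in> fil3 a b e q"
    and span: "\<And>w. \<exists>c u1 u2 u3. w - ((\<Sum>i<n. kscale (c i) (v i)) + u1 * F + u2 * h + u3 * g)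
      \<in> fil3 a b e (a * b * q * (a * b + 2 * q))"
  shows "q \<le> n"
proof -
  interpret filtered "fil3 a b e :: nat \<Rightarrow> 'k fps fps fps set" by (rule filtered_fil3)
  define p where "p = a * b"
  have p: "0 < p" using pos by (simp add: p_def)
  \<comment> \<open>With this choice the linear error \<open>p + 2 * q\<close> in the count of
    exponent pairs equals \<open>K\<close>, and the final inequality becomes
    \<open>p * q * q \<le> n * (p * q + 1)\<close>, which no integer \<open>n < q\<close>
    satisfies.\<close>
  define K where "K = p + 2 * q"
  define N where "N = p * q * K"
  note pos3 = pos(1-3)
  define J where "J = {..<n} \<times> below2 p q N"
  have finJ: "finite J"
  proof -
    have "below2 p q N = Sigma {..<N} (\<lambda>i. {j. q * j < N - p * i})"
      using p by (intro below2_Sigma) simp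
    then show ?thesis by (simp add: J_def multiples_below[OF pos(4)])
  qed
  define B where "B = (\<lambda>(i, \<alpha>, \<beta>). h ^ \<alpha> * g ^ \<beta> * v i)"
  define S where "S = {w. \<exists>c u. w - ((\<Sum>x\<in>J. kscale (c x) (B x)) + u * F) \<in> fil3 a b e N}"
  have S_add: "w + w' \<in> S" if ww: "w \<in> S" "w' \<in> S" for w w'
  proof -
    obtain c u c' u' where "w - ((\<Sum>x\<in>J. kscale (c x) (B x)) + u * F) \<in> fil3 a b e N"
      "w' - ((\<Sum>x\<in>J. kscale (c' x) (B x)) + u' * F) \<in> fil3 a b e N"
      using ww unfolding S_def by blast
    from Fil_add[OF this]
    have "(w + w') - ((\<Sum>x\<in>J. kscale (c x + c' x) (B x)) + (u + u') * F) \<in> fil3 a b e N"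
      by (simp add: kvs.scale_left_distrib sum.distrib algebra_simps)
    then show ?thesis
      unfolding S_def by (intro CollectI exI[of _ "\<lambda>x. c x + c' x"] exI[of _ "u + u'"])
  qed
  have S_fil: "w \<in> S" if "w \<in> fil3 a b e N" for w
    using that unfolding S_def by (intro CollectI exI[of _ "\<lambda>_. 0"] exI[of _ 0]) simp
  have S_F: "u * F \<in> S" for u
    unfolding S_def by (intro CollectI exI[of _ "\<lambda>_. 0"] exI[of _ u]) simp
  have S_B: "kscale c (B x) \<in> S" if "x \<in> J" for c x
    unfolding S_def by (intro CollectI exI[of _ "\<lambda>y. if y = x then c else 0"] exI[of _ 0])
      (use that finJ in \<open>simp add: if_distrib[of "\<lambda>t. kscale t _"] cong: if_cong\<close>)
  have S_sum: "sum s I \<in> S" if "\<And>i. i \<in> I \<Longrightarrow> s i \<in> S" for s and I :: "nat set"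
    using that by (induction I rule: infinite_finite_induct) (auto intro: S_add S_fil)
  \<comment> \<open>Rewriting \<open>w\<close> by the spanning hypothesis leads to the
    \<open>v i\<close>, to multiples of \<open>F\<close>, or to one more factor \<open>h\<close> or
    \<open>g\<close>. The induction ends once the weight of
    \<open>h ^ \<alpha> * g ^ \<beta>\<close> reaches \<open>N\<close>.\<close>
  have key: "h ^ \<alpha> * g ^ \<beta> * w \<in> S" for \<alpha> \<beta> w
  proof (induction "N - (p * \<alpha> + q * \<beta>)" arbitrary: \<alpha> \<beta> w rule: less_induct)
    case less
    have hg: "h ^ \<alpha> * g ^ \<beta> \<in> fil3 a b e (\<alpha> * p + \<beta> * q)"
      using h g by (intro Fil_mult Fil_power) (simp_all add: p_def)
    show ?case
    proof (cases "p * \<alpha> + q * \<beta> < N")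
      case False
      then show ?thesis
        by (intro S_fil Fil_mult2 Fil_mono[OF hg]) (simp add: mult.commute)
    next
      case True
      obtain c u1 u2 u3 where z: "w - ((\<Sum>i<n. kscale (c i) (v i)) + u1 * F + u2 * h + u3 * g) \<in> fil3 a b e N"
        using span[of w] by (auto simp: N_def K_def p_def)
      define z where "z = w - ((\<Sum>i<n. kscale (c i) (v i)) + u1 * F + u2 * h + u3 * g)"
      have "h ^ \<alpha> * g ^ \<beta> * w = (\<Sum>i<n. kscale (c i) (h ^ \<alpha> * g ^ \<beta> * v i)) + (h ^ \<alpha> * g ^ \<beta> * u1) * F
          + h ^ Suc \<alpha> * g ^ \<beta> * u2 + h ^ \<alpha> * g ^ Suc \<beta> * u3 + h ^ \<alpha> * g ^ \<beta> * z"
      proof -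
        have "w = (\<Sum>i<n. kscale (c i) (v i)) + u1 * F + u2 * h + u3 * g + z" by (simp add: z_def)
        then have "h ^ \<alpha> * g ^ \<beta> * w
            = h ^ \<alpha> * g ^ \<beta> * ((\<Sum>i<n. kscale (c i) (v i)) + u1 * F + u2 * h + u3 * g + z)"
          by (rule arg_cong)
        also have "\<dots> = h ^ \<alpha> * g ^ \<beta> * (\<Sum>i<n. kscale (c i) (v i)) + (h ^ \<alpha> * g ^ \<beta> * u1) * F
          + h ^ Suc \<alpha> * g ^ \<beta> * u2 + h ^ \<alpha> * g ^ Suc \<beta> * u3 + h ^ \<alpha> * g ^ \<beta> * z"
          by (simp add: algebra_simps)
        also have "h ^ \<alpha> * g ^ \<beta> * (\<Sum>i<n. kscale (c i) (v i)) = (\<Sum>i<n. kscale (c i) (h ^ \<alpha> * g ^ \<beta> * v i))"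
          by (simp add: sum_distrib_left kscale_mult)
        finally show ?thesis .
      qed
      moreover have "kscale (c i) (h ^ \<alpha> * g ^ \<beta> * v i) \<in> S" if "i < n" for i
        using S_B[of "(i, \<alpha>, \<beta>)"] that True by (simp add: J_def B_def below2_def)
      moreover have "h ^ Suc \<alpha> * g ^ \<beta> * u2 \<in> S" "h ^ \<alpha> * g ^ Suc \<beta> * u3 \<in> S"
        by (rule less; use True p pos in \<open>simp add: algebra_simps\<close>)+
      moreover have "h ^ \<alpha> * g ^ \<beta> * z \<in> S" using z by (intro S_fil Fil_mult1) (simp add: z_def)
      ultimately show ?thesis by (simp only:) (intro S_add S_sum S_F; simp)
    qed
  qed
  \<comment> \<open>Modulo weight \<open>N\<close>, the multiples of \<open>F\<close> are spanned by
    \<open>F\<close> times monomials of weight below \<open>N - e\<close>.\<close>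
  define J' where "J' = J <+> below3 a b e (N - e)"
  define B' where "B' = case_sum B (\<lambda>m. mono3 m * F)"
  have "card (below3 a b e N) \<le> card J'"
  proof (rule card_below3_le[OF pos3, of J' B'])
    show "finite J'" using finJ finite_below3[OF pos3] by (simp add: J'_def)
    fix w
    have "w \<in> S" using key[of 0 0 w] by simp
    then obtain c u where w: "w - ((\<Sum>x\<in>J. kscale (c x) (B x)) + u * F) \<in> fil3 a b e N"
      unfolding S_def by blast
    have "(u - (\<Sum>m\<in>below3 a b e (N - e). kscale (co3 u m) (mono3 m))) * F \<in> fil3 a b e N"
      by (rule Fil_multI[OF fil3_truncate[OF pos3] F]) simp
    from Fil_add[OF w this]
    have "w - (\<Sum>x\<in>J'. kscale (case_sum c (co3 u) x) (B' x)) \<in> fil3 a b e N"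
      using finJ finite_below3[OF pos3, of "N - e"] unfolding J'_def B'_def
      by (simp add: sum.Plus algebra_simps sum_distrib_left kscale_mult)
    then show "\<exists>c. w - (\<Sum>x\<in>J'. kscale (c x) (B' x)) \<in> fil3 a b e N" by blast
  qed
  also have "card J' = n * card (below2 p q N) + card (below3 a b e (N - e))"
    using finJ finite_below3[OF pos3] by (simp add: J'_def card_Plus) (simp add: J_def card_cartesian_product)
  finally have N1: "card (below2 a b N) \<le> n * card (below2 p q N)"
    using card_below3[OF pos3, of N] by simp
  have "p * (q * K)\<^sup>2 \<le> 2 * card (below2 a b N)"
    using card_below2(1)[OF pos(1,2), of "q * K"] by (simp add: N_def p_def mult.assoc)
  also have "\<dots> \<le> n * (2 * card (below2 p q N))"
    using mult_le_mono2[OF N1, of 2] by (simp add: mult.left_commute)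
  also have "\<dots> \<le> n * (K * (p * q * K + p + 2 * q))"
    using card_below2(2)[OF p pos(4), of K] by (intro mult_le_mono2) (simp add: N_def)
  finally have "p * (q * K)\<^sup>2 \<le> n * (K * (p * q * K + p + 2 * q))" .
  then have *: "K * (p * q * q * K) \<le> K * (n * (p * q * K + K))"
    by (simp add: power2_eq_square K_def algebra_simps)
  have "0 < K" using p by (simp add: K_def)
  moreover have "(K * K) * (p * q * q) \<le> (K * K) * (n * (p * q + 1))"
    using * by (simp add: algebra_simps)
  ultimately have "p * q * q \<le> n * (p * q + 1)" unfolding mult_le_cancel1 by simp
  show "q \<le> n"
  proof (rule ccontr)
    assume "\<not> q \<le> n"
    then have "n * (p * q + 1) \<le> (q - 1) * (p * q + 1)" by (intro mult_right_mono) simp_all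
    with \<open>p * q * q \<le> n * (p * q + 1)\<close> have "p * q * q \<le> (q - 1) * (p * q + 1)" by linarith
    also have "\<dots> + 1 + p * q = q * (p * q) + q" using pos(4) by (cases q) (simp_all add: algebra_simps)
    finally have "p * q + 1 \<le> q" by (simp add: algebra_simps)
    moreover have "q \<le> p * q" using p by simp
    ultimately show False by linarith
  qed
qed


section \<open>Colength of determinantal ideals\<close>

lemma comm_ring_hom_poly: "comm_ring_hom (\<lambda>p. poly p (x :: 'a::comm_ring_1))"
  by unfold_locales auto

text \<open>The determinant is a polynomial in \<open>x\<close> with value 1 at 0.\<close>

lemma finite_singular_perturbations:
  fixes Y :: "nat \<Rightarrow> nat \<Rightarrow> 'k::field"
  shows "finite {x. det (mat D D (\<lambda>(i, j). (if i = j then 1 else 0) + x * Y i j)) = 0}"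
proof -
  define A where "A = mat D D (\<lambda>(i, j). [:if i = j then 1 else 0, Y i j:])"
  have A: "det (mat D D (\<lambda>(i, j). (if i = j then 1 else 0) + x * Y i j)) = poly (det A) x" for x
  proof -
    interpret comm_ring_hom "\<lambda>p. poly p x" by (rule comm_ring_hom_poly)
    have "map_mat (\<lambda>p. poly p x) A = mat D D (\<lambda>(i, j). (if i = j then 1 else 0) + x * Y i j)"
      by (rule eq_matI) (auto simp: A_def)
    then show ?thesis using hom_det[of A] by simp
  qed
  have "mat D D (\<lambda>(i, j). (if i = j then 1 else 0) + 0 * Y i j) = 1\<^sub>m D"
    by (rule eq_matI) auto
  then have "poly (det A) 0 = 1" using A[of 0] by simp
  then have "det A \<noteq> 0" by auto
  then show ?thesis unfolding A by (rule poly_roots_finite)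
qed

text \<open>Generation of a finite-dimensional quotient is an open condition: it persists under
  all but finitely many multiples of a given perturbation.\<close>

lemma perturbed_span:
  fixes E :: "'k::field_char_0 \<Rightarrow> 'k fps fps fps set"
  assumes pos: "0 < a" "0 < b" "0 < e" and Z: "finite Z"
    and sub: "\<And>x. kvs.subspace (E x)" and fil: "\<And>x. fil3 a b e n \<subseteq> E x"
    and pert: "\<And>w. \<exists>y. \<forall>x. w + kscale x y \<in> E x"
  shows "\<exists>x. x \<notin> Z \<and> E x = UNIV"
proof -
  define M where "M = below3 a b e n"
  have "finite M" unfolding M_def using finite_below3[OF pos] .
  then obtain f where f: "bij_betw f {..<card M} M"
    using ex_bij_betw_nat_finite[of M] by (auto simp: atLeast0LessThan)
  define D where "D = card M"
  have "\<forall>i. \<exists>y. \<forall>x. mono3 (f i) + kscale x y \<in> E x" using pert by blast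
  from choice[OF this] obtain y where y: "\<And>i x. mono3 (f i) + kscale x (y i) \<in> E x" by blast
  define Y where "Y i j = co3 (y i) (f j)" for i j
  have expand: "w - (\<Sum>j<D. kscale (co3 w (f j)) (mono3 (f j))) \<in> fil3 a b e n" for w :: "'k fps fps fps"
  proof -
    have "(\<Sum>j<D. kscale (co3 w (f j)) (mono3 (f j))) = (\<Sum>m\<in>M. kscale (co3 w m) (mono3 m))"
      unfolding D_def by (rule sum.reindex_bij_betw[OF f])
    then show ?thesis unfolding M_def using fil3_truncate[OF pos] by simp
  qed
  have "finite (Z \<union> {x. det (mat D D (\<lambda>(i, j). (if i = j then 1 else 0) + x * Y i j)) = 0})"
    using Z finite_singular_perturbations by blast
  then obtain x where xZ: "x \<notin> Z" and x: "det (mat D D (\<lambda>(i, j). (if i = j then 1 else 0) + x * Y i j)) \<noteq> 0"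
    using ex_new_if_finite[OF infinite_UNIV_char_0] by blast
  \<comment> \<open>Row \<open>i\<close> expresses \<open>mono3 (f i) + kscale x (y i)\<close> in
    the monomials below weight \<open>n\<close>; where this matrix is invertible, all these
    monomials lie in \<open>E x\<close>.\<close>
  define A where "A = mat D D (\<lambda>(i, j). (if i = j then 1 else 0) + x * Y i j)"
  have A: "A \<in> carrier_mat D D" by (simp add: A_def)
  have row: "(\<Sum>j<D. kscale (A $$ (i, j)) (mono3 (f j))) \<in> E x" if i: "i < D" for i
  proof -
    have "(\<Sum>j<D. kscale (A $$ (i, j)) (mono3 (f j)))
        = (\<Sum>j<D. kscale (if i = j then 1 else 0) (mono3 (f j)) + kscale x (kscale (Y i j) (mono3 (f j))))"
      by (rule sum.cong) (use i in \<open>auto simp: A_def kvs.scale_left_distrib\<close>)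
    also have "\<dots> = mono3 (f i) + kscale x (\<Sum>j<D. kscale (Y i j) (mono3 (f j)))"
      using i by (simp add: sum.distrib kvs.scale_sum_right if_distrib[of "\<lambda>t. kscale t _"] cong: if_cong)
    also have "\<dots> = (mono3 (f i) + kscale x (y i))
        - kscale x (y i - (\<Sum>j<D. kscale (Y i j) (mono3 (f j))))"
      by (simp add: kvs.scale_right_diff_distrib)
    also have "\<dots> \<in> E x"
    proof (rule kvs.subspace_diff[OF sub y kvs.subspace_scale[OF sub]])
      show "y i - (\<Sum>j<D. kscale (Y i j) (mono3 (f j))) \<in> E x"
        using expand[of "y i"] fil unfolding Y_def by blast
    qed
    finally show ?thesis .
  qed
  have mono: "mono3 (f k) \<in> E x" if k: "k < D" for k
  proof -
    define B where "B = adj_mat A"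
    have B: "B \<in> carrier_mat D D" "B * A = det A \<cdot>\<^sub>m 1\<^sub>m D" unfolding B_def using adj_mat[OF A] by auto
    have BA: "(\<Sum>i<D. B $$ (k, i) * A $$ (i, j)) = (if k = j then det A else 0)" if "j < D" for j
    proof -
      have s: "(B * A) $$ (k, j) = (\<Sum>i<D. B $$ (k, i) * A $$ (i, j))"
        using A B(1) k that by (simp add: scalar_prod_def atLeast0LessThan)
      have "(B * A) $$ (k, j) = (if k = j then det A else 0)" unfolding B(2) using k that by simp
      from trans[OF sym[OF s] this] show ?thesis .
    qed
    have "(\<Sum>i<D. kscale (B $$ (k, i)) (\<Sum>j<D. kscale (A $$ (i, j)) (mono3 (f j)))) \<in> E x"
      by (rule kvs.subspace_sum[OF sub kvs.subspace_scale[OF sub row]]) simp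
    also have "(\<Sum>i<D. kscale (B $$ (k, i)) (\<Sum>j<D. kscale (A $$ (i, j)) (mono3 (f j))))
        = (\<Sum>j<D. kscale (\<Sum>i<D. B $$ (k, i) * A $$ (i, j)) (mono3 (f j)))"
      by (simp add: kvs.scale_sum_right kvs.scale_sum_left) (rule sum.swap)
    also have "\<dots> = kscale (det A) (mono3 (f k))"
      using k by (simp add: BA if_distrib[of "\<lambda>t. kscale t _"] cong: if_cong)
    finally have "kscale (inverse (det A)) (kscale (det A) (mono3 (f k))) \<in> E x"
      by (rule kvs.subspace_scale[OF sub])
    then show ?thesis using x by (simp add: A_def)
  qed
  have "w \<in> E x" for w
  proof -
    have "(\<Sum>j<D. kscale (co3 w (f j)) (mono3 (f j))) \<in> E x" 
      by (rule kvs.subspace_sum[OF sub kvs.subspace_scale[OF sub mono]]) simp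
    moreover have "w - (\<Sum>j<D. kscale (co3 w (f j)) (mono3 (f j))) \<in> E x" using expand fil by blast
    ultimately have "(w - (\<Sum>j<D. kscale (co3 w (f j)) (mono3 (f j)))) + (\<Sum>j<D. kscale (co3 w (f j)) (mono3 (f j))) \<in> E x"
      by (intro kvs.subspace_add[OF sub])
    then show ?thesis by simp
  qed
  with xZ show ?thesis by blast
qed

lemma is_unit_fps3_iff:
  fixes u :: "'k::field fps fps fps"
  shows "u dvd 1 \<longleftrightarrow> fps_nth (fps_nth (fps_nth u 0) 0) 0 \<noteq> 0"
  by (simp add: is_unit_fps_iff dvd_field_iff)

text \<open>If \<alpha>1 were a unit, the last minor would be redundant and
  \<open>colength_ge\<close> would apply to the other two. In general a scalar is added to
  \<alpha>1: a family that spans the original quotient also spans the perturbed one, modulo high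
  weights, for almost all scalars, so its size obeys the bound for the perturbed ideal.\<close>

theorem determinantal_colength:
  fixes F :: "'k::field_char_0 fps fps fps"
  assumes pos: "0 < a" "0 < b" "0 < e" "0 < q"
    and F: "F \<in> fil3 a b e e"
    and b1: "\<beta>1 \<in> fil3 a b e (a * b)" and b2: "\<beta>2 \<in> fil3 a b e (a * b)"
    and c1: "\<gamma>1 \<in> fil3 a b e q" and c2: "\<gamma>2 \<in> fil3 a b e q"
  shows "enat q \<le> quotient_dim kscale
    (ideal_gen {F, \<alpha>1 * \<beta>2 - \<alpha>2 * \<beta>1, \<alpha>1 * \<gamma>2 - \<alpha>2 * \<gamma>1, \<beta>1 * \<gamma>2 - \<beta>2 * \<gamma>1})"
proof (rule ccontr)
  interpret filtered "fil3 a b e :: nat \<Rightarrow> 'k fps fps fps set" by (rule filtered_fil3)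
  define h where "h = \<alpha>1 * \<beta>2 - \<alpha>2 * \<beta>1"
  define g where "g = \<alpha>1 * \<gamma>2 - \<alpha>2 * \<gamma>1"
  define l where "l = \<beta>1 * \<gamma>2 - \<beta>2 * \<gamma>1"
  assume "\<not> enat q \<le> quotient_dim kscale
    (ideal_gen {F, \<alpha>1 * \<beta>2 - \<alpha>2 * \<beta>1, \<alpha>1 * \<gamma>2 - \<alpha>2 * \<gamma>1, \<beta>1 * \<gamma>2 - \<beta>2 * \<gamma>1})"
  then have less: "quotient_dim kscale (ideal_gen {F, h, g, l}) < enat q"
    by (simp add: h_def g_def l_def)
  obtain n v where n: "n < q" and v: "\<And>w. \<exists>c. w - (\<Sum>i<n. kscale (c i) (v i)) \<in> ideal_gen {F, h, g, l}"
    using quotient_dim_less_span[OF vector_space_kscale subspace_ideal_gen less] by metis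
  define N where "N = a * b * q * (a * b + 2 * q)"
  \<comment> \<open>Adding \<open>x\<close> to \<alpha>1 changes \<open>h\<close> and
    \<open>g\<close> by multiples of \<beta>2 and \<gamma>2; \<open>l\<close> does not involve
    \<alpha>1.\<close>
  define E where "E x = {w. \<exists>c u1 u2 u3 u4. w - ((\<Sum>i<n. kscale (c i) (v i)) + u1 * F
    + u2 * (h + kscale x \<beta>2) + u3 * (g + kscale x \<gamma>2) + u4 * l) \<in> fil3 a b e N}" for x
  have sub: "kvs.subspace (E x)" for x
  proof (rule kvs.subspaceI)
    show "0 \<in> E x"
      unfolding E_def by (intro CollectI exI[of _ "\<lambda>_. 0"] exI[of _ 0]) simp
  next
    fix w w' assume "w \<in> E x" "w' \<in> E x"
    then obtain c u1 u2 u3 u4 c' u1' u2' u3' u4' where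
      "w - ((\<Sum>i<n. kscale (c i) (v i)) + u1 * F + u2 * (h + kscale x \<beta>2) + u3 * (g + kscale x \<gamma>2) + u4 * l) \<in> fil3 a b e N"
      "w' - ((\<Sum>i<n. kscale (c' i) (v i)) + u1' * F + u2' * (h + kscale x \<beta>2) + u3' * (g + kscale x \<gamma>2) + u4' * l) \<in> fil3 a b e N"
      unfolding E_def by blast
    from Fil_add[OF this]
    have "(w + w') - ((\<Sum>i<n. kscale (c i + c' i) (v i)) + (u1 + u1') * F + (u2 + u2') * (h + kscale x \<beta>2)
        + (u3 + u3') * (g + kscale x \<gamma>2) + (u4 + u4') * l) \<in> fil3 a b e N"
      by (simp add: kvs.scale_left_distrib sum.distrib algebra_simps)
    then show "w + w' \<in> E x"
      unfolding E_def
      by (intro CollectI exI[of _ "\<lambda>i. c i + c' i"] exI[of _ "u1 + u1'"] exI[of _ "u2 + u2'"]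
          exI[of _ "u3 + u3'"] exI[of _ "u4 + u4'"])
  next
    fix r w assume "w \<in> E x"
    then obtain c u1 u2 u3 u4 where
      "w - ((\<Sum>i<n. kscale (c i) (v i)) + u1 * F + u2 * (h + kscale x \<beta>2) + u3 * (g + kscale x \<gamma>2) + u4 * l) \<in> fil3 a b e N"
      unfolding E_def by blast
    from Fil_mult1[OF this, of "const2 (fps_const r)", folded kscale_def]
    have "kscale r w - ((\<Sum>i<n. kscale (r * c i) (v i)) + kscale r u1 * F + kscale r u2 * (h + kscale x \<beta>2)
        + kscale r u3 * (g + kscale x \<gamma>2) + kscale r u4 * l) \<in> fil3 a b e N"
      by (simp only: kvs.scale_right_diff_distrib kvs.scale_right_distrib kvs.scale_sum_right
          kvs.scale_scale kscale_mult)
    then show "kscale r w \<in> E x"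
      unfolding E_def
      by (intro CollectI exI[of _ "\<lambda>i. r * c i"] exI[of _ "kscale r u1"] exI[of _ "kscale r u2"]
          exI[of _ "kscale r u3"] exI[of _ "kscale r u4"])
  qed
  have fil: "fil3 a b e N \<subseteq> E x" for x
    unfolding E_def by (intro subsetI CollectI exI[of _ "\<lambda>_. 0"] exI[of _ 0]) simp
  have pert: "\<exists>y. \<forall>x. w + kscale x y \<in> E x" for w
  proof -
    obtain c where "w - (\<Sum>i<n. kscale (c i) (v i)) \<in> ideal_gen {F, h, g, l}" using v by blast
    then obtain u1 u2 u3 u4 where u: "w - (\<Sum>i<n. kscale (c i) (v i)) = u1 * F + u2 * h + u3 * g + u4 * l"
      unfolding ideal_gen_4 by blast
    have eq: "w + kscale x (u2 * \<beta>2 + u3 * \<gamma>2) = (\<Sum>i<n. kscale (c i) (v i)) + u1 * F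
      + u2 * (h + kscale x \<beta>2) + u3 * (g + kscale x \<gamma>2) + u4 * l" for x
    proof -
      have "w = (\<Sum>i<n. kscale (c i) (v i)) + (u1 * F + u2 * h + u3 * g + u4 * l)" using u by (simp add: diff_eq_eq add.commute)
      then show ?thesis by (simp add: distrib_left kvs.scale_right_distrib kscale_mult)
    qed
    have "w + kscale x (u2 * \<beta>2 + u3 * \<gamma>2) \<in> E x" for x
      unfolding E_def eq
      by (intro CollectI exI[of _ c] exI[of _ u1] exI[of _ u2] exI[of _ u3] exI[of _ u4]) simp
    then show ?thesis by blast
  qed
  \<comment> \<open>The excluded scalar is the one for which the perturbed entry would fail to be a
    unit.\<close>
  obtain x where x0: "x \<notin> {- co3 \<alpha>1 (0, 0, 0)}" and Ex: "E x = UNIV"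
    using perturbed_span[OF pos(1-3) finite.insertI[OF finite.emptyI] sub fil pert] by blast
  define \<alpha> where "\<alpha> = \<alpha>1 + kscale x 1"
  have \<alpha>0: "co3 \<alpha> (0, 0, 0) = co3 \<alpha>1 (0, 0, 0) + x"
    by (simp add: \<alpha>_def co3_add co3_scale) (simp add: co3_def)
  have "co3 \<alpha> (0, 0, 0) \<noteq> 0"
  proof
    assume "co3 \<alpha> (0, 0, 0) = 0"
    then have "x = - co3 \<alpha>1 (0, 0, 0)" unfolding \<alpha>0 by (simp add: eq_neg_iff_add_eq_0 add.commute)
    with x0 show False by simp
  qed
  then have "\<alpha> dvd 1" unfolding is_unit_fps3_iff by (simp add: co3_def)
  then obtain i where i: "1 = \<alpha> * i" by (rule dvdE)
  define h' where "h' = h + kscale x \<beta>2"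
  define g' where "g' = g + kscale x \<gamma>2"
  have h': "h' = \<alpha> * \<beta>2 - \<alpha>2 * \<beta>1" and g': "g' = \<alpha> * \<gamma>2 - \<alpha>2 * \<gamma>1"
    by (simp_all add: h'_def g'_def h_def g_def \<alpha>_def distrib_right kscale_mult)
  have "\<alpha> * l = \<beta>1 * g' - \<gamma>1 * h'" by (simp add: l_def h' g' algebra_simps)
  then have "(\<alpha> * i) * l = i * (\<beta>1 * g' - \<gamma>1 * h')" by (metis mult.assoc mult.commute)
  then have l: "l = i * (\<beta>1 * g' - \<gamma>1 * h')" using i by simp
  have "q \<le> n"
  proof (rule colength_ge[OF pos F])
    show "h' \<in> fil3 a b e (a * b)" unfolding h' using b1 b2 by (intro Fil_diff Fil_mult1)
    show "g' \<in> fil3 a b e q" unfolding g' using c1 c2 by (intro Fil_diff Fil_mult1)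
    fix w
    have "w \<in> E x" using Ex by blast
    then obtain c u1 u2 u3 u4 where
      w: "w - ((\<Sum>i<n. kscale (c i) (v i)) + u1 * F + u2 * h' + u3 * g' + u4 * l) \<in> fil3 a b e N"
      unfolding E_def h'_def g'_def by blast
    have "(\<Sum>i<n. kscale (c i) (v i)) + u1 * F + u2 * h' + u3 * g' + u4 * l
        = (\<Sum>i<n. kscale (c i) (v i)) + u1 * F + (u2 - u4 * i * \<gamma>1) * h' + (u3 + u4 * i * \<beta>1) * g'"
      unfolding l by (simp add: algebra_simps)
    with w have "w - ((\<Sum>i<n. kscale (c i) (v i)) + u1 * F + (u2 - u4 * i * \<gamma>1) * h' + (u3 + u4 * i * \<beta>1) * g')
        \<in> fil3 a b e N" by simp
    then show "\<exists>c u1 u2 u3. w - ((\<Sum>i<n. kscale (c i) (v i)) + u1 * F + u2 * h' + u3 * g')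
        \<in> fil3 a b e (a * b * q * (a * b + 2 * q))"
      unfolding N_def by blast
  qed
  with n show False by simp
qed


section \<open>A free dual excludes a singular generic fibre\<close>

section \<open>A free dual forces the deformation to be a smoothing\<close>

lemma pp_dual_lin_add:
  assumes "pp_dual F m \<phi>" "pp_dual F m \<psi>"
  shows "pp_dual F m (\<lambda>w. \<phi> w + \<psi> w)"
  unfolding pp_dual_def ideal_gen_dvd
proof (intro conjI allI ballI)
  fix u v r
  show "F dvd \<phi> (u + v) + \<psi> (u + v) - (\<phi> u + \<psi> u) - (\<phi> v + \<psi> v)"
    using dvd_add[OF pp_dual_add[OF assms(1), of u v] pp_dual_add[OF assms(2), of u v]]
    by (simp add: algebra_simps)
  show "F dvd \<phi> (inleft r * u) + \<psi> (inleft r * u) - r * (\<phi> u + \<psi> u)"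
    using dvd_add[OF pp_dual_scale[OF assms(1), of r u] pp_dual_scale[OF assms(2), of r u]]
    by (simp add: algebra_simps)
next
  fix u assume "u \<in> pp_ideal F m"
  then show "F dvd \<phi> u + \<psi> u" using assms by (intro dvd_add) (auto intro: pp_dual_ideal)
qed

lemma pp_dual_lin_scale:
  assumes "pp_dual F m \<phi>"
  shows "pp_dual F m (\<lambda>w. c * \<phi> w)"
  unfolding pp_dual_def ideal_gen_dvd
proof (intro conjI allI ballI)
  fix u v r
  show "F dvd c * \<phi> (u + v) - c * \<phi> u - c * \<phi> v"
    using dvd_mult[OF pp_dual_add[OF assms(1), of u v], of c] by (simp add: algebra_simps)
  show "F dvd c * \<phi> (inleft r * u) - r * (c * \<phi> u)"
    using dvd_mult[OF pp_dual_scale[OF assms(1), of r u], of c] by (simp add: algebra_simps)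
next
  fix u assume "u \<in> pp_ideal F m"
  then show "F dvd c * \<phi> u" using assms by (intro dvd_mult) (auto intro: pp_dual_ideal)
qed

definition cscale :: "'c::comm_ring_1 \<Rightarrow> 'c fps fps \<Rightarrow> 'c fps fps" where
  "cscale c g = const2 c * g"

lemma cscale_simps:
  "cscale (a + b) g = cscale a g + cscale b g" "cscale c (g + h) = cscale c g + cscale c h"
  "cscale c (g - h) = cscale c g - cscale c h"
  "cscale a (cscale b g) = cscale (a * b) g" "cscale 1 g = g" "cscale 0 g = 0" "cscale c 0 = 0"
  by (simp_all add: cscale_def const2_add const2_mult const2_1 const2_0 algebra_simps)

lemma cscale_sum: "cscale c (sum s I) = (\<Sum>i\<in>I. cscale c (s i))"
  and cscale_sum_left: "cscale (sum t I) g = (\<Sum>i\<in>I. cscale (t i) g)"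
  by (rule hom_sum; simp add: cscale_simps)+

lemma cscale_mult: "cscale c g * h = cscale c (g * h)" "h * cscale c g = cscale c (h * g)"
  by (simp_all add: cscale_def mult_ac)

text \<open>A rank argument over the fraction field of the base: the vectors need to be combinations
  of the \<open>b j\<close> only after scaling by a nonzero constant.\<close>

lemma cscale_relation:
  fixes v :: "'i \<Rightarrow> 'c::idom fps fps" and b :: "'j \<Rightarrow> 'c fps fps"
  assumes fin: "finite J" "finite I" and card: "card J < card I" and N: "ideal.subspace N"
    and span: "\<And>i. i \<in> I \<Longrightarrow> \<exists>d c. d \<noteq> 0 \<and> cscale d (v i) - (\<Sum>j\<in>J. cscale (c j) (b j)) \<in> N"
  shows "\<exists>r. (\<exists>i\<in>I. r i \<noteq> 0) \<and> (\<Sum>i\<in>I. cscale (r i) (v i)) \<in> N"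
proof -
  have "\<forall>i\<in>I. \<exists>d. \<exists>c. d \<noteq> 0 \<and> cscale d (v i) - (\<Sum>j\<in>J. cscale (c j) (b j)) \<in> N" using span by blast
  from bchoice[OF this] obtain d where
    "\<forall>i\<in>I. \<exists>c. d i \<noteq> 0 \<and> cscale (d i) (v i) - (\<Sum>j\<in>J. cscale (c j) (b j)) \<in> N" by blast
  from bchoice[OF this] obtain c where
    dc: "\<And>i. i \<in> I \<Longrightarrow> d i \<noteq> 0 \<and> cscale (d i) (v i) - (\<Sum>j\<in>J. cscale (c i j) (b j)) \<in> N" by blast
  obtain r where r: "\<exists>i\<in>I. r i \<noteq> 0" "\<forall>j\<in>J. (\<Sum>i\<in>I. r i * c i j) = 0"
    using more_vectors_than_coordinates[OF fin card, of c] by blast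
  have "(\<Sum>i\<in>I. cscale (r i) (cscale (d i) (v i) - (\<Sum>j\<in>J. cscale (c i j) (b j)))) \<in> N"
    unfolding cscale_def[of "r _"] by (intro ideal.subspace_sum[OF N] ideal.subspace_scale[OF N]) (use dc in blast)
  also have "(\<Sum>i\<in>I. cscale (r i) (cscale (d i) (v i) - (\<Sum>j\<in>J. cscale (c i j) (b j))))
      = (\<Sum>i\<in>I. cscale (r i * d i) (v i)) - (\<Sum>j\<in>J. cscale (\<Sum>i\<in>I. r i * c i j) (b j))"
    by (simp add: cscale_simps sum_subtractf cscale_sum cscale_sum_left) (rule sum.swap)
  also have "\<dots> = (\<Sum>i\<in>I. cscale (r i * d i) (v i))" using r(2) by (simp add: cscale_simps)
  finally show ?thesis using r(1) dc by (intro exI[of _ "\<lambda>i. r i * d i"]) auto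
qed

text \<open>The quotient by (\<open>F\<close>, \<open>dy F\<close>) is a finitely generated,
  torsion-free module over the base, with generators \<open>B\<close>. The bound
  \<open>\<rho>\<close> for its rank reappears as the degree of the forms in
  \<open>dx F, dy F\<close>.\<close>

locale relative_curve =
  fixes F :: "'c::{idom,ring_char_0} fps fps" and \<rho> :: nat and B :: "nat \<Rightarrow> 'c fps fps"
  assumes two: "(2 :: 'c fps fps) dvd 1"
    and nzd_Y: "nzd {F} (dy F)"
    and fin_gen: "\<And>v. \<exists>c v0 v1. v = (\<Sum>j<\<rho>. cscale (c j) (B j)) + v0 * F + v1 * dy F"
    and torsion_free: "\<And>c r. c \<noteq> 0 \<Longrightarrow> cscale c r \<in> ideal_gen {F, dy F} \<Longrightarrow> r \<in> ideal_gen {F, dy F}"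
begin

abbreviation "\<aa> \<equiv> ideal_gen {F, dy F}"

lemma cancel_Y: "F dvd dy F * r \<Longrightarrow> F dvd r"
  using nzdD[OF nzd_Y, of r] by (simp add: ideal_gen_dvd)

lemma F_mem: "F dvd r \<Longrightarrow> r \<in> \<aa>" and Y_mem: "r * dy F \<in> \<aa>"
proof -
  show "r * dy F \<in> \<aa>" by (intro ideal_gen_mult ideal.span_base) simp
  assume "F dvd r"
  then obtain k where "r = F * k" by (rule dvdE)
  then show "r \<in> \<aa>" by (simp add: ideal_gen_mult2 ideal.span_base)
qed

lemma mod_a: "\<exists>c. v - (\<Sum>j<\<rho>. cscale (c j) (B j)) \<in> \<aa>"
proof -
  obtain c v0 v1 where "v = (\<Sum>j<\<rho>. cscale (c j) (B j)) + v0 * F + v1 * dy F" using fin_gen by blast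
  then have "v - (\<Sum>j<\<rho>. cscale (c j) (B j)) = v0 * F + v1 * dy F" by simp
  then show ?thesis unfolding ideal_gen_2 by blast
qed

definition indep :: "nat \<Rightarrow> 'c fps fps set \<Rightarrow> bool" where
  "indep n I \<longleftrightarrow> (\<exists>v. \<forall>c. (\<Sum>i<n. cscale (c i) (v i)) \<in> I \<longrightarrow> (\<forall>i<n. c i = 0))"

lemma indep_bounded:
  fixes b :: "'j \<Rightarrow> 'c fps fps"
  assumes I: "ideal.subspace I" and J: "finite J"
    and span: "\<And>v. \<exists>c. v - (\<Sum>j\<in>J. cscale (c j) (b j)) \<in> I" and n: "indep n I"
  shows "n \<le> card J"
proof (rule ccontr)
  assume "\<not> n \<le> card J"
  obtain v where v: "\<And>c. (\<Sum>i<n. cscale (c i) (v i)) \<in> I \<Longrightarrow> \<forall>i<n. c i = 0"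
    using n unfolding indep_def by blast
  have "\<exists>r. (\<exists>i\<in>{..<n}. r i \<noteq> 0) \<and> (\<Sum>i<n. cscale (r i) (v i)) \<in> I"
  proof (rule cscale_relation[OF J finite_lessThan _ I])
    show "card J < card {..<n}" using \<open>\<not> n \<le> card J\<close> by simp
    fix i
    obtain c where "v i - (\<Sum>j\<in>J. cscale (c j) (b j)) \<in> I" using span by blast
    then show "\<exists>d c. d \<noteq> 0 \<and> cscale d (v i) - (\<Sum>j\<in>J. cscale (c j) (b j)) \<in> I"
      by (intro exI[of _ 1] exI[of _ c]) (simp add: cscale_simps)
  qed
  then show False using v by auto
qed

lemma indep_maximal:
  fixes b :: "'j \<Rightarrow> 'c fps fps"
  assumes I: "ideal.subspace I" and J: "finite J"
    and span: "\<And>v. \<exists>c. v - (\<Sum>j\<in>J. cscale (c j) (b j)) \<in> I"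
  obtains n :: nat and u where "\<And>c. (\<Sum>i<n. cscale (c i) (u i)) \<in> I \<Longrightarrow> \<forall>i<n. c i = 0"
    "\<And>v. \<exists>d c. d \<noteq> 0 \<and> cscale d v - (\<Sum>i<n. cscale (c i) (u i)) \<in> I"
proof -
  have "indep 0 I" by (simp add: indep_def)
  then have "\<exists>n. indep n I \<and> (\<forall>m. indep m I \<longrightarrow> m \<le> n)"
    using indep_bounded[OF I J span] by (intro ex_has_greatest_nat[where b = "Suc (card J)"]) (auto simp: less_Suc_eq_le)
  then obtain n where n: "indep n I" "\<not> indep (Suc n) I" by fastforce
  from n(1) obtain u where u: "\<And>c. (\<Sum>i<n. cscale (c i) (u i)) \<in> I \<Longrightarrow> \<forall>i<n. c i = 0"
    unfolding indep_def by blast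
  have *: "\<exists>d c. d \<noteq> 0 \<and> cscale d v - (\<Sum>i<n. cscale (c i) (u i)) \<in> I" for v
  proof -
    define u' where "u' i = (if i < n then u i else v)" for i
    have eq: "(\<Sum>i<Suc n. cscale (c i) (u' i)) = (\<Sum>i<n. cscale (c i) (u i)) + cscale (c n) v" for c
      by (simp add: u'_def)
    obtain c where "(\<Sum>i<Suc n. cscale (c i) (u' i)) \<in> I" and c0: "\<not> (\<forall>i<Suc n. c i = 0)"
      using n(2) unfolding indep_def by blast
    then have c: "(\<Sum>i<n. cscale (c i) (u i)) + cscale (c n) v \<in> I" unfolding eq by simp
    have "c n \<noteq> 0"
    proof
      assume "c n = 0"
      then have "\<forall>i<n. c i = 0" using c u by (simp add: cscale_simps)
      with c0 \<open>c n = 0\<close> show False using less_Suc_eq by auto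
    qed
    moreover have "cscale (c n) v - (\<Sum>i<n. cscale (- c i) (u i)) \<in> I"
      using c by (simp add: cscale_def const2_minus sum_negf add.commute)
    ultimately show ?thesis by (intro exI[of _ "c n"] exI[of _ "\<lambda>i. - c i"]) simp
  qed
  show ?thesis by (rule that[where n = n and u = u]) (use u * in blast)+
qed

definition K :: "'c fps fps \<Rightarrow> 'c fps fps set" where
  "K d = {r. d * r \<in> \<aa>}"

lemma subspace_K: "ideal.subspace (K d)"
  by (rule ideal.subspaceI)
    (auto simp: K_def distrib_left mult.left_commute[of d] intro: ideal.span_zero ideal.span_add ideal_gen_mult)

text \<open>A zero divisor \<open>dx F\<close> modulo \<open>(F, dy F)\<close> yields an associated prime
  \<open>((F, dy F) : d)\<close> containing it, by minimizing the rank of the quotient.\<close>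

lemma associated_prime:
  assumes d0: "d0 \<notin> \<aa>" "dx F * d0 \<in> \<aa>"
  obtains d where "d \<notin> \<aa>" "dx F \<in> K d" "1 \<notin> K d"
    "\<And>r s. r * s \<in> K d \<Longrightarrow> r \<in> K d \<or> s \<in> K d" "\<And>c. c \<noteq> 0 \<Longrightarrow> const2 c \<notin> K d"
proof -
  define S where "S = {d. d \<notin> \<aa> \<and> dx F * d \<in> \<aa>}"
  have span: "\<exists>c. v - (\<Sum>j<\<rho>. cscale (c j) (B j)) \<in> K d" for d v
    using mod_a[of v] unfolding K_def by (auto intro: ideal_gen_mult)
  \<comment> \<open>The rank of the quotient by \<open>K d\<close>. If \<open>r * s\<close> lies in
    \<open>K d\<close> but neither factor does, then \<open>s\<close> extends any family that is
    independent modulo \<open>K (d * r)\<close>, so replacing \<open>d\<close> by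
    \<open>d * r\<close> lowers the rank. Hence minimal rank gives a prime.\<close>
  define \<mu> where "\<mu> d = (GREATEST n. indep n (K d))" for d
  have bound: "n \<le> \<rho>" if "indep n (K d)" for n d
    using indep_bounded[OF subspace_K finite_lessThan span that] by simp
  have \<mu>: "indep (\<mu> d) (K d)" for d
    unfolding \<mu>_def
    by (rule GreatestI_nat[where k = 0 and b = \<rho>]) (use bound in \<open>auto simp: indep_def\<close>)
  have \<mu>_ge: "n \<le> \<mu> d" if "indep n (K d)" for n d
    unfolding \<mu>_def by (rule Greatest_le_nat[where b = \<rho>]) (use bound that in auto)
  have "d0 \<in> S" using d0 by (simp add: S_def)
  from ex_has_least_nat[of "\<lambda>d. d \<in> S", OF this, of \<mu>]
  obtain d where d: "d \<in> S" and min: "\<And>d'. d' \<in> S \<Longrightarrow> \<mu> d \<le> \<mu> d'" by blast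
  have d': "d \<notin> \<aa>" "dx F * d \<in> \<aa>" using d by (auto simp: S_def)
  have prime: "r \<in> K d \<or> s \<in> K d" if rs: "r * s \<in> K d" for r s
  proof (rule ccontr)
    assume "\<not> (r \<in> K d \<or> s \<in> K d)"
    then have r: "d * r \<notin> \<aa>" and s: "d * s \<notin> \<aa>" by (auto simp: K_def)
    have "dx F * (d * r) \<in> \<aa>" using ideal_gen_mult2[OF d'(2), of r] by (simp add: mult.assoc)
    with r have "\<mu> d \<le> \<mu> (d * r)" by (intro min) (simp add: S_def)
    moreover have "indep (Suc (\<mu> (d * r))) (K d)"
    proof -
      obtain v where v: "\<And>c. (\<Sum>i<\<mu> (d * r). cscale (c i) (v i)) \<in> K (d * r) \<Longrightarrow> \<forall>i<\<mu> (d * r). c i = 0"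
        using \<mu>[of "d * r"] unfolding indep_def by blast
      define v' where "v' i = (if i < \<mu> (d * r) then v i else s)" for i
      have "\<forall>i<Suc (\<mu> (d * r)). c i = 0"
        if c: "(\<Sum>i<Suc (\<mu> (d * r)). cscale (c i) (v' i)) \<in> K d" for c
      proof -
        have eq: "(\<Sum>i<Suc (\<mu> (d * r)). cscale (c i) (v' i)) = (\<Sum>i<\<mu> (d * r). cscale (c i) (v i)) + cscale (c (\<mu> (d * r))) s"
          by (simp add: v'_def)
        have "r * (d * ((\<Sum>i<\<mu> (d * r). cscale (c i) (v i)) + cscale (c (\<mu> (d * r))) s)) \<in> \<aa>"
          using c unfolding eq K_def mem_Collect_eq by (rule ideal_gen_mult)
        moreover have "cscale (c (\<mu> (d * r))) (d * (r * s)) \<in> \<aa>"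
          using rs unfolding K_def cscale_def mem_Collect_eq by (rule ideal_gen_mult)
        ultimately have "r * (d * ((\<Sum>i<\<mu> (d * r). cscale (c i) (v i)) + cscale (c (\<mu> (d * r))) s))
            - cscale (c (\<mu> (d * r))) (d * (r * s)) \<in> \<aa>" by (rule ideal.span_diff)
        then have "(d * r) * (\<Sum>i<\<mu> (d * r). cscale (c i) (v i)) \<in> \<aa>"
          by (simp add: cscale_def algebra_simps)
        then have z: "\<forall>i<\<mu> (d * r). c i = 0" using v unfolding K_def by blast
        then have "cscale (c (\<mu> (d * r))) s \<in> K d" using c unfolding eq by (simp add: cscale_simps)
        then have "cscale (c (\<mu> (d * r))) (d * s) \<in> \<aa>" by (simp add: K_def cscale_mult)
        then have "c (\<mu> (d * r)) = 0" using torsion_free s by blast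
        with z show ?thesis by (simp add: less_Suc_eq)
      qed
      then show ?thesis unfolding indep_def by blast
    qed
    then have "Suc (\<mu> (d * r)) \<le> \<mu> d" by (rule \<mu>_ge)
    ultimately show False by simp
  qed
  show ?thesis
  proof (rule that[of d])
    show "1 \<notin> K d" using d' by (simp add: K_def)
    show "const2 c \<notin> K d" if "c \<noteq> 0" for c
      using torsion_free[OF that, of d] d' by (auto simp: K_def cscale_def mult.commute)
  qed (use d' prime in \<open>auto simp: K_def mult.commute\<close>)
qed

lemma two_cancel: "2 * r \<in> K d \<Longrightarrow> r \<in> K d"
proof -
  assume r: "2 * r \<in> K d"
  obtain h :: "'c fps fps" where "1 = 2 * h" using two by (rule dvdE)
  have "h * (2 * r) \<in> K d" by (rule ideal.subspace_scale[OF subspace_K r])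
  moreover have "h * (2 * r) = r" using \<open>1 = 2 * h\<close> by (metis mult.assoc mult.commute mult_1)
  ultimately show "r \<in> K d" by simp
qed

end

text \<open>The situation to be refuted: an associated prime of (\<open>F\<close>,
  \<open>dy F\<close>) that contains \<open>dx F\<close> and no nonzero constant of the base, that
  is, a singular point of the generic fibre.\<close>

locale curve_prime = relative_curve F \<rho> B
  for F :: "'c::{idom,ring_char_0} fps fps" and \<rho> B +
  fixes d
  assumes d: "d \<notin> \<aa>" and X_K: "dx F \<in> K d" and one_K: "1 \<notin> K d"
    and prime: "\<And>r s. r * s \<in> K d \<Longrightarrow> r \<in> K d \<or> s \<in> K d"
    and const_K: "\<And>c. c \<noteq> 0 \<Longrightarrow> const2 c \<notin> K d"
begin

lemmas K_add = ideal.subspace_add[OF subspace_K]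
lemmas K_diff = ideal.subspace_diff[OF subspace_K]
lemmas K_mult = ideal.subspace_scale[OF subspace_K]
lemmas K_sum = ideal.subspace_sum[OF subspace_K]
lemmas K_zero = ideal.subspace_0[OF subspace_K]

lemma K_mult2: "r \<in> K d \<Longrightarrow> r * s \<in> K d"
  using K_mult[of r d s] by (simp add: mult.commute)

lemma a_K: "r \<in> \<aa> \<Longrightarrow> r \<in> K d"
  by (simp add: K_def ideal_gen_mult)

lemma F_K: "F dvd r \<Longrightarrow> r \<in> K d" and Y_K: "dy F \<in> K d"
  using F_mem a_K Y_mem[of 1] by auto

lemma of_nat_K: "n \<noteq> 0 \<Longrightarrow> of_nat n \<notin> K d"
  using const_K[of "of_nat n"] const2_of_nat[of n "1 :: 'c"] by (simp add: const2_1)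

lemma K_mod: "F dvd r - s \<Longrightarrow> r \<in> K d \<longleftrightarrow> s \<in> K d"
  using K_add[OF F_K[of "r - s"], of s] K_diff[OF _ F_K[of "r - s"], of r] by auto

text \<open>The pair defines a derivation, linear over the base, that preserves (\<open>F\<close>,
  \<open>dx F\<close>, \<open>dy F\<close>). Modulo this ideal \<open>z\<close> is algebraic over
  the base. If the derivative of \<open>z\<close> were outside the prime, differentiating a relation
  of minimal degree would give a shorter nontrivial one, by characteristic 0. For \<open>z\<close> a
  coordinate this puts \<alpha> and \<beta> into the prime.\<close>

lemma symbol_mem_prime:
  assumes \<alpha>\<beta>: "F dvd dx F * \<alpha> + dy F * \<beta>"
  shows "\<alpha> * dx z + \<beta> * dy z \<in> K d"
proof (rule ccontr)
  define \<D> where "\<D> r = \<alpha> * dx r + \<beta> * dy r" for r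
  assume "\<alpha> * dx z + \<beta> * dy z \<notin> K d"
  then have \<D>z: "\<D> z \<notin> K d" by (simp add: \<D>_def)
  have \<D>_add: "\<D> (r + s) = \<D> r + \<D> s" and \<D>_mult: "\<D> (r * s) = \<D> r * s + r * \<D> s" for r s
    by (simp_all add: \<D>_def dx_add dy_add dx_mult dy_mult algebra_simps)
  have \<D>_scale: "\<D> (cscale c r) = cscale c (\<D> r)" for c r
    by (simp add: cscale_def \<D>_mult) (simp add: \<D>_def dx_const2 dy_const2)
  have \<D>_1: "\<D> 1 = 0" using \<D>_mult[of 1 1] by simp
  have \<D>_power: "\<D> (z ^ i) = of_nat i * z ^ (i - 1) * \<D> z" for i
  proof (induction i)
    case (Suc i)
    then show ?case by (cases i) (simp_all add: \<D>_mult \<D>_1 algebra_simps)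
  qed (simp add: \<D>_1)
  have \<D>_sum: "\<D> (sum s I) = (\<Sum>i\<in>I. \<D> (s i))" for s :: "nat \<Rightarrow> _" and I
    by (rule hom_sum) (use \<D>_add[of 0 0] in \<open>simp_all add: \<D>_add\<close>)
  define J where "J = ideal_gen {F, dx F, dy F}"
  have J_mult: "r * s \<in> J" if "s \<in> J" for r s using that unfolding J_def by (rule ideal_gen_mult)
  have J_base: "F \<in> J" "dx F \<in> J" "dy F \<in> J" unfolding J_def by (rule ideal.span_base; simp)+
  have J_add: "r + s \<in> J" if "r \<in> J" "s \<in> J" for r s using that unfolding J_def by (rule ideal.span_add)
  have J_diff: "r - s \<in> J" if "r \<in> J" "s \<in> J" for r s using that unfolding J_def by (rule ideal.span_diff)
  have J_K: "r \<in> K d" if r: "r \<in> J" for r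
  proof -
    obtain k l m where "r = k * F + l * dx F + m * dy F" using r unfolding J_def ideal_gen_3 by blast
    then show ?thesis by (simp add: K_add K_mult X_K Y_K F_K)
  qed
  obtain k where k: "dx F * \<alpha> + dy F * \<beta> = F * k" using \<alpha>\<beta> by (rule dvdE)
  have "\<D> F = k * F" using k by (simp add: \<D>_def algebra_simps)
  then have DF: "\<D> F \<in> J" by (simp add: J_mult J_base)
  have "\<D> (dx F) = k * dx F + dx k * F - (dx \<alpha> * dx F + dx \<beta> * dy F)"
    using arg_cong[OF k, of dx] by (simp add: \<D>_def dx_add dx_mult dx_dy algebra_simps)
  then have DX: "\<D> (dx F) \<in> J" by (simp add: J_mult J_base J_add J_diff)
  have "\<D> (dy F) = k * dy F + dy k * F - (dy \<alpha> * dx F + dy \<beta> * dy F)"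
    using arg_cong[OF k, of dy] by (simp add: \<D>_def dy_add dy_mult dx_dy algebra_simps)
  then have DY: "\<D> (dy F) \<in> J" by (simp add: J_mult J_base J_add J_diff)
  have \<D>_J: "\<D> r \<in> J" if r: "r \<in> J" for r
  proof -
    obtain k l m where "r = k * F + l * dx F + m * dy F" using r unfolding J_def ideal_gen_3 by blast
    then show ?thesis by (simp add: \<D>_add \<D>_mult J_add J_mult J_base DF DX DY)
  qed
  \<comment> \<open>The multiplier \<open>r\<close> outside the prime imitates localization.\<close>
  define Q where "Q n \<longleftrightarrow> (\<exists>c r. r \<notin> K d \<and> (\<exists>i<n. c i \<noteq> 0) \<and> r * (\<Sum>i<n. cscale (c i) (z ^ i)) \<in> J)" for n :: nat
  have "\<exists>r. (\<exists>i\<in>{..<Suc \<rho>}. r i \<noteq> 0) \<and> (\<Sum>i<Suc \<rho>. cscale (r i) (z ^ i)) \<in> \<aa>"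
  proof (rule cscale_relation[where J = "{..<\<rho>}" and b = B])
    fix i
    obtain c where "z ^ i - (\<Sum>j<\<rho>. cscale (c j) (B j)) \<in> \<aa>" using mod_a by blast
    then show "\<exists>d c. d \<noteq> 0 \<and> cscale d (z ^ i) - (\<Sum>j<\<rho>. cscale (c j) (B j)) \<in> \<aa>"
      by (intro exI[of _ 1] exI[of _ c]) (simp add: cscale_simps)
  qed (simp_all add: ideal.subspace_span)
  then obtain r where "\<exists>i<Suc \<rho>. r i \<noteq> 0" "(\<Sum>i<Suc \<rho>. cscale (r i) (z ^ i)) \<in> \<aa>" by auto
  moreover have "\<aa> \<subseteq> J" unfolding J_def by (rule ideal.span_mono) auto
  ultimately have "Q (Suc \<rho>)"
    unfolding Q_def using one_K by (intro exI[of _ r] exI[of _ 1]) auto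
  define n where "n = (LEAST n. Q n)"
  have Qn: "Q n" unfolding n_def using \<open>Q (Suc \<rho>)\<close> by (rule LeastI)
  have min: "\<not> Q m" if "m < n" for m using that unfolding n_def by (rule not_less_Least)
  from Qn obtain c r where r: "r \<notin> K d" and c: "\<exists>i<n. c i \<noteq> 0" and rJ: "r * (\<Sum>i<n. cscale (c i) (z ^ i)) \<in> J"
    unfolding Q_def by blast
  obtain m where m: "n = Suc m" using c by (cases n) auto
  have cm: "c m \<noteq> 0"
  proof
    assume 0: "c m = 0"
    have "\<exists>i<m. c i \<noteq> 0" using c 0 unfolding m by (auto simp: less_Suc_eq)
    moreover have "r * (\<Sum>i<m. cscale (c i) (z ^ i)) \<in> J" using rJ 0 unfolding m by (simp add: cscale_simps)
    ultimately have "Q m" unfolding Q_def using r by blast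
    then show False using min m by simp
  qed
  show False
  proof (cases m)
    case 0
    then have "r * const2 (c 0) \<in> K d" using rJ J_K unfolding m by (simp add: cscale_def)
    then show False using prime r const_K[OF cm] 0 by blast
  next
    case (Suc m')
    define c' where "c' i = of_nat (Suc i) * c (Suc i)" for i
    define G where "G = (\<Sum>i<n. cscale (c i) (z ^ i))"
    define G' where "G' = (\<Sum>i<m. cscale (c' i) (z ^ i))"
    have "\<D> G = (\<Sum>i<m. \<D> (cscale (c (Suc i)) (z ^ Suc i)))"
      unfolding G_def m sum.lessThan_Suc_shift \<D>_add \<D>_sum
      by (simp only: \<D>_scale power_0 \<D>_1 cscale_simps add_0_left)
    also have "\<dots> = G' * \<D> z"
      unfolding G'_def sum_distrib_right
    proof (rule sum.cong)
      fix i
      have "cscale (c (Suc i)) (of_nat (Suc i) * z ^ i * \<D> z) = cscale (c' i) (z ^ i) * \<D> z"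
        using const2_of_nat[of "Suc i" "c (Suc i)"] unfolding c'_def cscale_def
        by (simp only: mult_ac)
      then show "\<D> (cscale (c (Suc i)) (z ^ Suc i)) = cscale (c' i) (z ^ i) * \<D> z"
        by (simp only: \<D>_scale \<D>_power diff_Suc_1)
    qed simp
    finally have DG: "\<D> G = G' * \<D> z" .
    have rJ': "r * G \<in> J" using rJ by (simp add: G_def)
    \<comment> \<open>The multiplier is not constant, so its derivative contributes a term, which is
      subtracted; the new multiplier is \<open>r * r * \<D> z\<close>.\<close>
    have "r * \<D> (r * G) - \<D> r * (r * G) \<in> J"
      by (rule J_diff[OF J_mult[OF \<D>_J[OF rJ']] J_mult[OF rJ']])
    then have "(r * r * \<D> z) * G' \<in> J" by (simp add: \<D>_mult DG algebra_simps)
    moreover have "r * r * \<D> z \<notin> K d" using prime r \<D>z by blast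
    moreover have "c' m' \<noteq> 0" using cm by (simp add: c'_def Suc del: of_nat_Suc)
    ultimately have "Q m" unfolding Q_def G'_def using Suc by blast
    then show False using min m by simp
  qed
qed

text \<open>Multiplied by \<open>d\<close>, the combination takes values in (\<open>F\<close>,
  \<open>dy F\<close>), so modulo \<open>F\<close> it is \<open>dy F\<close> times another
  functional. Expanding the latter in the basis and comparing coefficients puts every
  \<open>d * r\<close> into (\<open>F\<close>, \<open>dy F\<close>). Thus a basis stays independent
  modulo the prime, although both partials vanish there.\<close>

lemma basis_indep:
  assumes e: "pp_dual_basis F 3 e"
    and w: "\<And>w. w \<in> {1, dU, dV, dU\<^sup>2, dU * dV, dV\<^sup>2} \<Longrightarrow> r0 * e 0 w + r1 * e 1 w + r2 * e 2 w \<in> K d"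
  shows "r0 \<in> K d" "r1 \<in> K d" "r2 \<in> K d"
proof -
  have sum3: "(\<Sum>i<3. h i) = h 0 + h 1 + h 2" for h :: "nat \<Rightarrow> 'c fps fps"
    by (simp add: numeral_3_eq_3 numeral_2_eq_2)
  have dual: "pp_dual F 3 (e i)" if "i < 3" for i using e that unfolding pp_dual_basis_def by blast
  define \<phi> where "\<phi> u = d * (r0 * e 0 u + r1 * e 1 u + r2 * e 2 u)" for u
  have \<phi>: "pp_dual F 3 \<phi>"
    unfolding \<phi>_def by (intro pp_dual_lin_scale pp_dual_lin_add dual) simp_all
  have \<phi>0: "pp_dual F 3 (\<lambda>u. r0 * e 0 u + r1 * e 1 u + r2 * e 2 u)"
    by (intro pp_dual_lin_scale pp_dual_lin_add dual) simp_all
  have "r0 * e 0 u + r1 * e 1 u + r2 * e 2 u \<in> K d" for u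
    by (rule two_cancel, subst K_mod[OF pp_dual_taylor[OF \<phi>0]]) (intro K_add K_mult w; simp)
  then have "\<phi> u \<in> \<aa>" for u by (simp add: \<phi>_def K_def)
  have "\<exists>t. F dvd \<phi> u - dy F * t" for u
  proof -
    obtain k l where "\<phi> u = k * F + l * dy F" using \<open>\<phi> u \<in> \<aa>\<close> unfolding ideal_gen_2 by blast
    then show ?thesis by (intro exI[of _ l]) (simp add: mult.commute)
  qed
  then have "\<forall>u. \<exists>t. F dvd \<phi> u - dy F * t" by blast
  from choice[OF this] obtain \<chi> where \<chi>: "\<And>u. F dvd \<phi> u - dy F * \<chi> u" by blast
  have "pp_dual F 3 \<chi>"
    unfolding pp_dual_def ideal_gen_dvd
  proof (intro conjI allI ballI)
    fix u v s
    have "F dvd (\<phi> (u + v) - \<phi> u - \<phi> v) - ((\<phi> (u + v) - dy F * \<chi> (u + v)) - (\<phi> u - dy F * \<chi> u) - (\<phi> v - dy F * \<chi> v))"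
      by (intro dvd_diff pp_dual_add[OF \<phi>] \<chi>)
    then have "F dvd dy F * (\<chi> (u + v) - \<chi> u - \<chi> v)" by (simp add: algebra_simps)
    then show "F dvd \<chi> (u + v) - \<chi> u - \<chi> v" by (rule cancel_Y)
    have "F dvd (\<phi> (inleft s * u) - s * \<phi> u) - ((\<phi> (inleft s * u) - dy F * \<chi> (inleft s * u)) - s * (\<phi> u - dy F * \<chi> u))"
      by (intro dvd_diff dvd_mult pp_dual_scale[OF \<phi>] \<chi>)
    then have "F dvd dy F * (\<chi> (inleft s * u) - s * \<chi> u)" by (simp add: algebra_simps)
    then show "F dvd \<chi> (inleft s * u) - s * \<chi> u" by (rule cancel_Y)
  next
    fix u assume u: "u \<in> pp_ideal F 3"
    have "F dvd \<phi> u - (\<phi> u - dy F * \<chi> u)" by (intro dvd_diff pp_dual_ideal[OF \<phi> u] \<chi>)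
    then have "F dvd dy F * \<chi> u" by simp
    then show "F dvd \<chi> u" by (rule cancel_Y)
  qed
  with e obtain c :: "nat \<Rightarrow> 'c fps fps" where c: "\<And>u. F dvd \<chi> u - (c 0 * e 0 u + c 1 * e 1 u + c 2 * e 2 u)"
    unfolding pp_dual_basis_def sum3 ideal_gen_dvd by blast
  define rr where "rr i = (if i = 0 then r0 else if i = 1 then r1 else r2)" for i :: nat
  have rr: "rr 0 = r0" "rr 1 = r1" "rr 2 = r2" by (simp_all add: rr_def)
  have "F dvd (d * rr 0 - dy F * c 0) * e 0 u + (d * rr 1 - dy F * c 1) * e 1 u + (d * rr 2 - dy F * c 2) * e 2 u" for u
  proof -
    have "F dvd (\<phi> u - dy F * \<chi> u) + dy F * (\<chi> u - (c 0 * e 0 u + c 1 * e 1 u + c 2 * e 2 u))"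
      by (intro dvd_add dvd_mult \<chi> c)
    then show ?thesis unfolding rr \<phi>_def by (simp add: algebra_simps)
  qed
  with e have "\<forall>i<3. F dvd d * rr i - dy F * c i"
    unfolding pp_dual_basis_def sum3 ideal_gen_dvd by (elim conjE allE[of _ "\<lambda>i. d * rr i - dy F * c i"]) blast
  then have rK: "rr i \<in> K d" if "i < 3" for i
  proof -
    have "(d * rr i - dy F * c i) + c i * dy F \<in> \<aa>"
      by (rule ideal.span_add[OF F_mem Y_mem]) (use that \<open>\<forall>i<3. F dvd d * rr i - dy F * c i\<close> in blast)
    then show ?thesis by (simp add: K_def mult.commute)
  qed
  show "r0 \<in> K d" "r1 \<in> K d" "r2 \<in> K d" using rK[of 0] rK[of 1] rK[of 2] unfolding rr by simp_all
qed

text \<open>Formally, the derivation with coefficients \<open>b\<close>, \<open>b'\<close> sends the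
  fraction \<open>dx F / dy F\<close> to \<open>- 2 * D0\<close>, hence its i-th power to a multiple
  of the one before. After clearing denominators a relation among forms becomes one with
  coefficients shifted down, up to derivatives of the \<open>g i\<close>.\<close>

lemma relation_lower:
  assumes 1: "F dvd 2 * (dy F * D0) + dx (dx F) * b + 2 * dx (dy F) * b' + dy (dy F) * b''"
    and 2: "F dvd dx F * b + dy F * b'" and 3: "F dvd dx F * b' + dy F * b''"
    and g: "F dvd (\<Sum>i\<le>n. g i * (dx F ^ i * dy F ^ (n - i)))"
  shows "F dvd (\<Sum>i\<le>n. (b * dx (g i) + b' * dy (g i) - (if i < n then 2 * D0 * of_nat (Suc i) * g (Suc i) else 0))
    * (dx F ^ i * dy F ^ (n - i)))"
proof -
  let ?X = "dx F" and ?Y = "dy F"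
  define \<D> where "\<D> r = b * dx r + b' * dy r" for r
  have \<D>_add: "\<D> (r + s) = \<D> r + \<D> s" and \<D>_mult: "\<D> (r * s) = \<D> r * s + r * \<D> s" for r s
    by (simp_all add: \<D>_def dx_add dy_add dx_mult dy_mult algebra_simps)
  have \<D>_1: "\<D> 1 = 0" using \<D>_mult[of 1 1] by simp
  have \<D>_power: "\<D> (z ^ i) = of_nat i * z ^ (i - 1) * \<D> z" for i z
  proof (induction i)
    case (Suc i)
    then show ?case by (cases i) (simp_all add: \<D>_mult \<D>_1 algebra_simps)
  qed (simp add: \<D>_1)
  have \<D>_sum: "\<D> (sum s I) = (\<Sum>i\<in>I. \<D> (s i))" for s :: "nat \<Rightarrow> _" and I
    by (rule hom_sum) (use \<D>_add[of 0 0] in \<open>simp_all add: \<D>_add\<close>)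
  define S where "S = (\<Sum>i\<le>n. g i * (?X ^ i * ?Y ^ (n - i)))"
  define T where "T = (\<Sum>i\<le>n. g i * (of_nat i * ?X ^ (i - 1) * ?Y ^ (n - i)))"
  have star: "F dvd ?Y * \<D> ?X + 2 * D0 * ?Y\<^sup>2 - ?X * \<D> ?Y"
  proof -
    have "F dvd ?Y * (2 * (?Y * D0) + dx ?X * b + 2 * dx ?Y * b' + dy ?Y * b'')
        - (dx ?Y * (?X * b + ?Y * b') + dy ?Y * (?X * b' + ?Y * b''))"
      by (intro dvd_diff dvd_add dvd_mult 1 2 3)
    then show ?thesis by (simp add: \<D>_def dx_dy power2_eq_square algebra_simps)
  qed
  have "F dvd \<D> S"
  proof -
    obtain k where k: "S = F * k" using g unfolding S_def by (rule dvdE)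
    have "\<D> F = ?X * b + ?Y * b'" by (simp add: \<D>_def mult.commute)
    then show ?thesis using 2 by (simp add: k \<D>_mult)
  qed
  have "?Y * \<D> S = ?Y * (\<Sum>i\<le>n. \<D> (g i) * (?X ^ i * ?Y ^ (n - i))) - 2 * D0 * ?Y\<^sup>2 * T
      + of_nat n * \<D> ?Y * S + (?Y * \<D> ?X + 2 * D0 * ?Y\<^sup>2 - ?X * \<D> ?Y) * T"
  proof -
    have summand: "?Y * \<D> (g i * (?X ^ i * ?Y ^ (n - i))) = ?Y * (\<D> (g i) * (?X ^ i * ?Y ^ (n - i)))
        - 2 * D0 * ?Y\<^sup>2 * (g i * (of_nat i * ?X ^ (i - 1) * ?Y ^ (n - i)))
        + of_nat n * \<D> ?Y * (g i * (?X ^ i * ?Y ^ (n - i)))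
        + (?Y * \<D> ?X + 2 * D0 * ?Y\<^sup>2 - ?X * \<D> ?Y) * (g i * (of_nat i * ?X ^ (i - 1) * ?Y ^ (n - i)))"
      if i: "i \<le> n" for i
    proof -
      obtain j where j: "n = i + j" using le_Suc_ex[OF i] by blast
      have Xi: "of_nat i * ?X ^ (i - 1) * ?X = of_nat i * ?X ^ i" by (cases i) simp_all
      have Yj: "of_nat j * ?Y ^ (j - 1) * ?Y = of_nat j * ?Y ^ j" by (cases j) simp_all
      have "?Y * \<D> (g i * (?X ^ i * ?Y ^ j)) = ?Y * (\<D> (g i) * (?X ^ i * ?Y ^ j))
          + g i * ((of_nat i * ?X ^ (i - 1)) * ?Y ^ j * (?Y * \<D> ?X) + ?X ^ i * (of_nat j * ?Y ^ (j - 1) * ?Y) * \<D> ?Y)"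
        by (simp add: \<D>_mult \<D>_power algebra_simps)
      also have "\<dots> = ?Y * (\<D> (g i) * (?X ^ i * ?Y ^ j))
          - 2 * D0 * ?Y\<^sup>2 * (g i * (of_nat i * ?X ^ (i - 1) * ?Y ^ j))
          + (g i * ((of_nat i * ?X ^ (i - 1) * ?X) * ?Y ^ j + ?X ^ i * (of_nat j * ?Y ^ j)) * \<D> ?Y)
          + (?Y * \<D> ?X + 2 * D0 * ?Y\<^sup>2 - ?X * \<D> ?Y) * (g i * (of_nat i * ?X ^ (i - 1) * ?Y ^ j))"
        unfolding Yj by (simp add: algebra_simps)
      finally show ?thesis unfolding Xi by (simp add: j algebra_simps)
    qed
    have "?Y * \<D> S = (\<Sum>i\<le>n. ?Y * \<D> (g i * (?X ^ i * ?Y ^ (n - i))))"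
      unfolding S_def \<D>_sum by (rule sum_distrib_left)
    also have "\<dots> = (\<Sum>i\<le>n. ?Y * (\<D> (g i) * (?X ^ i * ?Y ^ (n - i)))
        - 2 * D0 * ?Y\<^sup>2 * (g i * (of_nat i * ?X ^ (i - 1) * ?Y ^ (n - i)))
        + of_nat n * \<D> ?Y * (g i * (?X ^ i * ?Y ^ (n - i)))
        + (?Y * \<D> ?X + 2 * D0 * ?Y\<^sup>2 - ?X * \<D> ?Y) * (g i * (of_nat i * ?X ^ (i - 1) * ?Y ^ (n - i))))"
      by (rule sum.cong) (use summand in auto)
    finally show ?thesis
      unfolding S_def T_def by (simp only: sum.distrib sum_subtractf sum_distrib_left)
  qed
  moreover have "(\<Sum>i\<le>n. (if i < n then 2 * D0 * of_nat (Suc i) * g (Suc i) else 0) * (?X ^ i * ?Y ^ (n - i)))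
      = 2 * D0 * ?Y * T"
  proof -
    have "(\<Sum>i\<le>n. (if i < n then 2 * D0 * of_nat (Suc i) * g (Suc i) else 0) * (?X ^ i * ?Y ^ (n - i)))
        = (\<Sum>i<n. 2 * D0 * of_nat (Suc i) * g (Suc i) * (?X ^ i * ?Y ^ (n - i)))"
      by (simp add: lessThan_Suc_atMost[symmetric])
    also have "\<dots> = (\<Sum>i<n. 2 * D0 * ?Y * (g (Suc i) * (of_nat (Suc i) * ?X ^ i * ?Y ^ (n - Suc i))))"
    proof (rule sum.cong)
      fix i assume "i \<in> {..<n}"
      then have "?Y ^ (n - i) = ?Y * ?Y ^ (n - Suc i)" by (simp add: Suc_diff_Suc flip: power_Suc)
      then show "2 * D0 * of_nat (Suc i) * g (Suc i) * (?X ^ i * ?Y ^ (n - i))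
          = 2 * D0 * ?Y * (g (Suc i) * (of_nat (Suc i) * ?X ^ i * ?Y ^ (n - Suc i)))"
        by (simp only: mult_ac)
    qed simp
    also have "\<dots> = 2 * D0 * ?Y * T"
      unfolding T_def lessThan_Suc_atMost[symmetric] sum.lessThan_Suc_shift sum_distrib_left distrib_left by simp
    finally show ?thesis .
  qed
  ultimately have "?Y * (\<Sum>i\<le>n. (\<D> (g i) - (if i < n then 2 * D0 * of_nat (Suc i) * g (Suc i) else 0)) * (?X ^ i * ?Y ^ (n - i)))
      = ?Y * \<D> S - of_nat n * \<D> ?Y * S - (?Y * \<D> ?X + 2 * D0 * ?Y\<^sup>2 - ?X * \<D> ?Y) * T"
    unfolding left_diff_distrib[of "\<D> (g _)"] sum_subtractf by (simp add: power2_eq_square algebra_simps)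
  moreover have "F dvd ?Y * \<D> S - of_nat n * \<D> ?Y * S - (?Y * \<D> ?X + 2 * D0 * ?Y\<^sup>2 - ?X * \<D> ?Y) * T"
    by (intro dvd_diff dvd_mult[OF \<open>F dvd \<D> S\<close>] dvd_mult2[OF star] dvd_mult[OF g[folded S_def]])
  ultimately have "F dvd ?Y * (\<Sum>i\<le>n. (\<D> (g i) - (if i < n then 2 * D0 * of_nat (Suc i) * g (Suc i) else 0)) * (?X ^ i * ?Y ^ (n - i)))"
    by simp
  then show ?thesis unfolding \<D>_def by (rule cancel_Y)
qed

end


context curve_prime
begin

text \<open>The counterpart of \<open>relation_lower\<close>: here \<open>dx F / dy F\<close> is
  sent to \<open>2 * D0\<close> times its square, so exponents go up. Together with the derivative
  of \<open>dy F ^ n\<close> the i-th power acquires the factor n - i up to sign, so raising stops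
  at the top degree.\<close>

lemma relation_raise:
  assumes 1: "F dvd 2 * (dx F * D0) + dx (dx F) * a + 2 * dx (dy F) * a' + dy (dy F) * a''"
    and 2: "F dvd dx F * a + dy F * a'" and 3: "F dvd dx F * a' + dy F * a''"
    and g: "F dvd (\<Sum>i\<le>n. g i * (dx F ^ i * dy F ^ (n - i)))"
  shows "F dvd (\<Sum>i\<le>n. (a' * dx (g i) + a'' * dy (g i) - (if 0 < i then 2 * D0 * of_nat (Suc n - i) * g (i - 1) else 0))
    * (dx F ^ i * dy F ^ (n - i)))"
proof -
  let ?X = "dx F" and ?Y = "dy F"
  define \<D> where "\<D> r = a' * dx r + a'' * dy r" for r
  have \<D>_add: "\<D> (r + s) = \<D> r + \<D> s" and \<D>_mult: "\<D> (r * s) = \<D> r * s + r * \<D> s" for r s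
    by (simp_all add: \<D>_def dx_add dy_add dx_mult dy_mult algebra_simps)
  have \<D>_1: "\<D> 1 = 0" using \<D>_mult[of 1 1] by simp
  have \<D>_power: "\<D> (z ^ i) = of_nat i * z ^ (i - 1) * \<D> z" for i z
  proof (induction i)
    case (Suc i)
    then show ?case by (cases i) (simp_all add: \<D>_mult \<D>_1 algebra_simps)
  qed (simp add: \<D>_1)
  have \<D>_sum: "\<D> (sum s I) = (\<Sum>i\<in>I. \<D> (s i))" for s :: "nat \<Rightarrow> _" and I
    by (rule hom_sum) (use \<D>_add[of 0 0] in \<open>simp_all add: \<D>_add\<close>)
  define S where "S = (\<Sum>i\<le>n. g i * (?X ^ i * ?Y ^ (n - i)))"
  define T where "T = a * dx ?X + a' * dy ?X"
  define T1 where "T1 = (\<Sum>i\<le>n. g i * (of_nat i * ?X ^ (i - 1) * ?Y ^ (n - i)))"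
  define T2 where "T2 = (\<Sum>i\<le>n. g i * (of_nat (n - i) * ?X ^ i * ?Y ^ (n - i)))"
  define T3 where "T3 = (\<Sum>i\<le>n. g i * (of_nat (n - i) * ?X ^ Suc i * ?Y ^ (n - i - 1)))"
  have starX: "F dvd ?Y * \<D> ?X + ?X * T"
  proof -
    have "F dvd dx ?X * (?X * a + ?Y * a') + dy ?X * (?X * a' + ?Y * a'')" by (intro dvd_add dvd_mult 2 3)
    then show ?thesis by (simp add: \<D>_def T_def algebra_simps)
  qed
  have starY: "F dvd \<D> ?Y + 2 * D0 * ?X + T"
    using 1 by (simp add: \<D>_def T_def dx_dy algebra_simps)
  have "F dvd \<D> S"
  proof -
    obtain k where k: "S = F * k" using g unfolding S_def by (rule dvdE)
    have "\<D> F = ?X * a' + ?Y * a''" by (simp add: \<D>_def mult.commute)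
    then show ?thesis using 3 by (simp add: k \<D>_mult)
  qed
  have "?Y * \<D> S = ?Y * (\<Sum>i\<le>n. \<D> (g i) * (?X ^ i * ?Y ^ (n - i))) + (?Y * \<D> ?X + ?X * T) * T1
      + (\<D> ?Y + 2 * D0 * ?X + T) * T2 - of_nat n * T * S - 2 * D0 * ?Y * T3"
  proof -
    have summand: "?Y * \<D> (g i * (?X ^ i * ?Y ^ (n - i))) = ?Y * (\<D> (g i) * (?X ^ i * ?Y ^ (n - i)))
        + (?Y * \<D> ?X + ?X * T) * (g i * (of_nat i * ?X ^ (i - 1) * ?Y ^ (n - i)))
        + (\<D> ?Y + 2 * D0 * ?X + T) * (g i * (of_nat (n - i) * ?X ^ i * ?Y ^ (n - i)))
        - of_nat n * T * (g i * (?X ^ i * ?Y ^ (n - i)))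
        - 2 * D0 * ?Y * (g i * (of_nat (n - i) * ?X ^ Suc i * ?Y ^ (n - i - 1)))"
      if i: "i \<le> n" for i
    proof -
      obtain j where j: "n = i + j" using le_Suc_ex[OF i] by blast
      have Xi: "of_nat i * ?X ^ (i - 1) * ?X = of_nat i * ?X ^ i" by (cases i) simp_all
      have Yj: "of_nat j * ?Y ^ (j - 1) * ?Y = of_nat j * ?Y ^ j" by (cases j) simp_all
      have "?Y * \<D> (g i * (?X ^ i * ?Y ^ j)) = ?Y * (\<D> (g i) * (?X ^ i * ?Y ^ j))
          + g i * ((of_nat i * ?X ^ (i - 1)) * ?Y ^ j * (?Y * \<D> ?X) + ?X ^ i * (of_nat j * ?Y ^ (j - 1) * ?Y) * \<D> ?Y)"
        by (simp add: \<D>_mult \<D>_power algebra_simps)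
      also have "\<dots> = ?Y * (\<D> (g i) * (?X ^ i * ?Y ^ j))
          + (?Y * \<D> ?X + ?X * T) * (g i * (of_nat i * ?X ^ (i - 1) * ?Y ^ j))
          + (\<D> ?Y + 2 * D0 * ?X + T) * (g i * (of_nat j * ?X ^ i * ?Y ^ j))
          - T * (g i * ((of_nat i * ?X ^ (i - 1) * ?X) * ?Y ^ j + ?X ^ i * (of_nat j * ?Y ^ j)))
          - 2 * D0 * g i * ?X ^ Suc i * (of_nat j * ?Y ^ j)"
        unfolding Yj by (simp add: algebra_simps)
      also have "\<dots> = ?Y * (\<D> (g i) * (?X ^ i * ?Y ^ j))
          + (?Y * \<D> ?X + ?X * T) * (g i * (of_nat i * ?X ^ (i - 1) * ?Y ^ j))
          + (\<D> ?Y + 2 * D0 * ?X + T) * (g i * (of_nat j * ?X ^ i * ?Y ^ j))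
          - of_nat n * T * (g i * (?X ^ i * ?Y ^ j))
          - 2 * D0 * ?Y * (g i * (of_nat j * ?X ^ Suc i * ?Y ^ (j - 1)))"
        unfolding Xi j by (cases j) (simp_all add: algebra_simps)
      finally show ?thesis by (simp add: j)
    qed
    have "?Y * \<D> S = (\<Sum>i\<le>n. ?Y * \<D> (g i * (?X ^ i * ?Y ^ (n - i))))"
      unfolding S_def \<D>_sum by (rule sum_distrib_left)
    also have "\<dots> = (\<Sum>i\<le>n. ?Y * (\<D> (g i) * (?X ^ i * ?Y ^ (n - i)))
        + (?Y * \<D> ?X + ?X * T) * (g i * (of_nat i * ?X ^ (i - 1) * ?Y ^ (n - i)))
        + (\<D> ?Y + 2 * D0 * ?X + T) * (g i * (of_nat (n - i) * ?X ^ i * ?Y ^ (n - i)))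
        - of_nat n * T * (g i * (?X ^ i * ?Y ^ (n - i)))
        - 2 * D0 * ?Y * (g i * (of_nat (n - i) * ?X ^ Suc i * ?Y ^ (n - i - 1))))"
      by (rule sum.cong[OF refl summand]) simp
    finally show ?thesis
      unfolding S_def T1_def T2_def T3_def by (simp only: sum.distrib sum_subtractf sum_distrib_left)
  qed
  moreover have "(\<Sum>i\<le>n. (if 0 < i then 2 * D0 * of_nat (Suc n - i) * g (i - 1) else 0) * (?X ^ i * ?Y ^ (n - i)))
      = 2 * D0 * T3"
  proof -
    have "(\<Sum>i\<le>n. (if 0 < i then 2 * D0 * of_nat (Suc n - i) * g (i - 1) else 0) * (?X ^ i * ?Y ^ (n - i)))
        = (\<Sum>i<n. 2 * D0 * of_nat (n - i) * g i * (?X ^ Suc i * ?Y ^ (n - Suc i)))"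
      unfolding lessThan_Suc_atMost[symmetric] sum.lessThan_Suc_shift by simp
    also have "\<dots> = 2 * D0 * T3"
      unfolding T3_def lessThan_Suc_atMost[symmetric] sum.lessThan_Suc distrib_left sum_distrib_left
      by (simp add: algebra_simps)
    finally show ?thesis .
  qed
  ultimately have "?Y * (\<Sum>i\<le>n. (\<D> (g i) - (if 0 < i then 2 * D0 * of_nat (Suc n - i) * g (i - 1) else 0)) * (?X ^ i * ?Y ^ (n - i)))
      = ?Y * \<D> S - (?Y * \<D> ?X + ?X * T) * T1 - (\<D> ?Y + 2 * D0 * ?X + T) * T2 + of_nat n * T * S"
    unfolding left_diff_distrib[of "\<D> (g _)"] sum_subtractf by (simp add: algebra_simps)
  moreover have "F dvd ?Y * \<D> S - (?Y * \<D> ?X + ?X * T) * T1 - (\<D> ?Y + 2 * D0 * ?X + T) * T2 + of_nat n * T * S"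
    by (intro dvd_add dvd_diff dvd_mult[OF \<open>F dvd \<D> S\<close>] dvd_mult2[OF starX] dvd_mult2[OF starY] dvd_mult[OF g[folded S_def]])
  ultimately have "F dvd ?Y * (\<Sum>i\<le>n. (\<D> (g i) - (if 0 < i then 2 * D0 * of_nat (Suc n - i) * g (i - 1) else 0)) * (?X ^ i * ?Y ^ (n - i)))"
    by simp
  then show ?thesis unfolding \<D>_def by (rule cancel_Y)
qed

text \<open>The homogeneous forms in \<open>dx F, dy F\<close> of a degree exceeding the rank of the fibre are
  dependent modulo the prime, since \<open>J\<^sup>n / (dy F) J\<^sup>n\<close> has the same rank as \<open>(F, dy F)\<close>.\<close>

lemma relation_exists:
  "\<exists>g i. i \<le> \<rho> \<and> g i \<notin> K d \<and> F dvd (\<Sum>i\<le>\<rho>. g i * (dx F ^ i * dy F ^ (\<rho> - i)))"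
proof -
  let ?X = "dx F" and ?Y = "dy F"
  define w where "w i = ?X ^ i * ?Y ^ (\<rho> - i)" for i
  define Jn where "Jn = {s. \<exists>h. F dvd s - (\<Sum>i\<le>\<rho>. h i * w i)}"
  define N where "N = {s. \<exists>h. F dvd s - ?Y * (\<Sum>i\<le>\<rho>. h i * w i)}"
  have sub_aux: "ideal.subspace {s. \<exists>h. F dvd s - y * (\<Sum>i\<le>\<rho>. h i * w i)}" for y
  proof (rule ideal.subspaceI)
    show "0 \<in> {s. \<exists>h. F dvd s - y * (\<Sum>i\<le>\<rho>. h i * w i)}" by (intro CollectI exI[of _ "\<lambda>_. 0"]) simp
  next
    fix s t assume "s \<in> {s. \<exists>h. F dvd s - y * (\<Sum>i\<le>\<rho>. h i * w i)}" "t \<in> {s. \<exists>h. F dvd s - y * (\<Sum>i\<le>\<rho>. h i * w i)}"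
    then obtain h h' where "F dvd s - y * (\<Sum>i\<le>\<rho>. h i * w i)" "F dvd t - y * (\<Sum>i\<le>\<rho>. h' i * w i)" by blast
    from dvd_add[OF this] show "s + t \<in> {s. \<exists>h. F dvd s - y * (\<Sum>i\<le>\<rho>. h i * w i)}"
      by (intro CollectI exI[of _ "\<lambda>i. h i + h' i"]) (simp add: distrib_left distrib_right sum.distrib algebra_simps)
  next
    fix c s assume "s \<in> {s. \<exists>h. F dvd s - y * (\<Sum>i\<le>\<rho>. h i * w i)}"
    then obtain h where "F dvd s - y * (\<Sum>i\<le>\<rho>. h i * w i)" by blast
    from dvd_mult[OF this, of c] show "c * s \<in> {s. \<exists>h. F dvd s - y * (\<Sum>i\<le>\<rho>. h i * w i)}"
      by (intro CollectI exI[of _ "\<lambda>i. c * h i"])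
        (simp add: right_diff_distrib sum_distrib_left mult.assoc mult.left_commute[of c])
  qed
  have subJ: "ideal.subspace Jn" using sub_aux[of 1] by (simp add: Jn_def)
  have subN: "ideal.subspace N" using sub_aux[of ?Y] by (simp add: N_def)
  have w_J: "w i \<in> Jn" if "i \<le> \<rho>" for i
    unfolding Jn_def by (intro CollectI exI[of _ "\<lambda>l. if l = i then 1 else 0"])
      (use that in \<open>simp add: if_distrib[of "\<lambda>t. t * _"] cong: if_cong\<close>)
  have F_J: "F * s \<in> Jn" for s
    unfolding Jn_def by (intro CollectI exI[of _ "\<lambda>_. 0"]) simp
  have Y_J: "?Y ^ \<rho> \<in> Jn" using w_J[of 0] by (simp add: w_def)
  have span: "\<exists>c v1 v0. v = (\<Sum>l<m. \<Sum>j<\<rho>. cscale (c (l, j)) (?Y ^ l * B j)) + ?Y ^ m * v1 + F * v0" for m v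
  proof (induction m)
    case 0
    show ?case by (rule exI[of _ "\<lambda>_. 0"], rule exI[of _ v], rule exI[of _ 0]) simp
  next
    case (Suc m)
    then obtain c v1 v0 where v: "v = (\<Sum>l<m. \<Sum>j<\<rho>. cscale (c (l, j)) (?Y ^ l * B j)) + ?Y ^ m * v1 + F * v0" by blast
    obtain c' v2 v3 where v1: "v1 = (\<Sum>j<\<rho>. cscale (c' j) (B j)) + v2 * F + v3 * ?Y" using fin_gen by blast
    define c'' where "c'' = (\<lambda>(l, j). if l = m then c' j else c (l, j))"
    have "(\<Sum>l<m. \<Sum>j<\<rho>. cscale (c'' (l, j)) (?Y ^ l * B j)) = (\<Sum>l<m. \<Sum>j<\<rho>. cscale (c (l, j)) (?Y ^ l * B j))"
      by (intro sum.cong) (auto simp: c''_def)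
    moreover have "(\<Sum>j<\<rho>. cscale (c'' (m, j)) (?Y ^ m * B j)) = ?Y ^ m * (\<Sum>j<\<rho>. cscale (c' j) (B j))"
      by (simp add: c''_def sum_distrib_left cscale_mult)
    ultimately have "v = (\<Sum>l<Suc m. \<Sum>j<\<rho>. cscale (c'' (l, j)) (?Y ^ l * B j)) + ?Y ^ Suc m * v3 + F * (v0 + ?Y ^ m * v2)"
      unfolding v v1 by (simp add: algebra_simps)
    then show ?case by blast
  qed
  have spanJ: "\<exists>c. v - (\<Sum>x\<in>{..<\<rho>} \<times> {..<\<rho>}. cscale (c x) (?Y ^ fst x * B (snd x))) \<in> Jn" for v
  proof -
    obtain c v1 v0 where v: "v = (\<Sum>l<\<rho>. \<Sum>j<\<rho>. cscale (c (l, j)) (?Y ^ l * B j)) + ?Y ^ \<rho> * v1 + F * v0" using span by blast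
    have "v1 * ?Y ^ \<rho> + F * v0 \<in> Jn"
      by (intro ideal.subspace_add[OF subJ] ideal.subspace_scale[OF subJ] Y_J F_J)
    moreover have "v - (\<Sum>x\<in>{..<\<rho>} \<times> {..<\<rho>}. cscale (c x) (?Y ^ fst x * B (snd x))) = v1 * ?Y ^ \<rho> + F * v0"
      unfolding v sum.cartesian_product by (simp add: case_prod_beta mult.commute)
    ultimately show ?thesis by (intro exI[of _ c]) simp
  qed
  obtain r :: nat and u where ind: "\<And>c. (\<Sum>i<r. cscale (c i) (u i)) \<in> Jn \<Longrightarrow> \<forall>i<r. c i = 0"
    and max: "\<And>v. \<exists>d c. d \<noteq> 0 \<and> cscale d v - (\<Sum>i<r. cscale (c i) (u i)) \<in> Jn"
    by (rule indep_maximal[OF subJ finite_cartesian_product[OF finite_lessThan finite_lessThan] spanJ], rule that)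
  \<comment> \<open>There are \<open>\<rho> + 1\<close> forms and \<open>r\<close> vectors
    \<open>u\<close>, but modulo \<open>N\<close> everything is spanned, up to scalars, by the
    \<open>\<rho>\<close> generators \<open>B\<close> and the \<open>r\<close> elements
    \<open>dy F * u l\<close>. A relation results; modulo the forms it only involves the
    \<open>u\<close>, whose coefficients must therefore vanish.\<close>
  have "\<exists>k. (\<exists>i\<in>{..\<rho>} <+> {..<r}. k i \<noteq> 0) \<and> (\<Sum>i\<in>{..\<rho>} <+> {..<r}. cscale (k i) (case_sum w u i)) \<in> N"
  proof (rule cscale_relation[where J = "{..<\<rho>} <+> {..<r}" and b = "case_sum B (\<lambda>l. ?Y * u l)", OF _ _ _ subN])
    fix i
    define v where "v = case_sum w u i"
    obtain c v0 v1 where v: "v = (\<Sum>j<\<rho>. cscale (c j) (B j)) + v0 * F + v1 * ?Y" using fin_gen by blast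
    obtain k c' where k: "k \<noteq> 0" "cscale k v1 - (\<Sum>i<r. cscale (c' i) (u i)) \<in> Jn" using max by blast
    then obtain h where h: "F dvd cscale k v1 - (\<Sum>i<r. cscale (c' i) (u i)) - (\<Sum>i\<le>\<rho>. h i * w i)"
      unfolding Jn_def by blast
    have "F dvd F * cscale k v0 + ?Y * (cscale k v1 - (\<Sum>i<r. cscale (c' i) (u i)) - (\<Sum>i\<le>\<rho>. h i * w i))"
      by (intro dvd_add dvd_mult[OF h]) simp
    also have "F * cscale k v0 + ?Y * (cscale k v1 - (\<Sum>i<r. cscale (c' i) (u i)) - (\<Sum>i\<le>\<rho>. h i * w i))
        = cscale k v - (\<Sum>x\<in>{..<\<rho>} <+> {..<r}. cscale (case_sum (\<lambda>j. k * c j) c' x) (case_sum B (\<lambda>l. ?Y * u l) x))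
          - ?Y * (\<Sum>i\<le>\<rho>. h i * w i)"
      unfolding v by (simp add: sum.Plus cscale_simps cscale_sum cscale_mult sum_distrib_left right_diff_distrib mult.commute)
    finally show "\<exists>d c. d \<noteq> 0 \<and> cscale d (case_sum w u i)
        - (\<Sum>x\<in>{..<\<rho>} <+> {..<r}. cscale (c x) (case_sum B (\<lambda>l. ?Y * u l) x)) \<in> N"
      unfolding N_def v_def using k(1) by blast
  qed (simp_all add: card_Plus)
  then obtain k where k: "\<exists>i\<in>{..\<rho>} <+> {..<r}. k i \<noteq> 0"
    "(\<Sum>i\<le>\<rho>. cscale (k (Inl i)) (w i)) + (\<Sum>i<r. cscale (k (Inr i)) (u i)) \<in> N"
    by (auto simp: sum.Plus)
  have "N \<subseteq> Jn"
  proof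
    fix s assume "s \<in> N"
    then obtain h where "F dvd s - ?Y * (\<Sum>i\<le>\<rho>. h i * w i)" unfolding N_def by blast
    then show "s \<in> Jn"
      unfolding Jn_def by (intro CollectI exI[of _ "\<lambda>i. ?Y * h i"]) (simp add: sum_distrib_left mult.assoc)
  qed
  moreover have "(\<Sum>i\<le>\<rho>. cscale (k (Inl i)) (w i)) \<in> Jn"
    unfolding cscale_def by (rule ideal.subspace_sum[OF subJ ideal.subspace_scale[OF subJ w_J]]) simp
  ultimately have "((\<Sum>i\<le>\<rho>. cscale (k (Inl i)) (w i)) + (\<Sum>i<r. cscale (k (Inr i)) (u i)))
      - (\<Sum>i\<le>\<rho>. cscale (k (Inl i)) (w i)) \<in> Jn"
    using k(2) by (intro ideal.subspace_diff[OF subJ]) blast+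
  then have "(\<Sum>i<r. cscale (k (Inr i)) (u i)) \<in> Jn" by simp
  then have k0: "\<forall>i<r. k (Inr i) = 0" by (rule ind)
  then obtain i where i: "i \<le> \<rho>" "k (Inl i) \<noteq> 0" using k(1) by auto
  have "(\<Sum>i\<le>\<rho>. cscale (k (Inl i)) (w i)) \<in> N" using k(2) k0 by (simp add: cscale_simps)
  then obtain h where h: "F dvd (\<Sum>i\<le>\<rho>. cscale (k (Inl i)) (w i)) - ?Y * (\<Sum>i\<le>\<rho>. h i * w i)"
    unfolding N_def by blast
  define g where "g i = const2 (k (Inl i)) - ?Y * h i" for i
  have "F dvd (\<Sum>i\<le>\<rho>. g i * (?X ^ i * ?Y ^ (\<rho> - i)))"
    using h by (simp add: g_def w_def cscale_def left_diff_distrib sum_subtractf sum_distrib_left mult.assoc)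
  moreover have "g i \<notin> K d"
  proof
    assume "g i \<in> K d"
    then have "g i + ?Y * h i \<in> K d" by (intro K_add K_mult2 Y_K)
    then show False using const_K[OF i(2)] by (simp add: g_def)
  qed
  ultimately show ?thesis using i(1) by blast
qed

text \<open>Every permutation other than the identity picks an off-diagonal entry, so modulo the
  prime only the product of the diagonal survives.\<close>

lemma det_unit_mod_prime:
  assumes diag: "\<And>i. i < n \<Longrightarrow> h (i, i) \<notin> K d"
    and off: "\<And>i j. i < n \<Longrightarrow> j < n \<Longrightarrow> i \<noteq> j \<Longrightarrow> h (i, j) \<in> K d"
  shows "det (mat n n h) \<notin> K d"
proof
  let ?S = "{p. p permutes {0..<n}}"
  let ?t = "\<lambda>p. signof p * (\<Prod>i=0..<n. mat n n h $$ (i, p i))"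
  assume "det (mat n n h) \<in> K d"
  then have tot: "(\<Sum>p\<in>?S. ?t p) \<in> K d" by (simp add: det_def'[of _ n])
  have fin: "finite ?S" by (intro finite_permutations) simp
  have rest: "(\<Sum>p\<in>?S - {id}. ?t p) \<in> K d"
  proof (rule K_sum)
    fix p assume p: "p \<in> ?S - {id}"
    then obtain i where i: "p i \<noteq> i" by (auto simp: fun_eq_iff)
    then have i': "i < n" using p permutes_not_in[of p "{0..<n}" i] by auto
    moreover have "p i < n" using p permutes_in_image[of p "{0..<n}" i] i' by auto
    ultimately have hK: "h (i, p i) \<in> K d" and pi: "p i < n" using off[of i "p i"] i by simp_all
    have prod: "(\<Prod>i=0..<n. mat n n h $$ (i, p i)) = mat n n h $$ (i, p i) * (\<Prod>i\<in>{0..<n} - {i}. mat n n h $$ (i, p i))"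
      using i' by (intro prod.remove) auto
    have "?t p = signof p * (h (i, p i) * (\<Prod>i\<in>{0..<n} - {i}. mat n n h $$ (i, p i)))"
      unfolding prod using i' pi by simp
    then show "?t p \<in> K d" using K_mult[OF K_mult2[OF hK]] by (simp only:)
  qed
  have "(\<Sum>p\<in>?S. ?t p) = ?t id + (\<Sum>p\<in>?S - {id}. ?t p)"
    using fin by (intro sum.remove) (auto simp: permutes_id)
  then have "?t id = (\<Sum>p\<in>?S. ?t p) - (\<Sum>p\<in>?S - {id}. ?t p)" by (simp only: add_diff_cancel_right')
  with K_diff[OF tot rest] have "?t id \<in> K d" by (simp only:)
  then have "(\<Prod>i=0..<n. h (i, i)) \<in> K d" by (simp add: sign_id)
  moreover have "(\<Prod>i=0..<m. h (i, i)) \<notin> K d" if "m \<le> n" for m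
    using that
  proof (induction m)
    case (Suc m)
    then show ?case using prime[of "\<Prod>i=0..<m. h (i, i)" "h (m, m)"] diag[of m] by auto
  qed (simp add: one_K)
  ultimately show False by blast
qed

text \<open>Modulo the prime all second-order values vanish, so independence rests on the values at
  1, \<open>dU\<close>, \<open>dV\<close>, whose determinant \<open>D0\<close> is therefore outside
  the prime. Its adjugate yields functionals \<psi> and \<chi> that provide the raising and the
  lowering operator. Lowering brings one relation among forms to a single coefficient outside the
  prime, at index 0; raising moves it to every index. The resulting square system has determinant
  outside the prime, and solving it gives \<open>dy F ^ \<rho> * det A = 0\<close> modulo
  \<open>F\<close>.\<close>

lemma no_dual_basis: "\<not> pp_dual_basis F 3 e"
proof
  assume e: "pp_dual_basis F 3 e"
  let ?X = "dx F" and ?Y = "dy F"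
  have dual: "pp_dual F 3 (e i)" if "i < 3" for i using e that unfolding pp_dual_basis_def by blast
  have symb: "\<psi> (dU\<^sup>2) \<in> K d" "\<psi> (dU * dV) \<in> K d" "\<psi> (dV\<^sup>2) \<in> K d" if \<psi>: "pp_dual F 3 \<psi>" for \<psi>
    using symbol_mem_prime[OF pp_dual_relations(2)[OF \<psi> two], of varx]
      symbol_mem_prime[OF pp_dual_relations(2)[OF \<psi> two], of vary]
      symbol_mem_prime[OF pp_dual_relations(3)[OF \<psi> two], of vary]
    by (simp_all add: dx_varx dx_vary dy_varx dy_vary)
  define p where "p i = e i 1" for i
  define u where "u i = e i dU" for i
  define v where "v i = e i dV" for i
  have ind: "r0 \<in> K d \<and> r1 \<in> K d \<and> r2 \<in> K d"
    if "r0 * p 0 + r1 * p 1 + r2 * p 2 \<in> K d" "r0 * u 0 + r1 * u 1 + r2 * u 2 \<in> K d"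
      "r0 * v 0 + r1 * v 1 + r2 * v 2 \<in> K d" for r0 r1 r2
  proof -
    have *: "r0 * e 0 w + r1 * e 1 w + r2 * e 2 w \<in> K d" if "w \<in> {1, dU, dV, dU\<^sup>2, dU * dV, dV\<^sup>2}" for w
      using that
    proof (elim insertE)
      assume "w = dU\<^sup>2"
      then show ?thesis using symb(1)[OF dual] by (intro K_add K_mult) simp_all
    next
      assume "w = dU * dV"
      then show ?thesis using symb(2)[OF dual] by (intro K_add K_mult) simp_all
    next
      assume "w = dV\<^sup>2"
      then show ?thesis using symb(3)[OF dual] by (intro K_add K_mult) simp_all
    qed (use \<open>r0 * p 0 + r1 * p 1 + r2 * p 2 \<in> K d\<close> \<open>r0 * u 0 + r1 * u 1 + r2 * u 2 \<in> K d\<close>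
        \<open>r0 * v 0 + r1 * v 1 + r2 * v 2 \<in> K d\<close> in \<open>simp_all add: p_def u_def v_def\<close>)
    then show ?thesis using basis_indep[OF e *] by blast
  qed
  define D0 where "D0 = p 0 * (u 1 * v 2 - u 2 * v 1) - p 1 * (u 0 * v 2 - u 2 * v 0) + p 2 * (u 0 * v 1 - u 1 * v 0)"
  have D0: "D0 \<notin> K d"
  proof
    \<comment> \<open>Cofactor columns annihilate the value vectors modulo the prime, so
      \<open>ind\<close> puts the 2 x 2 minors of the functionals 0 and 1 into the prime, then all
      values of these two functionals, and finally 1.\<close>
    assume D0: "D0 \<in> K d"
    have z: "0 \<in> K d" by (rule K_zero)
    have m1: "u 0 * v 1 - u 1 * v 0 \<in> K d"
      using ind[of "u 1 * v 2 - u 2 * v 1" "- (u 0 * v 2 - u 2 * v 0)" "u 0 * v 1 - u 1 * v 0"] D0 z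
      by (simp add: D0_def algebra_simps)
    have neg: "- r \<in> K d" if "r \<in> K d" for r using K_mult[OF that, of "- 1"] by simp
    have "- (p 0 * v 1 - p 1 * v 0) \<in> K d"
      using ind[of "- (p 1 * v 2 - p 2 * v 1)" "p 0 * v 2 - p 2 * v 0" "- (p 0 * v 1 - p 1 * v 0)"] D0 z
      by (simp add: D0_def algebra_simps)
    from neg[OF this] have m2: "p 0 * v 1 - p 1 * v 0 \<in> K d" by simp
    have m3: "p 0 * u 1 - p 1 * u 0 \<in> K d"
      using ind[of "p 1 * u 2 - p 2 * u 1" "- (p 0 * u 2 - p 2 * u 0)" "p 0 * u 1 - p 1 * u 0"] D0 z
      by (simp add: D0_def algebra_simps)
    have "u 1 \<in> K d \<and> - u 0 \<in> K d \<and> 0 \<in> K d"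
      by (rule ind) (use z m3 neg[OF m1] in \<open>simp_all add: algebra_simps\<close>)
    moreover have "v 1 \<in> K d \<and> - v 0 \<in> K d \<and> 0 \<in> K d"
      by (rule ind) (use z m2 m1 in \<open>simp_all add: algebra_simps\<close>)
    moreover have "p 1 \<in> K d \<and> - p 0 \<in> K d \<and> 0 \<in> K d"
      by (rule ind) (use z neg[OF m2] neg[OF m3] in \<open>simp_all add: algebra_simps\<close>)
    ultimately have "p 0 \<in> K d" "u 0 \<in> K d" "v 0 \<in> K d" using neg by force+
    then have "1 \<in> K d \<and> 0 \<in> K d \<and> 0 \<in> K d" by (intro ind) simp_all
    then show False using one_K by blast
  qed
  define \<psi> where "\<psi> w = - (p 1 * v 2 - p 2 * v 1) * e 0 w + (p 0 * v 2 - p 2 * v 0) * e 1 w + - (p 0 * v 1 - p 1 * v 0) * e 2 w" for w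
  define \<chi> where "\<chi> w = (p 1 * u 2 - p 2 * u 1) * e 0 w + - (p 0 * u 2 - p 2 * u 0) * e 1 w + (p 0 * u 1 - p 1 * u 0) * e 2 w" for w
  have \<psi>: "pp_dual F 3 \<psi>" and \<chi>: "pp_dual F 3 \<chi>"
    unfolding \<psi>_def \<chi>_def by (intro pp_dual_lin_add pp_dual_lin_scale dual; simp)+
  have vals: "\<psi> dU = D0" "\<psi> dV = 0" "\<chi> dU = 0" "\<chi> dV = D0"
    by (simp_all add: \<psi>_def \<chi>_def D0_def u_def[symmetric] v_def[symmetric] algebra_simps)
  note symb = symb[OF \<psi>] symb[OF \<chi>]
  define rel where "rel g \<longleftrightarrow> F dvd (\<Sum>i\<le>\<rho>. g i * (?X ^ i * ?Y ^ (\<rho> - i)))" for g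
  have D0n: "2 * D0 * of_nat m * r \<notin> K d" if "m \<noteq> 0" "r \<notin> K d" for m r
  proof -
    have "of_nat 2 \<notin> K d" by (rule of_nat_K) simp
    then have "2 \<notin> K d" by simp
    then show ?thesis using prime that D0 of_nat_K[OF that(1)] by blast
  qed
  obtain g0 i0 where g0: "i0 \<le> \<rho>" "g0 i0 \<notin> K d" "rel g0"
    using relation_exists unfolding rel_def by blast
  have "\<exists>g. rel g \<and> g 0 \<notin> K d \<and> (\<forall>l. 0 < l \<and> l \<le> \<rho> \<longrightarrow> g l \<in> K d)"
    if "i \<le> \<rho>" "rel g" "g i \<notin> K d" "\<forall>l. i < l \<and> l \<le> \<rho> \<longrightarrow> g l \<in> K d" for i g
    using that
  proof (induction i arbitrary: g)
    case (Suc i)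
    define g' where "g' l = \<chi> (dU\<^sup>2) * dx (g l) + \<chi> (dU * dV) * dy (g l)
      - (if l < \<rho> then 2 * D0 * of_nat (Suc l) * g (Suc l) else 0)" for l
    have "rel g'"
      unfolding rel_def g'_def
    proof (rule relation_lower)
      show "F dvd 2 * (?Y * D0) + dx ?X * \<chi> (dU\<^sup>2) + 2 * dx ?Y * \<chi> (dU * dV) + dy ?Y * \<chi> (dV\<^sup>2)"
        using pp_dual_relations(1)[OF \<chi> two] by (simp add: vals)
    qed (use pp_dual_relations(2,3)[OF \<chi> two] Suc.prems(2) in \<open>simp_all add: rel_def\<close>)
    moreover have \<theta>: "\<chi> (dU\<^sup>2) * dx (g l) + \<chi> (dU * dV) * dy (g l) \<in> K d" for l
      by (intro K_add K_mult2 symb)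
    have "g' i \<notin> K d"
    proof
      assume "g' i \<in> K d"
      then have "(\<chi> (dU\<^sup>2) * dx (g i) + \<chi> (dU * dV) * dy (g i)) - g' i \<in> K d" using \<theta> by (intro K_diff)
      then show False using D0n[of "Suc i" "g (Suc i)"] Suc.prems by (simp add: g'_def del: of_nat_Suc)
    qed
    moreover have "g' l \<in> K d" if "i < l" "l \<le> \<rho>" for l
      unfolding g'_def using \<theta> that Suc.prems(4) by (intro K_diff) (auto intro: K_mult K_zero)
    ultimately show ?case using Suc.IH[of g'] Suc.prems(1) by auto
  qed blast
  note lower = this
  \<comment> \<open>Lowering starts from the last coefficient outside the prime; each step then
    moves that position down by exactly one.\<close>
  define i where "i = Max {i. i \<le> \<rho> \<and> g0 i \<notin> K d}"
  have fin: "finite {i. i \<le> \<rho> \<and> g0 i \<notin> K d}" by simp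
  have "i \<in> {i. i \<le> \<rho> \<and> g0 i \<notin> K d}" unfolding i_def using fin g0 by (intro Max_in) auto
  moreover have "\<forall>l. i < l \<and> l \<le> \<rho> \<longrightarrow> g0 l \<in> K d"
  proof (intro allI impI, rule ccontr)
    fix l assume "i < l \<and> l \<le> \<rho>" "g0 l \<notin> K d"
    then have "l \<le> i" unfolding i_def by (intro Max_ge[OF fin]) simp
    with \<open>i < l \<and> l \<le> \<rho>\<close> show False by simp
  qed
  ultimately obtain g1 where g1: "rel g1" "g1 0 \<notin> K d" "\<And>l. 0 < l \<Longrightarrow> l \<le> \<rho> \<Longrightarrow> g1 l \<in> K d"
    using lower[of i g0] g0(3) by auto
  have "\<exists>g. rel g \<and> g j \<notin> K d \<and> (\<forall>l. l \<noteq> j \<and> l \<le> \<rho> \<longrightarrow> g l \<in> K d)" if "j \<le> \<rho>" for j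
    using that
  proof (induction j)
    case 0
    show ?case using g1 by blast
  next
    case (Suc j)
    then obtain g where g: "rel g" "g j \<notin> K d" "\<forall>l. l \<noteq> j \<and> l \<le> \<rho> \<longrightarrow> g l \<in> K d" by auto
    define g' where "g' l = \<psi> (dU * dV) * dx (g l) + \<psi> (dV\<^sup>2) * dy (g l)
      - (if 0 < l then 2 * D0 * of_nat (Suc \<rho> - l) * g (l - 1) else 0)" for l
    have "rel g'"
      unfolding rel_def g'_def
    proof (rule relation_raise)
      show "F dvd 2 * (?X * D0) + dx ?X * \<psi> (dU\<^sup>2) + 2 * dx ?Y * \<psi> (dU * dV) + dy ?Y * \<psi> (dV\<^sup>2)"
        using pp_dual_relations(1)[OF \<psi> two] by (simp add: vals)
    qed (use pp_dual_relations(2,3)[OF \<psi> two] g(1) in \<open>simp_all add: rel_def\<close>)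
    moreover have \<theta>: "\<psi> (dU * dV) * dx (g l) + \<psi> (dV\<^sup>2) * dy (g l) \<in> K d" for l
      by (intro K_add K_mult2 symb)
    have "g' (Suc j) \<notin> K d"
    proof
      assume "g' (Suc j) \<in> K d"
      then have "(\<psi> (dU * dV) * dx (g (Suc j)) + \<psi> (dV\<^sup>2) * dy (g (Suc j))) - g' (Suc j) \<in> K d"
        using \<theta> by (intro K_diff)
      then show False using D0n[of "\<rho> - j" "g j"] Suc.prems g(2) by (simp add: g'_def)
    qed
    moreover have "g' l \<in> K d" if "l \<noteq> Suc j" "l \<le> \<rho>" for l
    proof -
      have "g (l - 1) \<in> K d" if "0 < l"
      proof -
        have "l - 1 \<noteq> j \<and> l - 1 \<le> \<rho>" using that \<open>l \<noteq> Suc j\<close> \<open>l \<le> \<rho>\<close> by linarith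
        then show ?thesis using g(3) by blast
      qed
      then show ?thesis unfolding g'_def by (intro K_diff[OF \<theta>]) (auto intro: K_mult K_zero)
    qed
    ultimately show ?case by blast
  qed
  then have "\<forall>j\<in>{..\<rho>}. \<exists>g. rel g \<and> g j \<notin> K d \<and> (\<forall>l. l \<noteq> j \<and> l \<le> \<rho> \<longrightarrow> g l \<in> K d)" by blast
  from bchoice[OF this] obtain R where R: "\<And>j. j \<le> \<rho> \<Longrightarrow> rel (R j)" "\<And>j. j \<le> \<rho> \<Longrightarrow> R j j \<notin> K d"
    "\<And>j l. j \<le> \<rho> \<Longrightarrow> l \<le> \<rho> \<Longrightarrow> l \<noteq> j \<Longrightarrow> R j l \<in> K d" by auto
  define A where "A = mat (Suc \<rho>) (Suc \<rho>) (\<lambda>(j, l). R j l)"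
  have detA: "det A \<notin> K d"
    unfolding A_def by (rule det_unit_mod_prime) (use R in \<open>auto simp: less_Suc_eq_le\<close>)
  have A: "A \<in> carrier_mat (Suc \<rho>) (Suc \<rho>)" by (simp add: A_def)
  define C where "C = adj_mat A"
  have C: "C \<in> carrier_mat (Suc \<rho>) (Suc \<rho>)" "C * A = det A \<cdot>\<^sub>m 1\<^sub>m (Suc \<rho>)"
    unfolding C_def using adj_mat[OF A] by auto
  have CA: "(\<Sum>j\<le>\<rho>. C $$ (0, j) * R j l) = (if l = 0 then det A else 0)" if l: "l \<le> \<rho>" for l
  proof -
    have "(C * A) $$ (0, l) = (\<Sum>j<Suc \<rho>. C $$ (0, j) * A $$ (j, l))"
      using A C(1) l by (simp add: scalar_prod_def atLeast0LessThan del: sum.lessThan_Suc)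
    also have "\<dots> = (\<Sum>j\<le>\<rho>. C $$ (0, j) * R j l)"
      unfolding lessThan_Suc_atMost by (rule sum.cong) (use l in \<open>auto simp: A_def\<close>)
    finally have s: "(C * A) $$ (0, l) = (\<Sum>j\<le>\<rho>. C $$ (0, j) * R j l)" .
    have "(C * A) $$ (0, l) = (if l = 0 then det A else 0)" unfolding C(2) using l by simp
    from trans[OF sym[OF s] this] show ?thesis .
  qed
  have "F dvd (\<Sum>j\<le>\<rho>. C $$ (0, j) * (\<Sum>l\<le>\<rho>. R j l * (?X ^ l * ?Y ^ (\<rho> - l))))"
    by (rule dvd_sum, rule dvd_mult) (use R(1) in \<open>auto simp: rel_def\<close>)
  also have "(\<Sum>j\<le>\<rho>. C $$ (0, j) * (\<Sum>l\<le>\<rho>. R j l * (?X ^ l * ?Y ^ (\<rho> - l))))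
      = (\<Sum>l\<le>\<rho>. (\<Sum>j\<le>\<rho>. C $$ (0, j) * R j l) * (?X ^ l * ?Y ^ (\<rho> - l)))"
    unfolding sum_distrib_left sum_distrib_right by (subst sum.swap) (simp add: mult.assoc)
  also have "\<dots> = (\<Sum>l\<le>\<rho>. if l = 0 then det A * ?Y ^ \<rho> else 0)"
    by (rule sum.cong) (auto simp: CA)
  also have "\<dots> = ?Y ^ \<rho> * det A" by (simp add: mult.commute)
  finally have "?Y ^ \<rho> * det A \<in> ideal_gen {F}" by (simp add: ideal_gen_dvd)
  then have "det A \<in> ideal_gen {F}" by (rule nzd_power[OF nzd_Y])
  then have "F dvd det A" by (simp add: ideal_gen_dvd)
  then show False using F_K detA by blast
qed

end

theorem (in relative_curve) dual_basis_imp_regular: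
  assumes "pp_dual_basis F 3 e"
  shows "nzd {F, dy F} (dx F)"
proof (rule ccontr)
  assume "\<not> nzd {F, dy F} (dx F)"
  then obtain d0 where d0: "d0 \<notin> \<aa>" "dx F * d0 \<in> \<aa>" unfolding nzd_def by blast
  show False
  proof (rule associated_prime[OF d0])
    fix d assume "d \<notin> \<aa>" "dx F \<in> K d" "1 \<notin> K d"
      "\<And>r s. r * s \<in> K d \<Longrightarrow> r \<in> K d \<or> s \<in> K d" "\<And>c. c \<noteq> 0 \<Longrightarrow> const2 c \<notin> K d"
    then interpret curve_prime F \<rho> B d by unfold_locales
    show False using no_dual_basis assms by blast
  qed
qed


section \<open>Division with remainder by leading forms, and lengths of finite-dimensional
  algebras\<close>

section \<open>Reduction modulo leading forms\<close>

locale leading = filtered G for G :: "nat \<Rightarrow> 'r::comm_ring_1 set" +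
  fixes g :: "nat \<Rightarrow> 'r" and r w :: nat
begin

text \<open>The leading forms of weight \<open>n\<close> of the ideal generated by the \<open>g i\<close>; the shift \<open>w\<close>
  bounds the weights of the generators.\<close>

definition L :: "nat \<Rightarrow> 'r set" where
  "L n = {u. \<exists>a. (\<forall>i<r. a i \<in> G (n - w)) \<and> u - (\<Sum>i<r. a i * g i) \<in> G (Suc n)}"

lemma L_add: "u \<in> L n \<Longrightarrow> v \<in> L n \<Longrightarrow> u + v \<in> L n"
proof -
  assume "u \<in> L n" "v \<in> L n"
  then obtain a b where ab: "\<forall>i<r. a i \<in> G (n - w)" "\<forall>i<r. b i \<in> G (n - w)"
    and "u - (\<Sum>i<r. a i * g i) \<in> G (Suc n)" "v - (\<Sum>i<r. b i * g i) \<in> G (Suc n)"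
    unfolding L_def by blast
  from Fil_add[OF this(3,4)] have "(u + v) - (\<Sum>i<r. (a i + b i) * g i) \<in> G (Suc n)"
    by (simp add: algebra_simps sum.distrib)
  then show ?thesis
    unfolding L_def using ab by (intro CollectI exI[of _ "\<lambda>i. a i + b i"]) (auto intro: Fil_add)
qed

lemma L_mult: "u \<in> L n \<Longrightarrow> v \<in> G k \<Longrightarrow> n + k = m \<Longrightarrow> v * u \<in> L m"
proof -
  assume "u \<in> L n" and v: "v \<in> G k" and m: "n + k = m"
  then obtain a where a: "\<forall>i<r. a i \<in> G (n - w)" and u: "u - (\<Sum>i<r. a i * g i) \<in> G (Suc n)"
    unfolding L_def by blast
  have "v * (u - (\<Sum>i<r. a i * g i)) \<in> G (Suc m)" by (rule Fil_multI[OF v u]) (use m in simp)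
  then have "v * u - (\<Sum>i<r. (v * a i) * g i) \<in> G (Suc m)"
    by (simp add: right_diff_distrib sum_distrib_left mult.assoc)
  moreover have "\<forall>i<r. v * a i \<in> G (m - w)" using a v m by (auto intro: Fil_multI)
  ultimately show ?thesis unfolding L_def by (intro CollectI exI[of _ "\<lambda>i. v * a i"] conjI)
qed

lemma L_scale: "u \<in> L n \<Longrightarrow> v * u \<in> L n"
  using L_mult[of u n v 0 n] by simp

lemma L_uminus: "u \<in> L n \<Longrightarrow> - u \<in> L n"
  using L_scale[of u n "- 1"] by simp

lemma L_diff: "u \<in> L n \<Longrightarrow> v \<in> L n \<Longrightarrow> u - v \<in> L n"
  using L_add[of u n "- v"] L_uminus[of v n] by simp

lemma L_higher: "u \<in> G (Suc n) \<Longrightarrow> u \<in> L n"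
  unfolding L_def by (intro CollectI exI[of _ "\<lambda>_. 0"]) simp

lemma L_zero: "0 \<in> L n"
  by (rule L_higher) simp

lemma L_lead:
  assumes "i < r" "n \<le> w" "g i - u \<in> G (Suc n)"
  shows "u \<in> L n"
proof -
  have "(\<Sum>l<r. (if l = i then 1 else 0) * g l) = g i"
    using assms(1) by (simp add: if_distrib[of "\<lambda>t. t * _"] cong: if_cong)
  then have "u - (\<Sum>l<r. (if l = i then 1 else 0) * g l) \<in> G (Suc n)"
    using Fil_uminus[OF assms(3)] by simp
  then show ?thesis
    unfolding L_def using assms(2) by (intro CollectI exI[of _ "\<lambda>l. if l = i then 1 else 0"]) simp
qed

lemma L_unit: "c dvd 1 \<Longrightarrow> c * u \<in> L n \<Longrightarrow> u \<in> L n"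
proof -
  assume "c dvd 1" "c * u \<in> L n"
  obtain k where k: "1 = c * k" using \<open>c dvd 1\<close> by (rule dvdE)
  have "k * (c * u) \<in> L n" by (rule L_scale) fact
  also have "k * (c * u) = (c * k) * u" by (simp add: mult_ac)
  finally show "u \<in> L n" using k by simp
qed

context
  fixes x y :: 'r and a b m n :: nat
  assumes x: "x \<in> G a" and y: "y \<in> G b"
begin

lemma xy: "x ^ i * y ^ j \<in> G (a * i + b * j)"
  by (rule Fil_multI[OF Fil_power[OF x] Fil_power[OF y]]) (simp add: mult.commute)

text \<open>The standard monomials are those with \<open>i \<le> m\<close> and \<open>j < n\<close>.
  Either both leading forms are monomials, or the situation is homogeneous with forms
  \<open>y ^ n - c * x ^ n\<close> and \<open>x ^ n * (x - \<kappa> * y)\<close>, where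
  \<open>emb\<close> is suppressed. Up to sign \<open>1 - \<kappa> ^ n * c\<close> is the resultant
  of the two; being a unit, it excludes common zeros.\<close>

lemma normal_form:
  fixes emb :: "'v::comm_ring_1 \<Rightarrow> 'r"
  assumes emb: "\<And>s t. emb (s * t) = emb s * emb t" "emb 0 = 0" "emb 1 = 1"
    and P1: "y ^ n - emb c * x ^ m \<in> L (b * n)"
    and P2: "x ^ Suc m - emb \<kappa> * (x ^ m * y) \<in> L (a * Suc m)"
    and cases: "c = 0 \<and> \<kappa> = 0 \<or> m = n \<and> a = b \<and> (1 - emb \<kappa> ^ n * emb c) dvd 1"
  shows "\<exists>i' j' s. x ^ i * y ^ j - emb s * (x ^ i' * y ^ j') \<in> L (a * i + b * j)
    \<and> (s = 0 \<or> i' \<le> m \<and> j' < n \<and> a * i' + b * j' = a * i + b * j)"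
proof -
  define nf where "nf i j \<longleftrightarrow> (\<exists>i' j' s. x ^ i * y ^ j - emb s * (x ^ i' * y ^ j') \<in> L (a * i + b * j)
    \<and> (s = 0 \<or> i' \<le> m \<and> j' < n \<and> a * i' + b * j' = a * i + b * j))" for i j
  have nf_0: "nf i j" if "x ^ i * y ^ j \<in> L (a * i + b * j)" for i j
    unfolding nf_def by (rule exI[of _ 0], rule exI[of _ 0], rule exI[of _ 0]) (use that emb in simp)
  have nf_1: "nf i j" if "i \<le> m" "j < n" for i j
    unfolding nf_def by (rule exI[of _ i], rule exI[of _ j], rule exI[of _ 1]) (use that emb L_zero in simp)
  have nf_trans: "nf i j" if 1: "x ^ i * y ^ j - emb t * (x ^ k * y ^ l) \<in> L (a * i + b * j)"
    and wt: "a * i + b * j = a * k + b * l" and nf: "nf k l" for i j k l t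
  proof -
    obtain i' j' s where s: "x ^ k * y ^ l - emb s * (x ^ i' * y ^ j') \<in> L (a * k + b * l)"
      "s = 0 \<or> i' \<le> m \<and> j' < n \<and> a * i' + b * j' = a * k + b * l"
      using nf unfolding nf_def by blast
    have "(x ^ i * y ^ j - emb t * (x ^ k * y ^ l)) + emb t * (x ^ k * y ^ l - emb s * (x ^ i' * y ^ j')) \<in> L (a * i + b * j)"
      using 1 s(1) wt by (intro L_add L_scale) simp_all
    then have "x ^ i * y ^ j - emb (t * s) * (x ^ i' * y ^ j') \<in> L (a * i + b * j)"
      by (simp add: emb algebra_simps)
    then show ?thesis
      unfolding nf_def by (rule exI[of _ i', OF exI[of _ j', OF exI[of _ "t * s"], OF conjI]]) (use s(2) wt in auto)
  qed
  have up: "x ^ (m' + i) * y ^ (n' + j) = (x ^ i * y ^ j) * (x ^ m' * y ^ n')" for m' n' i j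
    by (simp add: power_add mult_ac)
  have Q1: "x ^ i * y ^ (n + j) - emb c * (x ^ (m + i) * y ^ j) \<in> L (a * i + b * (n + j))" for i j
  proof -
    have "(x ^ i * y ^ j) * (y ^ n - emb c * x ^ m) \<in> L (a * i + b * (n + j))"
      by (rule L_mult[OF P1 xy]) (simp add: algebra_simps)
    then show ?thesis by (simp add: power_add algebra_simps)
  qed
  have Q2: "x ^ (Suc m + i) * y ^ j - emb \<kappa> * (x ^ (m + i) * y ^ Suc j) \<in> L (a * (Suc m + i) + b * j)" for i j
  proof -
    have "(x ^ i * y ^ j) * (x ^ Suc m - emb \<kappa> * (x ^ m * y)) \<in> L (a * (Suc m + i) + b * j)"
      by (rule L_mult[OF P2 xy]) (simp add: algebra_simps)
    then show ?thesis by (simp add: power_add algebra_simps)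
  qed
  have "nf i j"
  proof (cases "c = 0 \<and> \<kappa> = 0")
    case True
    consider "n \<le> j" | "Suc m \<le> i" | "i \<le> m" "j < n" by linarith
    then show ?thesis
    proof cases
      case 1
      then obtain j' where j: "j = n + j'" using le_Suc_ex by blast
      show ?thesis using Q1[of i j'] True unfolding j by (intro nf_0) (simp add: emb)
    next
      case 2
      then obtain i' where i: "i = Suc m + i'" using le_Suc_ex by blast
      show ?thesis using Q2[of i' j] True unfolding i by (intro nf_0) (simp add: emb)
    qed (rule nf_1)
  next
    case False
    then have mn: "m = n" "a = b" and unit: "(1 - emb \<kappa> ^ n * emb c) dvd 1" using cases by auto
    have pow: "x ^ (Suc n + i + k) * y ^ j - emb \<kappa> ^ k * (x ^ (Suc n + i) * y ^ (k + j)) \<in> L (a * (Suc n + i + k) + b * j)" for i j k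
    proof (induction k arbitrary: j)
      case (Suc k)
      have "x ^ (Suc n + (i + Suc k)) * y ^ j - emb \<kappa> * (x ^ (n + (i + Suc k)) * y ^ Suc j) \<in> L (a * (Suc n + i + Suc k) + b * j)"
        using Q2[of "i + Suc k" j] mn by (simp add: add.assoc)
      moreover have "x ^ (Suc n + i + k) * y ^ Suc j - emb \<kappa> ^ k * (x ^ (Suc n + i) * y ^ (k + Suc j)) \<in> L (a * (Suc n + i + Suc k) + b * j)"
        using Suc.IH[of "Suc j"] mn by (simp add: algebra_simps)
      ultimately have "(x ^ (Suc n + (i + Suc k)) * y ^ j - emb \<kappa> * (x ^ (n + (i + Suc k)) * y ^ Suc j))
        + emb \<kappa> * (x ^ (Suc n + i + k) * y ^ Suc j - emb \<kappa> ^ k * (x ^ (Suc n + i) * y ^ (k + Suc j))) \<in> L (a * (Suc n + i + Suc k) + b * j)"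
        by (intro L_add L_scale)
      then show ?case by (simp add: algebra_simps)
    qed (simp add: L_zero)
    show ?thesis
    proof (cases "n = 0")
      case True
      have "(1 - emb \<kappa> ^ n * emb c) * 1 \<in> L 0" using P1 mn True by simp
      then have "1 \<in> L 0" by (rule L_unit[OF unit])
      then have "(x ^ i * y ^ j) * 1 \<in> L (a * i + b * j)" by (rule L_mult[OF _ xy]) simp
      then show ?thesis by (intro nf_0) simp
    next
      case n: False
      then obtain n' where n': "n = Suc n'" by (cases n) auto
      \<comment> \<open>Going once around the rewriting cycle returns the same monomial with the
        factor \<open>\<kappa> ^ n * c\<close>; the unit condition then removes it.\<close>
      have top: "x ^ (Suc n + i) * y ^ n' \<in> L (a * (Suc n + i) + b * n')" for i
      proof -
        have wt: "a * (Suc n + i) + b * n' = a * (n + (n + i))" using mn n' by (simp add: algebra_simps)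
        have "x ^ (Suc n + i) * y ^ n' - emb \<kappa> * (x ^ (n + i) * y ^ n) \<in> L (a * (n + (n + i)))"
          using Q2[of i n', unfolded mn(1) n'[symmetric]] unfolding wt[symmetric] .
        moreover have "x ^ (n + i) * y ^ n - emb c * x ^ (n + (n + i)) \<in> L (a * (n + (n + i)))"
          using Q1[of "n + i" 0] mn by (simp add: algebra_simps)
        moreover have "x ^ (n + (n + i)) - emb \<kappa> ^ n' * (x ^ (Suc n + i) * y ^ n') \<in> L (a * (n + (n + i)))"
          using pow[of i n' 0] n' by (simp add: algebra_simps)
        ultimately have "(x ^ (Suc n + i) * y ^ n' - emb \<kappa> * (x ^ (n + i) * y ^ n))
          + emb \<kappa> * ((x ^ (n + i) * y ^ n - emb c * x ^ (n + (n + i)))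
          + emb c * (x ^ (n + (n + i)) - emb \<kappa> ^ n' * (x ^ (Suc n + i) * y ^ n'))) \<in> L (a * (n + (n + i)))"
          by (intro L_add L_scale)
        then have "(1 - emb \<kappa> ^ n * emb c) * (x ^ (Suc n + i) * y ^ n') \<in> L (a * (n + (n + i)))"
          by (simp add: n' algebra_simps)
        then show ?thesis unfolding wt by (rule L_unit[OF unit])
      qed
      \<comment> \<open>The second relation trades a factor x for a factor y until either the
        x-exponent is small enough or the last column is reached, which \<open>top\<close>
        settles.\<close>
      have small: "nf i j" if "j < n" for i j
        using that
      proof (induction "n - j" arbitrary: i j rule: less_induct)
        case less
        show ?case
        proof (cases "i \<le> n")
          case True
          then show ?thesis using less.prems mn by (intro nf_1) simp_all
        next
          case False
          then obtain i' where i: "i = Suc n + i'" using le_Suc_ex[of "Suc n" i] by auto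
          show ?thesis
          proof (cases "j = n'")
            case True
            then show ?thesis using top[of i'] i by (intro nf_0) simp
          next
            case False
            then have nf': "nf (n + i') (Suc j)" using less.prems n' by (intro less.hyps) auto
            have "x ^ i * y ^ j - emb \<kappa> * (x ^ (n + i') * y ^ Suc j) \<in> L (a * i + b * j)"
              using Q2[of i' j, unfolded mn(1)] unfolding i .
            then show ?thesis by (rule nf_trans[OF _ _ nf']) (simp add: i mn(2))
          qed
        qed
      qed
      show ?thesis
      proof (induction j arbitrary: i rule: less_induct)
        case (less j)
        show ?case
        proof (cases "j < n")
          case False
          then obtain j' where j: "j = n + j'" using le_Suc_ex[of n j] by auto
          have nf': "nf (n + i) j'" using less[of j'] j n by simp
          have "x ^ i * y ^ j - emb c * (x ^ (n + i) * y ^ j') \<in> L (a * i + b * j)"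
            using Q1[of i j', unfolded mn(1)] unfolding j .
          then show ?thesis by (rule nf_trans[OF _ _ nf']) (simp add: j mn(2) algebra_simps)
        qed (rule small)
      qed
    qed
  qed
  then show ?thesis unfolding nf_def .
qed

text \<open>For \<open>c = 0\<close> the relations already give \<open>z\<close>. Otherwise two
  expressions for c x^(n+1) y yield z x = \<rho> z y with \<rho> = c c0 / c1. Inserted into z (y^n -
  c x^n), this gives z y^n by the unit condition, and multiplying by y once more gives c1
  z^2.\<close>

lemma square_in_L:
  assumes z: "z \<in> G p" and p: "p = a * Suc m" "p = b * Suc n"
    and P1: "y ^ n - c * x ^ m \<in> L (b * n)"
    and Y: "y ^ Suc n - c1 * z \<in> L p" and X': "x ^ Suc m - c0 * z \<in> L p"
    and c1: "c1 * k1 = 1"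
    and cases: "c = 0 \<or> m = n \<and> a = b \<and> (1 - c * (c * c0 * k1) ^ n) dvd 1"
  shows "z\<^sup>2 \<in> L (2 * p)"
proof -
  have c1u: "c1 dvd 1" using c1[symmetric] by (rule dvdI)
  show ?thesis
  proof (cases "c = 0")
    case True
    have "y * (y ^ n - c * x ^ m) \<in> L p" by (rule L_mult[OF P1 y]) (use p in simp)
    then have "y ^ Suc n \<in> L p" using True by simp
    from L_diff[OF this Y] have "c1 * z \<in> L p" by simp
    then have "z \<in> L p" by (rule L_unit[OF c1u])
    then have "z * z \<in> L (2 * p)" by (rule L_mult[OF _ z]) simp
    then show ?thesis by (simp add: power2_eq_square)
  next
    case False
    then have mn: "m = n" "a = b" and unit: "(1 - c * (c * c0 * k1) ^ n) dvd 1" using cases by auto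
    define \<rho> where "\<rho> = c * c0 * k1"
    have P1': "y ^ n - c * x ^ n \<in> L (a * n)" using P1 mn by simp
    have pa: "p = a * n + a" using p mn by simp
    have 1: "y * (y ^ n - c * x ^ n) \<in> L p" by (rule L_mult[OF P1']) (use y mn pa in simp_all)
    from L_diff[OF Y this] have "c * (x ^ n * y) - c1 * z \<in> L p" by (simp add: algebra_simps)
    then have A: "x * (c * (x ^ n * y) - c1 * z) \<in> L (p + a)" by (rule L_mult[OF _ x]) simp
    have B: "(c * y) * (x ^ Suc n - c0 * z) \<in> L (p + a)"
      by (rule L_mult[of _ p _ a]) (use X' mn y in \<open>simp_all add: Fil_mult1\<close>)
    from L_diff[OF B A] have "c1 * (z * x) - c * c0 * (z * y) \<in> L (p + a)" by (simp add: algebra_simps)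
    from L_scale[OF this, of k1] have "(c1 * k1) * (z * x) - \<rho> * (z * y) \<in> L (p + a)"
      by (simp add: \<rho>_def algebra_simps)
    then have zx: "z * x - \<rho> * (z * y) \<in> L (p + a)" by (simp add: c1)
    have zxn: "z * x ^ i - \<rho> ^ i * (z * y ^ i) \<in> L (p + a * i)" for i
    proof (induction i)
      case (Suc i)
      have "x * (z * x ^ i - \<rho> ^ i * (z * y ^ i)) \<in> L (p + a * Suc i)" by (rule L_mult[OF Suc x]) simp
      moreover have "(\<rho> ^ i * y ^ i) * (z * x - \<rho> * (z * y)) \<in> L (p + a * Suc i)"
        by (rule L_mult[OF zx, of _ "a * i"]) (use Fil_power[OF y, of i] mn in \<open>simp_all add: Fil_mult1 mult.commute\<close>)
      ultimately have "x * (z * x ^ i - \<rho> ^ i * (z * y ^ i)) + (\<rho> ^ i * y ^ i) * (z * x - \<rho> * (z * y)) \<in> L (p + a * Suc i)"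
        by (rule L_add)
      then show ?case by (simp add: algebra_simps)
    qed (simp add: L_zero)
    have "z * (y ^ n - c * x ^ n) \<in> L (p + a * n)" by (rule L_mult[OF P1' z]) simp
    from L_add[OF this L_scale[OF zxn[of n], of c]]
    have "(1 - c * (c * c0 * k1) ^ n) * (z * y ^ n) \<in> L (p + a * n)" by (simp add: \<rho>_def algebra_simps)
    then have "z * y ^ n \<in> L (p + a * n)" by (rule L_unit[OF unit])
    then have "y * (z * y ^ n) \<in> L (2 * p)" by (rule L_mult[OF _ y]) (use mn pa in simp)
    moreover have "z * (y ^ Suc n - c1 * z) \<in> L (2 * p)" by (rule L_mult[OF Y z]) simp
    ultimately have "y * (z * y ^ n) - z * (y ^ Suc n - c1 * z) \<in> L (2 * p)" by (rule L_diff)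
    then have "c1 * z\<^sup>2 \<in> L (2 * p)" by (simp add: power2_eq_square algebra_simps)
    then show ?thesis by (rule L_unit[OF c1u])
  qed
qed

end

end


section \<open>Spanning sets of quotients\<close>

definition cst :: "'v::comm_ring_1 \<Rightarrow> 'v fps fps fps" where "cst c = const2 (fps_const c)"
definition veps :: "'v::comm_ring_1 fps fps fps" where "veps = const2 fps_X"

lemma cst_hom: "cst (a + b) = cst a + cst b" "cst (a * b) = cst a * cst b" "cst 0 = 0" "cst 1 = 1"
  "cst (a - b) = cst a - cst b" "cst (- a) = - cst a"
  by (simp_all add: cst_def const2_add const2_mult const2_0 const2_1 const2_diff const2_minus
      flip: fps_const_add fps_const_mult fps_const_sub fps_const_neg)

lemma wfil_reduce_xy:
  assumes V: "filtered V" and pos: "0 < a" "0 < b" and u: "u \<in> wfil b (wfil a V) n"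
    and Q_add: "\<And>u v. Q u \<Longrightarrow> Q v \<Longrightarrow> Q (u + v)"
    and Q_higher: "\<And>u. u \<in> wfil b (wfil a V) (Suc n) \<Longrightarrow> Q u"
    and Q_monom: "\<And>c i j. a * i + b * j \<le> n \<Longrightarrow> c \<in> V (n - (a * i + b * j)) \<Longrightarrow> Q (const2 c * (varx ^ i * vary ^ j))"
  shows "Q u"
proof (rule wfil_reduce[where Q = Q, OF filtered_wfil[OF V] pos(2) u Q_add Q_higher])
  fix g j assume j: "b * j \<le> n" and g: "g \<in> wfil a V (n - b * j)"
  show "Q (fps_const g * fps_X ^ j)"
  proof (rule wfil_reduce[OF V pos(1) g, where Q = "\<lambda>g. Q (fps_const g * fps_X ^ j)"])
    fix g h assume "Q (fps_const g * fps_X ^ j)" "Q (fps_const h * fps_X ^ j)"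
    from Q_add[OF this] show "Q (fps_const (g + h) * fps_X ^ j)"
      by (simp add: distrib_right flip: fps_const_add)
  next
    fix g assume "g \<in> wfil a V (Suc (n - b * j))"
    then show "Q (fps_const g * fps_X ^ j)"
      using j by (intro Q_higher wfil_monom filtered_wfil V) (simp add: Suc_diff_le)
  next
    fix c i assume i: "a * i \<le> n - b * j" and c: "c \<in> V (n - b * j - a * i)"
    have "fps_const (fps_const c * fps_X ^ i) * fps_X ^ j = const2 c * (varx ^ i * vary ^ j)"
      by (simp add: const2_def varx_def vary_def fps_const_power mult.assoc flip: fps_const_mult)
    then show "Q (fps_const (fps_const c * fps_X ^ i) * fps_X ^ j)"
      using Q_monom[of i j c] i j c by (simp add: add.commute)
  qed
qed

lemma wfil_reduce_xye:
  assumes V: "filtered V" and pos: "0 < a" "0 < b" "0 < e" and u: "u \<in> wfil b (wfil a (wfil e V)) n"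
    and Q_add: "\<And>u v. Q u \<Longrightarrow> Q v \<Longrightarrow> Q (u + v)"
    and Q_higher: "\<And>u. u \<in> wfil b (wfil a (wfil e V)) (Suc n) \<Longrightarrow> Q u"
    and Q_monom: "\<And>c i j l. a * i + b * j + e * l \<le> n \<Longrightarrow> c \<in> V (n - (a * i + b * j + e * l)) \<Longrightarrow>
      Q (cst c * (veps ^ l * (varx ^ i * vary ^ j)))"
  shows "Q u"
proof (rule wfil_reduce_xy[where Q = Q, OF filtered_wfil[OF V] pos(1,2) u Q_add Q_higher])
  fix g i j assume ij: "a * i + b * j \<le> n" and g: "g \<in> wfil e V (n - (a * i + b * j))"
  show "Q (const2 g * (varx ^ i * vary ^ j))"
  proof (rule wfil_reduce[OF V pos(3) g, where Q = "\<lambda>g. Q (const2 g * (varx ^ i * vary ^ j))"])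
    fix g h assume "Q (const2 g * (varx ^ i * vary ^ j))" "Q (const2 h * (varx ^ i * vary ^ j))"
    from Q_add[OF this] show "Q (const2 (g + h) * (varx ^ i * vary ^ j))"
      by (simp add: distrib_right const2_add)
  next
    fix g assume g: "g \<in> wfil e V (Suc (n - (a * i + b * j)))"
    have "const2 g * (varx ^ i * vary ^ j) = fps_const (fps_const g * fps_X ^ i) * fps_X ^ j"
      by (simp add: const2_def varx_def vary_def fps_const_power mult.assoc flip: fps_const_mult)
    also have "\<dots> \<in> wfil b (wfil a (wfil e V)) (Suc n)"
      using g ij by (intro wfil_monom filtered_wfil V) (simp add: Suc_diff_le add.commute)
    finally show "Q (const2 g * (varx ^ i * vary ^ j))" by (rule Q_higher)
  next
    fix c l assume l: "e * l \<le> n - (a * i + b * j)" and c: "c \<in> V (n - (a * i + b * j) - e * l)"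
    have "const2 (fps_const c * fps_X ^ l) = cst c * veps ^ l"
      by (simp add: cst_def veps_def const2_def fps_const_power flip: fps_const_mult)
    then show "Q (const2 (fps_const c * fps_X ^ l) * (varx ^ i * vary ^ j))"
      using Q_monom[of i j l c] l ij c by (simp add: mult.assoc)
  qed
qed

context leading
begin

text \<open>One step of division with remainder: a monomial with coefficient is replaced by its
  normal form, leaving an error of higher weight.\<close>

lemma L_remainder_step:
  fixes emb :: "'v::comm_ring_1 \<Rightarrow> 'r"
  assumes FV: "filtered FV" and emb: "\<And>s t. emb (s * t) = emb s * emb t" "emb 0 = 0"
    and emb_G: "\<And>c k. c \<in> FV k \<Longrightarrow> emb c \<in> G k"
    and J: "finite J" "\<And>x. x \<in> J \<Longrightarrow> wt x \<le> w"
    and nf: "u - emb s * mo x \<in> L d" "s = 0 \<or> x \<in> J \<and> wt x = d"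
    and c: "c \<in> FV (n - d)" and d: "d \<le> n"
  shows "\<exists>a b. (\<forall>i<r. a i \<in> G (n - w)) \<and> (\<forall>x\<in>J. b x \<in> FV (n - w)) \<and>
    emb c * u - ((\<Sum>i<r. a i * g i) + (\<Sum>x\<in>J. emb (b x) * mo x)) \<in> G (Suc n)"
proof -
  interpret V: filtered FV by fact
  have "emb c * (u - emb s * mo x) \<in> L n" using nf(1) emb_G[OF c] by (rule L_mult) (use d in simp)
  then obtain a where a: "\<forall>i<r. a i \<in> G (n - w)"
    and u: "emb c * (u - emb s * mo x) - (\<Sum>i<r. a i * g i) \<in> G (Suc n)" unfolding L_def by blast
  define b where "b z = (if s \<noteq> 0 \<and> z = x then c * s else 0)" for z
  have "(\<Sum>z\<in>J. emb (b z) * mo z) = emb c * emb s * mo x"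
  proof (cases "s = 0")
    case False
    then have "x \<in> J" using nf(2) by blast
    then have "(\<Sum>z\<in>J. emb (b z) * mo z) = (\<Sum>z\<in>J. if z = x then emb c * emb s * mo x else 0)"
      using False by (intro sum.cong) (auto simp: b_def emb)
    then show ?thesis using J(1) \<open>x \<in> J\<close> by simp
  qed (simp add: b_def emb)
  then have "emb c * u - ((\<Sum>i<r. a i * g i) + (\<Sum>x\<in>J. emb (b x) * mo x)) \<in> G (Suc n)"
    using u by (simp add: algebra_simps)
  moreover have "b z \<in> FV (n - w)" for z
  proof (cases "s \<noteq> 0 \<and> z = x")
    case True
    then have "d \<le> w" using nf(2) J(2) by blast
    then have "c \<in> FV (n - w)" using V.Fil_mono[OF c] by simp
    then show ?thesis unfolding b_def using True by (simp add: V.Fil_mult2)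
  qed (auto simp: b_def)
  ultimately show ?thesis using a by blast
qed

lemma remainder_add:
  fixes emb :: "'v::comm_ring_1 \<Rightarrow> 'r"
  assumes FV: "filtered FV" and emb: "\<And>s t. emb (s + t) = emb s + emb t"
    and 1: "\<exists>a b. (\<forall>i<r. a i \<in> G k) \<and> (\<forall>x\<in>J. b x \<in> FV k) \<and> u - ((\<Sum>i<r. a i * g i) + (\<Sum>x\<in>J. emb (b x) * mo x)) \<in> G n"
    and 2: "\<exists>a b. (\<forall>i<r. a i \<in> G k) \<and> (\<forall>x\<in>J. b x \<in> FV k) \<and> v - ((\<Sum>i<r. a i * g i) + (\<Sum>x\<in>J. emb (b x) * mo x)) \<in> G n"
  shows "\<exists>a b. (\<forall>i<r. a i \<in> G k) \<and> (\<forall>x\<in>J. b x \<in> FV k) \<and> (u + v) - ((\<Sum>i<r. a i * g i) + (\<Sum>x\<in>J. emb (b x) * mo x)) \<in> G n"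
proof -
  obtain a b where ab: "\<forall>i<r. a i \<in> G k" "\<forall>x\<in>J. b x \<in> FV k"
    "u - ((\<Sum>i<r. a i * g i) + (\<Sum>x\<in>J. emb (b x) * mo x)) \<in> G n" using 1 by blast
  obtain a' b' where ab': "\<forall>i<r. a' i \<in> G k" "\<forall>x\<in>J. b' x \<in> FV k"
    "v - ((\<Sum>i<r. a' i * g i) + (\<Sum>x\<in>J. emb (b' x) * mo x)) \<in> G n" using 2 by blast
  from Fil_add[OF ab(3) ab'(3)]
  have "(u + v) - ((\<Sum>i<r. (a i + a' i) * g i) + (\<Sum>x\<in>J. emb (b x + b' x) * mo x)) \<in> G n"
    by (simp add: emb distrib_right sum.distrib algebra_simps)
  then show ?thesis
    using ab ab' by (intro exI[of _ "\<lambda>i. a i + a' i"] exI[of _ "\<lambda>x. b x + b' x"])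
      (auto intro: Fil_add filtered.Fil_add[OF FV])
qed

end

lemma span_xy:
  fixes FV :: "nat \<Rightarrow> 'c::comm_ring_1 set" and g :: "nat \<Rightarrow> 'c fps fps"
  assumes FV: "filtered FV" and pos: "0 < a" "0 < b" and G: "G = wfil b (wfil a FV)"
    and J: "finite J" "\<And>i j. (i, j) \<in> J \<Longrightarrow> a * i + b * j \<le> w"
    and nf: "\<And>i j. varx ^ i * vary ^ j \<in> leading.L G g r w (a * i + b * j) \<or> (i, j) \<in> J"
  shows "\<exists>c k. u = (\<Sum>i<r. k i * g i) + (\<Sum>x\<in>J. const2 (c x) * (varx ^ fst x * vary ^ snd x))"
proof -
  have G': "filtered G" unfolding G by (intro filtered_wfil FV)
  interpret leading G g r w using G' by (rule leading.intro)
  have wtJ: "a * fst x + b * snd x \<le> w" if "x \<in> J" for x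
    using J(2)[of "fst x" "snd x"] that by simp
  have emb_G: "const2 c \<in> G k" if "c \<in> FV k" for c k
    using that unfolding G const2_def by (intro wfil_const filtered_wfil FV)
  have "\<exists>k c. u = (\<Sum>i\<in>{..<r}. k i * g i) + (\<Sum>x\<in>J. const2 (c x) * (varx ^ fst x * vary ^ snd x))"
  proof (rule approx_rem[where FV = FV and Q = G and w = w and N = 0])
    fix n u assume "0 \<le> n" and u: "u \<in> G n"
    have "\<exists>a b. (\<forall>i<r. a i \<in> G (n - w)) \<and> (\<forall>x\<in>J. b x \<in> FV (n - w)) \<and>
      u - ((\<Sum>i<r. a i * g i) + (\<Sum>x\<in>J. const2 (b x) * (varx ^ fst x * vary ^ snd x))) \<in> G (Suc n)"
    proof (rule wfil_reduce_xy[OF FV pos u[unfolded G]])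
      fix u v
      assume "\<exists>a b. (\<forall>i<r. a i \<in> G (n - w)) \<and> (\<forall>x\<in>J. b x \<in> FV (n - w)) \<and>
        u - ((\<Sum>i<r. a i * g i) + (\<Sum>x\<in>J. const2 (b x) * (varx ^ fst x * vary ^ snd x))) \<in> G (Suc n)"
      "\<exists>a b. (\<forall>i<r. a i \<in> G (n - w)) \<and> (\<forall>x\<in>J. b x \<in> FV (n - w)) \<and>
        v - ((\<Sum>i<r. a i * g i) + (\<Sum>x\<in>J. const2 (b x) * (varx ^ fst x * vary ^ snd x))) \<in> G (Suc n)"
      then show "\<exists>a b. (\<forall>i<r. a i \<in> G (n - w)) \<and> (\<forall>x\<in>J. b x \<in> FV (n - w)) \<and>
        (u + v) - ((\<Sum>i<r. a i * g i) + (\<Sum>x\<in>J. const2 (b x) * (varx ^ fst x * vary ^ snd x))) \<in> G (Suc n)"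
        by (rule remainder_add[OF FV const2_add])
    next
      fix u assume "u \<in> wfil b (wfil a FV) (Suc n)"
      then show "\<exists>a b. (\<forall>i<r. a i \<in> G (n - w)) \<and> (\<forall>x\<in>J. b x \<in> FV (n - w)) \<and>
        u - ((\<Sum>i<r. a i * g i) + (\<Sum>x\<in>J. const2 (b x) * (varx ^ fst x * vary ^ snd x))) \<in> G (Suc n)"
        unfolding G[symmetric] by (intro exI[of _ "\<lambda>_. 0"]) (simp add: const2_0 filtered.Fil_zero[OF FV])
    next
      fix c i j assume ij: "a * i + b * j \<le> n" and c: "c \<in> FV (n - (a * i + b * j))"
      from nf[of i j]
      have "\<exists>s. varx ^ i * vary ^ j - const2 s * (varx ^ fst (i, j) * vary ^ snd (i, j)) \<in> L (a * i + b * j)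
          \<and> (s = 0 \<or> (i, j) \<in> J \<and> a * fst (i, j) + b * snd (i, j) = a * i + b * j)"
      proof
        assume "varx ^ i * vary ^ j \<in> L (a * i + b * j)"
        then show ?thesis by (intro exI[of _ 0]) (simp add: const2_0)
      next
        assume "(i, j) \<in> J"
        then show ?thesis by (intro exI[of _ 1]) (simp add: const2_1 L_zero)
      qed
      then obtain s where "varx ^ i * vary ^ j - const2 s * (varx ^ fst (i, j) * vary ^ snd (i, j)) \<in> L (a * i + b * j)"
          "s = 0 \<or> (i, j) \<in> J \<and> a * fst (i, j) + b * snd (i, j) = a * i + b * j" by blast
      from L_remainder_step[where emb = const2 and mo = "\<lambda>x. varx ^ fst x * vary ^ snd x"
          and wt = "\<lambda>x. a * fst x + b * snd x", OF FV const2_mult const2_0 emb_G J(1) wtJ this c ij]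
      show "\<exists>k d. (\<forall>i<r. k i \<in> G (n - w)) \<and> (\<forall>x\<in>J. d x \<in> FV (n - w)) \<and>
        const2 c * (varx ^ i * vary ^ j) - ((\<Sum>i<r. k i * g i) + (\<Sum>x\<in>J. const2 (d x) * (varx ^ fst x * vary ^ snd x))) \<in> G (Suc n)"
        .
    qed
    then show "\<exists>a b. (\<forall>i\<in>{..<r}. a i \<in> G (n - w)) \<and> (\<forall>x\<in>J. b x \<in> FV (n - w)) \<and>
      u - ((\<Sum>i<r. a i * g i) + (\<Sum>x\<in>J. const2 (b x) * (varx ^ fst x * vary ^ snd x))) \<in> G (Suc n)"
      by (simp only: Ball_def lessThan_iff)
  qed (use FV const2_add emb_G J(1) in auto)
  then show ?thesis by blast
qed

text \<open>Here the parameter is itself a leading form, so the remainders involve x and y alone; in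
  \<open>span_xy\<close> the parameter stays in the coefficients.\<close>

lemma span_xye:
  fixes FV :: "nat \<Rightarrow> 'v::comm_ring_1 set" and g :: "nat \<Rightarrow> 'v fps fps fps"
  assumes FV: "filtered FV" and pos: "0 < a" "0 < b" "0 < e" and G: "G = wfil b (wfil a (wfil e FV))"
    and J: "finite J" "\<And>i j. (i, j) \<in> J \<Longrightarrow> a * i + b * j \<le> w"
    and eps: "veps \<in> leading.L G g r w e"
    and nf: "\<And>i j. \<exists>i' j' s. varx ^ i * vary ^ j - cst s * (varx ^ i' * vary ^ j') \<in> leading.L G g r w (a * i + b * j)
      \<and> (s = 0 \<or> (i', j') \<in> J \<and> a * i' + b * j' = a * i + b * j)"
  shows "\<exists>c k. u = (\<Sum>i<r. k i * g i) + (\<Sum>x\<in>J. cst (c x) * (varx ^ fst x * vary ^ snd x))"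
proof -
  have G': "filtered G" unfolding G by (intro filtered_wfil FV)
  interpret leading G g r w using G' by (rule leading.intro)
  have wtJ: "a * fst x + b * snd x \<le> w" if "x \<in> J" for x
    using J(2)[of "fst x" "snd x"] that by simp
  have emb_G: "cst c \<in> G k" if "c \<in> FV k" for c k
    using that unfolding G cst_def const2_def by (intro wfil_const filtered_wfil FV)
  have xG: "varx \<in> G a" unfolding G varx_def by (intro wfil_const wfil_X filtered_wfil FV) simp
  have yG: "vary \<in> G b" unfolding G vary_def by (intro wfil_X filtered_wfil FV) simp
  have eG: "veps \<in> G e" unfolding G veps_def const2_def by (intro wfil_const wfil_X filtered_wfil FV) simp
  have "\<exists>k c. u = (\<Sum>i\<in>{..<r}. k i * g i) + (\<Sum>x\<in>J. cst (c x) * (varx ^ fst x * vary ^ snd x))"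
  proof (rule approx_rem[where FV = FV and Q = G and w = w and N = 0])
    fix n u assume "0 \<le> n" and u: "u \<in> G n"
    have "\<exists>a b. (\<forall>i<r. a i \<in> G (n - w)) \<and> (\<forall>x\<in>J. b x \<in> FV (n - w)) \<and>
      u - ((\<Sum>i<r. a i * g i) + (\<Sum>x\<in>J. cst (b x) * (varx ^ fst x * vary ^ snd x))) \<in> G (Suc n)"
    proof (rule wfil_reduce_xye[OF FV pos u[unfolded G]])
      fix u v
      assume "\<exists>a b. (\<forall>i<r. a i \<in> G (n - w)) \<and> (\<forall>x\<in>J. b x \<in> FV (n - w)) \<and>
        u - ((\<Sum>i<r. a i * g i) + (\<Sum>x\<in>J. cst (b x) * (varx ^ fst x * vary ^ snd x))) \<in> G (Suc n)"
      "\<exists>a b. (\<forall>i<r. a i \<in> G (n - w)) \<and> (\<forall>x\<in>J. b x \<in> FV (n - w)) \<and>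
        v - ((\<Sum>i<r. a i * g i) + (\<Sum>x\<in>J. cst (b x) * (varx ^ fst x * vary ^ snd x))) \<in> G (Suc n)"
      then show "\<exists>a b. (\<forall>i<r. a i \<in> G (n - w)) \<and> (\<forall>x\<in>J. b x \<in> FV (n - w)) \<and>
        (u + v) - ((\<Sum>i<r. a i * g i) + (\<Sum>x\<in>J. cst (b x) * (varx ^ fst x * vary ^ snd x))) \<in> G (Suc n)"
        by (rule remainder_add[OF FV cst_hom(1)])
    next
      fix u assume "u \<in> wfil b (wfil a (wfil e FV)) (Suc n)"
      then show "\<exists>a b. (\<forall>i<r. a i \<in> G (n - w)) \<and> (\<forall>x\<in>J. b x \<in> FV (n - w)) \<and>
        u - ((\<Sum>i<r. a i * g i) + (\<Sum>x\<in>J. cst (b x) * (varx ^ fst x * vary ^ snd x))) \<in> G (Suc n)"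
        unfolding G[symmetric] by (intro exI[of _ "\<lambda>_. 0"]) (simp add: cst_hom filtered.Fil_zero[OF FV])
    next
      fix c i j l assume ijl: "a * i + b * j + e * l \<le> n" and c: "c \<in> FV (n - (a * i + b * j + e * l))"
      have "\<exists>x s. veps ^ l * (varx ^ i * vary ^ j) - cst s * (varx ^ fst x * vary ^ snd x) \<in> L (a * i + b * j + e * l)
          \<and> (s = 0 \<or> x \<in> J \<and> a * fst x + b * snd x = a * i + b * j + e * l)"
      proof (cases l)
        case 0
        obtain i' j' s where "varx ^ i * vary ^ j - cst s * (varx ^ i' * vary ^ j') \<in> L (a * i + b * j)"
          "s = 0 \<or> (i', j') \<in> J \<and> a * i' + b * j' = a * i + b * j" using nf by blast
        then show ?thesis using 0 by (intro exI[of _ "(i', j')"] exI[of _ s]) simp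
      next
        case (Suc l')
        have "veps ^ l' * (varx ^ i * vary ^ j) \<in> G (l' * e + (i * a + j * b))"
          by (intro Fil_mult Fil_power xG yG eG)
        then have "(veps ^ l' * (varx ^ i * vary ^ j)) * veps \<in> L (a * i + b * j + e * l)"
          by (rule L_mult[OF eps]) (simp add: Suc algebra_simps)
        then show ?thesis using Suc by (intro exI[of _ "(0, 0)"] exI[of _ 0]) (simp add: cst_hom mult_ac)
      qed
      then obtain x s where "veps ^ l * (varx ^ i * vary ^ j) - cst s * (varx ^ fst x * vary ^ snd x) \<in> L (a * i + b * j + e * l)"
          "s = 0 \<or> x \<in> J \<and> a * fst x + b * snd x = a * i + b * j + e * l" by blast
      from L_remainder_step[where emb = cst and mo = "\<lambda>x. varx ^ fst x * vary ^ snd x"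
          and wt = "\<lambda>x. a * fst x + b * snd x", OF FV cst_hom(2,3) emb_G J(1) wtJ this c ijl]
      show "\<exists>k d. (\<forall>i<r. k i \<in> G (n - w)) \<and> (\<forall>x\<in>J. d x \<in> FV (n - w)) \<and>
        cst c * (veps ^ l * (varx ^ i * vary ^ j)) - ((\<Sum>i<r. k i * g i) + (\<Sum>x\<in>J. cst (d x) * (varx ^ fst x * vary ^ snd x))) \<in> G (Suc n)"
        .
    qed
    then show "\<exists>a b. (\<forall>i\<in>{..<r}. a i \<in> G (n - w)) \<and> (\<forall>x\<in>J. b x \<in> FV (n - w)) \<and>
      u - ((\<Sum>i<r. a i * g i) + (\<Sum>x\<in>J. cst (b x) * (varx ^ fst x * vary ^ snd x))) \<in> G (Suc n)"
      by (simp only: Ball_def lessThan_iff)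
  qed (use FV cst_hom(1) emb_G J(1) in auto)
  then show ?thesis by blast
qed


section \<open>Lengths of finite-dimensional algebras\<close>

definition loc_kernel :: "'a::comm_ring_1 set \<Rightarrow> 'a set \<Rightarrow> 'a set" where
  "loc_kernel K P = {v. \<exists>u. u \<notin> P \<and> u * v \<in> K}"

locale scalar_algebra = vector_space scale for scale :: "'l::field \<Rightarrow> 'a::comm_ring_1 \<Rightarrow> 'a" +
  assumes scale_mult: "scale c (a * b) = scale c a * b"
begin

lemma scale_mult2: "scale c (a * b) = a * scale c b"
  using scale_mult[of c b a] by (simp add: mult.commute)

lemma scale_one_mult: "scale c a = scale c 1 * a"
  using scale_mult[of c 1 a] by simp

lemma ideal_subspace:
  assumes K: "ideal.subspace K"
  shows "subspace K"
proof (rule subspaceI)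
  show "scale c a \<in> K" if "a \<in> K" for c a
    unfolding scale_one_mult[of c a] by (rule ideal.subspace_scale[OF K that])
qed (use ideal.subspace_0[OF K] ideal.subspace_add[OF K] in auto)

text \<open>Multiplying a family of fractions by the product of their denominators, a unit of the
  localization, turns them into elements of the ring and preserves independence.\<close>

lemma localization_dim_eq:
  assumes "prime_ideal P"
  shows "localization_dim scale K P = quotient_dim scale (loc_kernel K P)"
proof -
  have one: "1 \<notin> P" using assms by (simp add: prime_ideal_def)
  have "(\<exists>a s :: nat \<Rightarrow> 'a. (\<forall>i<n. s i \<notin> P) \<and>
     (\<forall>c. (\<exists>u. u \<notin> P \<and> u * (\<Sum>i<n. scale (c i) (a i) * (\<Prod>j\<in>{..<n} - {i}. s j)) \<in> K)
        \<longrightarrow> (\<forall>i<n. c i = 0))) \<longleftrightarrow>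
     (\<exists>v :: nat \<Rightarrow> 'a. \<forall>c. (\<Sum>i<n. scale (c i) (v i)) \<in> loc_kernel K P \<longrightarrow> (\<forall>i<n. c i = 0))" (is "?A \<longleftrightarrow> ?B") for n
  proof
    assume ?A
    then obtain a s :: "nat \<Rightarrow> 'a" where *: "\<And>c. (\<exists>u. u \<notin> P \<and> u * (\<Sum>i<n. scale (c i) (a i) * (\<Prod>j\<in>{..<n} - {i}. s j)) \<in> K)
        \<longrightarrow> (\<forall>i<n. c i = 0)" by blast
    show ?B
      by (rule exI[of _ "\<lambda>i. a i * (\<Prod>j\<in>{..<n} - {i}. s j)"]) (use * in \<open>simp add: loc_kernel_def scale_mult\<close>)
  next
    assume ?B
    then obtain v where *: "\<And>c. (\<Sum>i<n. scale (c i) (v i)) \<in> loc_kernel K P \<longrightarrow> (\<forall>i<n. c i = 0)" by blast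
    show ?A
      by (rule exI[of _ v], rule exI[of _ "\<lambda>_. 1"]) (use * one in \<open>simp add: loc_kernel_def\<close>)
  qed
  then show ?thesis unfolding localization_dim_def quotient_dim_def by simp
qed

lemma quotient_dim_basis:
  assumes "subspace K" "quotient_dim scale K \<le> enat n"
  obtains k :: nat and b :: "nat \<Rightarrow> 'a" where "k \<le> n" "quotient_dim scale K = enat k" "\<And>v. \<exists>c. v - (\<Sum>i<k. scale (c i) (b i)) \<in> K"
    "\<And>c. (\<Sum>i<k. scale (c i) (b i)) \<in> K \<Longrightarrow> \<forall>i<k. c i = 0"
proof -
  have "quotient_dim scale K < enat (Suc n)" using assms(2) by (simp add: order.strict_trans1)
  from quotient_dim_less_span[OF vector_space_axioms assms(1) this]
  obtain k b where kb: "k < Suc n" "\<And>v. \<exists>c. v - (\<Sum>i<k. scale (c i) (b i)) \<in> K"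
    "\<And>c. (\<Sum>i<k. scale (c i) (b i)) \<in> K \<Longrightarrow> \<forall>i<k. c i = 0" by blast
  have "quotient_dim scale K = enat k"
  proof (rule antisym)
    have "quotient_dim scale K \<le> enat (card {..<k})"
      by (rule quotient_dim_le[OF vector_space_axioms assms(1) finite_lessThan, where b = b]) (use kb(2) in auto)
    then show "quotient_dim scale K \<le> enat k" by simp
    have "enat (card {..<k}) \<le> quotient_dim scale K"
      by (rule quotient_dim_ge[OF finite_lessThan, where b = b]) (use kb(3) in auto)
    then show "enat k \<le> quotient_dim scale K" by simp
  qed
  moreover have "k \<le> n" using kb(1) by simp
  ultimately show ?thesis using kb(2,3) by (intro that[of k b])
qed

lemma quotient_dim_mono:
  assumes "subspace K'" "K \<subseteq> K'" "subspace K" "quotient_dim scale K = enat n"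
  shows "quotient_dim scale K' \<le> enat n"
proof -
  obtain k b where kb: "k \<le> n" "quotient_dim scale K = enat k" "\<And>v. \<exists>c. v - (\<Sum>i<k. scale (c i) (b i)) \<in> K"
    by (rule quotient_dim_basis[OF assms(3), of n]) (use assms(4) in simp, rule that)
  have "quotient_dim scale K' \<le> enat (card {..<k})"
  proof (rule quotient_dim_le[OF vector_space_axioms assms(1) finite_lessThan])
    show "\<exists>c. v - (\<Sum>j<k. scale (c j) (b j)) \<in> K'" for v using kb(3)[of v] assms(2) by blast
  qed
  then show ?thesis using kb assms(4) by simp
qed

lemma quotient_dim_pos: "1 \<notin> K \<Longrightarrow> ideal.subspace K \<Longrightarrow> 1 \<le> quotient_dim scale K"
proof -
  assume K: "1 \<notin> K" "ideal.subspace K"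
  have "enat (card {0::nat}) \<le> quotient_dim scale K"
  proof (rule quotient_dim_ge[where b = "\<lambda>_. 1"])
    fix c assume "(\<Sum>j\<in>{0::nat}. scale (c j) 1) \<in> K"
    then have c: "scale (c 0) 1 \<in> K" by simp
    have "c 0 = 0"
    proof (rule ccontr)
      assume "c 0 \<noteq> 0"
      have "scale (inverse (c 0)) (scale (c 0) 1) \<in> K" by (rule subspace_scale[OF ideal_subspace[OF K(2)] c])
      then show False using K(1) \<open>c 0 \<noteq> 0\<close> by simp
    qed
    then show "\<forall>j\<in>{0}. c j = 0" by simp
  qed simp
  moreover have "card {0::nat} = 1" by simp
  ultimately show ?thesis unfolding one_enat_def by (simp only:)
qed

lemma idempotent_split:
  assumes K: "ideal.subspace K" and e: "e * e - e \<in> K"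
  shows "v \<in> ideal_gen (insert e K) \<longleftrightarrow> (1 - e) * v \<in> K" "v \<in> ideal_gen (insert (1 - e) K) \<longleftrightarrow> e * v \<in> K"
proof -
  have gen: "ideal_gen K = K" using K by simp
  note K_simps = ideal.subspace_add[OF K] ideal.subspace_diff[OF K] ideal.subspace_scale[OF K]
  show "v \<in> ideal_gen (insert e K) \<longleftrightarrow> (1 - e) * v \<in> K"
  proof
    assume "v \<in> ideal_gen (insert e K)"
    then obtain k where k: "v - k * e \<in> K" by (rule ideal_gen_insertE) (simp add: gen)
    have "(1 - e) * (v - k * e) - k * (e * e - e) \<in> K" using k e by - (assumption | rule K_simps)+
    then show "(1 - e) * v \<in> K" by (simp add: algebra_simps)
  next
    assume "(1 - e) * v \<in> K"
    then show "v \<in> ideal_gen (insert e K)" by (intro ideal_gen_insertI[of v v]) (simp add: gen algebra_simps)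
  qed
  show "v \<in> ideal_gen (insert (1 - e) K) \<longleftrightarrow> e * v \<in> K"
  proof
    assume "v \<in> ideal_gen (insert (1 - e) K)"
    then obtain k where k: "v - k * (1 - e) \<in> K" by (rule ideal_gen_insertE) (simp add: gen)
    have "e * (v - k * (1 - e)) - k * (e * e - e) \<in> K" using k e by - (assumption | rule K_simps)+
    then show "e * v \<in> K" by (simp add: algebra_simps)
  next
    assume "e * v \<in> K"
    then show "v \<in> ideal_gen (insert (1 - e) K)" by (intro ideal_gen_insertI[of v v]) (simp add: gen algebra_simps)
  qed
qed

lemma quotient_dim_split:
  assumes K: "ideal.subspace K" and e: "e * e - e \<in> K" and n: "quotient_dim scale K = enat n"
  obtains n1 n2 where "quotient_dim scale (ideal_gen (insert e K)) = enat n1"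
    "quotient_dim scale (ideal_gen (insert (1 - e) K)) = enat n2" "n = n1 + n2"
proof -
  let ?K1 = "ideal_gen (insert e K)" and ?K2 = "ideal_gen (insert (1 - e) K)"
  note sub = ideal_subspace[OF K] ideal_subspace[OF ideal.subspace_span, of "insert e K"]
    ideal_subspace[OF ideal.subspace_span, of "insert (1 - e) K"]
  have sup: "K \<subseteq> ?K1" "K \<subseteq> ?K2" using ideal.span_superset by blast+
  note K_simps = ideal.subspace_add[OF K] ideal.subspace_diff[OF K] ideal.subspace_scale[OF K]
  obtain n1 b1 where b1: "quotient_dim scale ?K1 = enat n1" "\<And>v. \<exists>c. v - (\<Sum>i<n1. scale (c i) (b1 i)) \<in> ?K1"
    "\<And>c. (\<Sum>i<n1. scale (c i) (b1 i)) \<in> ?K1 \<Longrightarrow> \<forall>i<n1. c i = 0"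
    by (rule quotient_dim_basis[OF sub(2) quotient_dim_mono[OF sub(2) sup(1) sub(1) n]], rule that)
  obtain n2 b2 where b2: "quotient_dim scale ?K2 = enat n2" "\<And>v. \<exists>c. v - (\<Sum>i<n2. scale (c i) (b2 i)) \<in> ?K2"
    "\<And>c. (\<Sum>i<n2. scale (c i) (b2 i)) \<in> ?K2 \<Longrightarrow> \<forall>i<n2. c i = 0"
    by (rule quotient_dim_basis[OF sub(3) quotient_dim_mono[OF sub(3) sup(2) sub(1) n]], rule that)
  define J where "J = {..<n1} <+> {..<n2}"
  define b where "b = case_sum (\<lambda>i. (1 - e) * b1 i) (\<lambda>i. e * b2 i)"
  have J: "finite J" "card J = n1 + n2" by (simp_all add: J_def card_Plus)
  have sumb: "(\<Sum>x\<in>J. scale (c x) (b x)) = (1 - e) * (\<Sum>i<n1. scale (c (Inl i)) (b1 i)) + e * (\<Sum>i<n2. scale (c (Inr i)) (b2 i))" for c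
    by (simp add: J_def b_def sum.Plus sum_distrib_left scale_mult2)
  have "quotient_dim scale K \<le> enat (card J)"
  proof (rule quotient_dim_le[OF vector_space_axioms sub(1) J(1)])
    fix v
    obtain c1 where c1: "v - (\<Sum>i<n1. scale (c1 i) (b1 i)) \<in> ?K1" using b1(2) by blast
    obtain c2 where c2: "v - (\<Sum>i<n2. scale (c2 i) (b2 i)) \<in> ?K2" using b2(2) by blast
    have "(1 - e) * (v - (\<Sum>i<n1. scale (c1 i) (b1 i))) + e * (v - (\<Sum>i<n2. scale (c2 i) (b2 i))) \<in> K"
      using c1 c2 idempotent_split[OF K e] by (intro K_simps(1)) blast+
    then have "v - (\<Sum>x\<in>J. scale (case_sum c1 c2 x) (b x)) \<in> K" unfolding sumb by (simp add: algebra_simps)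
    then show "\<exists>c. v - (\<Sum>x\<in>J. scale (c x) (b x)) \<in> K" by blast
  qed
  moreover have "enat (card J) \<le> quotient_dim scale K"
  proof (rule quotient_dim_ge[OF J(1)])
    fix c assume c: "(\<Sum>x\<in>J. scale (c x) (b x)) \<in> K"
    define s1 where "s1 = (\<Sum>i<n1. scale (c (Inl i)) (b1 i))"
    define s2 where "s2 = (\<Sum>i<n2. scale (c (Inr i)) (b2 i))"
    have s: "(1 - e) * s1 + e * s2 \<in> K" using c unfolding sumb s1_def s2_def .
    have "(1 - e) * ((1 - e) * s1 + e * s2) - (s1 - s2) * (e * e - e) \<in> K" using s e by - (assumption | rule K_simps)+
    moreover have "(1 - e) * ((1 - e) * s1 + e * s2) - (s1 - s2) * (e * e - e) = (1 - e) * s1" by (simp add: algebra_simps)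
    ultimately have s1: "(1 - e) * s1 \<in> K" by (simp only:)
    then have "s1 \<in> ?K1" unfolding idempotent_split(1)[OF K e] .
    from b1(3)[OF this[unfolded s1_def]] have 1: "\<forall>i<n1. c (Inl i) = 0" .
    have "((1 - e) * s1 + e * s2) - (1 - e) * s1 \<in> K" using s s1 by (rule K_simps(2))
    then have "s2 \<in> ?K2" unfolding idempotent_split(2)[OF K e] by simp
    from b2(3)[OF this[unfolded s2_def]] have 2: "\<forall>i<n2. c (Inr i) = 0" .
    show "\<forall>x\<in>J. c x = 0" using 1 2 by (auto simp: J_def)
  qed
  ultimately have "n = n1 + n2" using n J by simp
  with that b1(1) b2(1) show ?thesis by blast
qed

text \<open>The powers of \<open>a\<close> are dependent modulo \<open>K\<close>; a relation is
  divided by its lowest nonzero coefficient.\<close>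

lemma power_relation:
  assumes K: "ideal.subspace K" and n: "quotient_dim scale K = enat n"
  obtains m q where "a ^ m - a ^ Suc m * q \<in> K"
proof -
  have "\<exists>c. (\<Sum>i<Suc n. scale (c i) (a ^ i)) \<in> K \<and> \<not> (\<forall>i<Suc n. c i = 0)"
  proof (rule ccontr)
    assume "\<not> ?thesis"
    then have "enat (card {..<Suc n}) \<le> quotient_dim scale K"
      by (intro quotient_dim_ge[where b = "\<lambda>i. a ^ i"]) auto
    then show False using n by simp
  qed
  then obtain c where c: "(\<Sum>i<Suc n. scale (c i) (a ^ i)) \<in> K" "\<exists>i. i < Suc n \<and> c i \<noteq> 0" by blast
  define m where "m = (LEAST i. i < Suc n \<and> c i \<noteq> 0)"
  have m: "m < Suc n" "c m \<noteq> 0" using LeastI_ex[OF c(2)] unfolding m_def by blast+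
  have 0: "c i = 0" if "i < m" for i
    using not_less_Least[of i "\<lambda>i. i < Suc n \<and> c i \<noteq> 0"] that m unfolding m_def[symmetric] by auto
  obtain k where k: "Suc n = Suc m + k" using m(1) by (metis less_iff_Suc_add add_Suc)
  define q where "q = (\<Sum>i<k. scale (- inverse (c m) * c (Suc m + i)) (a ^ i))"
  have split: "(\<Sum>i<Suc m + k. f i) = (\<Sum>i<Suc m. f i) + (\<Sum>i<k. f (Suc m + i))" for f :: "nat \<Rightarrow> 'a" and k
    by (induction k) (simp_all add: add.assoc)
  have "(\<Sum>i<Suc n. scale (c i) (a ^ i)) = (\<Sum>i<Suc m. scale (c i) (a ^ i)) + (\<Sum>i<k. scale (c (Suc m + i)) (a ^ (Suc m + i)))"
    unfolding k by (rule split)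
  also have "(\<Sum>i<Suc m. scale (c i) (a ^ i)) = scale (c m) (a ^ m)" using 0 by simp
  finally have "scale (inverse (c m)) (scale (c m) (a ^ m) + (\<Sum>i<k. scale (c (Suc m + i)) (a ^ (Suc m + i)))) \<in> K"
    using c(1) by (intro subspace_scale[OF ideal_subspace[OF K]]) simp
  also have "scale (inverse (c m)) (scale (c m) (a ^ m) + (\<Sum>i<k. scale (c (Suc m + i)) (a ^ (Suc m + i))))
      = a ^ m - a ^ Suc m * q"
    using m(2) by (simp add: q_def scale_right_distrib scale_sum_right sum_distrib_left sum_negf
        scale_mult2[symmetric] power_add[symmetric] mult.assoc[symmetric] del: power_Suc)
  finally show ?thesis by (rule that)
qed

text \<open>Induction on the dimension. If modulo \<open>K\<close> every element is nilpotent or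
  invertible, the nilpotent ones form the only prime above \<open>K\<close>, and localizing there
  changes nothing. Otherwise \<open>power_relation\<close> for an element that is neither yields a
  nontrivial idempotent, which splits the algebra into two smaller ones and distributes the primes
  among them.\<close>

theorem length_sum:
  assumes "ideal.subspace K" "quotient_dim scale K = enat n"
  shows "finite {P. prime_ideal P \<and> K \<subseteq> P}
    \<and> (\<Sum>P\<in>{P. prime_ideal P \<and> K \<subseteq> P}. quotient_dim scale (loc_kernel K P)) = enat n"
  using assms
proof (induction n arbitrary: K rule: less_induct)
  case (less n)
  note K = less.prems(1) and n = less.prems(2)
  note K_simps = ideal.subspace_add[OF K] ideal.subspace_diff[OF K] ideal.subspace_scale[OF K]
  have primeD: "ideal.subspace P" "1 \<notin> P" "\<And>a b. a * b \<in> P \<Longrightarrow> a \<in> P \<or> b \<in> P" if "prime_ideal P" for P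
    using that unfolding prime_ideal_def by blast+
  have prime_power: "a \<in> P" if "prime_ideal P" "a ^ m \<in> P" for P a m
    using that(2) by (induction m) (use primeD[OF that(1)] in auto)
  show ?case
  proof (cases "1 \<in> K")
    case True
    then have "K = UNIV" using K_simps(3)[of 1] by force
    then have none: "{P. prime_ideal P \<and> K \<subseteq> P} = {}" using primeD(2) by auto
    have "quotient_dim scale K \<le> enat (card ({} :: nat set))"
      by (rule quotient_dim_le[OF vector_space_axioms ideal_subspace[OF K]]) (use \<open>K = UNIV\<close> in auto)
    then have "n = 0" using n by simp
    then show ?thesis unfolding none by (simp flip: zero_enat_def)
  next
    case one: False
    show ?thesis
    proof (cases "\<forall>a. (\<exists>m. a ^ m \<in> K) \<or> (\<exists>b. a * b - 1 \<in> K)")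
      case True
      define P0 where "P0 = {a. \<exists>m. a ^ m \<in> K}"
      have nil_unit: False if "a ^ m \<in> K" "a * b - 1 \<in> K" for a b m
      proof -
        have "(a * b) ^ m - 1 \<in> K"
        proof -
          have "(a * b) ^ m - 1 = (a * b - 1) * (\<Sum>i<m. (a * b) ^ i)" by (rule power_diff_1_eq)
          then show ?thesis using K_simps(3)[OF that(2), of "\<Sum>i<m. (a * b) ^ i"] by (simp add: mult.commute)
        qed
        have "(a * b) ^ m \<in> K" using K_simps(3)[OF that(1), of "b ^ m"] by (simp add: power_mult_distrib mult.commute)
        have "(a * b) ^ m - ((a * b) ^ m - 1) \<in> K" using \<open>(a * b) ^ m \<in> K\<close> \<open>(a * b) ^ m - 1 \<in> K\<close> by (rule K_simps(2))
        then show False using one by simp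
      qed
      have not_P0: "\<exists>b. a * b - 1 \<in> K" if "a \<notin> P0" for a using True that by (auto simp: P0_def)
      have unit_mult: "\<exists>d. (a * b) * d - 1 \<in> K" if "a * c - 1 \<in> K" "b * d - 1 \<in> K" for a b c d
      proof -
        have "(a * c) * (b * d - 1) + (a * c - 1) \<in> K" using that by - (assumption | rule K_simps)+
        then show ?thesis by (intro exI[of _ "c * d"]) (simp add: algebra_simps)
      qed
      have P0: "prime_ideal P0"
        unfolding prime_ideal_def
      proof (intro conjI allI impI)
        show "ideal.subspace P0"
        proof (rule ideal.subspaceI)
          show "0 \<in> P0" unfolding P0_def by (intro CollectI exI[of _ 1]) (simp add: ideal.subspace_0[OF K])
          show "r * a \<in> P0" if "a \<in> P0" for r a
            using that K_simps(3) unfolding P0_def by (auto simp: power_mult_distrib)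
          show "a + b \<in> P0" if ab: "a \<in> P0" "b \<in> P0" for a b
          proof (rule ccontr)
            assume "a + b \<notin> P0"
            then obtain c where c: "(a + b) * c - 1 \<in> K" using not_P0 by blast
            obtain m where m: "b ^ m \<in> K" using ab(2) by (auto simp: P0_def)
            obtain m' where m': "a ^ m' \<in> K" using ab(1) by (auto simp: P0_def)
            define z where "z = b * c"
            have "z ^ m \<in> K" unfolding z_def power_mult_distrib using K_simps(3)[OF m, of "c ^ m"] by (simp add: mult.commute)
            have "1 - z ^ m = (1 - z) * (\<Sum>i<m. z ^ i)" by (rule one_diff_power_eq)
            then have "(a * c) * (\<Sum>i<m. z ^ i) - 1 = (\<Sum>i<m. z ^ i) * ((a + b) * c - 1) - z ^ m"
              by (simp add: z_def algebra_simps)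
            also have "\<dots> \<in> K" using c \<open>z ^ m \<in> K\<close> by - (assumption | rule K_simps)+
            finally have "a * (c * (\<Sum>i<m. z ^ i)) - 1 \<in> K" by (simp add: mult.assoc)
            then show False using nil_unit[OF m'] by blast
          qed
        qed
        show "1 \<notin> P0" using one by (auto simp: P0_def)
        show "a \<in> P0 \<or> b \<in> P0" if "a * b \<in> P0" for a b
          using that not_P0[of a] not_P0[of b] unit_mult nil_unit unfolding P0_def by blast
      qed
      have K_P0: "K \<subseteq> P0" unfolding P0_def by (auto intro: exI[of _ 1])
      have set: "{P. prime_ideal P \<and> K \<subseteq> P} = {P0}"
      proof (intro equalityI subsetI)
        fix P assume "P \<in> {P. prime_ideal P \<and> K \<subseteq> P}"
        then have P: "prime_ideal P" "K \<subseteq> P" by auto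
        have "P0 \<subseteq> P" unfolding P0_def using P prime_power by blast
        moreover have "P \<subseteq> P0"
        proof
          fix a assume a: "a \<in> P"
          show "a \<in> P0"
          proof (rule ccontr)
            assume "a \<notin> P0"
            then obtain b where "a * b - 1 \<in> K" using not_P0 by blast
            then have "a * b - 1 \<in> P" using P(2) by blast
            moreover have "b * a \<in> P" by (rule ideal.subspace_scale[OF primeD(1)[OF P(1)] a])
            ultimately have "b * a - (a * b - 1) \<in> P"
              using ideal.subspace_diff[OF primeD(1)[OF P(1)], of "b * a" "a * b - 1"] by blast
            then show False using primeD(2)[OF P(1)] by (simp add: mult.commute)
          qed
        qed
        ultimately show "P \<in> {P0}" by blast
      qed (use P0 K_P0 in auto)
      have "loc_kernel K P0 = K"
      proof (intro equalityI subsetI)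
        fix v assume "v \<in> loc_kernel K P0"
        then obtain u b where "u * v \<in> K" "u * b - 1 \<in> K" using not_P0 unfolding loc_kernel_def by blast
        then have "b * (u * v) - v * (u * b - 1) \<in> K" by - (assumption | rule K_simps)+
        then show "v \<in> K" by (simp add: algebra_simps)
      next
        fix v assume "v \<in> K"
        moreover have "1 \<notin> P0" using primeD(2)[OF P0] .
        ultimately show "v \<in> loc_kernel K P0" unfolding loc_kernel_def by (intro CollectI exI[of _ 1]) simp
      qed
      then show ?thesis unfolding set using n by simp
    next
      case False
      then obtain a where a: "\<And>m. a ^ m \<notin> K" "\<And>b. a * b - 1 \<notin> K" by blast
      obtain m q where mq: "a ^ m - a ^ Suc m * q \<in> K" using power_relation[OF K n] by blast
      have mk: "a ^ m - a ^ (m + k) * q ^ k \<in> K" for k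
      proof (induction k)
        case (Suc k)
        have "(a ^ m - a ^ (m + k) * q ^ k) + (a ^ k * q ^ k) * (a ^ m - a ^ Suc m * q) \<in> K"
          using Suc mq by - (assumption | rule K_simps)+
        then show ?case by (simp add: power_add algebra_simps)
      qed (simp add: ideal.subspace_0[OF K])
      \<comment> \<open>Modulo \<open>K\<close> one has a^m = a^(2m) q^m, so a^m q^m is idempotent.
        It is neither 0 nor 1 there, because \<open>a\<close> is neither nilpotent nor
        invertible.\<close>
      define e where "e = a ^ m * q ^ m"
      have "- (q ^ m * (a ^ m - a ^ (m + m) * q ^ m)) \<in> K" using K_simps(3)[OF K_simps(3)[OF mk], of "- 1"] by simp
      then have e: "e * e - e \<in> K" by (simp add: e_def power_add algebra_simps)
      let ?K1 = "ideal_gen (insert e K)" and ?K2 = "ideal_gen (insert (1 - e) K)"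
      have m0: "m \<noteq> 0"
      proof
        assume "m = 0"
        then have "- (1 - a * q) \<in> K" using K_simps(3)[OF mq, of "- 1"] by simp
        then show False using a(2)[of q] by simp
      qed
      have K1: "1 \<notin> ?K1"
      proof
        assume "1 \<in> ?K1"
        then have "(1 - e) * 1 \<in> K" using idempotent_split(1)[OF K e] by blast
        then have "- (1 - e) \<in> K" using K_simps(3)[of "1 - e" "- 1"] by simp
        then have "a * (a ^ (m - 1) * q ^ m) - 1 \<in> K" using m0 by (cases m) (simp_all add: e_def mult.assoc)
        then show False using a(2) by blast
      qed
      have K2: "1 \<notin> ?K2"
      proof
        assume "1 \<in> ?K2"
        then have "e * 1 \<in> K" using idempotent_split(2)[OF K e] by blast
        then have "(a ^ m - a ^ (m + m) * q ^ m) + a ^ m * (e * 1) \<in> K" using mk by - (assumption | rule K_simps)+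
        then show False using a(1)[of m] by (simp add: e_def power_add algebra_simps)
      qed
      obtain n1 n2 where n12: "quotient_dim scale ?K1 = enat n1" "quotient_dim scale ?K2 = enat n2" "n = n1 + n2"
        by (rule quotient_dim_split[OF K e n])
      have "1 \<le> n1" "1 \<le> n2"
        using quotient_dim_pos[OF K1 ideal.subspace_span, unfolded one_enat_def]
          quotient_dim_pos[OF K2 ideal.subspace_span, unfolded one_enat_def] n12 by simp_all
      then have less': "n1 < n" "n2 < n" using n12(3) by auto
      note IH1 = less.IH[OF less'(1) ideal.subspace_span n12(1)] and IH2 = less.IH[OF less'(2) ideal.subspace_span n12(2)]
      let ?S = "{P. prime_ideal P \<and> K \<subseteq> P}" and ?S1 = "{P. prime_ideal P \<and> ?K1 \<subseteq> P}" and ?S2 = "{P. prime_ideal P \<and> ?K2 \<subseteq> P}"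
      have sup: "K \<subseteq> ?K1" "K \<subseteq> ?K2" using ideal.span_superset by blast+
      have eP: "e \<in> P \<Longrightarrow> 1 - e \<in> P \<Longrightarrow> False" if "prime_ideal P" for P
        using ideal.subspace_add[OF primeD(1)[OF that], of e "1 - e"] primeD(2)[OF that] by simp
      have in1: "?K1 \<subseteq> P \<longleftrightarrow> K \<subseteq> P \<and> e \<in> P" if "prime_ideal P" for P
        using ideal.span_minimal[OF _ primeD(1)[OF that], of "insert e K"] ideal.span_superset[of "insert e K"] by blast
      have in2: "?K2 \<subseteq> P \<longleftrightarrow> K \<subseteq> P \<and> 1 - e \<in> P" if "prime_ideal P" for P
        using ideal.span_minimal[OF _ primeD(1)[OF that], of "insert (1 - e) K"] ideal.span_superset[of "insert (1 - e) K"] by blast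
      have or: "e \<in> P \<or> 1 - e \<in> P" if "prime_ideal P" "K \<subseteq> P" for P
      proof -
        have "- (e * e - e) \<in> K" using K_simps(3)[OF e, of "- 1"] by simp
        then have "e * (1 - e) \<in> P" using that(2) by (auto simp: algebra_simps)
        then show ?thesis using primeD(3)[OF that(1)] by blast
      qed
      have un: "?S = ?S1 \<union> ?S2" using in1 in2 or by blast
      have dis: "?S1 \<inter> ?S2 = {}" using in1 in2 eP by blast
      have ker1: "loc_kernel K P = loc_kernel ?K1 P" if "P \<in> ?S1" for P
      proof (intro equalityI subsetI)
        fix v assume "v \<in> loc_kernel ?K1 P"
        then obtain u where u: "u \<notin> P" "u * v \<in> ?K1" unfolding loc_kernel_def by blast
        have P: "prime_ideal P" "e \<in> P" using that in1 by blast+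
        then have "(1 - e) * u \<notin> P" using primeD(3)[OF P(1), of "1 - e" u] u(1) eP[OF P(1)] by blast
        moreover have "((1 - e) * u) * v \<in> K" using u(2) idempotent_split(1)[OF K e] by (simp add: mult.assoc)
        ultimately show "v \<in> loc_kernel K P" unfolding loc_kernel_def by blast
      qed (use sup(1) in \<open>auto simp: loc_kernel_def\<close>)
      have ker2: "loc_kernel K P = loc_kernel ?K2 P" if "P \<in> ?S2" for P
      proof (intro equalityI subsetI)
        fix v assume "v \<in> loc_kernel ?K2 P"
        then obtain u where u: "u \<notin> P" "u * v \<in> ?K2" unfolding loc_kernel_def by blast
        have P: "prime_ideal P" "1 - e \<in> P" using that in2 by blast+
        then have "e * u \<notin> P" using primeD(3)[OF P(1), of e u] u(1) eP[OF P(1)] by blast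
        moreover have "(e * u) * v \<in> K" using u(2) idempotent_split(2)[OF K e] by (simp add: mult.assoc)
        ultimately show "v \<in> loc_kernel K P" unfolding loc_kernel_def by blast
      qed (use sup(2) in \<open>auto simp: loc_kernel_def\<close>)
      have "(\<Sum>P\<in>?S. quotient_dim scale (loc_kernel K P))
          = (\<Sum>P\<in>?S1. quotient_dim scale (loc_kernel K P)) + (\<Sum>P\<in>?S2. quotient_dim scale (loc_kernel K P))"
        unfolding un using IH1 IH2 dis by (intro sum.union_disjoint) auto
      also have "(\<Sum>P\<in>?S1. quotient_dim scale (loc_kernel K P)) = (\<Sum>P\<in>?S1. quotient_dim scale (loc_kernel ?K1 P))"
        by (rule sum.cong) (use ker1 in auto)
      also have "(\<Sum>P\<in>?S2. quotient_dim scale (loc_kernel K P)) = (\<Sum>P\<in>?S2. quotient_dim scale (loc_kernel ?K2 P))"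
        by (rule sum.cong) (use ker2 in auto)
      finally have "(\<Sum>P\<in>?S. quotient_dim scale (loc_kernel K P)) = enat n" using IH1 IH2 n12(3) by simp
      moreover have "finite ?S" unfolding un using IH1 IH2 by blast
      ultimately show ?thesis by blast
    qed
  qed
qed

end


section \<open>One-parameter deformations of the germ and the value of the degeneracy\<close>

section \<open>Pencils of deformations\<close>

lemma kscale_cst: "kscale c g = cst c * g"
  by (simp add: kscale_def cst_def)

interpretation kalg: scalar_algebra kscale
  by unfold_locales (simp add: kscale_cst mult.assoc)

lemma cst_unit: "c \<noteq> 0 \<Longrightarrow> cst (c :: 'k::field) dvd 1"
  by (rule dvdI[of _ _ "cst (inverse c)"]) (simp flip: cst_hom(2,4))

lemma cst_power: "cst (c ^ n) = cst c ^ n"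
  by (induction n) (simp_all add: cst_hom)

lemma cst_of_nat: "cst (of_nat n) = of_nat n"
  by (induction n) (simp_all add: cst_hom)

lemma ct_cst: "fps_nth (fps_nth (fps_nth (cst c) 0) 0) 0 = c"
  by (simp add: cst_def const2_def)

lemma fil3_1:
  assumes "0 < a" "0 < b" "0 < e"
  shows "u \<in> fil3 a b e 1 \<longleftrightarrow> fps_nth (fps_nth (fps_nth u 0) 0) 0 = 0"
  using assms by (auto simp: fil3_iff)

lemma varx_fil3: "varx \<in> fil3 a b e a" and vary_fil3: "vary \<in> fil3 a b e b" and veps_fil3: "veps \<in> fil3 a b e e"
  by (auto simp: fil3_iff varx_def vary_def veps_def const2_def fps_X_def)

text \<open>In a finite-dimensional quotient z^M = z^(M+1) q for some M, and 1 - z q is a unit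
  because \<open>z\<close> has no constant term.\<close>

lemma power_mem_of_span:
  fixes z :: "'k::field fps fps fps"
  assumes J: "finite J" and span: "\<And>u. \<exists>c. u - (\<Sum>x\<in>J. cst (c x) * mo x) \<in> ideal_gen S"
    and z: "fps_nth (fps_nth (fps_nth z 0) 0) 0 = 0"
  obtains M where "z ^ M \<in> ideal_gen S"
proof -
  have "quotient_dim kscale (ideal_gen S) \<le> enat (card J)"
    by (rule quotient_dim_le[OF vector_space_kscale subspace_ideal_gen J, where b = mo]) (use span in \<open>simp add: kscale_cst\<close>)
  then obtain n where "quotient_dim kscale (ideal_gen S) = enat n" by (cases "quotient_dim kscale (ideal_gen S)") auto
  then obtain M q where "z ^ M - z ^ Suc M * q \<in> ideal_gen S"
    by (rule kalg.power_relation[OF ideal.subspace_span])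
  then have *: "(1 - z * q) * z ^ M \<in> ideal_gen S" by (simp add: algebra_simps)
  have "(1 - z * q) dvd 1" using z by (simp add: is_unit_fps_iff)
  then obtain r where r: "1 = (1 - z * q) * r" by (rule dvdE)
  have "((1 - z * q) * r) * z ^ M \<in> ideal_gen S"
    using ideal_gen_mult[OF *, of r] by (simp only: mult_ac)
  then have "z ^ M \<in> ideal_gen S" unfolding r[symmetric] by simp
  then show ?thesis by (rule that)
qed

lemma span_normal_form:
  fixes g :: "nat \<Rightarrow> 'k::comm_ring_1 fps fps fps"
  assumes pos: "0 < a" "0 < b" "0 < e" and G: "G = fil3 a b e"
    and eps: "veps \<in> leading.L G g r w e"
    and P1: "vary ^ n - cst c * varx ^ m \<in> leading.L G g r w (b * n)"
    and P2: "varx ^ Suc m - cst \<kappa> * (varx ^ m * vary) \<in> leading.L G g r w (a * Suc m)"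
    and cases: "c = 0 \<and> \<kappa> = 0 \<or> m = n \<and> a = b \<and> (1 - cst \<kappa> ^ n * cst c) dvd 1"
    and w: "a * m + b * n \<le> w"
  shows "\<exists>c k. u = (\<Sum>i<r. k i * g i) + (\<Sum>x\<in>{..m} \<times> {..<n}. cst (c x) * (varx ^ fst x * vary ^ snd x))"
proof (rule span_xye[OF filtered_trivial pos G[unfolded fil3_def] _ _ eps])
  have "filtered G" unfolding G by (rule filtered_fil3)
  then interpret leading G g r w by (rule leading.intro)
  fix i j
  show "\<exists>i' j' s. varx ^ i * vary ^ j - cst s * (varx ^ i' * vary ^ j') \<in> L (a * i + b * j)
      \<and> (s = 0 \<or> (i', j') \<in> {..m} \<times> {..<n} \<and> a * i' + b * j' = a * i + b * j)"
    using normal_form[where emb = cst, OF _ _ cst_hom(2-4) P1 P2 cases, of i j] varx_fil3[of a b e] vary_fil3[of a b e]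
    unfolding G by auto
next
  fix i j assume "(i, j) \<in> {..m} \<times> {..<n}"
  then have "a * i + b * j \<le> a * m + b * n" by (intro add_mono mult_le_mono2) auto
  then show "a * i + b * j \<le> w" using w by simp
qed simp

lemma nzd_varx: "nzd {} (varx :: 'c::idom fps fps)"
  by (simp add: nzd_def varx_def)

lemma nzd_vary: "nzd {varx} (vary :: 'c::comm_ring_1 fps fps)"
  unfolding nzd_def ideal_gen_singleton
proof (intro allI impI)
  fix r :: "'c fps fps" assume "\<exists>q. vary * r = q * varx"
  then obtain q :: "'c fps fps" where q: "vary * r = q * varx" by blast
  have c: "fps_nth r j = fps_nth (fps_shift 1 q * varx) j" for j
  proof -
    have "fps_nth (vary * r) (Suc j) = fps_nth (q * varx) (Suc j)" using q by simp
    then show ?thesis by (simp add: vary_def varx_def fps_mult_right_const_nth)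
  qed
  have "r = fps_shift 1 q * varx" by (rule fps_ext) (rule c)
  then show "\<exists>k. r = k * varx" by blast
qed

lemma ideal_gen_varx_vary: "g \<in> ideal_gen {varx, vary} \<longleftrightarrow> fps_nth (fps_nth (g :: 'c::comm_ring_1 fps fps) 0) 0 = 0"
proof
  assume "fps_nth (fps_nth g 0) 0 = 0"
  then have g0: "fps_shift 1 (fps_nth g 0) * fps_X = fps_nth g 0"
    by (intro fps_ext, case_tac n) simp_all
  have "g = fps_const (fps_shift 1 (fps_nth g 0)) * varx + fps_shift 1 g * vary"
  proof (rule fps_ext)
    fix j
    show "fps_nth g j = fps_nth (fps_const (fps_shift 1 (fps_nth g 0)) * varx + fps_shift 1 g * vary) j"
      by (cases j) (simp_all add: varx_def vary_def g0[unfolded One_nat_def])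
  qed
  then show "g \<in> ideal_gen {varx, vary}" unfolding ideal_gen_2 by blast
qed (auto simp: ideal_gen_2 varx_def vary_def)

lemma nzd_varx_vary:
  fixes F :: "'c::idom fps fps"
  assumes "fps_nth (fps_nth F 0) 0 \<noteq> 0"
  shows "nzd {varx, vary} F"
  using assms by (simp add: nzd_def ideal_gen_varx_vary)

lemma dx_varx_power: "dx (varx ^ n) = of_nat n * varx ^ (n - 1)" and dy_varx_power: "dy (varx ^ n) = 0"
  and dx_vary_power: "dx (vary ^ n) = 0" and dy_vary_power: "dy (vary ^ n) = of_nat n * vary ^ (n - 1)"
proof -
  show "dx (varx ^ n) = of_nat n * varx ^ (n - 1)"
  proof (induction n)
    case (Suc n)
    then show ?case by (cases n) (simp_all add: dx_mult dx_varx dx_const2[of 1, unfolded const2_1] algebra_simps)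
  qed (simp add: dx_const2[of 1, unfolded const2_1])
  show "dy (vary ^ n) = of_nat n * vary ^ (n - 1)"
  proof (induction n)
    case (Suc n)
    then show ?case by (cases n) (simp_all add: dy_mult dy_vary dy_const2[of 1, unfolded const2_1] algebra_simps)
  qed (simp add: dy_const2[of 1, unfolded const2_1])
  show "dy (varx ^ n) = 0" "dx (vary ^ n) = 0"
    by (induction n) (simp_all add: dx_mult dy_mult dx_vary dy_varx dx_const2[of 1, unfolded const2_1] dy_const2[of 1, unfolded const2_1])
qed

abbreviation econst :: "'k::comm_ring_1 fps fps \<Rightarrow> 'k fps fps fps" where
  "econst \<equiv> map_coeffs fps_const"

lemma dx_econst: "dx (econst g) = econst (dx g)" and dy_econst: "dy (econst g) = econst (dy g)"
  by (simp_all add: dx_def dy_def map_coeffs_def fps_eq_iff fps_of_nat[symmetric] flip: of_nat_Suc)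

lemma dx_veps: "dx veps = 0" and dy_veps: "dy veps = 0"
  by (simp_all add: veps_def dx_const2 dy_const2)

text \<open>The germ with t = n + 2 and s = m + 2 and an arbitrary perturbation \<open>B\<close>.
  The shift by 2 keeps the exponents in second derivatives natural.\<close>

locale pencil0 =
  fixes n m :: nat and B :: "'k::field_char_0 fps fps" and F :: "'k fps fps fps"
  assumes nm: "n \<le> m" and F: "F = vary ^ (n + 2) - varx ^ (m + 2) + veps * econst B"
begin

lemma dxF: "dx F = veps * econst (dx B) - of_nat (m + 2) * varx ^ (m + 1)"
  and dyF: "dy F = veps * econst (dy B) + of_nat (n + 2) * vary ^ (n + 1)"
  by (simp_all add: F dx_add dx_diff dy_add dy_diff dx_mult dy_mult dx_veps dy_veps dx_econst dy_econst
      dx_varx_power dy_varx_power dx_vary_power dy_vary_power del: power_Suc of_nat_add of_nat_Suc)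

lemma dx_of_nat: "dx (of_nat k) = 0" and dy_of_nat: "dy (of_nat k) = 0"
  by (induction k) (simp_all add: dx_add dy_add dx_0 dy_0 dx_const2[of 1, unfolded const2_1] dy_const2[of 1, unfolded const2_1])

lemma dxxF: "dx (dx F) = veps * econst (dx (dx B)) - of_nat ((m + 2) * (m + 1)) * varx ^ m"
  and dxyF: "dx (dy F) = veps * econst (dx (dy B))"
  and dyyF: "dy (dy F) = veps * econst (dy (dy B)) + of_nat ((n + 2) * (n + 1)) * vary ^ n"
  unfolding of_nat_mult by (simp_all add: dxF dyF dx_add dx_diff dy_add dy_diff dx_mult dy_mult dx_veps dy_veps dx_econst dy_econst
      dx_varx_power dy_varx_power dx_vary_power dy_vary_power dx_of_nat dy_of_nat mult.assoc del: power_Suc of_nat_add of_nat_Suc)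

text \<open>The weights of the lower bound. Both first partials have order (n+1)(m+1), the product
  of the weights of x and y, as \<open>colength_ge\<close> requires; the parameter gets the order of
  x^(m+2), the smaller of the two orders in the germ.\<close>

abbreviation H where "H \<equiv> fil3 (n + 1) (m + 1) ((m + 2) * (n + 1))"

lemma eps_H: "k \<le> (m + 2) * (n + 1) \<Longrightarrow> veps * u \<in> H k"
  by (rule filtered.Fil_mult2[OF filtered_fil3 filtered.Fil_mono[OF filtered_fil3 veps_fil3]])

lemma x_power_H: "k \<le> i * (n + 1) \<Longrightarrow> u * varx ^ i \<in> H k" and y_power_H: "k \<le> j * (m + 1) \<Longrightarrow> u * vary ^ j \<in> H k"
  by (rule filtered.Fil_mult1[OF filtered_fil3 filtered.Fil_powerI[OF filtered_fil3 varx_fil3]]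
      filtered.Fil_mult1[OF filtered_fil3 filtered.Fil_powerI[OF filtered_fil3 vary_fil3]], assumption)+

lemma H_derivs: "F \<in> H ((m + 2) * (n + 1))" "dx F \<in> H ((n + 1) * (m + 1))" "dy F \<in> H ((n + 1) * (m + 1))"
  "dx (dx F) \<in> H (n * (m + 1))" "dx (dy F) \<in> H ((m + 2) * (n + 1))" "dy (dy F) \<in> H (n * (m + 1))"
proof -
  interpret filtered H by (rule filtered_fil3)
  have le: "(m + 2) * (n + 1) \<le> (n + 2) * (m + 1)" "(n + 1) * (m + 1) \<le> (m + 2) * (n + 1)"
    "n * (m + 1) \<le> (m + 2) * (n + 1)" "n * (m + 1) \<le> m * (n + 1)" "(n + 1) * (m + 1) \<le> (m + 1) * (n + 1)"
    using nm by (auto simp: algebra_simps)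
  show "F \<in> H ((m + 2) * (n + 1))"
  proof -
    have y: "1 * vary ^ (n + 2) \<in> H ((m + 2) * (n + 1))" by (rule y_power_H[OF le(1)])
    have x: "1 * varx ^ (m + 2) \<in> H ((m + 2) * (n + 1))" by (rule x_power_H[OF order_refl])
    show ?thesis unfolding F
      by (rule Fil_add[OF Fil_diff[OF y[unfolded mult_1] x[unfolded mult_1]] eps_H[OF order_refl]])
  qed
  show "dx F \<in> H ((n + 1) * (m + 1))"
    unfolding dxF by (rule Fil_diff[OF eps_H[OF le(2)] x_power_H[OF le(5)]])
  show "dy F \<in> H ((n + 1) * (m + 1))"
    unfolding dyF by (rule Fil_add[OF eps_H[OF le(2)] y_power_H[OF order_refl]])
  show "dx (dx F) \<in> H (n * (m + 1))"
    unfolding dxxF by (rule Fil_diff[OF eps_H[OF le(3)] x_power_H[OF le(4)]])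
  show "dx (dy F) \<in> H ((m + 2) * (n + 1))"
    unfolding dxyF by (rule eps_H[OF order_refl])
  show "dy (dy F) \<in> H (n * (m + 1))"
    unfolding dyyF by (rule Fil_add[OF eps_H[OF le(3)] y_power_H[OF order_refl]])
qed

end

text \<open>A nonzero constant term of \<open>B\<close> makes the total space smooth at the origin,
  and in suitable weights the parameter becomes the leading form of \<open>F\<close>.\<close>

locale pencil = pencil0 n m B F for n m :: nat and B :: "'k::field_char_0 fps fps" and F :: "'k fps fps fps" +
  assumes B0: "fps_nth (fps_nth B 0) 0 \<noteq> 0"
begin

text \<open>The weights of the division argument. \<open>we\<close> lies strictly between the order
  \<open>wp\<close> of the partials and the orders of the two terms of the germ, so that
  \<open>F\<close> leads with \<open>veps\<close> while the partials lead with pure powers. The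
  factor 2 leaves room for such an integer even when n = 0.\<close>

definition wa where "wa = 2 * (n + 1)"
definition wb where "wb = 2 * (m + 1)"
definition wp where "wp = wb * Suc n"
definition we where "we = wp + wa - 1"
definition G where "G = fil3 wa wb we"

lemma weights: "0 < wa" "0 < wb" "0 < we" "wp = wa * Suc m" "wp < we" "we < wp + wa" "wa \<le> wb" "wa \<le> wp"
  "wb * n + wb = wp" "wa * m + wa = wp" "m = n \<Longrightarrow> wa = wb" "n < m \<Longrightarrow> wa < wb"
  unfolding wa_def wb_def wp_def we_def using nm by (auto simp: algebra_simps)

sublocale filtered G
  unfolding G_def by (rule filtered_fil3)

lemma xG: "varx \<in> G wa" and yG: "vary \<in> G wb" and eG: "veps \<in> G we"
  unfolding G_def by (rule varx_fil3 vary_fil3 veps_fil3)+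

lemma G_1: "u \<in> G 1 \<longleftrightarrow> fps_nth (fps_nth (fps_nth u 0) 0) 0 = 0"
  unfolding G_def by (rule fil3_1) (use weights in auto)

lemma lead_mult: "v \<in> G k \<Longrightarrow> u * v - cst (fps_nth (fps_nth (fps_nth u 0) 0) 0) * v \<in> G (Suc k)"
proof -
  assume v: "v \<in> G k"
  have "u - cst (fps_nth (fps_nth (fps_nth u 0) 0) 0) \<in> G 1" unfolding G_1 by (simp add: ct_cst)
  from Fil_mult[OF this v] show ?thesis by (simp add: left_diff_distrib)
qed

lemma x_power: "k \<le> wa * i \<Longrightarrow> varx ^ i \<in> G k" and y_power: "k \<le> wb * j \<Longrightarrow> vary ^ j \<in> G k"
  by (rule Fil_powerI[OF xG] Fil_powerI[OF yG], simp add: mult.commute)+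

lemma eps_mult: "k \<le> we \<Longrightarrow> veps * u \<in> G k"
  by (rule Fil_mult2[OF Fil_mono[OF eG]])

lemma F_lead: "F - cst (fps_nth (fps_nth B 0) 0) * veps \<in> G (Suc we)"
proof -
  have "econst B * veps - cst (fps_nth (fps_nth (fps_nth (econst B) 0) 0) 0) * veps \<in> G (Suc we)"
    by (rule lead_mult[OF eG])
  moreover have "wb * (n + 2) = wp + wb" "wa * (m + 2) = wp + wa"
    unfolding wp_def using weights(4)[unfolded wp_def] by simp_all
  then have "vary ^ (n + 2) \<in> G (Suc we)" "varx ^ (m + 2) \<in> G (Suc we)"
    using weights by (linarith | intro y_power x_power)+
  ultimately have "(vary ^ (n + 2) - varx ^ (m + 2)) + (econst B * veps - cst (fps_nth (fps_nth B 0) 0) * veps) \<in> G (Suc we)"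
    using Fil_add[OF Fil_diff, of "vary ^ (n + 2)" "Suc we" "varx ^ (m + 2)"] by (simp add: map_coeffs_nth)
  then show ?thesis by (simp add: F algebra_simps)
qed

lemma dxF_lead: "dx F - cst (- of_nat (m + 2)) * varx ^ Suc m \<in> G (Suc wp)"
  and dyF_lead: "dy F - cst (of_nat (n + 2)) * vary ^ Suc n \<in> G (Suc wp)"
  using weights eps_mult[of "Suc wp" "econst (dx B)"] eps_mult[of "Suc wp" "econst (dy B)"]
  unfolding dxF dyF cst_hom cst_of_nat by (simp_all del: of_nat_add of_nat_Suc power_Suc)

lemma dxF_G: "dx F \<in> G wp" and dyF_G: "dy F \<in> G wp"
proof -
  have "cst (- of_nat (m + 2)) * varx ^ Suc m \<in> G wp" "cst (of_nat (n + 2)) * vary ^ Suc n \<in> G wp"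
    using weights by (auto intro!: Fil_mult1 x_power y_power simp: wp_def simp del: power_Suc)
  from Fil_add[OF Fil_SucD[OF dxF_lead] this(1)] Fil_add[OF Fil_SucD[OF dyF_lead] this(2)]
  show "dx F \<in> G wp" "dy F \<in> G wp" by simp_all
qed

text \<open>\<beta> and \<gamma> stand for the first derivatives of a section on the diagonal,
  \<open>h\<close> for the first minor, and \<open>k\<close> for the polar factor of the second;
  \<open>c\<close> collects the second-order data of the section.\<close>

context
  fixes \<beta> \<gamma> c h k :: "'k fps fps fps" and \<beta>0 \<gamma>0 :: 'k
  assumes \<beta>0: "\<beta>0 = fps_nth (fps_nth (fps_nth \<beta> 0) 0) 0" and \<gamma>0: "\<gamma>0 = fps_nth (fps_nth (fps_nth \<gamma> 0) 0) 0"
    and nonzero: "\<beta>0 \<noteq> 0"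
    and h: "h = \<beta> * dy F - \<gamma> * dx F"
    and k: "k = - \<beta> * (\<beta>\<^sup>2 * dy (dy F) - 2 * \<beta> * \<gamma> * dx (dy F) + \<gamma>\<^sup>2 * dx (dx F)) + dx F * c"
begin

lemma h_lead: "h - (cst (\<beta>0 * of_nat (n + 2)) * vary ^ Suc n + cst (\<gamma>0 * of_nat (m + 2)) * varx ^ Suc m) \<in> G (Suc wp)"
proof -
  have "(\<beta> * dy F - cst \<beta>0 * dy F) + cst \<beta>0 * (dy F - cst (of_nat (n + 2)) * vary ^ Suc n)
    - ((\<gamma> * dx F - cst \<gamma>0 * dx F) + cst \<gamma>0 * (dx F - cst (- of_nat (m + 2)) * varx ^ Suc m)) \<in> G (Suc wp)"
    unfolding \<beta>0 \<gamma>0 by (intro Fil_add Fil_diff[of _ _ "_ + _"] lead_mult dxF_G dyF_G Fil_mult1 dxF_lead dyF_lead)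
  then show ?thesis unfolding h cst_hom by (simp add: algebra_simps del: of_nat_add of_nat_Suc power_Suc)
qed

text \<open>Up to a unit the leading form of \<open>k\<close> is y^n - cc x^m. For n < m the power
  of x has higher weight than the power of y, hence the 0.\<close>

definition "cc = (if m = n then \<gamma>0\<^sup>2 / \<beta>0\<^sup>2 else 0)"

lemma k_lead: "k - cst (- (\<beta>0 ^ 3 * of_nat ((n + 2) * (n + 1)))) * (vary ^ n - cst cc * varx ^ m) \<in> G (Suc (wb * n))"
proof -
  let ?w = "wb * n"
  have y: "vary ^ n \<in> G ?w" by (rule y_power) simp
  have x: "varx ^ m \<in> G ?w" using weights(7,9,10) by (intro x_power) simp
  have 1: "\<beta> ^ 3 * vary ^ n - cst (\<beta>0 ^ 3) * vary ^ n \<in> G (Suc ?w)"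
    using lead_mult[OF y, of "\<beta> ^ 3"] by (simp add: \<beta>0 power3_eq_cube)
  have 2: "of_nat ((m + 2) * (m + 1)) * (\<beta> * \<gamma>\<^sup>2 * varx ^ m) - cst (\<beta>0 ^ 3 * of_nat ((n + 2) * (n + 1)) * cc) * varx ^ m \<in> G (Suc ?w)"
  proof (cases "m = n")
    case True
    have "\<beta>0 ^ 3 * of_nat ((n + 2) * (n + 1)) * cc = of_nat ((n + 2) * (n + 1)) * (\<beta>0 * \<gamma>0\<^sup>2)"
      unfolding cc_def using nonzero True by (simp add: power2_eq_square power3_eq_cube)
    moreover have "of_nat ((n + 2) * (n + 1)) * (\<beta> * \<gamma>\<^sup>2 * varx ^ m - cst (\<beta>0 * \<gamma>0\<^sup>2) * varx ^ m) \<in> G (Suc ?w)"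
      using lead_mult[OF x, of "\<beta> * \<gamma>\<^sup>2"] by (intro Fil_mult1) (simp add: \<beta>0 \<gamma>0 power2_eq_square)
    ultimately show ?thesis using True by (simp only: cst_hom cst_of_nat right_diff_distrib mult.assoc)
  next
    case False
    then have "varx ^ m \<in> G (Suc ?w)" using weights(9,10,12) nm by (intro x_power) simp
    then have "of_nat ((m + 2) * (m + 1)) * (\<beta> * \<gamma>\<^sup>2 * varx ^ m) \<in> G (Suc ?w)" by (intro Fil_mult1)
    then show ?thesis using False by (simp add: cc_def cst_hom)
  qed
  have le: "Suc ?w \<le> we" "Suc ?w \<le> wp" using weights(2,5,9) by simp_all
  have eps: "veps * (- \<beta> * (\<beta>\<^sup>2 * econst (dy (dy B)) - 2 * \<beta> * \<gamma> * econst (dx (dy B)) + \<gamma>\<^sup>2 * econst (dx (dx B)))) \<in> G (Suc ?w)"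
    by (rule eps_mult[OF le(1)])
  have c: "dx F * c \<in> G (Suc ?w)" by (rule Fil_mult2[OF Fil_mono[OF dxF_G le(2)]])
  have id: "- (p * (b * b * b * y - b0 * y)) + (q * (b * (g * g) * x) - b0 * p * d * x)
      + e * (- b * (b * b * f1 - 2 * b * g * f2 + g * g * f3)) + z
    = - b * (b * b * (e * f1 + p * y) - 2 * b * g * (e * f2) + g * g * (e * f3 - q * x)) + z - - (b0 * p) * (y - d * x)"
    for p q b y b0 g x d e f1 f2 f3 z :: "'k fps fps fps"
    by (simp add: algebra_simps)
  have "- (of_nat ((n + 2) * (n + 1)) * (\<beta> ^ 3 * vary ^ n - cst (\<beta>0 ^ 3) * vary ^ n))
    + (of_nat ((m + 2) * (m + 1)) * (\<beta> * \<gamma>\<^sup>2 * varx ^ m) - cst (\<beta>0 ^ 3 * of_nat ((n + 2) * (n + 1)) * cc) * varx ^ m)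
    + veps * (- \<beta> * (\<beta>\<^sup>2 * econst (dy (dy B)) - 2 * \<beta> * \<gamma> * econst (dx (dy B)) + \<gamma>\<^sup>2 * econst (dx (dx B))))
    + dx F * c \<in> G (Suc ?w)"
    by (rule Fil_add[OF Fil_add[OF Fil_add[OF Fil_uminus[OF Fil_mult1[OF 1]] 2] eps] c])
  also have "- (of_nat ((n + 2) * (n + 1)) * (\<beta> ^ 3 * vary ^ n - cst (\<beta>0 ^ 3) * vary ^ n))
    + (of_nat ((m + 2) * (m + 1)) * (\<beta> * \<gamma>\<^sup>2 * varx ^ m) - cst (\<beta>0 ^ 3 * of_nat ((n + 2) * (n + 1)) * cc) * varx ^ m)
    + veps * (- \<beta> * (\<beta>\<^sup>2 * econst (dy (dy B)) - 2 * \<beta> * \<gamma> * econst (dx (dy B)) + \<gamma>\<^sup>2 * econst (dx (dx B))))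
    + dx F * c = k - cst (- (\<beta>0 ^ 3 * of_nat ((n + 2) * (n + 1)))) * (vary ^ n - cst cc * varx ^ m)"
    unfolding k dxxF dxyF dyyF cst_hom cst_of_nat power2_eq_square power3_eq_cube
    by (rule id)
  finally show ?thesis .
qed

definition W where "W = we + wp + wp"

lemma span:
  assumes P1: "vary ^ n' - cst d * varx ^ m' \<in> leading.L G ((!) [F, h, z]) 3 W (wb * n')"
    and P2: "varx ^ Suc m' - cst \<kappa> * (varx ^ m' * vary) \<in> leading.L G ((!) [F, h, z]) 3 W (wa * Suc m')"
    and cases: "d = 0 \<and> \<kappa> = 0 \<or> m' = n' \<and> wa = wb \<and> (1 - cst \<kappa> ^ n' * cst d) dvd 1"
    and le: "m' \<le> m" "n' \<le> Suc n"
  shows "\<exists>c. u - (\<Sum>x\<in>{..m'} \<times> {..<n'}. cst (c x) * (varx ^ fst x * vary ^ snd x)) \<in> ideal_gen {F, h, z}"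
proof -
  interpret leading G "(!) [F, h, z]" 3 W by unfold_locales
  have "cst (fps_nth (fps_nth B 0) 0) * veps \<in> L we"
    by (rule L_lead[of 0]) (use F_lead in \<open>simp_all add: W_def\<close>)
  then have eps: "veps \<in> L we" by (rule L_unit[OF cst_unit[OF B0]])
  have "wa * m' \<le> wa * m" "wb * n' \<le> wb * Suc n" by (rule mult_le_mono2, rule le)+
  then have "wa * m' + wb * n' \<le> W" using weights by (simp only: W_def wp_def[symmetric])
  from span_normal_form[OF weights(1-3) G_def eps P1 P2 cases this, of u] obtain c l
    where "u = (\<Sum>i<3. l i * [F, h, z] ! i) + (\<Sum>x\<in>{..m'} \<times> {..<n'}. cst (c x) * (varx ^ fst x * vary ^ snd x))" by blast
  moreover have "(\<Sum>i<3. l i * [F, h, z] ! i) = l 0 * F + l 1 * h + l 2 * z"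
    by (simp add: eval_nat_numeral)
  ultimately have "u - (\<Sum>x\<in>{..m'} \<times> {..<n'}. cst (c x) * (varx ^ fst x * vary ^ snd x)) = l 0 * F + l 1 * h + l 2 * z"
    by simp
  then show ?thesis unfolding ideal_gen_3 by blast
qed

lemma y_in_L:
  assumes "varx ^ Suc m \<in> leading.L G ((!) [F, h, z]) 3 W wp"
  shows "vary ^ Suc n \<in> leading.L G ((!) [F, h, z]) 3 W wp"
proof -
  interpret leading G "(!) [F, h, z]" 3 W by unfold_locales
  have h': "cst (\<beta>0 * of_nat (n + 2)) * vary ^ Suc n + cst (\<gamma>0 * of_nat (m + 2)) * varx ^ Suc m \<in> L wp"
    by (rule L_lead[of 1]) (use h_lead in \<open>simp_all add: W_def\<close>)
  from L_diff[OF this L_scale[OF assms, of "cst (\<gamma>0 * of_nat (m + 2))"]]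
  have "cst (\<beta>0 * of_nat (n + 2)) * vary ^ Suc n \<in> L wp" by simp
  then show ?thesis
    by (rule L_unit[OF cst_unit, rotated]) (use nonzero in \<open>simp del: of_nat_add of_nat_Suc add: of_nat_eq_0_iff\<close>)
qed

text \<open>An auxiliary finite quotient: it provides the power of y that starts the exchanges in
  \<open>nzd_F_h\<close>.\<close>

lemma span_x: "\<exists>c. u - (\<Sum>x\<in>{..0} \<times> {..<Suc n}. cst (c x) * (varx ^ fst x * vary ^ snd x)) \<in> ideal_gen {F, h, varx}"
proof -
  interpret leading G "(!) [F, h, varx]" 3 W by unfold_locales
  have x: "varx \<in> L wa" by (rule L_lead[of 2]) (use weights in \<open>simp_all add: W_def\<close>)
  have "varx ^ m * varx \<in> L wp" by (rule L_mult[OF x x_power[of "wa * m"]]) (use weights in simp_all)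
  then have "vary ^ Suc n \<in> L wp" by (intro y_in_L) (simp add: mult.commute)
  then have P1: "vary ^ Suc n - cst 0 * varx ^ 0 \<in> L (wb * Suc n)" by (simp add: cst_hom wp_def del: mult_Suc_right power_Suc)
  have P2: "varx ^ Suc 0 - cst 0 * (varx ^ 0 * vary) \<in> L (wa * Suc 0)" using x by (simp add: cst_hom)
  show ?thesis by (rule span[OF P1 P2]) simp_all
qed

lemma span_dx: "\<exists>c. u - (\<Sum>x\<in>{..m} \<times> {..<Suc n}. cst (c x) * (varx ^ fst x * vary ^ snd x)) \<in> ideal_gen {F, h, dx F}"
proof -
  interpret leading G "(!) [F, h, dx F]" 3 W by unfold_locales
  have "cst (- of_nat (m + 2)) * varx ^ Suc m \<in> L wp"
    by (rule L_lead[of 2]) (use dxF_lead in \<open>simp_all add: W_def\<close>)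
  then have x: "varx ^ Suc m \<in> L wp"
    by (rule L_unit[OF cst_unit, rotated]) (simp del: of_nat_add of_nat_Suc add: of_nat_eq_0_iff)
  then have y: "vary ^ Suc n \<in> L wp" by (rule y_in_L)
  show ?thesis
    by (rule span[where d = 0 and \<kappa> = 0])
      (use x[unfolded weights(4)] y in \<open>simp_all add: cst_hom wp_def del: mult_Suc_right power_Suc\<close>)
qed

text \<open>The leading forms of \<open>h\<close> and \<open>k\<close> combine to x^m (x - \<kappa>
  y). For m = n one finds \<kappa> = - \<gamma>0 / \<beta>0 and \<kappa>^n cc = (- \<gamma>0 /
  \<beta>0)^(n+2), so the hypothesis on the powers is the resultant condition of
  \<open>normal_form\<close>.\<close>

lemma span_k:
  assumes g0: "\<gamma>0 \<noteq> 0" and ne: "m = n \<Longrightarrow> (- \<gamma>0) ^ (n + 2) \<noteq> \<beta>0 ^ (n + 2)"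
  shows "\<exists>c. u - (\<Sum>x\<in>{..m} \<times> {..<n}. cst (c x) * (varx ^ fst x * vary ^ snd x)) \<in> ideal_gen {F, h, k}"
proof -
  interpret leading G "(!) [F, h, k]" 3 W by unfold_locales
  have "cst (- (\<beta>0 ^ 3 * of_nat ((n + 2) * (n + 1)))) * (vary ^ n - cst cc * varx ^ m) \<in> L (wb * n)"
    by (rule L_lead[of 2]) (use k_lead weights in \<open>simp_all add: W_def\<close>)
  then have P1: "vary ^ n - cst cc * varx ^ m \<in> L (wb * n)"
    by (rule L_unit[OF cst_unit, rotated]) (use nonzero in \<open>simp del: of_nat_add of_nat_Suc of_nat_mult add: of_nat_eq_0_iff\<close>)
  define \<kappa> where "\<kappa> = - (\<beta>0 * of_nat (n + 2) * cc / (\<gamma>0 * of_nat (m + 2)))"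
  define q where "q = \<gamma>0 * of_nat (m + 2)"
  have q0: "q \<noteq> 0" unfolding q_def using g0 by (simp del: of_nat_add of_nat_Suc add: of_nat_eq_0_iff)
  have h': "cst (\<beta>0 * of_nat (n + 2)) * vary ^ Suc n + cst q * varx ^ Suc m \<in> L wp"
    unfolding q_def by (rule L_lead[of 1]) (use h_lead in \<open>simp_all add: W_def\<close>)
  have "vary * (vary ^ n - cst cc * varx ^ m) \<in> L wp" by (rule L_mult[OF P1 yG]) (use weights in simp)
  from L_diff[OF h' L_scale[OF this, of "cst (\<beta>0 * of_nat (n + 2))"]]
  have "cst q * varx ^ Suc m + cst (\<beta>0 * of_nat (n + 2) * cc) * (varx ^ m * vary) \<in> L wp"
    by (simp add: cst_hom algebra_simps)
  also have "\<beta>0 * of_nat (n + 2) * cc = q * (- \<kappa>)" using q0 by (simp add: \<kappa>_def q_def)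
  also have "cst q * varx ^ Suc m + cst (q * (- \<kappa>)) * (varx ^ m * vary) = cst q * (varx ^ Suc m - cst \<kappa> * (varx ^ m * vary))"
    by (simp add: cst_hom algebra_simps)
  finally have P2: "varx ^ Suc m - cst \<kappa> * (varx ^ m * vary) \<in> L wp" by (rule L_unit[OF cst_unit[OF q0]])
  have cases: "cc = 0 \<and> \<kappa> = 0 \<or> m = n \<and> wa = wb \<and> (1 - cst \<kappa> ^ n * cst cc) dvd 1"
  proof (cases "m = n")
    case True
    have \<kappa>: "\<kappa> = (- \<gamma>0) / \<beta>0"
      unfolding \<kappa>_def cc_def using True nonzero g0 by (simp add: power2_eq_square del: of_nat_add of_nat_Suc)
    have "cc = ((- \<gamma>0) / \<beta>0) ^ 2" unfolding cc_def using True by (simp add: power_divide)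
    then have "\<kappa> ^ n * cc = ((- \<gamma>0) / \<beta>0) ^ (n + 2)" unfolding \<kappa> by (simp only: power_add)
    also have "\<dots> = (- \<gamma>0) ^ (n + 2) / \<beta>0 ^ (n + 2)" by (rule power_divide)
    finally have "\<kappa> ^ n * cc = (- \<gamma>0) ^ (n + 2) / \<beta>0 ^ (n + 2)" .
    then have "1 - \<kappa> ^ n * cc \<noteq> 0" using ne[OF True] nonzero by simp
    from cst_unit[OF this] show ?thesis using True weights(11) by (simp add: cst_hom cst_power)
  qed (simp add: cc_def \<kappa>_def)
  show ?thesis by (rule span[OF P1 P2[unfolded weights(4)] cases]) simp_all
qed

text \<open>In the weights of \<open>H\<close> the orders of \<open>h\<close> and \<open>k\<close>
  are at least (n+1)(m+1) and n(m+1), so by \<open>colength_ge\<close> no fewer than n(m+1) elements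
  span. A dependency would allow one of exactly that many monomials to be dropped.\<close>

lemma indep_k:
  assumes g0: "\<gamma>0 \<noteq> 0" and ne: "m = n \<Longrightarrow> (- \<gamma>0) ^ (n + 2) \<noteq> \<beta>0 ^ (n + 2)"
    and d: "(\<Sum>x\<in>{..m} \<times> {..<n}. cst (d x) * (varx ^ fst x * vary ^ snd x)) \<in> ideal_gen {F, h, k}"
  shows "\<forall>x\<in>{..m} \<times> {..<n}. d x = 0"
proof (rule ccontr)
  let ?J = "{..m} \<times> {..<n}" and ?mo = "\<lambda>x. varx ^ fst x * vary ^ snd x :: 'k fps fps fps"
  assume "\<not> ?thesis"
  then obtain x0 where x0: "x0 \<in> ?J" "d x0 \<noteq> 0" by blast
  then have n: "0 < n" by auto
  obtain f where f: "bij_betw f {0..<card (?J - {x0})} (?J - {x0})"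
    using ex_bij_betw_nat_finite[of "?J - {x0}"] by auto
  let ?N = "card (?J - {x0})"
  interpret H: filtered H by (rule filtered_fil3)
  have "n * (m + 1) \<le> ?N"
  proof (rule colength_ge[where v = "\<lambda>i. ?mo (f i)"])
    show "h \<in> H ((n + 1) * (m + 1))"
      unfolding h by (rule H.Fil_diff[OF H.Fil_mult1[OF H_derivs(3)] H.Fil_mult1[OF H_derivs(2)]])
    have le: "n * (m + 1) \<le> (m + 2) * (n + 1)" "n * (m + 1) \<le> (n + 1) * (m + 1)" using nm by (auto simp: algebra_simps)
    show "k \<in> H (n * (m + 1))"
      unfolding k by (rule H.Fil_add[OF H.Fil_mult1[OF H.Fil_add[OF H.Fil_diff[OF H.Fil_mult1[OF H_derivs(6)]
        H.Fil_mult1[OF H.Fil_mono[OF H_derivs(5) le(1)]]] H.Fil_mult1[OF H_derivs(4)]]] H.Fil_mult2[OF H.Fil_mono[OF H_derivs(2) le(2)]]])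
    fix u
    obtain c where c: "u - (\<Sum>x\<in>?J. cst (c x) * ?mo x) \<in> ideal_gen {F, h, k}"
      using span_k[OF g0 ne] by blast
    define r where "r = c x0 / d x0"
    have "(u - (\<Sum>x\<in>?J. cst (c x) * ?mo x)) + cst r * (\<Sum>x\<in>?J. cst (d x) * ?mo x) \<in> ideal_gen {F, h, k}"
      by (rule ideal.span_add[OF c ideal_gen_mult[OF d]])
    moreover have eq: "(\<Sum>x\<in>?J. cst (c x - r * d x) * ?mo x) = (\<Sum>x\<in>?J. cst (c x) * ?mo x) - cst r * (\<Sum>x\<in>?J. cst (d x) * ?mo x)"
      unfolding cst_hom left_diff_distrib sum_subtractf sum_distrib_left mult.assoc ..
    have "u - (\<Sum>x\<in>?J. cst (c x - r * d x) * ?mo x) = (u - (\<Sum>x\<in>?J. cst (c x) * ?mo x)) + cst r * (\<Sum>x\<in>?J. cst (d x) * ?mo x)"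
      unfolding eq by simp
    ultimately have "u - (\<Sum>x\<in>?J. cst (c x - r * d x) * ?mo x) \<in> ideal_gen {F, h, k}" by (simp only:)
    moreover have "(\<Sum>x\<in>?J. cst (c x - r * d x) * ?mo x) = (\<Sum>x\<in>?J - {x0}. cst (c x - r * d x) * ?mo x)"
      using x0 by (subst sum.remove[of _ x0]) (simp_all add: r_def cst_hom(3))
    moreover have "\<dots> = (\<Sum>i<?N. kscale (c (f i) - r * d (f i)) (?mo (f i)))"
      unfolding kscale_cst using sum.reindex_bij_betw[OF f, of "\<lambda>x. cst (c x - r * d x) * ?mo x"]
      by (simp add: lessThan_atLeast0)
    ultimately obtain u1 u2 u3 where
      "u - (\<Sum>i<?N. kscale (c (f i) - r * d (f i)) (?mo (f i))) = u1 * F + u2 * h + u3 * k"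
      unfolding ideal_gen_3 by auto
    then have "u - ((\<Sum>i<?N. kscale (c (f i) - r * d (f i)) (?mo (f i))) + u1 * F + u2 * h + u3 * k) = 0"
      by (simp add: algebra_simps)
    then show "\<exists>c u1 u2 u3. u - ((\<Sum>i<?N. kscale (c i) (?mo (f i))) + u1 * F + u2 * h + u3 * k)
        \<in> H ((n + 1) * (m + 1) * (n * (m + 1)) * ((n + 1) * (m + 1) + 2 * (n * (m + 1))))"
      by (intro exI[of _ "\<lambda>i. c (f i) - r * d (f i)"] exI[of _ u1] exI[of _ u2] exI[of _ u3]) (simp only: H.Fil_zero)
  qed (use n H_derivs(1) in auto)
  moreover have "?N < card ?J" using x0(1) by (intro psubset_card_mono) auto
  ultimately show False by (simp add: mult.commute)
qed

text \<open>x, y, F is regular because F at x = y = 0 is the parameter times a nonzero constant.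
  Neighbours are then exchanged, and y is replaced by \<open>h\<close> and x by \<open>z\<close>,
  each time through a power that lies in the larger ideal.\<close>

lemma nzd_F_h: "nzd {F} h" and nzd_F_h_z: "(\<And>u. \<exists>c. u - (\<Sum>x\<in>J. cst (c x) * mo x) \<in> ideal_gen {F, h, z}) \<Longrightarrow> finite J \<Longrightarrow> nzd {F, h} z"
proof -
  have ct: "fps_nth (fps_nth (fps_nth varx 0) 0) 0 = (0 :: 'k)" "fps_nth (fps_nth (fps_nth vary 0) 0) 0 = (0 :: 'k)"
    by (simp_all add: varx_def vary_def)
  have "fps_nth (fps_nth F 0) 0 = fps_X * fps_const (fps_nth (fps_nth B 0) 0)"
    by (simp add: F veps_def varx_def vary_def const2_def map_coeffs_nth)
  then have "fps_nth (fps_nth F 0) 0 \<noteq> 0" using B0 by simp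
  then have "regular {} [varx, vary, F]"
    using nzd_varx nzd_vary nzd_varx_vary[of F] by (simp add: insert_commute)
  then have "regular {varx} [F, vary]" by (intro regular_swap[OF _ G_1[THEN iffD2, OF ct(2)]]) simp_all
  then have Fy: "nzd {varx} F" "nzd {varx, F} vary" by (simp_all add: insert_commute)
  obtain M where "vary ^ M \<in> ideal_gen {F, h, varx}"
    by (rule power_mem_of_span[OF _ span_x ct(2)]) auto
  then have "nzd {varx, F} h"
    by (intro nzd_if_power_mem[OF Fy(2)]) (simp add: insert_commute)
  then have "regular {} [varx, F, h]" using nzd_varx Fy(1) by (simp add: insert_commute)
  then have "regular {} [F, varx, h]" by (intro regular_swap[OF _ G_1[THEN iffD2, OF ct(1)]]) simp_all
  then have "regular {F} [h, varx]" by (intro regular_swap[OF _ G_1[THEN iffD2, OF ct(1)]]) simp_all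
  then have hx: "nzd {F} h" "nzd {F, h} varx" by (simp_all add: insert_commute)
  show "nzd {F} h" by fact
  show "nzd {F, h} z" if sp: "\<And>u. \<exists>c. u - (\<Sum>x\<in>J. cst (c x) * mo x) \<in> ideal_gen {F, h, z}" and fin: "finite J"
  proof -
    obtain M where "varx ^ M \<in> ideal_gen {F, h, z}"
      by (rule power_mem_of_span[OF fin sp ct(1)])
    then show ?thesis by (intro nzd_if_power_mem[OF hx(2)]) (simp add: insert_commute)
  qed
qed

end

lemma nzd_dyF: "nzd {F} (dy F)" and nzd_dxF: "nzd {F, dy F} (dx F)"
proof -
  \<comment> \<open>The partials are the special case \<beta> = 1, \<gamma> = 0, where
    \<open>h\<close> is \<open>dy F\<close>; the third element is \<open>dx F\<close>.\<close>
  have 1: "(1::'k) = fps_nth (fps_nth (fps_nth 1 0) 0) 0" "(0::'k) = fps_nth (fps_nth (fps_nth 0 0) 0) 0" "(1::'k) \<noteq> 0"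
    "dy F = 1 * dy F - 0 * dx F" by simp_all
  note 2 = 1 refl[of "- 1 * (1\<^sup>2 * dy (dy F) - 2 * 1 * 0 * dx (dy F) + 0\<^sup>2 * dx (dx F)) + dx F * 0"]
  show "nzd {F} (dy F)" by (rule nzd_F_h[OF 2])
  have "finite ({..m} \<times> {..<Suc n})" by simp
  with span_dx[OF 2] show "nzd {F, dy F} (dx F)" by (rule nzd_F_h_z[OF 2])
qed

end


section \<open>Automatic degeneracy\<close>

lemma two_unit: "(2 :: 'k::field_char_0 fps fps fps) dvd 1"
  by (rule dvdI[of _ _ "cst (inverse 2)"]) (simp flip: cst_of_nat[of 2, simplified] cst_hom(2,4))

lemma inj_of_nat_fps: "inj (of_nat :: nat \<Rightarrow> 'a::ring_char_0 fps)"
proof (rule injI)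
  fix i j :: nat assume "of_nat i = (of_nat j :: 'a fps)"
  then have "fps_nth (fps_const (of_nat i)) 0 = (fps_nth (fps_const (of_nat j)) 0 :: 'a)" by (simp only: fps_of_nat)
  then show "i = j" by simp
qed

instance fps :: (ring_char_0) ring_char_0
  by intro_classes (rule inj_of_nat_fps)

lemma const2_veps_power: "const2 (fps_X ^ l) = veps ^ l"
  by (induction l) (simp_all add: const2_1 const2_mult veps_def)

context pencil0
begin

text \<open>For arbitrary \<open>B\<close> regularity is checked modulo the parameter, where
  \<open>F\<close> and \<open>dy F\<close> become those of the germ, and is then moved by exchanges.
  Having \<open>veps\<close> at the end makes the quotient by (\<open>F\<close>,
  \<open>dy F\<close>) torsion free over the base.\<close>

lemma nzd_chain: "nzd {F} (dy F)" "nzd {F, dy F} veps"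
proof -
  have ct: "varx \<in> fil3 1 1 1 1" "vary \<in> fil3 1 1 1 1" "veps \<in> fil3 1 1 1 1"
    by (rule varx_fil3 vary_fil3 veps_fil3)+
  interpret filtered "fil3 1 1 1 :: nat \<Rightarrow> 'k fps fps fps set" by (rule filtered_fil3)
  have e: "fps_nth (fps_nth veps 0) 0 \<noteq> (0 :: 'k fps)" by (simp add: veps_def const2_def)
  have "regular {} [varx, vary, veps :: 'k fps fps fps]"
    using nzd_varx nzd_vary nzd_varx_vary[OF e] by (simp add: insert_commute)
  then have "regular {varx} [veps, vary :: 'k fps fps fps]" by (intro regular_swap[OF _ ct(2)]) simp_all
  then have "regular {} [varx, veps, vary :: 'k fps fps fps]" using nzd_varx by simp
  then have "regular {} [veps, varx, vary :: 'k fps fps fps]" by (intro regular_swap[OF _ ct(1)]) simp_all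
  then have 1: "nzd {} (veps :: 'k fps fps fps)" "nzd {veps} (varx :: 'k fps fps fps)" "nzd {veps, varx} (vary :: 'k fps fps fps)" by (simp_all add: insert_commute)
  have "vary ^ (n + 2) = 1 * F + (- econst B) * veps + (varx ^ Suc m) * varx" by (simp add: F mult.commute)
  then have "vary ^ (n + 2) \<in> ideal_gen {F, veps, varx}" unfolding ideal_gen_3 by blast
  then have "nzd {veps, varx} F" by (rule nzd_if_power_mem[OF 1(3)])
  then have "regular {veps} [F, varx]" using 1(2) by (intro regular_swap[OF _ ct(1)]) (simp_all add: insert_commute)
  then have 2: "nzd {veps} F" "nzd {veps, F} varx" by (simp_all add: insert_commute)
  have u: "(of_nat (n + 2) :: 'k fps fps fps) dvd 1"
    unfolding cst_of_nat[symmetric] by (rule cst_unit) (simp del: of_nat_add of_nat_Suc add: of_nat_eq_0_iff)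
  then obtain r :: "'k fps fps fps" where r: "1 = of_nat (n + 2) * r" by (rule dvdE)
  have "vary ^ (n + 2) = (of_nat (n + 2) * r) * (vary * vary ^ (n + 1))" unfolding r[symmetric] by simp
  also have "\<dots> = (r * vary) * dy F + (- r * vary * econst (dy B)) * veps"
    unfolding dyF by (simp add: algebra_simps del: of_nat_add of_nat_Suc)
  finally have "varx ^ (m + 2) = (r * vary) * dy F + (econst B - r * vary * econst (dy B)) * veps + (- 1) * F"
    by (simp add: F algebra_simps)
  then have "varx ^ (m + 2) \<in> ideal_gen {dy F, veps, F}" unfolding ideal_gen_3 by blast
  then have "nzd {veps, F} (dy F)" by (rule nzd_if_power_mem[OF 2(2)])
  then have "regular {} [veps, F, dy F]" using 1(1) 2(1) by (simp add: insert_commute)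
  then have "regular {} [F, veps, dy F]" by (intro regular_swap[OF _ ct(3)]) simp_all
  then have "regular {F} [dy F, veps]" by (intro regular_swap[OF _ ct(3)]) simp_all
  then show "nzd {F} (dy F)" "nzd {F, dy F} veps" by (simp_all add: insert_commute)
qed

text \<open>The parameter is made heavier than both terms of the germ, so the leading forms are
  y^(n+2) - x^(m+2) and, up to a unit, y^(n+1); together they also give x^(m+2).\<close>

lemma span_dy: "\<exists>c v0 v1. v = (\<Sum>x\<in>{..<m + 2} \<times> {..<n + 1}. const2 (c x) * (varx ^ fst x * vary ^ snd x)) + v0 * F + v1 * dy F"
proof -
  define w where "w = (m + 2) * (n + 2)"
  define G :: "nat \<Rightarrow> 'k fps fps fps set" where "G = fil3 (n + 2) (m + 2) (Suc w) "
  have G: "filtered G" unfolding G_def by (rule filtered_fil3)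
  interpret leading G "(!) [F, dy F]" 2 "w + w" using G by (rule leading.intro)
  have xG: "varx \<in> G (n + 2)" and yG: "vary \<in> G (m + 2)" and eG: "veps \<in> G (Suc w)"
    unfolding G_def by (rule varx_fil3 vary_fil3 veps_fil3)+
  have F': "vary ^ (n + 2) - varx ^ (m + 2) \<in> L w"
    by (rule L_lead[of 0]) (use Fil_mult2[OF eG] in \<open>simp_all add: F\<close>)
  have "Suc ((m + 2) * (n + 1)) \<le> Suc w" by (simp add: w_def)
  then have "veps * econst (dy B) \<in> G (Suc ((m + 2) * (n + 1)))" by (rule Fil_mult2[OF Fil_mono[OF eG]])
  moreover have "dy F - of_nat (n + 2) * vary ^ (n + 1) = veps * econst (dy B)" unfolding dyF by simp
  moreover have g1: "[F, dy F] ! 1 = dy F" by simp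
  ultimately have lead: "[F, dy F] ! 1 - of_nat (n + 2) * vary ^ (n + 1) \<in> G (Suc ((m + 2) * (n + 1)))" by (simp only:)
  have "of_nat (n + 2) * vary ^ (n + 1) \<in> L ((m + 2) * (n + 1))"
    by (rule L_lead[OF _ _ lead]) (simp_all add: w_def)
  then have Y: "vary ^ (n + 1) \<in> L ((m + 2) * (n + 1))"
    by (rule L_unit[rotated], unfold cst_of_nat[symmetric])
      (rule cst_unit, simp del: of_nat_add of_nat_Suc add: of_nat_eq_0_iff)
  have "vary * vary ^ (n + 1) \<in> L w" by (rule L_mult[OF Y yG]) (simp add: w_def)
  from L_diff[OF this F'] have x: "varx ^ (m + 2) \<in> L w" by simp
  have nf: "varx ^ i * vary ^ j \<in> L ((n + 2) * i + (m + 2) * j) \<or> (i, j) \<in> {..<m + 2} \<times> {..<n + 1}" for i j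
  proof -
    consider "m + 2 \<le> i" | "n + 1 \<le> j" | "i < m + 2" "j < n + 1" by linarith
    then show ?thesis
    proof cases
      case 1
      then obtain i' where i: "i = i' + (m + 2)" by (metis le_add_diff_inverse2)
      have "(varx ^ i' * vary ^ j) * varx ^ (m + 2) \<in> L ((n + 2) * i + (m + 2) * j)"
        by (rule L_mult[OF x Fil_mult[OF Fil_power[OF xG] Fil_power[OF yG]]]) (simp add: i w_def algebra_simps)
      moreover have "(varx ^ i' * vary ^ j) * varx ^ (m + 2) = (varx ^ i * vary ^ j :: 'k fps fps fps)"
        by (simp only: i power_add mult_ac)
      ultimately have "varx ^ i * vary ^ j \<in> L ((n + 2) * i + (m + 2) * j)" by (simp only:)
      then show ?thesis ..
    next
      case 2
      then obtain j' where j: "j = j' + (n + 1)" by (metis le_add_diff_inverse2)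
      have "(varx ^ i * vary ^ j') * vary ^ (n + 1) \<in> L ((n + 2) * i + (m + 2) * j)"
        by (rule L_mult[OF Y Fil_mult[OF Fil_power[OF xG] Fil_power[OF yG]]]) (simp add: j algebra_simps)
      moreover have "(varx ^ i * vary ^ j') * vary ^ (n + 1) = (varx ^ i * vary ^ j :: 'k fps fps fps)"
        by (simp only: j power_add mult_ac)
      ultimately have "varx ^ i * vary ^ j \<in> L ((n + 2) * i + (m + 2) * j)" by (simp only:)
      then show ?thesis ..
    qed auto
  qed
  have "\<exists>c k. v = (\<Sum>i<2. k i * [F, dy F] ! i) + (\<Sum>x\<in>{..<m + 2} \<times> {..<n + 1}. const2 (c x) * (varx ^ fst x * vary ^ snd x))"
  proof (rule span_xy[OF filtered_wfil[OF filtered_trivial] _ _ _ _ _ nf])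
    show "G = wfil (m + 2) (wfil (n + 2) (wfil (Suc w) trivial_fil))" by (simp add: G_def fil3_def)
    fix i j assume "(i, j) \<in> {..<m + 2} \<times> {..<n + 1}"
    then have "(n + 2) * i + (m + 2) * j \<le> (n + 2) * (m + 2) + (m + 2) * (n + 2)"
      by (intro add_mono mult_le_mono2) auto
    then show "(n + 2) * i + (m + 2) * j \<le> w + w" by (simp add: w_def mult.commute)
  qed simp_all
  then obtain c k where "v = (\<Sum>i<2. k i * [F, dy F] ! i) + (\<Sum>x\<in>{..<m + 2} \<times> {..<n + 1}. const2 (c x) * (varx ^ fst x * vary ^ snd x))" by blast
  moreover have "(\<Sum>i<2. k i * [F, dy F] ! i) = k 0 * F + k 1 * dy F" by (simp add: eval_nat_numeral)
  ultimately have "v = (\<Sum>x\<in>{..<m + 2} \<times> {..<n + 1}. const2 (c x) * (varx ^ fst x * vary ^ snd x)) + k 0 * F + k 1 * dy F"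
    by simp
  then show ?thesis by blast
qed

lemma dual_basis_imp_nzd:
  assumes "pp_dual_basis F 3 e"
  shows "nzd {F} (dy F)" "nzd {F, dy F} (dx F)"
proof -
  let ?J = "{..<m + 2} \<times> {..<n + 1}"
  obtain f where f: "bij_betw f {0..<card ?J} ?J" using ex_bij_betw_nat_finite[of ?J] by auto
  have "relative_curve F (card ?J) (\<lambda>i. varx ^ fst (f i) * vary ^ snd (f i))"
  proof (rule relative_curve.intro)
    show "(2 :: 'k fps fps fps) dvd 1" by (rule two_unit)
    show "nzd {F} (dy F)" by (rule nzd_chain)
    show "\<exists>c v0 v1. v = (\<Sum>i<card ?J. cscale (c i) (varx ^ fst (f i) * vary ^ snd (f i))) + v0 * F + v1 * dy F" for v
    proof -
      obtain c v0 v1 where "v = (\<Sum>x\<in>?J. const2 (c x) * (varx ^ fst x * vary ^ snd x)) + v0 * F + v1 * dy F"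
        using span_dy by blast
      moreover have "(\<Sum>x\<in>?J. const2 (c x) * (varx ^ fst x * vary ^ snd x)) =
          (\<Sum>i<card ?J. cscale (c (f i)) (varx ^ fst (f i) * vary ^ snd (f i)))"
        unfolding cscale_def using sum.reindex_bij_betw[OF f, of "\<lambda>x. const2 (c x) * (varx ^ fst x * vary ^ snd x)"]
        by (simp only: lessThan_atLeast0)
      ultimately show ?thesis by (intro exI[of _ "\<lambda>i. c (f i)"] exI[of _ v0] exI[of _ v1]) (simp only:)
    qed
    show "r \<in> ideal_gen {F, dy F}" if c: "c \<noteq> 0" and r: "cscale c r \<in> ideal_gen {F, dy F}" for c :: "'k fps" and r
    proof -
      define U where "U = fps_shift (subdegree c) c"
      have "c = U * fps_X ^ subdegree c" unfolding U_def by (rule subdegree_decompose)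
      then have c': "const2 c = const2 U * veps ^ subdegree c" by (metis const2_mult const2_veps_power)
      have u: "const2 U dvd (1 :: 'k fps fps fps)"
        using c by (simp add: is_unit_fps_iff const2_def U_def)
      then obtain q where q: "1 = const2 U * q" by (rule dvdE)
      have "q * cscale c r = (const2 U * q) * (veps ^ subdegree c * r)"
        unfolding cscale_def c' by (simp only: mult_ac)
      then have "veps ^ subdegree c * r \<in> ideal_gen {F, dy F}"
        using ideal_gen_mult[OF r, of q] unfolding q[symmetric] by simp
      then show ?thesis by (rule nzd_power[OF nzd_chain(2)])
    qed
  qed
  from relative_curve.dual_basis_imp_regular[OF this assms] show "nzd {F, dy F} (dx F)" .
qed (rule nzd_chain)

text \<open>In \<open>dbasis F 2\<close> every term contains either two first partials or a first
  and a second one, so the orders add up to at least (2n+1)(m+1).\<close>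

lemma degeneracy_ge:
  assumes "pp_dual_basis F 3 e"
  shows "enat ((2 * n + 1) * (m + 1)) \<le> quotient_dim kscale (minors_ideal F 3 e [v, w])"
proof -
  interpret H: filtered H by (rule filtered_fil3)
  note nz = dual_basis_imp_nzd[OF assms]
  have M: "minors_ideal F 3 e [v, w] = minors_ideal F 3 (dbasis F) [v, w]"
    by (rule minors_ideal_basis_eq[OF assms pp_dual_basis_dbasis[OF two_unit nz]])
  have 1: "dbasis F 1 u \<in> H ((n + 1) * (m + 1))" for u
    unfolding dbasis_1 by (intro H.Fil_diff H.Fil_mult2 H_derivs)
  have le: "(2 * n + 1) * (m + 1) \<le> (n + 1) * (m + 1) + (n + 1) * (m + 1)"
    "(2 * n + 1) * (m + 1) \<le> (n + 1) * (m + 1) + n * (m + 1)"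
    "(2 * n + 1) * (m + 1) \<le> (n + 1) * (m + 1) + (m + 2) * (n + 1)" by (auto simp: algebra_simps)
  note d = H_derivs
  have 2: "dbasis F 2 u \<in> H ((2 * n + 1) * (m + 1))" for u
  proof -
    have "(dy F)\<^sup>2 * ev (dx (dx u)) \<in> H ((2 * n + 1) * (m + 1))" unfolding power2_eq_square
      by (rule H.Fil_mult2[OF H.Fil_multI[OF d(3,3) le(1)]])
    moreover have "2 * (ev (dx (dy u)) * (dy F * dx F)) \<in> H ((2 * n + 1) * (m + 1))"
      by (rule H.Fil_mult1[OF H.Fil_mult1[OF H.Fil_multI[OF d(3,2) le(1)]]])
    moreover have "(dx F)\<^sup>2 * ev (dy (dy u)) \<in> H ((2 * n + 1) * (m + 1))" unfolding power2_eq_square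
      by (rule H.Fil_mult2[OF H.Fil_multI[OF d(2,2) le(1)]])
    moreover have "(dy F * dx (dy F) - dx F * dy (dy F)) * ev (dx u) \<in> H ((2 * n + 1) * (m + 1))"
      by (rule H.Fil_mult2[OF H.Fil_diff[OF H.Fil_multI[OF d(3,5) le(3)] H.Fil_multI[OF d(2,6) le(2)]]])
    moreover have "(dy F * dx (dx F) - dx F * dx (dy F)) * ev (dy u) \<in> H ((2 * n + 1) * (m + 1))"
      by (rule H.Fil_mult2[OF H.Fil_diff[OF H.Fil_multI[OF d(3,4) le(2)] H.Fil_multI[OF d(2,5) le(3)]]])
    ultimately have "(dy F)\<^sup>2 * ev (dx (dx u)) - 2 * (ev (dx (dy u)) * (dy F * dx F)) + (dx F)\<^sup>2 * ev (dy (dy u))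
      + (dy F * dx (dy F) - dx F * dy (dy F)) * ev (dx u) - (dy F * dx (dx F) - dx F * dx (dy F)) * ev (dy u) \<in> H ((2 * n + 1) * (m + 1))"
      by (rule H.Fil_diff[OF H.Fil_add[OF H.Fil_add[OF H.Fil_diff]]])
    moreover have "2 * (ev (dx (dy u)) * (dy F * dx F)) = 2 * dy F * dx F * ev (dx (dy u))" by (simp only: mult_ac)
    ultimately show ?thesis unfolding dbasis_2 by (simp only:)
  qed
  show ?thesis
    unfolding M unfolding minors_ideal_3 minor2_def
    by (rule determinantal_colength[OF _ _ _ _ d(1) 1 1 2 2]) simp_all
qed

end

text \<open>In coordinates in which \<open>\<tau> = (1, w)\<close>, modulo \<open>F\<close> and the first minor the second one is
  \<open>dx F\<close> times the polar \<open>k\<close>, up to a unit.\<close>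

lemma minors_ideal_unit:
  assumes "ev v dvd 1" and u: "u = inleft (ev v) * w - inleft (ev w) * v"
  shows "minors_ideal F 3 (dbasis F) [v, w] = ideal_gen {F, dbasis F 1 u, dbasis F 2 u}"
proof -
  have d: "dbasis F i u = ev v * dbasis F i w - ev w * dbasis F i v" for i
  proof -
    have "dbasis F i (inleft r * z) = r * dbasis F i z" for r z
      by (simp add: dbasis_def tangent_pow_const[OF tangent_inleft] ev_mult ev_inleft)
    moreover have "dbasis F i (y + z) = dbasis F i y + dbasis F i z" for y z
      by (simp add: dbasis_def tangent_pow_add ev_add)
    moreover have "u = inleft (ev v) * w + inleft (- ev w) * v" by (simp add: u inleft_def const2_minus)
    ultimately show ?thesis by simp
  qed
  obtain r where r: "1 = ev v * r" using assms(1) by (rule dvdE)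
  let ?g1 = "dbasis F 1 u" and ?g2 = "dbasis F 2 u"
  have m01: "minor2 (dbasis F) v w 0 1 = ?g1" and m02: "minor2 (dbasis F) v w 0 2 = ?g2"
    unfolding d minor2_def dbasis_0 by simp_all
  have "minor2 (dbasis F) v w 1 2 = (ev v * r) * (dbasis F 1 v * dbasis F 2 w - dbasis F 1 w * dbasis F 2 v)"
    unfolding r[symmetric] minor2_def by simp
  also have "\<dots> = (- r * dbasis F 2 v) * ?g1 + (r * dbasis F 1 v) * ?g2"
    unfolding d by (simp add: algebra_simps)
  finally have m12: "minor2 (dbasis F) v w 1 2 \<in> ideal_gen {F, ?g1, ?g2}"
    unfolding ideal_gen_3 by (intro exI[of _ 0] exI[of _ "- r * dbasis F 2 v"] exI[of _ "r * dbasis F 1 v"]) simp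
  then have "ideal_gen (insert (minor2 (dbasis F) v w 1 2) {F, ?g1, ?g2}) = ideal_gen {F, ?g1, ?g2}"
    unfolding ideal.span_eq by (auto intro: ideal.span_base)
  then show ?thesis unfolding minors_ideal_3 m01 m02 by (simp add: insert_commute)
qed

text \<open>Modulo the minor \<beta> \<open>dy F\<close> - \<gamma> \<open>dx F\<close>, the product
  \<beta> \<open>dy F\<close> may be replaced by \<gamma> \<open>dx F\<close>. With the factor
  \<beta>^2 in front this can be done in every term, and each then contains
  \<open>dx F\<close>.\<close>

lemma dbasis_2_polar:
  fixes F :: "'c::comm_ring_1 fps fps" and u
  defines "\<beta> \<equiv> ev (dx u)" and "\<gamma> \<equiv> ev (dy u)"
  defines "c \<equiv> \<gamma>\<^sup>2 * ev (dx (dx u)) - 2 * \<beta> * \<gamma> * ev (dx (dy u)) + \<beta>\<^sup>2 * ev (dy (dy u))"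
  shows "\<exists>z. \<beta>\<^sup>2 * dbasis F 2 u = dx F * (- \<beta> * (\<beta>\<^sup>2 * dy (dy F) - 2 * \<beta> * \<gamma> * dx (dy F) + \<gamma>\<^sup>2 * dx (dx F)) + dx F * c)
    + z * (\<beta> * dy F - \<gamma> * dx F)"
proof -
  have id: "b\<^sup>2 * (y\<^sup>2 * p - 2 * y * x * q + x\<^sup>2 * r + (y * f2 - x * f1) * b - (y * f3 - x * f2) * g)
    = x * (- b * (b\<^sup>2 * f1 - 2 * b * g * f2 + g\<^sup>2 * f3) + x * (g\<^sup>2 * p - 2 * b * g * q + b\<^sup>2 * r))
      + (p * (b * y + g * x) - 2 * b * x * q + b * (b * f2 - g * f3)) * (b * y - g * x)"
    for b g x y p q r f1 f2 f3 :: "'c fps fps"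
    by (simp add: algebra_simps power2_eq_square)
  show ?thesis unfolding dbasis_2 c_def \<beta>_def[symmetric] \<gamma>_def[symmetric] by (intro exI) (rule id)
qed

text \<open>The sections 1 and 2 \<open>dU\<close> + \<open>dV\<close> have \<beta> = 2 and \<gamma>
  = 1; the 2 keeps (- \<gamma>)^(n+2) and \<beta>^(n+2) apart for all n. A spanning set modulo
  (\<open>F\<close>, \<open>h\<close>, \<open>dx F\<close>) together with \<open>dx F\<close> times
  one modulo (\<open>F\<close>, \<open>h\<close>, \<open>k\<close>) spans, and the sizes add up to
  (n+1)(m+1) + n(m+1).\<close>

lemma (in pencil) degeneracy_le:
  fixes w
  defines "w \<equiv> inleft 2 * dU + dV"
  shows "pp_dual_basis F 3 (dbasis F)"
    and "quotient_dim kscale (minors_ideal F 3 (dbasis F) [1, w]) \<le> enat ((2 * n + 1) * (m + 1))"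
proof -
  show "pp_dual_basis F 3 (dbasis F)" by (rule pp_dual_basis_dbasis[OF two_unit nzd_dyF nzd_dxF])
  have ew: "ev w = 0" by (simp add: w_def ev_add ev_mult ev_dU ev_dV)
  have dw: "dx w = inleft 2" "dy w = 1"
    by (simp_all add: w_def dx_add dy_add dx_mult dy_mult dx_inleft dy_inleft dx_dU dy_dU dx_dV dy_dV)
  have I: "minors_ideal F 3 (dbasis F) [1, w] = ideal_gen {F, dbasis F 1 w, dbasis F 2 w}"
    by (rule minors_ideal_unit) (simp_all add: ev_monomials ew inleft_def const2_1 const2_0)
  define h where "h = 2 * dy F - 1 * dx F"
  define k where "k = - 2 * (2\<^sup>2 * dy (dy F) - 2 * 2 * 1 * dx (dy F) + 1\<^sup>2 * dx (dx F)) + dx F * 0"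
  have h: "dbasis F 1 w = h" unfolding dbasis_1 by (simp add: dw ev_inleft ev_monomials h_def)
  have ddw: "dx (dx w) = 0" "dx (dy w) = 0" "dy (dy w) = 0"
    unfolding dw by (simp_all add: dx_inleft ev_monomials)
  have ev0: "ev 0 = (0 :: 'k fps fps fps)" using ev_add[of "0 :: 'k fps fps fps fps fps" 0] by simp
  obtain z where z: "2\<^sup>2 * dbasis F 2 w = dx F * k + z * h"
    using dbasis_2_polar[of w F]
    unfolding dw ev_inleft ev_monomials dx_inleft dy_inleft ev0 h_def k_def mult_zero_right diff_self add_0_left add_0_right by blast
  let ?I = "ideal_gen {F, dbasis F 1 w, dbasis F 2 w}"
  have Xk: "dx F * k \<in> ?I"
    unfolding h ideal_gen_3 using z by (intro exI[of _ 0] exI[of _ "- z"] exI[of _ "2\<^sup>2"]) (simp add: algebra_simps)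
  have FI: "u * F \<in> ?I" "u * h \<in> ?I" for u unfolding h by (intro ideal_gen_mult ideal.span_base; simp)+
  have c: "fps_nth (fps_nth (fps_nth 2 0) 0) 0 = (2 :: 'k)" by (simp add: numeral_fps_const)
  have 1: "(2::'k) = fps_nth (fps_nth (fps_nth 2 0) 0) 0" "(1::'k) = fps_nth (fps_nth (fps_nth 1 0) 0) 0" "(2::'k) \<noteq> 0"
    using c by simp_all
  have ne: "(- 1) ^ (n + 2) \<noteq> (2::'k) ^ (n + 2)"
  proof
    assume "(- 1) ^ (n + 2) = (2::'k) ^ (n + 2)"
    then have "((- 1) ^ (n + 2))\<^sup>2 = ((2::'k) ^ (n + 2))\<^sup>2" by simp
    then have "(1::'k) = of_nat (4 ^ (n + 2))" by (simp add: power_mult[symmetric] mult.commute[of _ 2] power_mult)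
    then have "(4::nat) ^ (n + 2) = 1" by (metis of_nat_1 of_nat_eq_iff)
    then show False by simp
  qed
  note spX = span_dx[OF 1 h_def k_def]
  note spk = span_k[OF 1 h_def k_def one_neq_zero ne]
  define mo :: "nat \<times> nat \<Rightarrow> 'k fps fps fps" where "mo x = varx ^ fst x * vary ^ snd x" for x :: "nat \<times> nat"
  let ?J1 = "{..m} \<times> {..<Suc n}" and ?J2 = "{..m} \<times> {..<n}"
  have "quotient_dim kscale ?I \<le> enat (card (?J1 <+> ?J2))"
  proof (rule quotient_dim_le[OF vector_space_kscale subspace_ideal_gen, where b = "case_sum mo (\<lambda>x. dx F * mo x)"])
    fix u
    obtain c1 where "u - (\<Sum>x\<in>?J1. cst (c1 x) * mo x) \<in> ideal_gen {F, h, dx F}" using spX[of u] unfolding mo_def by blast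
    then obtain a1 a2 a3 where a: "u - (\<Sum>x\<in>?J1. cst (c1 x) * mo x) = a1 * F + a2 * h + a3 * dx F"
      unfolding ideal_gen_3 by blast
    obtain c2 where "a3 - (\<Sum>x\<in>?J2. cst (c2 x) * mo x) \<in> ideal_gen {F, h, k}" using spk[of a3] unfolding mo_def by blast
    then obtain b1 b2 b3 where b: "a3 - (\<Sum>x\<in>?J2. cst (c2 x) * mo x) = b1 * F + b2 * h + b3 * k"
      unfolding ideal_gen_3 by blast
    have "u - ((\<Sum>x\<in>?J1. cst (c1 x) * mo x) + dx F * (\<Sum>x\<in>?J2. cst (c2 x) * mo x))
        = (u - (\<Sum>x\<in>?J1. cst (c1 x) * mo x)) - a3 * dx F + dx F * (a3 - (\<Sum>x\<in>?J2. cst (c2 x) * mo x))"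
      by (simp add: algebra_simps)
    also have "\<dots> = (a1 + dx F * b1) * F + (a2 + dx F * b2) * h + b3 * (dx F * k)"
      unfolding a b by (simp add: algebra_simps)
    also have "\<dots> \<in> ?I" by (rule ideal.span_add[OF ideal.span_add[OF FI] ideal_gen_mult[OF Xk]])
    finally have "u - ((\<Sum>x\<in>?J1. cst (c1 x) * mo x) + dx F * (\<Sum>x\<in>?J2. cst (c2 x) * mo x)) \<in> ?I" .
    moreover have "(\<Sum>y\<in>?J1 <+> ?J2. kscale (case_sum c1 c2 y) (case_sum mo (\<lambda>x. dx F * mo x) y))
      = (\<Sum>x\<in>?J1. cst (c1 x) * mo x) + dx F * (\<Sum>x\<in>?J2. cst (c2 x) * mo x)"
      by (simp add: sum.Plus kscale_cst sum_distrib_left mult.left_commute)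
    ultimately show "\<exists>c. u - (\<Sum>y\<in>?J1 <+> ?J2. kscale (c y) (case_sum mo (\<lambda>x. dx F * mo x) y)) \<in> ?I"
      by (intro exI[of _ "case_sum c1 c2"]) (simp only:)
  qed simp
  moreover have "card (?J1 <+> ?J2) = (2 * n + 1) * (m + 1)" by (simp add: card_Plus card_cartesian_product algebra_simps)
  ultimately show "quotient_dim kscale (minors_ideal F 3 (dbasis F) [1, w]) \<le> enat ((2 * n + 1) * (m + 1))"
    unfolding I by simp
qed


section \<open>Two-parameter deformations and their limiting points over the field L\<close>

section \<open>Lengths at nonsingular points\<close>

lemma sigma_in_L_hom:
  "sigma_in_L (a + b) = sigma_in_L a + sigma_in_L b" "sigma_in_L (a * b) = sigma_in_L a * sigma_in_L b"
  "sigma_in_L 0 = 0" "sigma_in_L 1 = 1" "sigma_in_L a = 0 \<longleftrightarrow> a = 0"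
  by (simp_all add: sigma_in_L_def fps_to_fls_plus fls_times_fps_to_fls)

lemma sigma_in_total_eq: "sigma_in_total g = cst g"
  by (simp add: sigma_in_total_def cst_def)

definition mono_in :: "'r \<Rightarrow> 'l \<Rightarrow> 'r mon \<Rightarrow>\<^sub>0 'l::comm_ring_1" where
  "mono_in r l = Poly_Mapping.single (Mon r) l"

lemma mono_in_mult: "mono_in r l * mono_in s l' = mono_in (r * s) (l * l')"
  and mono_in_scale: "monalg_scale l (mono_in r l') = mono_in r (l * l')"
  and mono_in_add: "mono_in r (l + l') = mono_in r l + mono_in r l'"
  and mono_in_diff: "mono_in r (l - l') = mono_in r l - mono_in r l'"
  and mono_in_0: "mono_in r 0 = 0"
  and mono_in_1: "mono_in 1 1 = 1"
  by (simp_all add: mono_in_def mult_single monalg_scale_def zero_mon_def single_add single_diff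
      flip: single_one)

lemma monalg_induct:
  assumes "\<And>r l. P (mono_in r l)" "\<And>p q. P p \<Longrightarrow> P q \<Longrightarrow> P (p + q)"
  shows "P (v :: 'r::comm_ring_1 mon \<Rightarrow>\<^sub>0 'l::comm_ring_1)"
proof -
  have v: "v = (\<Sum>m\<in>Poly_Mapping.keys v. Poly_Mapping.single m (Poly_Mapping.lookup v m))"
    by (rule poly_mapping_eqI) (simp add: lookup_sum lookup_single when_def in_keys_iff)
  have "P (\<Sum>m\<in>M. Poly_Mapping.single m (Poly_Mapping.lookup v m))" if "finite M" for M
    using that
  proof induction
    case empty
    then show ?case using assms(1)[of undefined 0] by (simp add: mono_in_0)
  next
    case (insert m M)
    have "P (Poly_Mapping.single m (Poly_Mapping.lookup v m))"
      using assms(1) by (cases m) (simp add: mono_in_def)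
    then show ?case using insert assms(2) by simp
  qed
  then show ?thesis by (subst v) simp
qed

interpretation monalg: scalar_algebra "monalg_scale :: 'l::field \<Rightarrow> ('r::comm_ring_1 mon \<Rightarrow>\<^sub>0 'l) \<Rightarrow> _"
  by unfold_locales
    (simp_all add: monalg_scale_def single_add distrib_left distrib_right mult.assoc[symmetric] mult_single)

text \<open>Linear extension of a function on the monoid to the monoid algebra: the source of linear
  forms on tensor products.\<close>

definition functional :: "('r \<Rightarrow> 'l) \<Rightarrow> ('r mon \<Rightarrow>\<^sub>0 'l::comm_ring_1) \<Rightarrow> 'l" where
  "functional \<Lambda> q = (\<Sum>m\<in>Poly_Mapping.keys q. Poly_Mapping.lookup q m * \<Lambda> (case m of Mon r \<Rightarrow> r))"

lemma functional_superset:
  assumes "finite M" "Poly_Mapping.keys q \<subseteq> M"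
  shows "functional \<Lambda> q = (\<Sum>m\<in>M. Poly_Mapping.lookup q m * \<Lambda> (case m of Mon r \<Rightarrow> r))"
  unfolding functional_def using assms by (intro sum.mono_neutral_left) (auto simp: in_keys_iff)

lemma functional_add: "functional \<Lambda> (p + q) = functional \<Lambda> p + functional \<Lambda> q"
proof -
  let ?M = "Poly_Mapping.keys p \<union> Poly_Mapping.keys q"
  have "finite ?M" "Poly_Mapping.keys (p + q) \<subseteq> ?M" by (simp_all add: keys_add)
  then show ?thesis
    using functional_superset[of ?M p] functional_superset[of ?M q] functional_superset[of ?M "p + q"]
    by (simp add: lookup_add distrib_right sum.distrib)
qed

lemma functional_mono_in: "functional \<Lambda> (mono_in r l) = l * \<Lambda> r"
  using functional_superset[of "{Mon r}" "mono_in r l" \<Lambda>] by (simp add: mono_in_def)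

lemma functional_0: "functional \<Lambda> 0 = 0"
  by (simp add: functional_def)

lemma functional_diff: "functional \<Lambda> (p - q) = functional \<Lambda> p - functional \<Lambda> q"
  using functional_add[of \<Lambda> "p - q" q] by simp

lemma functional_sum: "functional \<Lambda> (sum f A) = (\<Sum>a\<in>A. functional \<Lambda> (f a))"
  by (rule hom_sum) (simp_all add: functional_0 functional_add)

context
  fixes i :: "'b::comm_ring_1 \<Rightarrow> 'r::comm_ring_1" and j :: "'b \<Rightarrow> 'l::field"
begin

abbreviation "T \<equiv> tensor_ideal i j"

lemma tensor_add: "mono_in (a + b) 1 - mono_in a 1 - mono_in b 1 \<in> T I"
  and tensor_scalar: "mono_in (i g * a) 1 - mono_in a (j g) \<in> T I"
  and tensor_mem: "a \<in> I \<Longrightarrow> mono_in a 1 \<in> T I"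
  unfolding tensor_ideal_def mono_in_def by (rule ideal.span_base; blast)+

lemma tensor_ideal_induct:
  assumes "v \<in> T I" and 0: "P 0" and add: "\<And>p q. P p \<Longrightarrow> P q \<Longrightarrow> P (p + q)"
    and 1: "\<And>q a b. P (q * (mono_in (a + b) 1 - mono_in a 1 - mono_in b 1))"
    and 2: "\<And>q g a. P (q * (mono_in (i g * a) 1 - mono_in a (j g)))"
    and 3: "\<And>q a. a \<in> I \<Longrightarrow> P (q * mono_in a 1)"
  shows "P v"
  using assms(1) unfolding tensor_ideal_def
proof (induction rule: ideal.span_induct_alt)
  case (step c x y)
  then have "P (c * x)" using 1[of c] 2[of c] 3[of _ c] unfolding mono_in_def by blast
  then show ?case using step by (intro add) simp_all
qed (rule 0)

lemma tensor_closed: "p \<in> T I \<Longrightarrow> q \<in> T I \<Longrightarrow> p + q \<in> T I" "p \<in> T I \<Longrightarrow> r * p \<in> T I" "p \<in> T I \<Longrightarrow> q \<in> T I \<Longrightarrow> p - q \<in> T I"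
  unfolding tensor_ideal_def by (rule ideal.span_add ideal_gen_mult ideal.span_diff; assumption)+

lemma tensor_sub: "ideal.subspace (T I)"
  unfolding tensor_ideal_def by (rule ideal.subspace_span)

lemma tensor_mono: "I \<subseteq> I' \<Longrightarrow> T I \<subseteq> T I'"
  unfolding tensor_ideal_def by (intro ideal.span_mono) blast

lemma tensor_mod:
  assumes I: "ideal.subspace I" and "a - b \<in> I"
  shows "mono_in a 1 - mono_in b 1 \<in> T I"
proof -
  have "mono_in ((a - b) + b) 1 - mono_in (a - b) 1 - mono_in b 1 + mono_in (a - b) 1 \<in> T I"
    by (rule tensor_closed(1)[OF tensor_add tensor_mem[OF assms(2)]])
  then show ?thesis by simp
qed

lemma tensor_sum:
  assumes "finite A" and "ideal.subspace I"
  shows "mono_in (sum f A) 1 - (\<Sum>a\<in>A. mono_in (f a) 1) \<in> T I"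
  using assms(1)
proof induction
  case empty
  show ?case using tensor_mem[OF ideal.subspace_0[OF assms(2)]] by simp
next
  case (insert a A)
  from tensor_closed(1)[OF tensor_add[of "f a" "sum f A"] insert.IH] insert(1,2) show ?case by (simp add: algebra_simps)
qed

text \<open>Base change preserves the rank of a free module. Generators carry over by the tensor
  relations. For independence, the coordinates with respect to the basis are extended by
  \<open>functional\<close> and shown to vanish on the tensor ideal.\<close>

lemma quotient_dim_tensor:
  fixes mo :: "'x \<Rightarrow> 'r"
  assumes I: "ideal.subspace I" and J: "finite J"
    and i: "\<And>a b. i (a + b) = i a + i b" "\<And>a b. i (a * b) = i a * i b" "i 0 = 0" "i 1 = 1" "\<And>a. i (- a) = - i a"
    and j: "\<And>a b. j (a + b) = j a + j b" "\<And>a b. j (a * b) = j a * j b" "j 0 = 0" "j 1 = 1"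
    and span: "\<And>r. \<exists>c. r - (\<Sum>x\<in>J. i (c x) * mo x) \<in> I"
    and indep: "\<And>c. (\<Sum>x\<in>J. i (c x) * mo x) \<in> I \<Longrightarrow> \<forall>x\<in>J. c x = 0"
  shows "quotient_dim monalg_scale (T I) = enat (card J)"
proof (rule antisym)
  show "quotient_dim monalg_scale (T I) \<le> enat (card J)"
  proof (rule quotient_dim_le[OF monalg.vector_space_axioms monalg.ideal_subspace[OF tensor_sub] J, where b = "\<lambda>x. mono_in (mo x) 1"])
    fix v :: "'r mon \<Rightarrow>\<^sub>0 'l"
    show "\<exists>d. v - (\<Sum>x\<in>J. monalg_scale (d x) (mono_in (mo x) 1)) \<in> T I"
    proof (induction v rule: monalg_induct)
      case (1 r l)
      obtain c where c: "r - (\<Sum>x\<in>J. i (c x) * mo x) \<in> I" using span by blast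
      have s: "(\<Sum>x\<in>J. mono_in (i (c x) * mo x) 1 - mono_in (mo x) (j (c x))) \<in> T I"
        unfolding tensor_ideal_def by (rule ideal.span_sum) (rule tensor_scalar[unfolded tensor_ideal_def])
      have "mono_in r 1 - (\<Sum>x\<in>J. mono_in (mo x) (j (c x))) \<in> T I"
        using tensor_closed(1)[OF tensor_closed(1)[OF tensor_mod[OF I c] tensor_sum[OF J I, of "\<lambda>x. i (c x) * mo x"]] s]
        by (simp add: sum_subtractf)
      from tensor_closed(2)[OF this, of "mono_in 1 l"]
      have "mono_in r l - (\<Sum>x\<in>J. monalg_scale (l * j (c x)) (mono_in (mo x) 1)) \<in> T I"
        by (simp add: right_diff_distrib sum_distrib_left mono_in_mult mono_in_scale)
      then show ?case by (intro exI)
    next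
      case (2 p q)
      then obtain d d' where "p - (\<Sum>x\<in>J. monalg_scale (d x) (mono_in (mo x) 1)) \<in> T I"
        "q - (\<Sum>x\<in>J. monalg_scale (d' x) (mono_in (mo x) 1)) \<in> T I" by blast
      from tensor_closed(1)[OF this]
      have "p + q - (\<Sum>x\<in>J. monalg_scale (d x + d' x) (mono_in (mo x) 1)) \<in> T I"
        by (simp add: monalg.scale_left_distrib sum.distrib algebra_simps)
      then show ?case by (rule exI[of _ "\<lambda>x. d x + d' x"])
    qed
  qed
next
  have "\<forall>r. \<exists>c. r - (\<Sum>x\<in>J. i (c x) * mo x) \<in> I" using span by blast
  from choice[OF this] obtain coord where coord: "\<And>r. r - (\<Sum>x\<in>J. i (coord r x) * mo x) \<in> I" by blast
  have unique: "coord r x = c x" if c: "r - (\<Sum>x\<in>J. i (c x) * mo x) \<in> I" and x: "x \<in> J" for r c x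
  proof -
    have "(r - (\<Sum>x\<in>J. i (c x) * mo x)) - (r - (\<Sum>x\<in>J. i (coord r x) * mo x)) \<in> I"
      by (rule ideal.subspace_diff[OF I c coord])
    then have "(\<Sum>x\<in>J. i (coord r x + - c x) * mo x) \<in> I"
      by (simp only: i(1,5) distrib_right sum.distrib) (simp add: sum_negf)
    from indep[OF this] x have "coord r x + - c x = 0" by blast
    then show ?thesis by simp
  qed
  have coord_add: "coord (a + b) x = coord a x + coord b x" if "x \<in> J" for a b x
  proof (rule unique[OF _ that])
    show "a + b - (\<Sum>x\<in>J. i (coord a x + coord b x) * mo x) \<in> I"
      using ideal.subspace_add[OF I coord[of a] coord[of b]]
      by (simp add: i(1) distrib_right sum.distrib algebra_simps)
  qed
  have coord_scale: "coord (i g * a) x = g * coord a x" if "x \<in> J" for g a x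
  proof (rule unique[OF _ that])
    show "i g * a - (\<Sum>x\<in>J. i (g * coord a x) * mo x) \<in> I"
      using ideal.subspace_scale[OF I coord[of a], of "i g"]
      by (simp add: i(2) right_diff_distrib sum_distrib_left mult.assoc)
  qed
  have coord_mem: "coord a x = 0" if "a \<in> I" "x \<in> J" for a x
    by (rule unique[OF _ that(2)]) (use that(1) i(3) in simp)
  have coord_mo: "coord (mo y) x = (if x = y then 1 else 0)" if "y \<in> J" "x \<in> J" for x y
  proof (rule unique[OF _ that(2)])
    have "(\<Sum>x\<in>J. i (if x = y then 1 else 0) * mo x) = (\<Sum>x\<in>J. if x = y then mo x else 0)"
      by (rule sum.cong) (simp_all add: i)
    then show "mo y - (\<Sum>x\<in>J. i (if x = y then 1 else 0) * mo x) \<in> I"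
      using J that(1) by (simp add: ideal.subspace_0[OF I])
  qed
  define \<Lambda> where "\<Lambda> x = functional (\<lambda>r. j (coord r x))" for x
  have zero: "\<Lambda> x v = 0" if x: "x \<in> J" and v: "v \<in> T I" for x v
    using v
  proof (rule tensor_ideal_induct)
    show "\<Lambda> x (q * (mono_in (a + b) 1 - mono_in a 1 - mono_in b 1)) = 0" for q a b
      by (induction q rule: monalg_induct)
        (simp_all add: \<Lambda>_def right_diff_distrib distrib_right distrib_left mono_in_mult functional_add functional_diff functional_mono_in
          coord_add[OF x] j, simp_all add: algebra_simps)
    show "\<Lambda> x (q * (mono_in (i g * a) 1 - mono_in a (j g))) = 0" for q g a
    proof (induction q rule: monalg_induct)
      case (1 r l)
      have eq: "r * (i g * a) = i g * (r * a)" by (simp add: mult_ac)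
      show ?case
        by (simp add: eq \<Lambda>_def right_diff_distrib mono_in_mult functional_diff functional_mono_in coord_scale[OF x] j)
    qed (simp add: \<Lambda>_def distrib_right functional_add)
    show "\<Lambda> x (q * mono_in a 1) = 0" if "a \<in> I" for q a
    proof (induction q rule: monalg_induct)
      case (1 r l)
      have "coord (r * a) x = 0" by (rule coord_mem[OF ideal.subspace_scale[OF I that] x])
      then show ?case by (simp add: \<Lambda>_def mono_in_mult functional_mono_in j)
    qed (simp add: \<Lambda>_def distrib_right functional_add)
  qed (simp_all add: \<Lambda>_def functional_0 functional_add)
  show "enat (card J) \<le> quotient_dim monalg_scale (T I)"
  proof (rule quotient_dim_ge[OF J, where b = "\<lambda>x. mono_in (mo x) 1"], rule ballI)
    fix d y assume d: "(\<Sum>x\<in>J. monalg_scale (d x) (mono_in (mo x) 1)) \<in> T I" and y: "y \<in> J"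
    have "(\<Sum>x\<in>J. d x * j (coord (mo x) y)) = 0"
      using zero[OF y d] by (simp add: \<Lambda>_def functional_sum mono_in_scale functional_mono_in)
    also have "(\<Sum>x\<in>J. d x * j (coord (mo x) y)) = (\<Sum>x\<in>J. if y = x then d x else 0)"
      by (rule sum.cong) (simp_all add: coord_mo y j)
    finally show "d y = 0" using J y by simp
  qed
qed

end

text \<open>At a nonsingular point \<open>dx F\<close> does not vanish, since modulo
  \<open>I\<close> the other partial is a multiple of it; hence \<open>I\<close> and
  \<open>I'\<close> agree locally. Conversely \<sigma> is invertible in L and one of its powers is a
  multiple of \<open>dx F\<close> modulo \<open>I'\<close>, so all points of \<open>I'\<close> are
  nonsingular. The total length is thus the full rank of the quotient by \<open>I'\<close>.\<close>

theorem nonsingular_length_eq: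
  fixes F :: "'k::field fps fps fps fps" and mo :: "'x \<Rightarrow> 'k fps fps fps fps"
  assumes I: "ideal.subspace I" "ideal.subspace I'" "I \<subseteq> I'"
    and XI: "\<And>u. u \<in> I' \<Longrightarrow> dx F * u \<in> I"
    and h: "\<beta> dvd 1" "\<beta> * dy F - \<gamma> * dx F \<in> I"
    and J: "finite J" and span: "\<And>r. \<exists>c. r - (\<Sum>x\<in>J. cst (c x) * mo x) \<in> I'"
    and indep: "\<And>c. (\<Sum>x\<in>J. cst (c x) * mo x) \<in> I' \<Longrightarrow> \<forall>x\<in>J. c x = 0"
    and sigma: "cst (fps_X ^ N) - r * dx F \<in> I'"
  shows "nonsingular_length F I = enat (card J)"
proof -
  let ?T = "tensor_ideal (sigma_in_total :: 'k fps \<Rightarrow> _) sigma_in_L"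
  let ?S = "{P. prime_ideal P \<and> ?T I' \<subseteq> P}"
  note T = tensor_mem[of _ _ "sigma_in_total :: 'k fps \<Rightarrow> _" sigma_in_L]
  have dim: "quotient_dim monalg_scale (?T I') = enat (card J)"
    by (rule quotient_dim_tensor[OF I(2) J, where mo = mo])
      (use span indep in \<open>auto simp: sigma_in_total_eq cst_hom sigma_in_L_hom\<close>)
  have primeD: "ideal.subspace P" "1 \<notin> P" "\<And>a b. a * b \<in> P \<Longrightarrow> a \<in> P \<or> b \<in> P" if "prime_ideal P"
    for P :: "('k fps fps fps fps mon \<Rightarrow>\<^sub>0 'k fls alg_closure) set"
    using that unfolding prime_ideal_def by blast+
  let ?X = "mono_in (dx F) (1 :: 'k fls alg_closure)" and ?Y = "mono_in (dy F) (1 :: 'k fls alg_closure)"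
  have X_nonsing: "?X \<notin> P" if P: "P \<in> nonsingular_points F I" for P
  proof
    assume X: "?X \<in> P"
    have P': "prime_ideal P" "?T I \<subseteq> P" "\<not> (?X \<in> P \<and> ?Y \<in> P)"
      using P unfolding nonsingular_points_def mono_in_def by blast+
    note sub = primeD(1)[OF P'(1)]
    obtain b where b: "1 = \<beta> * b" using h(1) by (rule dvdE)
    have "mono_in (\<beta> * dy F) 1 - mono_in (\<gamma> * dx F) (1 :: 'k fls alg_closure) \<in> P"
      using tensor_mod[OF I(1) h(2), of sigma_in_total sigma_in_L] P'(2) by blast
    moreover have "mono_in (\<gamma> * dx F) (1 :: 'k fls alg_closure) \<in> P"
      using ideal.subspace_scale[OF sub X, of "mono_in \<gamma> 1"] by (simp add: mono_in_mult)
    ultimately have "mono_in (\<beta> * dy F) (1 :: 'k fls alg_closure) \<in> P"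
      using ideal.subspace_add[OF sub] by fastforce
    from ideal.subspace_scale[OF sub this, of "mono_in b 1"]
    have "mono_in ((\<beta> * b) * dy F) (1 :: 'k fls alg_closure) \<in> P" by (simp add: mono_in_mult mult_ac)
    then have "?Y \<in> P" unfolding b[symmetric] by simp
    with X P'(3) show False by blast
  qed
  have XT: "?X * v \<in> ?T I" if "v \<in> ?T I'" for v
    using that
  proof (rule tensor_ideal_induct)
    show "?X * (q * mono_in a 1) \<in> ?T I" if "a \<in> I'" for q a
    proof -
      have "q * mono_in (dx F * a) 1 \<in> ?T I" by (rule tensor_closed(2)[OF T[OF XI[OF that]]])
      also have "q * mono_in (dx F * a) 1 = ?X * (q * mono_in a 1)"
        by (simp add: mult.left_commute mono_in_mult)
      finally show ?thesis .
    qed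
    show "?X * (q * (mono_in (a + b) 1 - mono_in a 1 - mono_in b 1)) \<in> ?T I" for q a b
      by (intro tensor_closed(2) tensor_add)
    show "?X * (q * (mono_in (sigma_in_total g * a) 1 - mono_in a (sigma_in_L g))) \<in> ?T I" for q g a
      by (intro tensor_closed(2) tensor_scalar)
    show "?X * 0 \<in> ?T I" using ideal.subspace_0[OF tensor_sub] by simp
    show "?X * (p + q) \<in> ?T I" if "?X * p \<in> ?T I" "?X * q \<in> ?T I" for p q
      using tensor_closed(1)[OF that] by (simp add: distrib_left)
  qed
  have points: "nonsingular_points F I = ?S"
  proof (intro equalityI subsetI)
    fix P assume P: "P \<in> nonsingular_points F I"
    have P': "prime_ideal P" "?T I \<subseteq> P" using P unfolding nonsingular_points_def by blast+
    have "?T I' \<subseteq> P" using XT P'(2) primeD(3)[OF P'(1)] X_nonsing[OF P] by blast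
    then show "P \<in> ?S" using P'(1) by blast
  next
    fix P assume "P \<in> ?S"
    then have P: "prime_ideal P" "?T I' \<subseteq> P" by blast+
    note sub = primeD(1)[OF P(1)]
    have "?X \<notin> P"
    proof
      assume X: "?X \<in> P"
      let ?l = "sigma_in_L (fps_X ^ N) :: 'k fls alg_closure"
      have l: "?l \<noteq> 0" by (simp add: sigma_in_L_hom)
      have "mono_in (r * dx F) (1 :: 'k fls alg_closure) \<in> P"
        using ideal.subspace_scale[OF sub X, of "mono_in r 1"] by (simp add: mono_in_mult)
      moreover have "mono_in (cst (fps_X ^ N)) 1 - mono_in (r * dx F) (1 :: 'k fls alg_closure) \<in> P"
        using tensor_mod[OF I(2) sigma, of sigma_in_total sigma_in_L] P(2) by blast
      ultimately have "mono_in (cst (fps_X ^ N)) (1 :: 'k fls alg_closure) \<in> P"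
        using ideal.subspace_add[OF sub] by fastforce
      moreover have "mono_in (cst (fps_X ^ N) * 1) 1 - mono_in 1 ?l \<in> P"
        using tensor_scalar[of sigma_in_total "fps_X ^ N" 1 sigma_in_L I'] P(2) unfolding sigma_in_total_eq by blast
      ultimately have "mono_in (cst (fps_X ^ N)) 1 - (mono_in (cst (fps_X ^ N) * 1) 1 - mono_in 1 ?l) \<in> P"
        by (rule ideal.subspace_diff[OF sub])
      then have "mono_in 1 ?l \<in> P" by simp
      from ideal.subspace_scale[OF sub this, of "mono_in 1 (inverse ?l)"] have "1 \<in> P"
        using l by (simp add: mono_in_mult mono_in_1)
      then show False using primeD(2)[OF P(1)] by blast
    qed
    then show "P \<in> nonsingular_points F I"
      using P tensor_mono[OF I(3), of sigma_in_total sigma_in_L] unfolding nonsingular_points_def mono_in_def by blast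
  qed
  have ker: "loc_kernel (?T I) P = loc_kernel (?T I') P" if P: "P \<in> ?S" for P
  proof (intro equalityI subsetI)
    fix v assume "v \<in> loc_kernel (?T I') P"
    then obtain u where u: "u \<notin> P" "u * v \<in> ?T I'" unfolding loc_kernel_def by blast
    have "?X \<notin> P" by (rule X_nonsing) (use P points in blast)
    then have "?X * u \<notin> P" using u(1) primeD(3) P by blast
    moreover have "(?X * u) * v \<in> ?T I" using XT[OF u(2)] by (simp add: mult.assoc)
    ultimately show "v \<in> loc_kernel (?T I) P" unfolding loc_kernel_def by blast
  next
    fix v assume "v \<in> loc_kernel (?T I) P"
    then show "v \<in> loc_kernel (?T I') P"
      using tensor_mono[OF I(3), of sigma_in_total sigma_in_L] unfolding loc_kernel_def by blast
  qed
  have loc: "localization_dim monalg_scale (?T I) P = quotient_dim monalg_scale (loc_kernel (?T I') P)" if "P \<in> ?S" for P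
    using monalg.localization_dim_eq[of P] ker[OF that] that by simp
  note S = monalg.length_sum[OF tensor_sub dim]
  have total: "(\<Sum>P\<in>?S. localization_dim monalg_scale (?T I) P) = enat (card J)"
    using S loc by simp
  show ?thesis
    unfolding nonsingular_length_def points
  proof (rule antisym)
    show "Sup {\<Sum>P\<in>\<A>. localization_dim monalg_scale (?T I) P | \<A>. finite \<A> \<and> \<A> \<subseteq> ?S} \<le> enat (card J)"
    proof (rule Sup_least)
      fix z assume "z \<in> {\<Sum>P\<in>\<A>. localization_dim monalg_scale (?T I) P | \<A>. finite \<A> \<and> \<A> \<subseteq> ?S}"
      then obtain \<A> where z: "z = (\<Sum>P\<in>\<A>. localization_dim monalg_scale (?T I) P)" "\<A> \<subseteq> ?S" by blast
      have "z \<le> (\<Sum>P\<in>?S. localization_dim monalg_scale (?T I) P)"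
        unfolding z(1) using z(2) S by (intro sum_mono2) auto
      then show "z \<le> enat (card J)" unfolding total .
    qed
    show "enat (card J) \<le> Sup {\<Sum>P\<in>\<A>. localization_dim monalg_scale (?T I) P | \<A>. finite \<A> \<and> \<A> \<subseteq> ?S}"
      by (rule Sup_upper, rule CollectI, rule exI[of _ ?S]) (use total S in simp)
  qed
qed


section \<open>Reduction modulo \<open>\<sigma>\<close>\<close>

definition mod_sigma :: "'k::comm_ring_1 fps fps fps fps \<Rightarrow> 'k fps fps fps" where
  "mod_sigma = map_coeffs (\<lambda>c. Abs_fps (\<lambda>l. fps_nth (fps_nth c l) 0))"

definition lift_sigma :: "'k::comm_ring_1 fps fps fps \<Rightarrow> 'k fps fps fps fps" where
  "lift_sigma = map_coeffs (\<lambda>c. Abs_fps (\<lambda>l. fps_const (fps_nth c l)))"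

abbreviation vsig :: "'k::comm_ring_1 fps fps fps fps" where "vsig \<equiv> cst fps_X"

text \<open>The \<sigma>-adic filtration: \<sigma> is the innermost variable and the only one of
  positive weight.\<close>

definition sigma_fil :: "nat \<Rightarrow> 'k::comm_ring_1 fps fps fps fps set" where
  "sigma_fil = wfil 0 (wfil 0 (wfil 0 (wfil 1 trivial_fil)))"

lemma filtered_sigma_fil: "filtered sigma_fil"
  unfolding sigma_fil_def by (intro filtered_wfil filtered_trivial)

lemma cst_mult_nth: "fps_nth (fps_nth (fps_nth (cst c * g) j) i) l = c * fps_nth (fps_nth (fps_nth g j) i) l"
  by (simp add: cst_def const2_def)

lemma vsig_power: "vsig ^ N = cst (fps_X ^ N)"
  by (simp add: cst_power)

lemma sigma_fil_iff: "u \<in> sigma_fil N \<longleftrightarrow> (\<exists>q. u = vsig ^ N * q)"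
proof
  assume u: "u \<in> sigma_fil N"
  have z: "fps_nth (fps_nth (fps_nth (fps_nth u j) i) l) M = 0" if "M < N" for j i l M
  proof -
    have "fps_nth (fps_nth (fps_nth (fps_nth u j) i) l) M \<in> (if N \<le> M then UNIV else {0})"
      using u by (simp add: sigma_fil_def wfil_def trivial_fil_def)
    then show ?thesis using that by simp
  qed
  have "u = vsig ^ N * map_coeffs (\<lambda>c. Abs_fps (\<lambda>l. fps_shift N (fps_nth c l))) u"
    unfolding vsig_power
    by (simp add: fps_eq_iff cst_mult_nth map_coeffs_nth fps_X_power_mult_nth z)
  then show "\<exists>q. u = vsig ^ N * q" by blast
next
  assume "\<exists>q. u = vsig ^ N * q"
  then show "u \<in> sigma_fil N"
    by (auto simp: sigma_fil_def wfil_def trivial_fil_def vsig_power cst_mult_nth fps_X_power_mult_nth)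
qed

lemma mod_sigma_hom: "mod_sigma (a + b) = mod_sigma a + mod_sigma b" "mod_sigma (a * b) = mod_sigma a * mod_sigma b"
  "mod_sigma 0 = 0" "mod_sigma 1 = 1" "mod_sigma (a - b) = mod_sigma a - mod_sigma b" "mod_sigma (- a) = - mod_sigma a"
proof -
  show "mod_sigma (a * b) = mod_sigma a * mod_sigma b"
    unfolding mod_sigma_def by (rule map_coeffs_mult) (simp_all add: fps_eq_iff fps_mult_nth fps_sum_nth)
qed (auto simp: mod_sigma_def map_coeffs_def fps_eq_iff)

lemma mod_sigma_lift: "mod_sigma (lift_sigma g) = g"
  by (simp add: mod_sigma_def lift_sigma_def map_coeffs_def fps_eq_iff)

lemma mod_sigma_vars: "mod_sigma varx = varx" "mod_sigma vary = vary" "mod_sigma veps = veps" "mod_sigma vsig = 0"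
  by (auto simp: mod_sigma_def map_coeffs_def varx_def vary_def veps_def cst_def const2_def fps_eq_iff fps_X_def)

lemma mod_sigma_cst: "mod_sigma (cst c) = cst (fps_nth c 0)"
  by (auto simp: mod_sigma_def map_coeffs_def cst_def const2_def fps_eq_iff)

lemma mod_sigma_inright: "mod_sigma (inright g) = econst g"
  by (auto simp: mod_sigma_def inright_def map_coeffs_def const2_def fps_eq_iff)

lemma mod_sigma_derivs: "mod_sigma (dx g) = dx (mod_sigma g)" "mod_sigma (dy g) = dy (mod_sigma g)"
proof -
  have *: "fps_nth (fps_nth (of_nat k * c) l) i = of_nat k * fps_nth (fps_nth c l) i" for k l i and c :: "'a fps fps"
    by (simp flip: fps_of_nat)
  show "mod_sigma (dx g) = dx (mod_sigma g)" "mod_sigma (dy g) = dy (mod_sigma g)"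
    by (simp_all add: mod_sigma_def map_coeffs_def dx_def dy_def fps_eq_iff * fps_of_nat[symmetric] del: of_nat_Suc)
qed

lemma mod_sigma_power: "mod_sigma (a ^ l) = mod_sigma a ^ l"
  by (induction l) (simp_all add: mod_sigma_hom)

lemma mod_sigma_ct: "fps_nth (fps_nth (fps_nth (mod_sigma g) 0) 0) 0 = fps_nth (fps_nth (fps_nth (fps_nth g 0) 0) 0) 0"
  by (simp add: mod_sigma_def map_coeffs_def)

lemma mod_sigma_eq_0: "mod_sigma g = 0 \<Longrightarrow> \<exists>q. g = q * vsig"
proof -
  assume "mod_sigma g = 0"
  then have "fps_nth (fps_nth (fps_nth (fps_nth g j) i) l) 0 = 0" for i j l
    by (auto simp: mod_sigma_def map_coeffs_def fps_eq_iff)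
  then have "g \<in> sigma_fil 1"
    by (auto simp: sigma_fil_def wfil_def trivial_fil_def Suc_le_eq)
  then show ?thesis unfolding sigma_fil_iff by (auto simp: mult.commute)
qed

lemma mod_sigma_ideal: "mod_sigma g \<in> ideal_gen (mod_sigma ` S) \<longleftrightarrow> g \<in> ideal_gen (insert vsig S)"
proof
  assume "mod_sigma g \<in> ideal_gen (mod_sigma ` S)"
  moreover have "\<exists>g'\<in>ideal_gen S. mod_sigma g' = y" if "y \<in> ideal_gen (mod_sigma ` S)" for y
    using that
  proof (induction rule: ideal.span_induct_alt)
    case base
    show ?case by (rule bexI[of _ 0]) (simp_all add: mod_sigma_hom ideal.span_zero)
  next
    case (step c x y)
    then obtain s g' where s: "s \<in> S" "x = mod_sigma s" "g' \<in> ideal_gen S" "mod_sigma g' = y" by blast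
    have "lift_sigma c * s + g' \<in> ideal_gen S" by (rule ideal.span_add[OF ideal_gen_mult[OF ideal.span_base[OF s(1)]] s(3)])
    moreover have "mod_sigma (lift_sigma c * s + g') = c * x + y" using s by (simp add: mod_sigma_hom mod_sigma_lift)
    ultimately show ?case by blast
  qed
  ultimately obtain g' where g': "g' \<in> ideal_gen S" "mod_sigma g' = mod_sigma g" by blast
  have "mod_sigma (g - g') = 0" using g'(2) by (simp add: mod_sigma_hom)
  then obtain q where "g - g' = q * vsig" using mod_sigma_eq_0 by blast
  then have "g - q * vsig = g'" by (simp add: algebra_simps)
  then show "g \<in> ideal_gen (insert vsig S)" using g'(1) by (intro ideal_gen_insertI[of g q]) simp
next
  assume "g \<in> ideal_gen (insert vsig S)"
  then show "mod_sigma g \<in> ideal_gen (mod_sigma ` S)"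
  proof (induction rule: ideal.span_induct_alt)
    case (step c x y)
    have "mod_sigma x \<in> ideal_gen (mod_sigma ` S)"
      using step(1) by (auto simp: mod_sigma_vars ideal.span_zero intro: ideal.span_base)
    then show ?case using step by (simp add: mod_sigma_hom ideal.span_add ideal_gen_mult)
  qed (simp add: mod_sigma_hom ideal.span_zero)
qed

lemma nzd_mod_sigma: "nzd (mod_sigma ` S) (mod_sigma a) \<Longrightarrow> nzd (insert vsig S) a"
  unfolding nzd_def mod_sigma_ideal[symmetric] mod_sigma_hom by blast

text \<open>Dividing by \<open>vsig\<close> first is the reduction, so the sequence starting with
  \<open>vsig\<close> is regular; exchanges then move \<open>vsig\<close> to the end.\<close>

lemma regular_lift_sigma:
  fixes F h k :: "'k::idom fps fps fps fps"
  assumes "mod_sigma F \<noteq> 0" "nzd {mod_sigma F} (mod_sigma h)" "nzd {mod_sigma F, mod_sigma h} (mod_sigma k)"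
  shows "nzd {F} h" "nzd {F, h} k" "nzd {F, h, k} vsig"
proof -
  interpret filtered "sigma_fil :: nat \<Rightarrow> 'k fps fps fps fps set" by (rule filtered_sigma_fil)
  have s: "vsig \<in> sigma_fil 1" unfolding sigma_fil_iff by (intro exI[of _ 1]) simp
  have s0: "nzd {} (vsig :: 'k fps fps fps fps)" by (simp add: nzd_def cst_def const2_def)
  have "nzd (mod_sigma ` {}) (mod_sigma F)" using assms(1) by (simp add: nzd_def)
  then have 1: "nzd {vsig} F" by (rule nzd_mod_sigma)
  have "nzd (mod_sigma ` {F}) (mod_sigma h)" using assms(2) by simp
  then have 2: "nzd {vsig, F} h" by (rule nzd_mod_sigma)
  have "nzd (mod_sigma ` {F, h}) (mod_sigma k)" using assms(3) by simp
  then have 3: "nzd {vsig, F, h} k" by (rule nzd_mod_sigma)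
  have "regular {} [vsig, F, h, k]" using s0 1 2 3 by (simp add: insert_commute)
  then have "regular {} [F, vsig, h, k]" by (intro regular_swap[OF _ s]) simp_all
  then have "regular {F} [h, vsig, k]" by (intro regular_swap[OF _ s]) simp_all
  then have h: "nzd {F} h" and "regular {F, h} [vsig, k]" by (simp_all add: insert_commute)
  then have "regular {F, h} [k, vsig]" by (intro regular_swap[OF _ s]) simp_all
  then show "nzd {F, h} k" "nzd {F, h, k} vsig" by (simp_all add: insert_commute)
  show "nzd {F} h" by (rule h)
qed

text \<open>Nakayama's lemma by successive approximation: each correction is a multiple of the next
  power of \<sigma>.\<close>

lemma span_lift_sigma:
  fixes F h k :: "'k::comm_ring_1 fps fps fps fps"
  assumes J: "finite J"
    and span: "\<And>u. \<exists>c. u - (\<Sum>x\<in>J. cst (c x) * mod_sigma (mo x)) \<in> ideal_gen {mod_sigma F, mod_sigma h, mod_sigma k}"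
  shows "\<exists>c. u - (\<Sum>x\<in>J. cst (c x) * mo x) \<in> ideal_gen {F, h, k}"
proof -
  interpret filtered "sigma_fil :: nat \<Rightarrow> 'k fps fps fps fps set" by (rule filtered_sigma_fil)
  let ?V = "wfil 1 trivial_fil :: nat \<Rightarrow> 'k fps set"
  have sumF: "(\<Sum>i\<in>{..<3::nat}. a i * [F, h, k] ! i) = a 0 * F + a 1 * h + a 2 * k" for a
    by (simp add: eval_nat_numeral)
  have "\<exists>a c. u = (\<Sum>i\<in>{..<3}. a i * [F, h, k] ! i) + (\<Sum>x\<in>J. cst (c x) * mo x)"
  proof (rule approx_rem[where FV = ?V and Q = sigma_fil and w = 0 and N = 0])
    show "cst c \<in> sigma_fil n" if "c \<in> ?V n" for c n
      unfolding sigma_fil_def cst_def const2_def by (intro wfil_const filtered_wfil filtered_trivial that)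
    fix n u assume "u \<in> (sigma_fil n :: 'k fps fps fps fps set)"
    then obtain q where q: "u = vsig ^ n * q" unfolding sigma_fil_iff by blast
    obtain d where "mod_sigma q - (\<Sum>x\<in>J. cst (d x) * mod_sigma (mo x)) \<in> ideal_gen {mod_sigma F, mod_sigma h, mod_sigma k}"
      using span by blast
    moreover have "mod_sigma (\<Sum>x\<in>J. cst (fps_const (d x)) * mo x) = (\<Sum>x\<in>J. cst (d x) * mod_sigma (mo x))"
      by (subst hom_sum[of mod_sigma]) (simp_all add: mod_sigma_hom mod_sigma_cst)
    ultimately have "mod_sigma (q - (\<Sum>x\<in>J. cst (fps_const (d x)) * mo x)) \<in> ideal_gen (mod_sigma ` {F, h, k})"
      by (simp add: mod_sigma_hom)
    then have "q - (\<Sum>x\<in>J. cst (fps_const (d x)) * mo x) \<in> ideal_gen {vsig, F, h, k}"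
      unfolding mod_sigma_ideal .
    then obtain b0 b1 b2 b3 where "q - (\<Sum>x\<in>J. cst (fps_const (d x)) * mo x) = b0 * vsig + b1 * F + b2 * h + b3 * k"
      unfolding ideal_gen_4 by blast
    then have q': "q = b0 * vsig + b1 * F + b2 * h + b3 * k + (\<Sum>x\<in>J. cst (fps_const (d x)) * mo x)"
      by (simp add: algebra_simps)
    define a where "a i = vsig ^ n * [b1, b2, b3] ! i" for i
    define c where "c x = fps_X ^ n * fps_const (d x)" for x
    have "(\<Sum>i\<in>{..<3}. a i * [F, h, k] ! i) = vsig ^ n * (b1 * F + b2 * h + b3 * k)"
      unfolding sumF by (simp add: a_def algebra_simps)
    moreover have "(\<Sum>x\<in>J. cst (c x) * mo x) = vsig ^ n * (\<Sum>x\<in>J. cst (fps_const (d x)) * mo x)"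
      unfolding c_def cst_hom vsig_power sum_distrib_left mult.assoc ..
    ultimately have "u - ((\<Sum>i\<in>{..<3}. a i * [F, h, k] ! i) + (\<Sum>x\<in>J. cst (c x) * mo x)) = vsig ^ Suc n * b0"
      unfolding q q' by (simp add: algebra_simps)
    then have "u - ((\<Sum>i\<in>{..<3}. a i * [F, h, k] ! i) + (\<Sum>x\<in>J. cst (c x) * mo x)) \<in> sigma_fil (Suc n)"
      unfolding sigma_fil_iff by blast
    moreover have "\<forall>i\<in>{..<3}. a i \<in> sigma_fil (n - 0)" unfolding a_def sigma_fil_iff by auto
    moreover have "\<forall>x\<in>J. c x \<in> ?V (n - 0)"
      unfolding c_def by (auto simp: wfil_def trivial_fil_def fps_X_power_mult_nth)
    ultimately show "\<exists>a b. (\<forall>i\<in>{..<3}. a i \<in> sigma_fil (n - 0)) \<and> (\<forall>x\<in>J. b x \<in> ?V (n - 0)) \<and>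
        u - ((\<Sum>i\<in>{..<3}. a i * [F, h, k] ! i) + (\<Sum>x\<in>J. cst (b x) * mo x)) \<in> sigma_fil (Suc n)" by blast
  qed (use J filtered_wfil[OF filtered_trivial] cst_hom in auto)
  then obtain a c where "u = (\<Sum>i\<in>{..<3}. a i * [F, h, k] ! i) + (\<Sum>x\<in>J. cst (c x) * mo x)" by blast
  then have "u - (\<Sum>x\<in>J. cst (c x) * mo x) = a 0 * F + a 1 * h + a 2 * k" unfolding sumF by simp
  then show ?thesis unfolding ideal_gen_3 by blast
qed

text \<open>Reduction shows that all constant terms of the coefficients vanish; the common factor
  \<sigma> is a nonzerodivisor and cancels, and the argument repeats.\<close>

lemma indep_lift_sigma:
  fixes F h k :: "'k::idom fps fps fps fps"
  assumes s: "nzd {F, h, k} vsig"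
    and indep: "\<And>c. (\<Sum>x\<in>J. cst (c x) * mod_sigma (mo x)) \<in> ideal_gen {mod_sigma F, mod_sigma h, mod_sigma k} \<Longrightarrow> \<forall>x\<in>J. c x = 0"
    and c: "(\<Sum>x\<in>J. cst (c x) * mo x) \<in> ideal_gen {F, h, k}"
  shows "\<forall>x\<in>J. c x = 0"
proof -
  have 0: "\<forall>x\<in>J. fps_nth (c x) 0 = 0" if "(\<Sum>x\<in>J. cst (c x) * mo x) \<in> ideal_gen {F, h, k}" for c
  proof -
    have "(\<Sum>x\<in>J. cst (c x) * mo x) \<in> ideal_gen {vsig, F, h, k}"
      using that ideal.span_mono[of "{F, h, k}" "{vsig, F, h, k}"] by blast
    then have "mod_sigma (\<Sum>x\<in>J. cst (c x) * mo x) \<in> ideal_gen (mod_sigma ` {F, h, k})"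
      unfolding mod_sigma_ideal .
    moreover have "mod_sigma (\<Sum>x\<in>J. cst (c x) * mo x) = (\<Sum>x\<in>J. cst (fps_nth (c x) 0) * mod_sigma (mo x))"
      by (subst hom_sum[of mod_sigma]) (simp_all add: mod_sigma_hom mod_sigma_cst)
    ultimately show ?thesis by (intro indep) simp
  qed
  have "\<forall>x\<in>J. fps_nth (c x) N = 0" for N
    using c
  proof (induction N arbitrary: c)
    case (Suc N)
    have "c x = fps_X * fps_shift 1 (c x)" if "x \<in> J" for x
      using 0[OF Suc.prems] that by (intro fps_ext, case_tac n) simp_all
    then have "(\<Sum>x\<in>J. cst (c x) * mo x) = (\<Sum>x\<in>J. cst (fps_X * fps_shift 1 (c x)) * mo x)"
      by (intro sum.cong) simp_all
    also have "\<dots> = vsig * (\<Sum>x\<in>J. cst (fps_shift 1 (c x)) * mo x)"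
      by (simp add: cst_hom sum_distrib_left mult.assoc)
    finally have "vsig * (\<Sum>x\<in>J. cst (fps_shift 1 (c x)) * mo x) \<in> ideal_gen {F, h, k}"
      using Suc.prems by simp
    with s have "(\<Sum>x\<in>J. cst (fps_shift 1 (c x)) * mo x) \<in> ideal_gen {F, h, k}" by (rule nzdD)
    from Suc.IH[OF this] show ?case by simp
  qed (rule 0)
  then show ?thesis by (simp add: fps_eq_iff)
qed


section \<open>Two-parameter deformations\<close>

abbreviation kc :: "'k::comm_ring_1 \<Rightarrow> 'k fps fps fps fps" where "kc c \<equiv> cst (fps_const c)"

abbreviation ct :: "'k fps fps fps fps \<Rightarrow> 'k::comm_ring_1" where
  "ct g \<equiv> fps_nth (fps_nth (fps_nth (fps_nth g 0) 0) 0) 0"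

lemma kc_hom: "kc (a * b) = kc a * kc b" "kc (a + b) = kc a + kc b" "kc (a - b) = kc a - kc b" "kc (- a) = - kc a"
  "kc 0 = 0" "kc 1 = 1" "kc (of_nat n) = of_nat n" "kc (a ^ n) = kc a ^ n"
proof -
  show "kc (of_nat n) = of_nat n" by (simp only: fps_of_nat cst_of_nat)
  show "kc (a ^ n) = kc a ^ n" by (simp only: fps_const_power[symmetric] cst_power)
qed (simp_all add: cst_hom flip: fps_const_mult fps_const_add fps_const_sub fps_const_neg)

lemma kc_unit: "c \<noteq> 0 \<Longrightarrow> kc (c :: 'k::field) dvd 1"
  by (rule dvdI[of _ _ "kc (inverse c)"]) (simp flip: kc_hom(1,6))

lemma ct_kc: "ct (kc c) = c"
  by (simp add: cst_def const2_def)

lemma two_unit2: "(2 :: 'k::field_char_0 fps fps fps fps) dvd 1"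
  using kc_unit[of "of_nat 2 :: 'k"] by (simp only: kc_hom(7)) simp

lemma wfil_1: "filtered V \<Longrightarrow> 0 < w \<Longrightarrow> g \<in> wfil w V 1 \<longleftrightarrow> fps_nth g 0 \<in> V 1"
proof -
  assume V: "filtered V" and w: "0 < w"
  have "fps_nth g j \<in> V (1 - w * j)" if "fps_nth g 0 \<in> V 1" for j
    using that w filtered.Fil_0[OF V] by (cases j) auto
  then show ?thesis unfolding wfil_def by (auto dest: spec[of _ 0])
qed

lemma dx_vsig: "dx vsig = 0" "dy vsig = 0"
  by (simp_all add: cst_def dx_const2 dy_const2)

locale pencil2 =
  fixes n m :: nat and A B :: "'k::field_char_0 fps fps" and F :: "'k fps fps fps fps"
  assumes nm: "n \<le> m" and B0: "fps_nth (fps_nth B 0) 0 \<noteq> 0"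
    and F: "F = vary ^ (n + 2) - varx ^ (m + 2) + vsig * inright A + veps * inright B"
begin

lemma dxF: "dx F = vsig * inright (dx A) + veps * inright (dx B) - of_nat (m + 2) * varx ^ (m + 1)"
  and dyF: "dy F = vsig * inright (dy A) + veps * inright (dy B) + of_nat (n + 2) * vary ^ (n + 1)"
  by (simp_all add: F dx_add dx_diff dy_add dy_diff dx_mult dy_mult dx_veps dy_veps dx_vsig dx_inright dy_inright
      dx_varx_power dy_varx_power dx_vary_power dy_vary_power del: power_Suc of_nat_add of_nat_Suc)

lemma dx_of_nat: "dx (of_nat k) = 0" and dy_of_nat: "dy (of_nat k) = 0"
  by (induction k) (simp_all add: dx_add dy_add dx_0 dy_0 dx_const2[of 1, unfolded const2_1] dy_const2[of 1, unfolded const2_1])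

lemma dxxF: "dx (dx F) = vsig * inright (dx (dx A)) + veps * inright (dx (dx B)) - of_nat ((m + 2) * (m + 1)) * varx ^ m"
  and dxyF: "dx (dy F) = vsig * inright (dx (dy A)) + veps * inright (dx (dy B))"
  and dyyF: "dy (dy F) = vsig * inright (dy (dy A)) + veps * inright (dy (dy B)) + of_nat ((n + 2) * (n + 1)) * vary ^ n"
  unfolding of_nat_mult by (simp_all add: dxF dyF dx_add dx_diff dy_add dy_diff dx_mult dy_mult dx_veps dy_veps dx_vsig
      dx_inright dy_inright dx_varx_power dy_varx_power dx_vary_power dy_vary_power dx_of_nat dy_of_nat mult.assoc
      del: power_Suc of_nat_add of_nat_Suc)

sublocale reduced: pencil n m B "mod_sigma F"
  by unfold_locales (simp_all add: nm B0 F mod_sigma_hom mod_sigma_vars mod_sigma_inright mod_sigma_power del: power_Suc)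

lemma reduced_nonzero: "mod_sigma F \<noteq> 0"
proof
  assume "mod_sigma F = 0"
  then have "fps_nth (fps_nth (fps_nth (mod_sigma F) 0) 0) 1 = 0" by simp
  moreover have "fps_nth (fps_nth (fps_nth (mod_sigma F) 0) 0) 1 = fps_nth (fps_nth B 0) 0"
    unfolding reduced.F by (simp add: varx_def vary_def veps_def const2_def map_coeffs_nth)
  ultimately show False using B0 by simp
qed

lemma dual_basis: "pp_dual_basis F 3 (dbasis F)"
proof (rule pp_dual_basis_dbasis[OF two_unit2])
  have "nzd {mod_sigma F} (mod_sigma (dy F))" "nzd {mod_sigma F, mod_sigma (dy F)} (mod_sigma (dx F))"
    unfolding mod_sigma_derivs by (rule reduced.nzd_dyF reduced.nzd_dxF)+
  from regular_lift_sigma[OF reduced_nonzero this] show "nzd {F} (dy F)" "nzd {F, dy F} (dx F)" by blast+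
qed

lemma ct_derivs: "ct F = 0" "ct (dx F) = 0" "ct (dy F) = 0"
proof -
  show "ct F = 0" unfolding F by (simp add: varx_def vary_def veps_def cst_def const2_def)
  show "ct (dx F) = 0" unfolding dxF by (simp add: varx_def vary_def veps_def cst_def const2_def)
  show "ct (dy F) = 0" unfolding dyF by (simp add: varx_def vary_def veps_def cst_def const2_def)
qed

text \<open>Both parameters get the order \<open>pp\<close> of the partials, so their linear terms
  enter the leading forms of \<open>dx F\<close> and \<open>dy F\<close> and make up the leading
  form of \<open>F\<close>.\<close>

definition pa where "pa = n + 1"
definition pb where "pb = m + 1"
definition pp where "pp = pb * Suc n"
definition G where "G = wfil pb (wfil pa (wfil pp (wfil pp trivial_fil)))"

lemma weights: "0 < pa" "0 < pb" "0 < pp" "pp = pa * Suc m" "pb * n + pb = pp" "pa * m + pa = pp" "pa \<le> pb"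
  "m = n \<Longrightarrow> pa = pb" "n < m \<Longrightarrow> pa < pb"
  unfolding pa_def pb_def pp_def using nm by (auto simp: algebra_simps)

sublocale filtered G
  unfolding G_def by (intro filtered_wfil filtered_trivial)

lemma xG: "varx \<in> G pa" and yG: "vary \<in> G pb" and eG: "veps \<in> G pp" and sG: "vsig \<in> G pp"
proof -
  show "varx \<in> G pa" unfolding G_def varx_def by (intro wfil_const wfil_X filtered_wfil filtered_trivial) simp
  show "vary \<in> G pb" unfolding G_def vary_def by (intro wfil_X filtered_wfil filtered_trivial) simp
  show "veps \<in> G pp" unfolding G_def veps_def const2_def by (intro wfil_const wfil_X filtered_wfil filtered_trivial) simp
  show "vsig \<in> G pp" unfolding G_def cst_def const2_def by (intro wfil_const wfil_X filtered_wfil filtered_trivial) simp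
qed

lemma G_1: "ct u = 0 \<Longrightarrow> u \<in> G 1"
  unfolding G_def using weights(1-3)
  by (simp add: wfil_1[unfolded One_nat_def] filtered_wfil filtered_trivial trivial_fil_def)

lemma lead_mult: "v \<in> G k \<Longrightarrow> u * v - kc (ct u) * v \<in> G (Suc k)"
proof -
  assume v: "v \<in> G k"
  have "u - kc (ct u) \<in> G 1" by (rule G_1) (simp add: ct_kc)
  from Fil_mult[OF this v] show ?thesis by (simp add: left_diff_distrib)
qed

lemma x_power: "k \<le> pa * i \<Longrightarrow> varx ^ i \<in> G k" and y_power: "k \<le> pb * j \<Longrightarrow> vary ^ j \<in> G k"
  by (rule Fil_powerI[OF xG] Fil_powerI[OF yG], simp add: mult.commute)+

lemma ct_inright: "ct (inright g) = fps_nth (fps_nth g 0) 0"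
  by (simp add: inright_def map_coeffs_nth const2_def)

lemma params_lead: "vsig * inright g + veps * inright g' - (kc (fps_nth (fps_nth g 0) 0) * vsig + kc (fps_nth (fps_nth g' 0) 0) * veps) \<in> G (Suc pp)"
  using Fil_add[OF lead_mult[OF sG, of "inright g"] lead_mult[OF eG, of "inright g'"]]
  unfolding ct_inright by (simp add: algebra_simps)

lemma params_G: "k \<le> pp \<Longrightarrow> vsig * u + veps * v \<in> G k"
  by (rule Fil_add[OF Fil_mult2[OF Fil_mono[OF sG]] Fil_mult2[OF Fil_mono[OF eG]]])

text \<open>Eliminating \<epsilon> by the leading form of \<open>F\<close>, the partials give the
  leading relations y^(n+1) = c1 \<sigma> and x^(m+1) = c0 \<sigma>.\<close>

definition "c1 = (fps_nth (fps_nth (dy B) 0) 0 * fps_nth (fps_nth A 0) 0 / fps_nth (fps_nth B 0) 0 - fps_nth (fps_nth (dy A) 0) 0) / of_nat (n + 2)"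
definition "c0 = (fps_nth (fps_nth (dx A) 0) 0 - fps_nth (fps_nth (dx B) 0) 0 * fps_nth (fps_nth A 0) 0 / fps_nth (fps_nth B 0) 0) / of_nat (m + 2)"

context
  fixes \<beta> \<gamma> c k :: "'k fps fps fps fps" and \<beta>0 \<gamma>0 :: 'k and cc
  assumes \<beta>0: "\<beta>0 = ct \<beta>" and \<gamma>0: "\<gamma>0 = ct \<gamma>"
    and nonzero: "\<beta>0 \<noteq> 0"
    and cc: "cc = (if m = n then \<gamma>0\<^sup>2 / \<beta>0\<^sup>2 else 0)"
    and k: "k = - \<beta> * (\<beta>\<^sup>2 * dy (dy F) - 2 * \<beta> * \<gamma> * dx (dy F) + \<gamma>\<^sup>2 * dx (dx F)) + dx F * c"
begin

lemma k_lead2: "k - kc (- (\<beta>0 ^ 3 * of_nat ((n + 2) * (n + 1)))) * (vary ^ n - kc cc * varx ^ m) \<in> G (Suc (pb * n))"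
proof -
  let ?w = "pb * n"
  have y: "vary ^ n \<in> G ?w" by (rule y_power) simp
  have x: "varx ^ m \<in> G ?w" using weights(5-7) by (intro x_power) simp
  have 1: "\<beta> ^ 3 * vary ^ n - kc (\<beta>0 ^ 3) * vary ^ n \<in> G (Suc ?w)"
    using lead_mult[OF y, of "\<beta> ^ 3"] by (simp add: \<beta>0 power3_eq_cube)
  have 2: "of_nat ((m + 2) * (m + 1)) * (\<beta> * \<gamma>\<^sup>2 * varx ^ m) - kc (\<beta>0 ^ 3 * of_nat ((n + 2) * (n + 1)) * cc) * varx ^ m \<in> G (Suc ?w)"
  proof (cases "m = n")
    case True
    have "\<beta>0 ^ 3 * of_nat ((n + 2) * (n + 1)) * cc = of_nat ((n + 2) * (n + 1)) * (\<beta>0 * \<gamma>0\<^sup>2)"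
      unfolding cc using nonzero True by (simp add: power2_eq_square power3_eq_cube)
    moreover have "of_nat ((n + 2) * (n + 1)) * (\<beta> * \<gamma>\<^sup>2 * varx ^ m - kc (\<beta>0 * \<gamma>0\<^sup>2) * varx ^ m) \<in> G (Suc ?w)"
      using lead_mult[OF x, of "\<beta> * \<gamma>\<^sup>2"] by (intro Fil_mult1) (simp add: \<beta>0 \<gamma>0 power2_eq_square)
    ultimately show ?thesis using True by (simp only: kc_hom right_diff_distrib mult.assoc)
  next
    case False
    then have "varx ^ m \<in> G (Suc ?w)" using weights(5,6,9) nm by (intro x_power) simp
    then have "of_nat ((m + 2) * (m + 1)) * (\<beta> * \<gamma>\<^sup>2 * varx ^ m) \<in> G (Suc ?w)" by (intro Fil_mult1)
    then show ?thesis using False by (simp add: cc cst_hom)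
  qed
  have le: "Suc ?w \<le> pp" using weights(2,5) by simp
  let ?e1 = "vsig * inright (dy (dy A)) + veps * inright (dy (dy B))"
    and ?e2 = "vsig * inright (dx (dy A)) + veps * inright (dx (dy B))"
    and ?e3 = "vsig * inright (dx (dx A)) + veps * inright (dx (dx B))"
  have "dx F \<in> G (Suc ?w)"
    unfolding dxF using weights(4) le by (intro Fil_diff params_G Fil_mult1 x_power) simp_all
  then have c: "dx F * c \<in> G (Suc ?w)" by (rule Fil_mult2)
  have eps: "- \<beta> * (\<beta>\<^sup>2 * ?e1 - 2 * \<beta> * \<gamma> * ?e2 + \<gamma>\<^sup>2 * ?e3) \<in> G (Suc ?w)"
    by (rule Fil_mult1[OF Fil_add[OF Fil_diff]]; rule Fil_mult1; rule params_G[OF le])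
  have id: "- (p * (b * b * b * y - b0 * y)) + (q * (b * (g * g) * x) - b0 * p * d * x)
      + (- b * (b * b * f1 - 2 * b * g * f2 + g * g * f3)) + z
    = - b * (b * b * (f1 + p * y) - 2 * b * g * f2 + g * g * (f3 - q * x)) + z - - (b0 * p) * (y - d * x)"
    for p q b y b0 g x d f1 f2 f3 z :: "'k fps fps fps fps"
    by (simp add: algebra_simps)
  have "- (of_nat ((n + 2) * (n + 1)) * (\<beta> ^ 3 * vary ^ n - kc (\<beta>0 ^ 3) * vary ^ n))
    + (of_nat ((m + 2) * (m + 1)) * (\<beta> * \<gamma>\<^sup>2 * varx ^ m) - kc (\<beta>0 ^ 3 * of_nat ((n + 2) * (n + 1)) * cc) * varx ^ m)
    + (- \<beta> * (\<beta>\<^sup>2 * ?e1 - 2 * \<beta> * \<gamma> * ?e2 + \<gamma>\<^sup>2 * ?e3)) + dx F * c \<in> G (Suc ?w)"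
    by (rule Fil_add[OF Fil_add[OF Fil_add[OF Fil_uminus[OF Fil_mult1[OF 1]] 2] eps] c])
  also have "- (of_nat ((n + 2) * (n + 1)) * (\<beta> ^ 3 * vary ^ n - kc (\<beta>0 ^ 3) * vary ^ n))
    + (of_nat ((m + 2) * (m + 1)) * (\<beta> * \<gamma>\<^sup>2 * varx ^ m) - kc (\<beta>0 ^ 3 * of_nat ((n + 2) * (n + 1)) * cc) * varx ^ m)
    + (- \<beta> * (\<beta>\<^sup>2 * ?e1 - 2 * \<beta> * \<gamma> * ?e2 + \<gamma>\<^sup>2 * ?e3)) + dx F * c
    = k - kc (- (\<beta>0 ^ 3 * of_nat ((n + 2) * (n + 1)))) * (vary ^ n - kc cc * varx ^ m)"
    unfolding k dxxF dxyF dyyF kc_hom power2_eq_square power3_eq_cube by (rule id)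
  finally show ?thesis .
qed

text \<open>By the leading relations \<epsilon>, x^(m+1) and y^(n+1) are multiples of \<sigma>, and
  \<open>square_in_L\<close> makes \<sigma>^2 a leading form of the ideal. Hence so are the products
  of two of these elements used below, and from some weight on every element lies in the
  ideal.\<close>

lemma sigma_power_mem:
  assumes c1: "c1 \<noteq> 0" and ne: "m = n \<Longrightarrow> cc * (cc * c0 / c1) ^ n \<noteq> 1"
  shows "\<exists>a0 a1 a2 a3. vsig ^ 5 = a0 * F + a1 * dy F + a2 * dx F + a3 * k"
proof -
  let ?g = "(!) [F, dy F, dx F, k]"
  interpret leading G ?g 4 "pp + pp" by unfold_locales
  have g: "?g 0 = F" "?g 1 = dy F" "?g 2 = dx F" "?g 3 = k" by simp_all
  let ?A = "fps_nth (fps_nth A 0) 0" and ?B = "fps_nth (fps_nth B 0) 0"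
  have "vary ^ (n + 2) - varx ^ (m + 2) + (vsig * inright A + veps * inright B - (kc ?A * vsig + kc ?B * veps)) \<in> G (Suc pp)"
  proof (rule Fil_add[OF Fil_diff params_lead])
    have "pb * (n + 2) = pp + pb" "pa * (m + 2) = pp + pa" unfolding pp_def using weights(4)[unfolded pp_def] by simp_all
    then show "vary ^ (n + 2) \<in> G (Suc pp)" "varx ^ (m + 2) \<in> G (Suc pp)" using weights(1,2) by (linarith | intro y_power x_power)+
  qed
  then have "F - (kc ?A * vsig + kc ?B * veps) \<in> G (Suc pp)" by (simp add: F algebra_simps)
  then have "kc ?A * vsig + kc ?B * veps \<in> L pp" by (intro L_lead[of 0]) simp_all
  also have "kc ?A * vsig + kc ?B * veps = kc ?B * (veps - kc (- (?A / ?B)) * vsig)"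
  proof -
    have "kc ?B * kc (- (?A / ?B)) = kc (- ?A)" unfolding kc_hom(1)[symmetric] using B0 by simp
    then have q: "kc ?B * kc (- (?A / ?B)) = - kc ?A" unfolding kc_hom(4)[of ?A] .
    have eq: "kc ?B * (veps - kc (- (?A / ?B)) * vsig) = kc ?B * veps - (kc ?B * kc (- (?A / ?B))) * vsig"
      unfolding right_diff_distrib mult.assoc ..
    show ?thesis unfolding eq q by simp
  qed
  finally have e: "veps - kc (- (?A / ?B)) * vsig \<in> L pp" by (rule L_unit[OF kc_unit[OF B0]])
  have param: "kc a * vsig + kc b * veps - kc (a - b * ?A / ?B) * vsig \<in> L pp" for a b
    using L_scale[OF e, of "kc b"] by (simp add: kc_hom algebra_simps divide_inverse)
  let ?N = "of_nat (n + 2) :: 'k" and ?M = "of_nat (m + 2) :: 'k"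
  have N0: "?N \<noteq> 0" "?M \<noteq> 0" by (simp_all del: of_nat_add of_nat_Suc add: of_nat_eq_0_iff)
  let ?Ay = "fps_nth (fps_nth (dy A) 0) 0" and ?By = "fps_nth (fps_nth (dy B) 0) 0"
  let ?Ax = "fps_nth (fps_nth (dx A) 0) 0" and ?Bx = "fps_nth (fps_nth (dx B) 0) 0"
  have "dy F - (kc ?N * vary ^ Suc n + (kc ?Ay * vsig + kc ?By * veps)) \<in> G (Suc pp)"
    using params_lead[of "dy A" "dy B"] unfolding dyF kc_hom(7) by (simp add: algebra_simps del: of_nat_add of_nat_Suc power_Suc)
  then have "kc ?N * vary ^ Suc n + (kc ?Ay * vsig + kc ?By * veps) \<in> L pp" by (intro L_lead[of 1]) simp_all
  from L_diff[OF this param[of ?Ay ?By]] have "kc ?N * vary ^ Suc n + kc (?Ay - ?By * ?A / ?B) * vsig \<in> L pp"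
    by (simp del: of_nat_add of_nat_Suc power_Suc)
  moreover have eq: "?Ay - ?By * ?A / ?B = - (?N * c1)" unfolding c1_def using N0 by (simp del: of_nat_add of_nat_Suc)
  ultimately have "kc ?N * vary ^ Suc n + kc (- (?N * c1)) * vsig \<in> L pp" by (simp only:)
  moreover have "kc ?N * vary ^ Suc n + kc (- (?N * c1)) * vsig = kc ?N * (vary ^ Suc n - kc c1 * vsig)"
    unfolding kc_hom(4)[of "?N * c1"] kc_hom(1)[of ?N c1] by (simp add: algebra_simps del: of_nat_add of_nat_Suc power_Suc)
  ultimately have "kc ?N * (vary ^ Suc n - kc c1 * vsig) \<in> L pp" by (simp only:)
  then have y: "vary ^ Suc n - kc c1 * vsig \<in> L pp" by (rule L_unit[OF kc_unit[OF N0(1)]])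
  have "dx F - (- (kc ?M * varx ^ Suc m) + (kc ?Ax * vsig + kc ?Bx * veps)) \<in> G (Suc pp)"
    using params_lead[of "dx A" "dx B"] unfolding dxF kc_hom(7) by (simp add: algebra_simps del: of_nat_add of_nat_Suc power_Suc)
  then have "- (kc ?M * varx ^ Suc m) + (kc ?Ax * vsig + kc ?Bx * veps) \<in> L pp" by (intro L_lead[of 2]) simp_all
  from L_uminus[OF L_diff[OF this param[of ?Ax ?Bx]]] have "kc ?M * varx ^ Suc m - kc (?Ax - ?Bx * ?A / ?B) * vsig \<in> L pp"
    by (simp del: of_nat_add of_nat_Suc power_Suc)
  moreover have eq': "?Ax - ?Bx * ?A / ?B = ?M * c0" unfolding c0_def using N0 by (simp del: of_nat_add of_nat_Suc)
  ultimately have "kc ?M * varx ^ Suc m - kc (?M * c0) * vsig \<in> L pp" by (simp only:)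
  moreover have "kc ?M * varx ^ Suc m - kc (?M * c0) * vsig = kc ?M * (varx ^ Suc m - kc c0 * vsig)"
    unfolding kc_hom(1)[of ?M c0] by (simp add: algebra_simps del: of_nat_add of_nat_Suc power_Suc)
  ultimately have "kc ?M * (varx ^ Suc m - kc c0 * vsig) \<in> L pp" by (simp only:)
  then have x: "varx ^ Suc m - kc c0 * vsig \<in> L pp" by (rule L_unit[OF kc_unit[OF N0(2)]])
  have "kc (- (\<beta>0 ^ 3 * of_nat ((n + 2) * (n + 1)))) * (vary ^ n - kc cc * varx ^ m) \<in> L (pb * n)"
    by (rule L_lead[of 3]) (use k_lead2 weights(5) in simp_all)
  then have P1: "vary ^ n - kc cc * varx ^ m \<in> L (pb * n)"
    by (rule L_unit[OF kc_unit, rotated]) (use nonzero in \<open>simp del: of_nat_add of_nat_Suc of_nat_mult add: of_nat_eq_0_iff\<close>)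
  have k1: "kc c1 * kc (1 / c1) = 1" using c1 by (simp flip: kc_hom(1,6))
  have cases: "kc cc = 0 \<or> m = n \<and> pa = pb \<and> (1 - kc cc * (kc cc * kc c0 * kc (1 / c1)) ^ n) dvd 1"
  proof (cases "m = n")
    case True
    then have "1 - cc * (cc * c0 / c1) ^ n \<noteq> 0" using ne by simp
    from kc_unit[OF this] have "(1 - kc cc * (kc cc * kc c0 * kc (1 / c1)) ^ n) dvd 1"
      by (simp only: kc_hom(1,3,6,8) divide_inverse mult_1)
    then show ?thesis using True weights(8) by blast
  qed (simp add: cc cst_hom)
  have z: "vsig\<^sup>2 \<in> L (2 * pp)"
    by (rule square_in_L[OF xG yG sG weights(4) pp_def P1 y x k1 cases])
  have prod: "u * v \<in> L (2 * pp)" if u: "u - kc a * vsig \<in> L pp" "u \<in> G pp" and v: "v - kc b * vsig \<in> L pp" for u v a b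
  proof -
    have "u * (v - kc b * vsig) + (kc b * (vsig * (u - kc a * vsig)) + (kc b * kc a) * vsig\<^sup>2) \<in> L (2 * pp)"
      by (rule L_add[OF L_mult[OF v u(2)] L_add[OF L_scale[OF L_mult[OF u(1) sG]] L_scale[OF z]]]) simp_all
    then show ?thesis by (simp add: algebra_simps power2_eq_square)
  qed
  have s: "vsig - kc 1 * vsig \<in> L pp" by (simp add: cst_hom L_zero)
  define M :: "nat \<Rightarrow> nat \<Rightarrow> nat \<Rightarrow> nat \<Rightarrow> 'k fps fps fps fps" where "M u l i j = vsig ^ u * veps ^ l * (varx ^ i * vary ^ j)" for u l i j :: nat
  have M_G: "M u l i j \<in> G (pp * u + pp * l + (pa * i + pb * j))" for u l i j
    unfolding M_def by (rule Fil_multI[OF Fil_mult[OF Fil_power[OF sG] Fil_power[OF eG]] Fil_mult[OF Fil_power[OF xG] Fil_power[OF yG]]])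
      (simp add: mult.commute)
  have M_add: "M (u + u') (l + l') (i + i') (j + j') = M u l i j * M u' l' i' j'" for u l i j u' l' i' j'
    unfolding M_def by (simp add: power_add mult_ac)
  have M_up: "M u l i j \<in> L n'" if base: "M u0 l0 i0 j0 \<in> L (2 * pp)"
    and le: "u0 \<le> u" "l0 \<le> l" "i0 \<le> i" "j0 \<le> j" and wt: "pp * u0 + pp * l0 + (pa * i0 + pb * j0) = 2 * pp"
    and n': "pp * u + pp * l + (pa * i + pb * j) = n'" for u0 l0 i0 j0 u l i j n'
  proof -
    have "u = (u - u0) + u0" "l = (l - l0) + l0" "i = (i - i0) + i0" "j = (j - j0) + j0" using le by simp_all
    then obtain u' l' i' j' where e: "u = u' + u0" "l = l' + l0" "i = i' + i0" "j = j' + j0" by blast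
    have "2 * pp + (pp * u' + pp * l' + (pa * i' + pb * j')) = n'"
      using n' wt unfolding e add_mult_distrib2 by linarith
    then have "M u' l' i' j' * M u0 l0 i0 j0 \<in> L n'" by (rule L_mult[OF base M_G])
    then show ?thesis unfolding e M_add .
  qed
  have b1: "M 2 0 0 0 \<in> L (2 * pp)" using z by (simp add: M_def)
  have b2: "M 1 1 0 0 \<in> L (2 * pp)" using prod[OF s sG e] by (simp add: M_def)
  have b3: "M 0 2 0 0 \<in> L (2 * pp)" using prod[OF e eG e] by (simp add: M_def power2_eq_square)
  have xx: "varx ^ Suc m \<in> G pp" "vary ^ Suc n \<in> G pp"
    using weights(4) by (auto intro!: x_power y_power simp: pp_def simp del: power_Suc)
  have b4: "M 0 0 (Suc m + Suc m) 0 \<in> L (2 * pp)" using prod[OF x xx(1) x] by (simp only: M_def power_add power_0 mult_1 mult_1_right)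
  have b5: "M 0 0 0 (Suc n + Suc n) \<in> L (2 * pp)" using prod[OF y xx(2) y] by (simp only: M_def power_add power_0 mult_1 mult_1_right)
  \<comment> \<open>A monomial divisible by none of the five contains at most one parameter, of
    weight \<open>pp\<close>, and has weight below \<open>2 * pp\<close> in each of x and y, in
    total below \<open>5 * pp\<close>. This is the origin of the exponent 5.\<close>
  have M_L: "M u l i j \<in> L n'" if n': "pp * u + pp * l + (pa * i + pb * j) = n'" "5 * pp \<le> n'" for u l i j n'
  proof -
    consider "2 \<le> u" | "1 \<le> u" "1 \<le> l" | "2 \<le> l" | "Suc m + Suc m \<le> i" | "Suc n + Suc n \<le> j"
      | "u + l \<le> 1" "i < Suc m + Suc m" "j < Suc n + Suc n" by linarith
    then show ?thesis
    proof cases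
      case 1 then show ?thesis by (intro M_up[OF b1 _ _ _ _ _ n'(1)]) simp_all
    next
      case 2 then show ?thesis by (intro M_up[OF b2 _ _ _ _ _ n'(1)]) simp_all
    next
      case 3 then show ?thesis by (intro M_up[OF b3 _ _ _ _ _ n'(1)]) simp_all
    next
      case 4 then show ?thesis by (intro M_up[OF b4 _ _ _ _ _ n'(1)]) (use weights(4) in \<open>simp_all add: algebra_simps\<close>)
    next
      case 5 then show ?thesis by (intro M_up[OF b5 _ _ _ _ _ n'(1)]) (simp_all add: pp_def algebra_simps)
    next
      case 6
      have "pa * i < pa * (Suc m + Suc m)" "pb * j < pb * (Suc n + Suc n)" using 6 weights(1,2) by (intro mult_strict_left_mono; simp)+
      moreover have "pa * (Suc m + Suc m) = 2 * pp" unfolding weights(4) by simp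
      moreover have "pb * (Suc n + Suc n) = 2 * pp" unfolding pp_def by simp
      moreover have "pp * u + pp * l \<le> pp * 1" using 6(1) unfolding add_mult_distrib2[symmetric] by (rule mult_le_mono2)
      ultimately show ?thesis using n' by linarith
    qed
  qed
  have big: "v \<in> L n'" if v: "v \<in> G n'" and n': "5 * pp \<le> n'" for v :: "'k fps fps fps fps" and n'
  proof (rule wfil_reduce_xye[where Q = "\<lambda>v. v \<in> L n'", OF filtered_wfil[OF filtered_trivial] weights(1-3) v[unfolded G_def]])
    show "u + v \<in> L n'" if "u \<in> L n'" "v \<in> L n'" for u v using that by (rule L_add)
    show "u \<in> L n'" if "u \<in> wfil pb (wfil pa (wfil pp (wfil pp trivial_fil))) (Suc n')" for u
      using that unfolding G_def[symmetric] by (rule L_higher)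
    fix d :: "'k fps" and i j l :: nat assume wt: "pa * i + pb * j + pp * l \<le> n'" and d: "d \<in> wfil pp trivial_fil (n' - (pa * i + pb * j + pp * l))"
    show "cst d * (veps ^ l * (varx ^ i * vary ^ j)) \<in> L n'"
    proof (rule wfil_reduce[OF filtered_trivial weights(3) d, where Q = "\<lambda>d. cst d * (veps ^ l * (varx ^ i * vary ^ j)) \<in> L n'"])
      fix d d' :: "'k fps" assume "cst d * (veps ^ l * (varx ^ i * vary ^ j)) \<in> L n'" "cst d' * (veps ^ l * (varx ^ i * vary ^ j)) \<in> L n'"
      from L_add[OF this] show "cst (d + d') * (veps ^ l * (varx ^ i * vary ^ j)) \<in> L n'" by (simp add: cst_hom distrib_right)
    next
      fix d :: "'k fps" assume "d \<in> wfil pp trivial_fil (Suc (n' - (pa * i + pb * j + pp * l)))"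
      then have "cst d \<in> G (Suc (n' - (pa * i + pb * j + pp * l)))"
        unfolding G_def cst_def const2_def by (intro wfil_const filtered_wfil filtered_trivial)
      then have "cst d * M 0 l i j \<in> G (Suc n')" by (rule Fil_multI[OF _ M_G]) (use wt in simp)
      then show "cst d * (veps ^ l * (varx ^ i * vary ^ j)) \<in> L n'" by (intro L_higher) (simp add: M_def)
    next
      fix d :: 'k and u :: nat assume u: "pp * u \<le> n' - (pa * i + pb * j + pp * l)"
        and d: "d \<in> trivial_fil (n' - (pa * i + pb * j + pp * l) - pp * u)"
      show "cst (fps_const d * fps_X ^ u) * (veps ^ l * (varx ^ i * vary ^ j)) \<in> L n'"
      proof (cases "d = 0")
        case False
        then have "pp * u + pp * l + (pa * i + pb * j) = n'"
          using d u wt by (auto simp: trivial_fil_def split: if_splits)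
        then have "kc d * M u l i j \<in> L n'" by (intro L_scale M_L n')
        then show ?thesis by (simp add: M_def cst_hom vsig_power mult.assoc)
      qed (simp add: cst_hom L_zero)
    qed
  qed
  have "\<exists>a. vsig ^ 5 = (\<Sum>i\<in>{..<4}. a i * ?g i)"
  proof (rule approx[where Q = G and w = "pp + pp" and N = "5 * pp"])
    fix n' and u :: "'k fps fps fps fps" assume "5 * pp \<le> n'" "u \<in> G n'"
    then have "u \<in> L n'" by (intro big)
    then show "\<exists>a. (\<forall>i\<in>{..<4}. a i \<in> G (n' - (pp + pp))) \<and> u - (\<Sum>i\<in>{..<4}. a i * ?g i) \<in> G (Suc n')"
      unfolding L_def by (simp only: mem_Collect_eq Ball_def lessThan_iff)
  next
    show "vsig ^ 5 \<in> G (5 * pp)" by (rule Fil_power[OF sG])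
  qed simp_all
  then obtain a where "vsig ^ 5 = (\<Sum>i\<in>{..<4}. a i * ?g i)" by blast
  also have "\<dots> = a 0 * F + a 1 * dy F + a 2 * dx F + a 3 * k" by (simp add: eval_nat_numeral)
  finally show ?thesis by blast
qed

end

text \<open>Rank and freeness of the quotient by (\<open>F\<close>, \<open>h\<close>,
  \<open>k\<close>) are lifted from the reduction modulo \<sigma>, which is a \<open>pencil\<close>.
  The power of \<sigma> comes from \<open>sigma_power_mem\<close>, with \<open>dy F\<close>
  eliminated through \<open>h\<close>.\<close>

theorem inflection_length:
  assumes v: "ct (ev v) \<noteq> 0"
    and u: "u = inleft (ev v) * w - inleft (ev w) * v"
    and \<beta>0: "\<beta>0 = ct (ev (dx u))" and \<gamma>0: "\<gamma>0 = ct (ev (dy u))"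
    and nonzero: "\<beta>0 \<noteq> 0" "\<gamma>0 \<noteq> 0"
    and ne: "m = n \<Longrightarrow> (- \<gamma>0) ^ (n + 2) \<noteq> \<beta>0 ^ (n + 2)"
    and c1: "n \<noteq> 0 \<Longrightarrow> c1 \<noteq> 0"
    and ne': "m = n \<Longrightarrow> n \<noteq> 0 \<Longrightarrow> \<gamma>0\<^sup>2 / \<beta>0\<^sup>2 * (\<gamma>0\<^sup>2 / \<beta>0\<^sup>2 * c0 / c1) ^ n \<noteq> 1"
    and e: "pp_dual_basis F 3 e"
  shows "nonsingular_length F (minors_ideal F 3 e [v, w]) = enat (n * (m + 1))"
proof -
  define \<beta> where "\<beta> = ev (dx u)"
  define \<gamma> where "\<gamma> = ev (dy u)"
  define c where "c = \<gamma>\<^sup>2 * ev (dx (dx u)) - 2 * \<beta> * \<gamma> * ev (dx (dy u)) + \<beta>\<^sup>2 * ev (dy (dy u))"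
  define k where "k = - \<beta> * (\<beta>\<^sup>2 * dy (dy F) - 2 * \<beta> * \<gamma> * dx (dy F) + \<gamma>\<^sup>2 * dx (dx F)) + dx F * c"
  define h where "h = \<beta> * dy F - \<gamma> * dx F"
  have unit: "g dvd 1" if "ct g \<noteq> 0" for g :: "'k fps fps fps fps" using that by (simp add: is_unit_fps_iff)
  have "ev v dvd 1" using v by (rule unit)
  have M: "minors_ideal F 3 e [v, w] = ideal_gen {F, h, dbasis F 2 u}"
    unfolding minors_ideal_basis_eq[OF e dual_basis] minors_ideal_unit[OF \<open>ev v dvd 1\<close> u] dbasis_1 h_def \<beta>_def \<gamma>_def
    by (simp add: mult.commute)
  have \<beta>1: "\<beta> dvd 1" using nonzero(1) unfolding \<beta>0 \<beta>_def by (rule unit)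
  then obtain b where b: "1 = \<beta> * b" by (rule dvdE)
  obtain z where z: "\<beta>\<^sup>2 * dbasis F 2 u = dx F * k + z * h"
    using dbasis_2_polar[of u F] unfolding k_def h_def c_def \<beta>_def \<gamma>_def by blast
  let ?I = "ideal_gen {F, h, dbasis F 2 u}" and ?I' = "ideal_gen {F, h, k}"
  have "dbasis F 2 u = (\<beta> * b)\<^sup>2 * dbasis F 2 u" unfolding b[symmetric] by simp
  also have "\<dots> = b\<^sup>2 * (\<beta>\<^sup>2 * dbasis F 2 u)" by (simp add: power_mult_distrib mult_ac)
  also have "\<dots> = 0 * F + (b\<^sup>2 * z) * h + (b\<^sup>2 * dx F) * k" unfolding z by (simp add: algebra_simps)
  finally have d2: "dbasis F 2 u \<in> ?I'" unfolding ideal_gen_3 by blast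
  have base: "F \<in> ?I" "h \<in> ?I" "dbasis F 2 u \<in> ?I" "F \<in> ?I'" "h \<in> ?I'" "k \<in> ?I'" by (simp_all add: ideal.span_base)
  have sub: "?I \<subseteq> ?I'" by (rule ideal.span_minimal) (use d2 base ideal.subspace_span in auto)
  have "\<beta>\<^sup>2 * dbasis F 2 u - z * h \<in> ?I" by (intro ideal.span_diff ideal_gen_mult base)
  then have Xk: "dx F * k \<in> ?I" unfolding z by simp
  have XI: "dx F * q \<in> ?I" if q: "q \<in> ?I'" for q
  proof -
    obtain q0 q1 q2 where "q = q0 * F + q1 * h + q2 * k" using q unfolding ideal_gen_3 by blast
    then have "dx F * q = (dx F * q0) * F + (dx F * q1) * h + q2 * (dx F * k)" by (simp add: algebra_simps)
    also have "\<dots> \<in> ?I" by (rule ideal.span_add[OF ideal.span_add[OF ideal_gen_mult[OF base(1)] ideal_gen_mult[OF base(2)]] ideal_gen_mult[OF Xk]])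
    finally show ?thesis .
  qed
  let ?J = "{..m} \<times> {..<n}"
  define mo :: "nat \<times> nat \<Rightarrow> 'k fps fps fps fps" where "mo x = varx ^ fst x * vary ^ snd x" for x
  have mo: "mod_sigma (mo x) = varx ^ fst x * vary ^ snd x" for x
    by (simp add: mo_def mod_sigma_hom mod_sigma_power mod_sigma_vars)
  have two: "mod_sigma 2 = 2" using mod_sigma_hom(1)[of 1 1] by (simp add: mod_sigma_hom(4))
  have ms: "mod_sigma h = mod_sigma \<beta> * dy (mod_sigma F) - mod_sigma \<gamma> * dx (mod_sigma F)"
    "mod_sigma k = - mod_sigma \<beta> * ((mod_sigma \<beta>)\<^sup>2 * dy (dy (mod_sigma F)) - 2 * mod_sigma \<beta> * mod_sigma \<gamma> * dx (dy (mod_sigma F))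
      + (mod_sigma \<gamma>)\<^sup>2 * dx (dx (mod_sigma F))) + dx (mod_sigma F) * mod_sigma c"
    by (simp_all only: h_def k_def mod_sigma_hom mod_sigma_derivs mod_sigma_power two)
  have \<beta>0': "\<beta>0 = fps_nth (fps_nth (fps_nth (mod_sigma \<beta>) 0) 0) 0" "\<gamma>0 = fps_nth (fps_nth (fps_nth (mod_sigma \<gamma>) 0) 0) 0"
    by (simp_all add: mod_sigma_ct \<beta>0 \<gamma>0 \<beta>_def \<gamma>_def)
  note ctx = \<beta>0' nonzero(1) ms
  note span1 = reduced.span_k[OF ctx nonzero(2) ne]
  have span: "\<exists>d. r - (\<Sum>x\<in>?J. cst (d x) * mo x) \<in> ?I'" for r
    by (rule span_lift_sigma) (use span1 in \<open>simp_all add: mo\<close>)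
  have "nzd {mod_sigma F} (mod_sigma h)" by (rule reduced.nzd_F_h[OF ctx])
  moreover have "finite ?J" by simp
  with span1 have "nzd {mod_sigma F, mod_sigma h} (mod_sigma k)" by (rule reduced.nzd_F_h_z[OF ctx])
  ultimately have s: "nzd {F, h, k} vsig" by (intro regular_lift_sigma(3) reduced_nonzero)
  have indep: "\<forall>x\<in>?J. d x = 0" if "(\<Sum>x\<in>?J. cst (d x) * mo x) \<in> ?I'" for d
  proof (rule indep_lift_sigma[OF s _ that])
    show "\<forall>x\<in>?J. d x = 0" if "(\<Sum>x\<in>?J. cst (d x) * mod_sigma (mo x)) \<in> ideal_gen {mod_sigma F, mod_sigma h, mod_sigma k}" for d
      using reduced.indep_k[OF ctx nonzero(2) ne that[unfolded mo]] .
  qed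
  have "\<exists>r. cst (fps_X ^ 5) - r * dx F \<in> ?I'"
  proof (cases "n = 0")
    \<comment> \<open>For n = 0 there are no standard monomials, so (\<open>F\<close>,
      \<open>h\<close>, \<open>k\<close>) is the whole ring.\<close>
    case True
    then have "r \<in> ?I'" for r using span[of r] by simp
    then show ?thesis by blast
  next
    case False
    have \<beta>0'': "\<beta>0 = ct \<beta>" "\<gamma>0 = ct \<gamma>" by (simp_all add: \<beta>0 \<gamma>0 \<beta>_def \<gamma>_def)
    let ?cc = "if m = n then \<gamma>0\<^sup>2 / \<beta>0\<^sup>2 else 0"
    obtain a0 a1 a2 a3 where a: "vsig ^ 5 = a0 * F + a1 * dy F + a2 * dx F + a3 * k"
      using sigma_power_mem[OF \<beta>0'' nonzero(1) refl k_def c1[OF False]] ne'[OF _ False] by auto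
    have "dy F = (\<beta> * b) * dy F" unfolding b[symmetric] by simp
    then have Y: "dy F = b * h + (b * \<gamma>) * dx F" unfolding h_def by (simp add: algebra_simps)
    have "vsig ^ 5 - (a1 * b * \<gamma> + a2) * dx F = a0 * F + (a1 * b) * h + a3 * k"
      unfolding a by (subst Y) (simp add: algebra_simps)
    then have "vsig ^ 5 - (a1 * b * \<gamma> + a2) * dx F \<in> ?I'" unfolding ideal_gen_3 by blast
    then show ?thesis unfolding vsig_power by blast
  qed
  then obtain r where r: "cst (fps_X ^ 5) - r * dx F \<in> ?I'" by blast
  have hI: "\<beta> * dy F - \<gamma> * dx F \<in> ?I" using base(2) unfolding h_def .
  have fin: "finite ?J" by simp
  have "nonsingular_length F ?I = enat (card ?J)"
    by (rule nonsingular_length_eq[OF ideal.subspace_span ideal.subspace_span sub XI \<beta>1 hI fin span indep r])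
  then show ?thesis unfolding M by (simp add: card_cartesian_product mult.commute)
qed

end


section \<open>First-order deformations, genericity and the conclusion\<close>

section \<open>First-order deformations of the germ\<close>

lemma nzd_germ:
  fixes f :: "'k::field_char_0 fps fps"
  assumes f: "f = vary ^ (n + 2) - varx ^ (m + 2)"
  shows "nzd {f} (dy f)"
proof -
  interpret filtered "adic :: nat \<Rightarrow> 'k fps fps set" by (rule filtered_adic)
  have dyf: "dy f = of_nat (n + 2) * vary ^ (n + 1)"
    unfolding f by (simp add: dy_diff dy_varx_power dy_vary_power del: power_Suc of_nat_add of_nat_Suc)
  have "vary ^ (n + 2) = 1 * f + varx ^ Suc m * varx" by (simp add: f mult.commute)
  then have "vary ^ (n + 2) \<in> ideal_gen {f, varx}" unfolding ideal_gen_2 by blast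
  then have "nzd {varx} f" by (rule nzd_if_power_mem[OF nzd_vary])
  then have "regular {} [varx, f]" using nzd_varx by simp
  then have "regular {} [f, varx]" by (intro regular_swap[OF _ varx_adic]) simp_all
  then have fx: "nzd {f} varx" by simp
  let ?N = "of_nat (n + 2) :: 'k"
  have "?N \<noteq> 0" by (simp del: of_nat_add of_nat_Suc add: of_nat_eq_0_iff)
  then have "const2 (inverse ?N) * (of_nat (n + 2) :: 'k fps fps) = 1"
    using const2_of_nat[of "n + 2" "1 :: 'k"] const2_mult[of "inverse ?N" ?N] by (simp add: const2_1 del: of_nat_add of_nat_Suc)
  then have "varx ^ (m + 2) = (const2 (inverse ?N) * of_nat (n + 2)) * vary ^ (n + 2) + (- 1) * f" by (simp add: f)
  also have "(const2 (inverse ?N) * of_nat (n + 2)) * vary ^ (n + 2) = (const2 (inverse ?N) * vary) * dy f"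
    unfolding dyf by (simp add: mult_ac del: of_nat_add of_nat_Suc)
  finally have "varx ^ (m + 2) \<in> ideal_gen {dy f, f}" unfolding ideal_gen_2 by blast
  then show ?thesis by (rule nzd_if_power_mem[OF fx])
qed

text \<open>Any \<open>g\<close> defines a homomorphism df \<mapsto> g, well defined because
  \<open>dy f\<close> is a nonzerodivisor modulo \<open>f\<close>. Its expansion in the given basis,
  evaluated at df, holds modulo \<open>f\<close> and its partials, all of which lie in the ideal of
  the two monomials.\<close>

lemma Def1_span:
  fixes f :: "'k::field_char_0 fps fps"
  assumes f: "f = vary ^ (n + 2) - varx ^ (m + 2)" and "represents_Def1_basis f \<delta>"
  obtains c where "g - (\<Sum>i<length \<delta>. const2 (c i) * \<delta> ! i) \<in> ideal_gen {varx ^ (m + 1), vary ^ (n + 1)}"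
proof -
  note nz = nzd_germ[OF f]
  obtain \<phi> :: "nat \<Rightarrow> 'k fps fps \<times> 'k fps fps \<Rightarrow> 'k fps fps" where
    \<phi>: "\<And>i. i < length \<delta> \<Longrightarrow> \<phi> i (dx f, dy f) - \<delta> ! i \<in> ideal_gen {f}"
    and span: "\<And>\<psi>. df_hom f \<psi> \<Longrightarrow> \<exists>c. df_hom_extends f (\<lambda>w. \<psi> w - (\<Sum>i<length \<delta>. const2 (c i) * \<phi> i w))"
    using assms(2) unfolding represents_Def1_basis_def by blast
  \<comment> \<open>The multiplier of df is determined only modulo \<open>f\<close>, so the chosen
    one is additive and linear only up to multiples of \<open>f\<close>.\<close>
  define coef where "coef w = (SOME a. fst w - a * dx f \<in> ideal_gen {f} \<and> snd w - a * dy f \<in> ideal_gen {f})" for w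
  have coef: "u - coef (u, v) * dx f \<in> ideal_gen {f}" "v - coef (u, v) * dy f \<in> ideal_gen {f}" if "(u, v) \<in> df_module f" for u v
  proof -
    have "\<exists>a. fst (u, v) - a * dx f \<in> ideal_gen {f} \<and> snd (u, v) - a * dy f \<in> ideal_gen {f}"
      using that by (simp add: df_module_def)
    from someI_ex[OF this] show "u - coef (u, v) * dx f \<in> ideal_gen {f}" "v - coef (u, v) * dy f \<in> ideal_gen {f}"
      unfolding coef_def by simp_all
  qed
  have cancel: "a \<in> ideal_gen {f}" if "a * dy f \<in> ideal_gen {f}" for a
    by (rule nzdD[OF nz]) (use that in \<open>simp add: mult.commute\<close>)
  have uniq: "coef (u, v) - a \<in> ideal_gen {f}" if "u - a * dx f \<in> ideal_gen {f}" "v - a * dy f \<in> ideal_gen {f}" for u v a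
  proof (rule cancel)
    have "(u, v) \<in> df_module f" using that by (auto simp: df_module_def)
    from ideal.span_diff[OF that(2) coef(2)[OF this]] show "(coef (u, v) - a) * dy f \<in> ideal_gen {f}"
      by (simp add: algebra_simps)
  qed
  define \<psi> where "\<psi> w = coef w * g" for w
  have "df_hom f \<psi>"
    unfolding df_hom_def
  proof (intro conjI allI impI)
    fix u v u' v' assume uv: "(u, v) \<in> df_module f" "(u', v') \<in> df_module f"
    have "coef (u + u', v + v') - (coef (u, v) + coef (u', v')) \<in> ideal_gen {f}"
      using ideal.span_add[OF coef(1)[OF uv(1)] coef(1)[OF uv(2)]] ideal.span_add[OF coef(2)[OF uv(1)] coef(2)[OF uv(2)]]
      by (intro uniq) (simp_all add: algebra_simps)
    from ideal_gen_mult2[OF this, of g] show "\<psi> (u + u', v + v') - \<psi> (u, v) - \<psi> (u', v') \<in> ideal_gen {f}"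
      by (simp add: \<psi>_def algebra_simps)
  next
    fix r u v assume uv: "(u, v) \<in> df_module f"
    have "coef (r * u, r * v) - r * coef (u, v) \<in> ideal_gen {f}"
      using ideal_gen_mult[OF coef(1)[OF uv], of r] ideal_gen_mult[OF coef(2)[OF uv], of r]
      by (intro uniq) (simp_all add: algebra_simps)
    from ideal_gen_mult2[OF this, of g] show "\<psi> (r * u, r * v) - r * \<psi> (u, v) \<in> ideal_gen {f}"
      by (simp add: \<psi>_def algebra_simps)
  next
    fix u v assume "u \<in> ideal_gen {f}" "v \<in> ideal_gen {f}"
    then have "coef (u, v) - 0 \<in> ideal_gen {f}" by (intro uniq) simp_all
    then show "\<psi> (u, v) \<in> ideal_gen {f}" unfolding \<psi>_def by (simp add: ideal_gen_mult2)
  qed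
  from span[OF this] obtain c \<alpha> \<beta> where c: "\<And>u v. (u, v) \<in> df_module f \<Longrightarrow>
      \<psi> (u, v) - (\<Sum>i<length \<delta>. const2 (c i) * \<phi> i (u, v)) - (\<alpha> * u + \<beta> * v) \<in> ideal_gen {f}"
    unfolding df_hom_extends_def by blast
  have m: "(dx f, dy f) \<in> df_module f" unfolding df_module_def by (auto intro!: exI[of _ 1] simp: ideal.span_zero)
  let ?M = "ideal_gen {varx ^ (m + 1), vary ^ (n + 1) :: 'k fps fps}"
  have x: "varx ^ (m + 1) \<in> ?M" and y: "vary ^ (n + 1) \<in> ?M" by (simp_all add: ideal.span_base)
  have fM: "f \<in> ?M"
    using ideal.span_diff[OF ideal_gen_mult[OF y, of vary] ideal_gen_mult[OF x, of varx]] by (simp add: f)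
  have dM: "dx f \<in> ?M" "dy f \<in> ?M"
    using ideal.span_neg[OF ideal_gen_mult[OF x, of "of_nat (m + 2)"]] ideal_gen_mult[OF y, of "of_nat (n + 2)"]
    unfolding f by (simp_all add: dx_diff dy_diff dx_varx_power dx_vary_power dy_varx_power dy_vary_power del: power_Suc of_nat_add of_nat_Suc)
  have F: "u \<in> ?M" if "u \<in> ideal_gen {f}" for u
    using that fM unfolding ideal_gen_singleton by (auto intro: ideal_gen_mult)
  have "coef (dx f, dy f) - 1 \<in> ideal_gen {f}" by (rule uniq) (simp_all add: ideal.span_zero)
  from F[OF ideal_gen_mult2[OF this, of g]] have 1: "\<psi> (dx f, dy f) - g \<in> ?M" by (simp add: \<psi>_def algebra_simps)
  have 2: "(\<Sum>i<length \<delta>. const2 (c i) * (\<phi> i (dx f, dy f) - \<delta> ! i)) \<in> ?M"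
    by (intro ideal.span_sum ideal_gen_mult F \<phi>) simp
  have 3: "\<alpha> * dx f + \<beta> * dy f \<in> ?M" by (intro ideal.span_add ideal_gen_mult dM)
  from ideal.span_add[OF ideal.span_add[OF ideal.span_diff[OF F[OF c[OF m]] 1] 2] 3]
  have "g - (\<Sum>i<length \<delta>. const2 (c i) * \<delta> ! i) \<in> ?M"
    by (simp add: algebra_simps sum_subtractf)
  then show ?thesis by (rule that)
qed

text \<open>The Jacobian ideal does not affect the constant term nor, for n > 0, the coefficient of
  y; combinations of any basis can therefore prescribe these.\<close>

lemma low_coeffs:
  fixes g :: "'k::comm_ring_1 fps fps"
  assumes "g \<in> ideal_gen {varx ^ (m + 1), vary ^ (n + 1)}"
  shows "fps_nth (fps_nth g 0) 0 = 0" "n \<noteq> 0 \<Longrightarrow> fps_nth (fps_nth g 1) 0 = 0"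
proof -
  obtain k l where g: "g = k * varx ^ (m + 1) + l * vary ^ (n + 1)" using assms unfolding ideal_gen_2 by blast
  have x: "fps_nth (fps_nth (k * varx ^ (m + 1)) j) 0 = 0" for j
    by (simp add: varx_def fps_const_power fps_mult_right_const_nth del: power_Suc)
  have y: "fps_nth (l * vary ^ (n + 1)) j = 0" if "j < n + 1" for j
    using that by (simp add: vary_def fps_X_power_mult_right_nth del: power_Suc)
  show "fps_nth (fps_nth g 0) 0 = 0" "n \<noteq> 0 \<Longrightarrow> fps_nth (fps_nth g 1) 0 = 0"
  proof -
    have y0: "fps_nth (l * vary ^ (n + 1)) 0 = 0" by (rule y) simp
    show "fps_nth (fps_nth g 0) 0 = 0" by (simp only: g fps_add_nth x y0 fps_zero_nth add_0_left)
    assume "n \<noteq> 0"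
    then have y1: "fps_nth (l * vary ^ (n + 1)) 1 = 0" by (intro y) simp
    show "fps_nth (fps_nth g 1) 0 = 0" by (simp only: g fps_add_nth x y1 fps_zero_nth add_0_left)
  qed
qed

section \<open>General elements\<close>

lemma polyfuns_diff: "p \<in> polyfuns \<Phi> \<Longrightarrow> q \<in> polyfuns \<Phi> \<Longrightarrow> (\<lambda>x. p x - q x) \<in> polyfuns \<Phi>"
  using polyfuns.add[OF _ polyfuns.mult[OF polyfuns.const[of "- 1"]], of p \<Phi> q] by simp

lemma polyfuns_power: "p \<in> polyfuns \<Phi> \<Longrightarrow> (\<lambda>x. p x ^ l) \<in> polyfuns \<Phi>"
  by (induction l) (simp_all add: polyfuns.const polyfuns.mult)

lemma polyfuns_sum: "(\<And>i. i \<in> I \<Longrightarrow> p i \<in> polyfuns \<Phi>) \<Longrightarrow> (\<lambda>x. \<Sum>i\<in>I. p i x) \<in> polyfuns \<Phi>"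
  by (induction I rule: infinite_finite_induct) (simp_all add: polyfuns.const polyfuns.add)

lemma poly_nonroot:
  fixes p :: "'k::field_char_0 poly"
  assumes "p \<noteq> 0"
  obtains z where "poly p z \<noteq> 0"
  using poly_all_0_iff_0[of p] assms by blast

text \<open>Density of a principal open set is tested on lines.\<close>

lemma for_generalI:
  fixes \<Phi> :: "('x \<Rightarrow> 'k::field_char_0) set"
  assumes line: "\<And>x0 x1. x0 \<in> S \<Longrightarrow> x1 \<in> S \<Longrightarrow> \<exists>l. l 0 = x0 \<and> l 1 = x1 \<and> (\<forall>z. l z \<in> S) \<and> (\<forall>\<phi>\<in>\<Phi>. \<exists>q. \<forall>z. \<phi> (l z) = poly q z)"
    and P: "P \<in> polyfuns \<Phi>" and x1: "x1 \<in> S" "P x1 \<noteq> 0"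
    and Q: "\<And>x. x \<in> S \<Longrightarrow> P x \<noteq> 0 \<Longrightarrow> Q x"
  shows "for_general S \<Phi> Q"
  unfolding for_general_def
proof (intro exI[of _ "{x \<in> S. P x \<noteq> 0}"] conjI allI impI ballI)
  show "zariski_open S \<Phi> {x \<in> S. P x \<noteq> 0}"
    unfolding zariski_open_def using P by (intro exI[of _ "{P}"]) simp
  show "Q x" if "x \<in> {x \<in> S. P x \<noteq> 0}" for x using that Q by simp
  fix W assume W: "zariski_open S \<Phi> W \<and> W \<noteq> {}"
  then obtain E where E: "E \<subseteq> polyfuns \<Phi>" "W = {x \<in> S. \<exists>p\<in>E. p x \<noteq> 0}" unfolding zariski_open_def by blast
  from W E obtain x0 p where x0: "x0 \<in> S" "p \<in> E" "p x0 \<noteq> 0" by blast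
  obtain l where l: "l 0 = x0" "l 1 = x1" "\<And>z. l z \<in> S" "\<And>\<phi>. \<phi> \<in> \<Phi> \<Longrightarrow> \<exists>q. \<forall>z. \<phi> (l z) = poly q z"
    using line[OF x0(1) x1(1)] by blast
  have on_line: "\<exists>q. \<forall>z. p (l z) = poly q z" if "p \<in> polyfuns \<Phi>" for p
    using that
  proof induction
    case (const c)
    show ?case by (rule exI[of _ "[:c:]"]) simp
  next
    case (add p q)
    then obtain p' q' where "\<forall>z. p (l z) = poly p' z" "\<forall>z. q (l z) = poly q' z" by blast
    then show ?case by (intro exI[of _ "p' + q'"]) simp
  next
    case (mult p q)
    then obtain p' q' where "\<forall>z. p (l z) = poly p' z" "\<forall>z. q (l z) = poly q' z" by blast
    then show ?case by (intro exI[of _ "p' * q'"]) simp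
  qed (rule l(4))
  obtain q where q: "\<And>z. p (l z) = poly q z" using on_line x0(2) E(1) by blast
  obtain r where r: "\<And>z. P (l z) = poly r z" using on_line[OF P] by blast
  \<comment> \<open>The two polynomials are nonzero by their values at the two given points of the
    line, so some point of the line avoids the zeros of both.\<close>
  have "q \<noteq> 0" using q[of 0] x0(3) l(1) by auto
  moreover have "r \<noteq> 0" using r[of 1] x1(2) l(2) by auto
  ultimately have "q * r \<noteq> 0" by simp
  then obtain z where "poly (q * r) z \<noteq> 0" by (rule poly_nonroot)
  then have "p (l z) \<noteq> 0" "P (l z) \<noteq> 0" unfolding q r by simp_all
  then have "l z \<in> {x \<in> S. P x \<noteq> 0} \<inter> W" using l(3) x0(2) E(2) by blast
  then show "{x \<in> S. P x \<noteq> 0} \<inter> W \<noteq> {}" by blast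
qed

section \<open>First-order jets of sections\<close>

text \<open>Value and first derivatives in the primed variables, taken on the diagonal at the
  origin: the only data of a section that the genericity conditions involve.\<close>

definition jet0 :: "'k::comm_ring_1 fps fps fps fps fps fps \<Rightarrow> 'k" where "jet0 u = ct (ev u)"
definition jetx :: "'k::comm_ring_1 fps fps fps fps fps fps \<Rightarrow> 'k" where "jetx u = ct (ev (dx u))"
definition jety :: "'k::comm_ring_1 fps fps fps fps fps fps \<Rightarrow> 'k" where "jety u = ct (ev (dy u))"

lemma jet_add: "jet0 (u + v) = jet0 u + jet0 v" "jetx (u + v) = jetx u + jetx v" "jety (u + v) = jety u + jety v"
  by (simp_all add: jet0_def jetx_def jety_def dx_add dy_add ev_add)

lemma jet_mult: "jet0 (u * v) = jet0 u * jet0 v" "jetx (u * v) = jetx u * jet0 v + jet0 u * jetx v"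
  "jety (u * v) = jety u * jet0 v + jet0 u * jety v"
  by (simp_all add: jet0_def jetx_def jety_def dx_mult dy_mult ev_add ev_mult)

lemma jet_inleft: "jet0 (inleft g) = ct g" "jetx (inleft g) = 0" "jety (inleft g) = 0"
proof -
  have "ev (inleft 0) = (0 :: 'a fps fps fps fps)" by (rule ev_inleft)
  then have "ev 0 = (0 :: 'a fps fps fps fps)" by (simp add: inleft_def const2_0)
  then show "jet0 (inleft g) = ct g" "jetx (inleft g) = 0" "jety (inleft g) = 0"
    by (simp_all add: jet0_def jetx_def jety_def ev_inleft dx_inleft dy_inleft)
qed

lemma jet_inright: "jet0 (inright g) = ct g" "jetx (inright g) = ct (dx g)" "jety (inright g) = ct (dy g)"
  by (simp_all add: jet0_def jetx_def jety_def ev_inright dx_inright dy_inright)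

lemma jet_nonunit:
  fixes g :: "'k::field fps fps fps fps fps fps"
  assumes "g \<in> nonunits" shows "jet0 g = 0"
proof -
  obtain a b where "g = inleft (ev g) + a * dU + b * dV" using ev_expand by blast
  then have "fps_nth (fps_nth (fps_nth (fps_nth (fps_nth (fps_nth g 0) 0) 0) 0) 0) 0 =
    fps_nth (fps_nth (fps_nth (fps_nth (fps_nth (fps_nth (inleft (ev g) + a * dU + b * dV) 0) 0) 0) 0) 0) 0" by (rule arg_cong)
  also have "\<dots> = jet0 g" by (simp add: jet0_def inleft_def const2_def dU_def dV_def varx_def vary_def)
  finally show ?thesis using assms by (simp add: nonunits_def is_unit_fps_iff)
qed

text \<open>\<open>F\<close> and its first partials vanish at the origin, and first-order jets kill
  products of two nonunits. Hence the jets are functions on principal parts modulo the square of the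
  maximal ideal, and truncation at 2 suffices.\<close>

lemma jet_kills:
  fixes F :: "'k::field fps fps fps fps"
  assumes F: "ct F = 0" "ct (dx F) = 0" "ct (dy F) = 0" and u: "u \<in> pp_ideal F 3 \<union> ideal_power nonunits 2"
  shows "jet0 u = 0 \<and> jetx u = 0 \<and> jety u = 0"
proof -
  have gen: "jet0 u = 0 \<and> jetx u = 0 \<and> jety u = 0" if "u \<in> ideal_gen T"
    and T: "\<And>x c. x \<in> T \<Longrightarrow> jet0 (c * x) = 0 \<and> jetx (c * x) = 0 \<and> jety (c * x) = 0" for T and u :: "'k fps fps fps fps fps fps"
    using that(1)
  proof (induction rule: ideal.span_induct_alt)
    case base
    have "jet0 (inleft 0 :: 'k fps fps fps fps fps fps) = 0" "jetx (inleft 0 :: 'k fps fps fps fps fps fps) = 0"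
      "jety (inleft 0 :: 'k fps fps fps fps fps fps) = 0" by (simp_all add: jet_inleft)
    then show ?case by (simp add: inleft_def const2_0)
  next
    case (step c x y)
    then show ?case using T by (simp add: jet_add)
  qed
  from u show ?thesis
  proof
    assume "u \<in> pp_ideal F 3"
    then show ?thesis
      unfolding pp_ideal_def
    proof (rule gen)
      fix x c :: "'k fps fps fps fps fps fps"
      assume "x \<in> {inleft F, inright F} \<union> ideal_power diagonal_ideal 3"
      then consider "x = inleft F" | "x = inright F" | "x \<in> ideal_power diagonal_ideal (Suc (Suc (Suc 0)))"
        by (auto simp: numeral_3_eq_3)
      then show "jet0 (c * x) = 0 \<and> jetx (c * x) = 0 \<and> jety (c * x) = 0"
      proof cases
        case 3
        have "ev x = 0" by (rule ev_ideal_power[OF 3])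
        moreover have "ev (dx x) = 0" "ev (dy x) = 0"
          using ev_ideal_power[OF derivation_ideal_power[OF dx_add dx_mult 3[unfolded diagonal_ideal_eq], folded diagonal_ideal_eq]]
            ev_ideal_power[OF derivation_ideal_power[OF dy_add dy_mult 3[unfolded diagonal_ideal_eq], folded diagonal_ideal_eq]] .
        ultimately have "jet0 x = 0" "jetx x = 0" "jety x = 0" by (simp_all add: jet0_def jetx_def jety_def)
        then show ?thesis by (simp add: jet_mult)
      qed (simp_all add: jet_mult jet_inleft jet_inright F)
    qed
  next
    assume "u \<in> ideal_power nonunits 2"
    then show ?thesis
      unfolding ideal_power_def
    proof (rule gen)
      fix x c :: "'k fps fps fps fps fps fps"
      assume "x \<in> {\<Prod>i<2::nat. g i |g. \<forall>i<2. g i \<in> nonunits}"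
      then obtain g where g: "x = (\<Prod>i<2::nat. g i)" "\<forall>i<2. g i \<in> nonunits" by blast
      have "x = g 0 * g 1" unfolding g(1) by (simp add: numeral_2_eq_2)
      moreover have "jet0 (g 0) = 0" "jet0 (g 1) = 0" using g(2) by (simp_all add: jet_nonunit)
      ultimately show "jet0 (c * x) = 0 \<and> jetx (c * x) = 0 \<and> jety (c * x) = 0" by (simp add: jet_mult)
    qed
  qed
qed

lemma jet_coords_mem:
  fixes F :: "'k::field fps fps fps fps"
  assumes F: "ct F = 0" "ct (dx F) = 0" "ct (dy F) = 0" and j: "j < l"
  shows "(\<lambda>\<tau>. jet0 (\<tau> ! j)) \<in> jet_coords F 3 l 2" "(\<lambda>\<tau>. jetx (\<tau> ! j)) \<in> jet_coords F 3 l 2"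
    "(\<lambda>\<tau>. jety (\<tau> ! j)) \<in> jet_coords F 3 l 2"
proof -
  have ctk: "ct (const2 (const2 c)) = (c :: 'k)" for c by (simp add: const2_def)
  let ?scale = "\<lambda>c u. inleft (const2 (const2 c)) * u :: 'k fps fps fps fps fps fps"
  have mod: "Modules.module ?scale"
    by unfold_locales (simp_all add: inleft_def const2_add const2_mult const2_1 algebra_simps)
  have hom: "Modules.module_hom ?scale (*) \<phi>" if "\<And>u v. \<phi> (u + v) = \<phi> u + \<phi> v" "\<And>c u. \<phi> (?scale c u) = c * \<phi> u" for \<phi>
    unfolding module_hom_def module_hom_axioms_def using mod module_times that by blast
  have "Modules.module_hom ?scale (*) jet0" "Modules.module_hom ?scale (*) jetx" "Modules.module_hom ?scale (*) jety"
    by (rule hom; simp add: jet_add jet_mult jet_inleft ctk)+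
  then show "(\<lambda>\<tau>. jet0 (\<tau> ! j)) \<in> jet_coords F 3 l 2" "(\<lambda>\<tau>. jetx (\<tau> ! j)) \<in> jet_coords F 3 l 2"
    "(\<lambda>\<tau>. jety (\<tau> ! j)) \<in> jet_coords F 3 l 2"
    unfolding jet_coords_def using j jet_kills[OF F] by blast+
qed


section \<open>Specialization to the germ\<close>

lemma econst_hom: "econst (a + b) = econst a + econst b" "econst (a * b) = econst a * econst b" "econst 0 = 0" "econst 1 = 1"
  "econst (a - b) = econst a - econst b" "econst (const2 c) = const2 (fps_const c)"
proof -
  show "econst (a * b) = econst a * econst b" by (rule map_coeffs_mult) simp_all
qed (auto simp: map_coeffs_def const2_def fps_eq_iff)

lemma inright_hom: "inright 0 = 0" "inright 1 = (1 :: 'k::comm_ring_1 fps fps fps fps)" "inright (a - b) = inright a - inright b"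
  "inright (const2 c) = (const2 (const2 c) :: 'k fps fps fps fps)"
proof -
  show "inright (a - b) = inright a - inright b" by (simp add: inright_def map_coeffs_def const2_diff fps_eq_iff)
qed (auto simp: inright_def map_coeffs_def const2_def fps_eq_iff)

lemma hom_power:
  assumes "h 1 = (1::'b::comm_ring_1)" "\<And>a b :: 'a::comm_ring_1. h (a * b) = h a * h b"
  shows "h (a ^ l) = h a ^ l"
  by (induction l) (simp_all add: assms)

lemma econst_vars: "econst varx = varx" "econst vary = vary"
  by (auto simp: map_coeffs_def varx_def vary_def fps_eq_iff fps_X_def)

definition combination :: "'k::field fps fps list \<Rightarrow> 'k list \<Rightarrow> 'k fps fps" where
  "combination \<delta> a = (\<Sum>i<length \<delta>. const2 (a ! i) * \<delta> ! i)"

lemma combination_nth: "fps_nth (fps_nth (combination \<delta> a) j) 0 = (\<Sum>i<length \<delta>. a ! i * fps_nth (fps_nth (\<delta> ! i) j) 0)"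
  by (simp add: combination_def fps_sum_nth const2_def)

lemma deformation1_eq:
  assumes "f = vary ^ (n + 2) - varx ^ (m + 2)"
  shows "deformation1 f \<delta> a = vary ^ (n + 2) - varx ^ (m + 2) + veps * econst (combination \<delta> a)"
proof -
  have "econst (combination \<delta> a) = (\<Sum>i<length \<delta>. econst (const2 (a ! i) * \<delta> ! i))"
    unfolding combination_def by (rule hom_sum) (simp_all add: econst_hom)
  then have "veps * econst (combination \<delta> a) = (\<Sum>i<length \<delta>. const2 (fps_const (a ! i) * fps_X) * econst (\<delta> ! i))"
    by (simp add: econst_hom const2_mult veps_def sum_distrib_left mult_ac)
  moreover have "econst f = vary ^ (n + 2) - varx ^ (m + 2)"
    unfolding assms econst_hom hom_power[of econst, OF econst_hom(4,2)] econst_vars ..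
  ultimately show ?thesis by (simp add: deformation1_def deformation_def)
qed

lemma deformation2_eq:
  assumes "f = vary ^ (n + 2) - varx ^ (m + 2)"
  shows "deformation2 f \<delta> a b = vary ^ (n + 2) - varx ^ (m + 2)
    + vsig * inright (combination \<delta> a) + veps * inright (combination \<delta> b)"
proof -
  have comb: "inright (combination \<delta> a) = (\<Sum>i<length \<delta>. const2 (const2 (a ! i)) * inright (\<delta> ! i))" for a
    unfolding combination_def by (subst hom_sum[of inright]) (simp_all add: inright_hom inright_add inright_mult)
  have "vsig * inright (combination \<delta> a) + veps * inright (combination \<delta> b)
    = (\<Sum>i<length \<delta>. const2 (const2 (a ! i) * fps_const fps_X + const2 (b ! i) * fps_X) * inright (\<delta> ! i))"
    unfolding comb by (simp add: const2_add const2_mult veps_def cst_def sum_distrib_left sum.distrib distrib_left distrib_right mult_ac)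
  moreover have "inright f = vary ^ (n + 2) - varx ^ (m + 2)"
    unfolding assms inright_hom hom_power[of inright, OF inright_hom(2) inright_mult] inright_varx inright_vary ..
  ultimately show ?thesis by (simp add: deformation2_def deformation_def inright_def[symmetric] add.assoc)
qed

lemma Def1_combination:
  fixes f :: "'k::field_char_0 fps fps"
  assumes "f = vary ^ (n + 2) - varx ^ (m + 2)" "represents_Def1_basis f \<delta>"
  obtains a where "length a = length \<delta>" "fps_nth (fps_nth (combination \<delta> a) 0) 0 = fps_nth (fps_nth g 0) 0"
    "n \<noteq> 0 \<Longrightarrow> fps_nth (fps_nth (combination \<delta> a) 1) 0 = fps_nth (fps_nth g 1) 0"
proof -
  obtain c where c: "g - (\<Sum>i<length \<delta>. const2 (c i) * \<delta> ! i) \<in> ideal_gen {varx ^ (m + 1), vary ^ (n + 1)}"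
    by (rule Def1_span[OF assms])
  define a where "a = map c [0..<length \<delta>]"
  have "combination \<delta> a = (\<Sum>i<length \<delta>. const2 (c i) * \<delta> ! i)" by (simp add: combination_def a_def)
  with c have "g - combination \<delta> a \<in> ideal_gen {varx ^ (m + 1), vary ^ (n + 1)}" by simp
  from low_coeffs[OF this] show ?thesis by (intro that[of a]) (simp_all add: a_def)
qed

text \<open>The lower bound applies to every combination of the basis; it is attained when the
  combination has a nonzero constant term, which can always be arranged.\<close>

lemma automatic_degeneracy:
  fixes f :: "'k::field_char_0 fps fps"
  assumes nm: "n \<le> m" and f: "f = vary ^ (n + 2) - varx ^ (m + 2)" and \<delta>: "represents_Def1_basis f \<delta>"
  shows "AD2 3 f \<delta> = enat ((2 * n + 1) * (m + 1))"
proof -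
  have scale: "(\<lambda>c g. const2 (fps_const c) * g) = (kscale :: 'k \<Rightarrow> _)" by (intro ext) (simp add: kscale_def)
  have pencil0: "pencil0 n m (combination \<delta> a) (deformation1 f \<delta> a)" for a
    by unfold_locales (simp_all only: nm deformation1_eq[OF f])
  show ?thesis
    unfolding AD2_def scale
  proof (rule antisym)
    obtain a where a: "length a = length \<delta>" "fps_nth (fps_nth (combination \<delta> a) 0) 0 = 1"
      by (rule Def1_combination[OF f \<delta>, of 1]) simp
    interpret pencil n m "combination \<delta> a" "deformation1 f \<delta> a"
      by (rule pencil.intro[OF pencil0]) (unfold_locales, simp add: a(2))
    have "Inf {quotient_dim kscale (minors_ideal (deformation1 f \<delta> a) 3 e \<tau>) | a e \<tau>.
        length a = length \<delta> \<and> pp_dual_basis (deformation1 f \<delta> a) 3 e \<and> length \<tau> = 3 - 1}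
      \<le> quotient_dim kscale (minors_ideal (deformation1 f \<delta> a) 3 (dbasis (deformation1 f \<delta> a)) [1, inleft 2 * dU + dV])"
      by (rule Inf_lower) (use a(1) degeneracy_le(1) in \<open>auto intro!: exI\<close>)
    also have "\<dots> \<le> enat ((2 * n + 1) * (m + 1))" by (rule degeneracy_le(2))
    finally show "Inf {quotient_dim kscale (minors_ideal (deformation1 f \<delta> a) 3 e \<tau>) | a e \<tau>.
        length a = length \<delta> \<and> pp_dual_basis (deformation1 f \<delta> a) 3 e \<and> length \<tau> = 3 - 1} \<le> enat ((2 * n + 1) * (m + 1))" .
    show "enat ((2 * n + 1) * (m + 1)) \<le> Inf {quotient_dim kscale (minors_ideal (deformation1 f \<delta> a) 3 e \<tau>) | a e \<tau>.
        length a = length \<delta> \<and> pp_dual_basis (deformation1 f \<delta> a) 3 e \<and> length \<tau> = 3 - 1}"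
    proof (rule Inf_greatest)
      fix z assume "z \<in> {quotient_dim kscale (minors_ideal (deformation1 f \<delta> a) 3 e \<tau>) | a e \<tau>.
        length a = length \<delta> \<and> pp_dual_basis (deformation1 f \<delta> a) 3 e \<and> length \<tau> = 3 - 1}"
      then obtain a e \<tau> where z: "z = quotient_dim kscale (minors_ideal (deformation1 f \<delta> a) 3 e \<tau>)"
        "pp_dual_basis (deformation1 f \<delta> a) 3 e" "length \<tau> = 2" by auto
      then obtain v w where "\<tau> = [v, w]" by (auto simp: numeral_2_eq_2 length_Suc_conv)
      then show "enat ((2 * n + 1) * (m + 1)) \<le> z"
        using pencil0.degeneracy_ge[OF pencil0 z(2)] z(1) by simp
    qed
  qed
qed

lemma general_sections:
  fixes F :: "'k::field_char_0 fps fps fps fps"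
  assumes p2: "pencil2 n m A B F" and c1: "n \<noteq> 0 \<Longrightarrow> pencil2.c1 n A B \<noteq> 0"
  shows "for_general {\<tau>. length \<tau> = 3 - 1} (jet_coords F 3 (3 - 1) 2)
    (\<lambda>\<tau>. \<forall>e. pp_dual_basis F 3 e \<longrightarrow> nonsingular_length F (minors_ideal F 3 e \<tau>) = enat (n * (m + 1)))"
proof -
  interpret pencil2 n m A B F by fact
  let ?\<Phi> = "jet_coords F 3 (3 - 1) 2"
  define \<beta>p where "\<beta>p \<tau> = jet0 (\<tau> ! 0) * jetx (\<tau> ! 1) - jet0 (\<tau> ! 1) * jetx (\<tau> ! 0)" for \<tau> :: "'k fps fps fps fps fps fps list"
  define \<gamma>p where "\<gamma>p \<tau> = jet0 (\<tau> ! 0) * jety (\<tau> ! 1) - jet0 (\<tau> ! 1) * jety (\<tau> ! 0)" for \<tau> :: "'k fps fps fps fps fps fps list"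
  \<comment> \<open>The product of the conditions of \<open>inflection_length\<close>, the last one
    with its denominators cleared.\<close>
  define P where "P \<tau> = jet0 (\<tau> ! 0) * (\<beta>p \<tau> * (\<gamma>p \<tau> * (((- 1 * \<gamma>p \<tau>) ^ (n + 2) - \<beta>p \<tau> ^ (n + 2))
    * (c1 ^ n * \<beta>p \<tau> ^ (2 * n + 2) - c0 ^ n * \<gamma>p \<tau> ^ (2 * n + 2)))))" for \<tau>
  have coord: "(\<lambda>\<tau>. jet0 (\<tau> ! j)) \<in> polyfuns ?\<Phi>" "(\<lambda>\<tau>. jetx (\<tau> ! j)) \<in> polyfuns ?\<Phi>" "(\<lambda>\<tau>. jety (\<tau> ! j)) \<in> polyfuns ?\<Phi>"
    if "j < 3 - 1" for j
    by (rule polyfuns.coord, rule jet_coords_mem[OF ct_derivs that])+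
  have \<beta>\<gamma>: "\<beta>p \<in> polyfuns ?\<Phi>" "\<gamma>p \<in> polyfuns ?\<Phi>"
    unfolding \<beta>p_def[abs_def] \<gamma>p_def[abs_def] by (intro polyfuns_diff polyfuns.mult coord; simp)+
  have P: "P \<in> polyfuns ?\<Phi>"
    unfolding P_def[abs_def] by (intro polyfuns.mult polyfuns_diff polyfuns_power polyfuns.const \<beta>\<gamma> coord) simp
  have c1n: "c1 ^ n \<noteq> 0" using c1 by (cases "n = 0") auto
  define r1 where "r1 = [:0, - 1:] ^ (n + 2) - (1 :: 'k poly)"
  define r2 where "r2 = [:c1 ^ n:] - [:c0 ^ n:] * [:0, 1:] ^ (2 * n + 2)"
  have "poly r1 0 \<noteq> 0" "poly r2 0 \<noteq> 0" using c1n by (simp_all add: r1_def r2_def)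
  then have "r1 \<noteq> 0" "r2 \<noteq> 0" by auto
  then have "[:0, 1:] * (r1 * r2) \<noteq> 0" by simp
  then obtain q where "poly ([:0, 1:] * (r1 * r2)) q \<noteq> 0" by (rule poly_nonroot)
  then have q: "q \<noteq> 0" "(- q) ^ (n + 2) - 1 \<noteq> 0" "c1 ^ n - c0 ^ n * q ^ (2 * n + 2) \<noteq> 0" by (simp_all add: r1_def r2_def mult_ac)
  \<comment> \<open>A pair of sections with \<beta> = 1 and \<gamma> = q, where q avoids the roots
    of the remaining factors; it shows that the polynomial is not identically zero.\<close>
  define x1 where "x1 = [1, dU + inleft (const2 (const2 q)) * dV :: 'k fps fps fps fps fps fps]"
  have one: "(1 :: 'k fps fps fps fps fps fps) = inleft 1" by (simp add: inleft_def const2_1)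
  have jets1: "jet0 (1 :: 'k fps fps fps fps fps fps) = 1" "jetx (1 :: 'k fps fps fps fps fps fps) = 0" "jety (1 :: 'k fps fps fps fps fps fps) = 0"
    unfolding one by (simp_all add: jet_inleft)
  have jetsU: "jet0 (dU :: 'k fps fps fps fps fps fps) = 0" "jetx (dU :: 'k fps fps fps fps fps fps) = 1" "jety (dU :: 'k fps fps fps fps fps fps) = 0"
    "jet0 (dV :: 'k fps fps fps fps fps fps) = 0" "jetx (dV :: 'k fps fps fps fps fps fps) = 0" "jety (dV :: 'k fps fps fps fps fps fps) = 1"
    using jets1 jet_inleft(1)[of "0 :: 'k fps fps fps fps"]
    by (simp_all add: jet0_def jetx_def jety_def ev_dU ev_dV dx_dU dy_dU dx_dV dy_dV inleft_def const2_0)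
  have ctk: "ct (const2 (const2 c)) = (c :: 'k)" for c by (simp add: const2_def)
  have x1: "jet0 (x1 ! 0) = 1" "\<beta>p x1 = 1" "\<gamma>p x1 = q"
    by (simp_all add: x1_def \<beta>p_def \<gamma>p_def jet_add jet_mult jet_inleft ctk jets1 jetsU)
  show ?thesis
  proof (rule for_generalI[OF _ P])
    show "x1 \<in> {\<tau>. length \<tau> = 3 - 1}" by (simp add: x1_def)
    show "P x1 \<noteq> 0" unfolding P_def x1 using q by simp
    fix x0 x1 :: "'k fps fps fps fps fps fps list"
    assume x: "x0 \<in> {\<tau>. length \<tau> = 3 - 1}" "x1 \<in> {\<tau>. length \<tau> = 3 - 1}"
    then obtain v0 w0 v1 w1 where vw: "x0 = [v0, w0]" "x1 = [v1, w1]" by (auto simp: numeral_2_eq_2 length_Suc_conv)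
    let ?s = "\<lambda>z u. inleft (const2 (const2 z)) * u :: 'k fps fps fps fps fps fps"
    show "\<exists>l. l 0 = x0 \<and> l 1 = x1 \<and> (\<forall>z. l z \<in> {\<tau>. length \<tau> = 3 - 1}) \<and> (\<forall>\<phi>\<in>?\<Phi>. \<exists>q. \<forall>z. \<phi> (l z) = poly q z)"
    proof (intro exI[of _ "\<lambda>z. [v0 + ?s z (v1 - v0), w0 + ?s z (w1 - w0)]"] conjI allI ballI)
      fix \<phi> assume "\<phi> \<in> ?\<Phi>"
      then obtain \<psi> j where \<phi>: "\<phi> = (\<lambda>\<tau>. \<psi> (\<tau> ! j))" "j < 3 - 1" and hom: "Modules.module_hom ?s (*) \<psi>"
        unfolding jet_coords_def by blast
      have lin: "\<psi> (a + ?s z b) = poly [:\<psi> a, \<psi> b:] z" for a b z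
        using module_hom.add[OF hom] module_hom.scale[OF hom] by simp
      have "j = 0 \<or> j = 1" using \<phi>(2) by auto
      then show "\<exists>q. \<forall>z. \<phi> [v0 + ?s z (v1 - v0), w0 + ?s z (w1 - w0)] = poly q z"
      proof
        assume "j = 0"
        then show ?thesis unfolding \<phi>(1)
          by (intro exI[of _ "[:\<psi> v0, \<psi> (v1 - v0):]"] allI) (simp only: nth_Cons_0 lin)
      next
        assume "j = 1"
        then show ?thesis unfolding \<phi>(1)
          by (intro exI[of _ "[:\<psi> w0, \<psi> (w1 - w0):]"] allI) (simp only: One_nat_def nth_Cons_Suc nth_Cons_0 lin)
      qed
    qed (simp_all add: vw inleft_def const2_0 const2_1)
  next
    fix \<tau> assume \<tau>: "\<tau> \<in> {\<tau>. length \<tau> = 3 - 1}" and P0: "P \<tau> \<noteq> 0"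
    then obtain v w where vw: "\<tau> = [v, w]" by (auto simp: numeral_2_eq_2 length_Suc_conv)
    define u where "u = inleft (ev v) * w - inleft (ev w) * v"
    have jd: "jetx (a - b) = jetx a - jetx b" "jety (a - b) = jety a - jety b" for a b :: "'k fps fps fps fps fps fps"
      using jet_add(2)[of "a - b" b] jet_add(3)[of "a - b" b] by simp_all
    have \<beta>: "\<beta>p \<tau> = ct (ev (dx u))" and \<gamma>: "\<gamma>p \<tau> = ct (ev (dy u))"
      unfolding jetx_def[symmetric] jety_def[symmetric] u_def
      by (simp_all add: vw \<beta>p_def \<gamma>p_def jd jet_mult jet_inleft) (simp_all add: jet0_def)
    have nz: "ct (ev v) \<noteq> 0" "\<beta>p \<tau> \<noteq> 0" "\<gamma>p \<tau> \<noteq> 0" "(- \<gamma>p \<tau>) ^ (n + 2) \<noteq> \<beta>p \<tau> ^ (n + 2)"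
      "c1 ^ n * \<beta>p \<tau> ^ (2 * n + 2) \<noteq> c0 ^ n * \<gamma>p \<tau> ^ (2 * n + 2)"
      using P0 unfolding P_def by (auto simp: vw jet0_def)
    have ne': "\<gamma>'\<^sup>2 / \<beta>'\<^sup>2 * (\<gamma>'\<^sup>2 / \<beta>'\<^sup>2 * c0 / c1) ^ n \<noteq> 1"
      if "\<beta>' \<noteq> 0" "c1 ^ n * \<beta>' ^ (2 * n + 2) \<noteq> c0 ^ n * \<gamma>' ^ (2 * n + 2)" for \<beta>' \<gamma>' :: 'k
    proof
      assume 1: "\<gamma>'\<^sup>2 / \<beta>'\<^sup>2 * (\<gamma>'\<^sup>2 / \<beta>'\<^sup>2 * c0 / c1) ^ n = 1"
      have "\<gamma>' ^ (2 * n + 2) = (\<gamma>'\<^sup>2) ^ n * \<gamma>'\<^sup>2" "\<beta>' ^ (2 * n + 2) = (\<beta>'\<^sup>2) ^ n * \<beta>'\<^sup>2"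
        unfolding power_add power_mult by simp_all
      then have "c0 ^ n * \<gamma>' ^ (2 * n + 2) = (\<gamma>'\<^sup>2 / \<beta>'\<^sup>2 * (\<gamma>'\<^sup>2 / \<beta>'\<^sup>2 * c0 / c1) ^ n) * (c1 ^ n * \<beta>' ^ (2 * n + 2))"
        using that(1) c1n by (auto simp: power_divide power_mult_distrib)
      then show False using that(2) unfolding 1 by simp
    qed
    show "\<forall>e. pp_dual_basis F 3 e \<longrightarrow> nonsingular_length F (minors_ideal F 3 e \<tau>) = enat (n * (m + 1))"
      unfolding vw
      by (intro allI impI inflection_length[OF nz(1) u_def \<beta> \<gamma> nz(2-4) c1 ne'[OF nz(2,5)]])
  qed
qed

lemma limiting_inflection:
  fixes f :: "'k::field_char_0 fps fps"
  assumes nm: "n \<le> m" and f: "f = vary ^ (n + 2) - varx ^ (m + 2)" and \<delta>: "represents_Def1_basis f \<delta>"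
  shows "limiting_inflection_points 3 f \<delta> (enat (n * (m + 1)))"
proof -
  let ?S = "{(a, b). length a = length \<delta> \<and> length b = length \<delta>} :: ('k list \<times> 'k list) set"
  let ?\<Phi> = "{\<lambda>(a, b). a ! i | i. i < length \<delta>} \<union> {\<lambda>(a, b). b ! i | i. i < length \<delta>} :: ('k list \<times> 'k list \<Rightarrow> 'k) set"
  define ca where "ca j x = (\<Sum>i<length \<delta>. (case x of (a, b) \<Rightarrow> a ! i) * fps_nth (fps_nth (\<delta> ! i) j) 0)" for j and x :: "'k list \<times> 'k list"
  define cb where "cb j x = (\<Sum>i<length \<delta>. (case x of (a, b) \<Rightarrow> b ! i) * fps_nth (fps_nth (\<delta> ! i) j) 0)" for j and x :: "'k list \<times> 'k list"
  have cab: "ca j (a, b) = fps_nth (fps_nth (combination \<delta> a) j) 0" "cb j (a, b) = fps_nth (fps_nth (combination \<delta> b) j) 0" for a b j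
    by (simp_all add: ca_def cb_def combination_nth)
  have polys: "ca j \<in> polyfuns ?\<Phi>" "cb j \<in> polyfuns ?\<Phi>" for j
    unfolding ca_def[abs_def] cb_def[abs_def]
    by (intro polyfuns_sum polyfuns.mult polyfuns.const polyfuns.coord; blast)+
  \<comment> \<open>The first factor is the constant term of the perturbation along \<epsilon>; the
    second is that constant term times \<open>c1\<close> up to a nonzero scalar. For n = 0 the
    coefficient of y cannot be prescribed, and 1 takes its place.\<close>
  define P where "P x = cb 0 x * (if n = 0 then 1 else ca 1 x * cb 0 x - ca 0 x * cb 1 x)" for x
  have P: "P \<in> polyfuns ?\<Phi>"
  proof (cases "n = 0")
    case True
    then show ?thesis using polys(2)[of 0] by (simp add: P_def[abs_def])
  next
    case False
    then show ?thesis unfolding P_def[abs_def] by (simp, intro polyfuns.mult polyfuns_diff polys)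
  qed
  \<comment> \<open>Combinations with the low coefficients of 1, along \<epsilon>, and of y, along
    \<sigma>, make the polynomial nonzero.\<close>
  obtain b1 where b1: "length b1 = length \<delta>" "fps_nth (fps_nth (combination \<delta> b1) 0) 0 = 1"
    "n \<noteq> 0 \<Longrightarrow> fps_nth (fps_nth (combination \<delta> b1) 1) 0 = 0"
    by (rule Def1_combination[OF f \<delta>, of 1]) simp
  obtain a1 where a1: "length a1 = length \<delta>" "fps_nth (fps_nth (combination \<delta> a1) 0) 0 = 0"
    "n \<noteq> 0 \<Longrightarrow> fps_nth (fps_nth (combination \<delta> a1) 1) 0 = 1"
    by (rule Def1_combination[OF f \<delta>, of vary]) (simp add: vary_def)
  show ?thesis
    unfolding limiting_inflection_points_def
  proof (rule for_generalI[OF _ P])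
    show "(a1, b1) \<in> ?S" using a1 b1 by simp
    show "P (a1, b1) \<noteq> 0" unfolding P_def cab using a1 b1 by simp
    fix x0 x1 assume "x0 \<in> ?S" "x1 \<in> ?S"
    then obtain a b a' b' where x: "x0 = (a, b)" "x1 = (a', b')" "length a = length \<delta>" "length b = length \<delta>"
      "length a' = length \<delta>" "length b' = length \<delta>" by auto
    let ?l = "\<lambda>a a' z. map2 (\<lambda>u v. u + z * (v - u)) a a' :: 'k list"
    have line: "?l a a' z ! i = poly [:a ! i, a' ! i - a ! i:] z" if "i < length \<delta>" "length a = length \<delta>" "length a' = length \<delta>" for a a' z i
      using that by simp
    show "\<exists>l. l 0 = x0 \<and> l 1 = x1 \<and> (\<forall>z. l z \<in> ?S) \<and> (\<forall>\<phi>\<in>?\<Phi>. \<exists>q. \<forall>z. \<phi> (l z) = poly q z)"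
    proof (intro exI[of _ "\<lambda>z. (?l a a' z, ?l b b' z)"] conjI allI ballI)
      show "(?l a a' 0, ?l b b' 0) = x0" "(?l a a' 1, ?l b b' 1) = x1"
        using x by (auto intro: nth_equalityI)
      show "(?l a a' z, ?l b b' z) \<in> ?S" for z using x by simp
      fix \<phi> assume "\<phi> \<in> ?\<Phi>"
      then obtain i where "i < length \<delta>" "\<phi> = (\<lambda>(a, b). a ! i) \<or> \<phi> = (\<lambda>(a, b). b ! i)" by blast
      then show "\<exists>q. \<forall>z. \<phi> (?l a a' z, ?l b b' z) = poly q z"
        using line[of i a a'] line[of i b b'] x(3-6) by (auto simp del: poly_pCons)
    qed
  next
    fix x assume "x \<in> ?S" and P0: "P x \<noteq> 0"
    then obtain a b where x: "x = (a, b)" by auto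
    let ?A = "combination \<delta> a" and ?B = "combination \<delta> b" and ?F = "deformation2 f \<delta> a b"
    have B0: "fps_nth (fps_nth ?B 0) 0 \<noteq> 0" using P0 unfolding x P_def cab by auto
    have p2: "pencil2 n m ?A ?B ?F"
      by unfold_locales (use nm B0 deformation2_eq[OF f] in simp_all)
    have c1: "pencil2.c1 n ?A ?B \<noteq> 0" if "n \<noteq> 0"
    proof -
      have N0: "of_nat (n + 2) \<noteq> (0 :: 'k)" by (simp del: of_nat_add of_nat_Suc add: of_nat_eq_0_iff)
      have "fps_nth (fps_nth ?A 1) 0 * fps_nth (fps_nth ?B 0) 0 - fps_nth (fps_nth ?A 0) 0 * fps_nth (fps_nth ?B 1) 0 \<noteq> 0"
        using P0 that unfolding x P_def cab by auto
      then have "fps_nth (fps_nth ?B 1) 0 * fps_nth (fps_nth ?A 0) 0 / fps_nth (fps_nth ?B 0) 0 - fps_nth (fps_nth ?A 1) 0 \<noteq> 0"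
        using B0 by (simp add: field_simps)
      then show ?thesis unfolding pencil2.c1_def[OF p2] using N0 by (simp add: dy_def of_nat_1[unfolded One_nat_def] del: of_nat_add of_nat_Suc)
    qed
    show "(case x of (a, b) \<Rightarrow> let F = deformation2 f \<delta> a b in
          (\<exists>e. pp_dual_basis F 3 e) \<and>
          (\<exists>N. for_general {\<tau>. length \<tau> = 3 - 1} (jet_coords F 3 (3 - 1) N)
             (\<lambda>\<tau>. \<forall>e. pp_dual_basis F 3 e \<longrightarrow>
                nonsingular_length F (minors_ideal F 3 e \<tau>) = enat (n * (m + 1)))))"
      unfolding x Let_def prod.case
      using pencil2.dual_basis[OF p2] general_sections[OF p2 c1] by blast
  qed
qed

theorem theorem6p4p1:
  fixes s t :: nat and f :: "'k::{alg_closed_field, field_char_0} fps fps"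
    and \<delta> :: "'k fps fps list"
  assumes "2 \<le> t" and "t \<le> s"
    and "f = vary ^ t - varx ^ s"
    and "represents_Def1_basis f \<delta>"
  shows "AD2 3 f \<delta> = enat ((2 * t - 3) * (s - 1)) \<and>
         limiting_inflection_points 3 f \<delta> (enat ((t - 2) * (s - 1)))"
proof -
  obtain n where n: "t = n + 2" using assms(1) by (metis le_add_diff_inverse2)
  obtain m where m: "s = m + 2" using assms(1,2) by (metis le_add_diff_inverse2 le_trans)
  have nm: "n \<le> m" and f: "f = vary ^ (n + 2) - varx ^ (m + 2)" using assms(2,3) n m by simp_all
  show ?thesis
    using automatic_degeneracy[OF nm f assms(4)] limiting_inflection[OF nm f assms(4)]
    by (simp add: n m)
qed

end
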